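(* Let $\mathcal{H}$ be a finite-dimensional complex Hilbert space, let $F\in\mathrm{Pick}(\mathbb{C}_+,B(\mathcal{H}))_{\mathbb{R}}$ be regular and let $\mathcal{K}$ be the multiplicity space of the complex regular one-parameter group $(L^2(\mathbb{R},\mathcal{H}),H^2(\mathbb{C}_+,\mathcal{H}),U^F)$, where $U^F_t=M_{e^{itF_*}}$. Then $\dim\mathcal{K}=\deg F$, so $$\mathcal{K}\cong\begin{cases}\mathbb{C}^{\deg F}&\text{if }F\in\mathrm{Rat}(\mathcal{H})\\ \ell^2(\mathbb{N},\mathbb{C})&\text{if }F\notin\mathrm{Rat}(\mathcal{H}).\end{cases}$$
   Context: All Hilbert spaces are separable. $\mathbb{C}_+=\{z\in\mathbb{C}:\operatorname{Im} z>0\}$. For a finite-dimensional complex Hilbert space $\mathcal{H}$, $\mathrm{Pick}(\mathbb{C}_+,B(\mathcal{H}))_{\mathbb{R}}$ is the set of holomorphic $F:\mathbb{C}_+\to B(\mathcal{H})$ with $\frac1{2i}(F(z)-F(z)^* )\ge0$ for all $z\in\mathbb{C}_+$ and such that the limit $F_*(x)=\lim_{\epsilon\downarrow0}F(x+i\epsilon)$ exists and is self-adjoint for almost every $x\in\mathbb{R}$. For a complex Hilbert space $\mathcal{K}$, $H^2(\mathbb{C}_+,\mathcal{K})$ is the Hardy space of holomorphic $f:\mathbb{C}_+\to\mathcal{K}$ with $\sup_{y>0}\int_{\mathbb{R}}\|f(x+iy)\|^2dx<\infty$, identified via boundary values with a closed subspace of $L^2(\mathbb{R},\mathcal{K})$.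 $M_g$ denotes multiplication by $g$. A complex regular one-parameter group (ROPG) is a triple $(\mathcal{E},\mathcal{E}_+,U)$ of a complex Hilbert space, a closed subspace and a strongly continuous unitary one-parameter group with $U_t\mathcal{E}_+\subseteq\mathcal{E}_+$ for $t\ge0$, $\bigcap_{t\in\mathbb{R}}U_t\mathcal{E}_+=\{0\}$ and $\overline{\bigcup_{t\in\mathbb{R}}U_t\mathcal{E}_+}=\mathcal{E}$. $F$ is called regular if $(L^2(\mathbb{R},\mathcal{H}),H^2(\mathbb{C}_+,\mathcal{H}),U^F)$ is a ROPG. By the Lax--Phillips theorem, for every complex ROPG there is a complex Hilbert space $\mathcal{K}$, unique up to isomorphism and called its multiplicity space, such that there is a unitary $\psi:\mathcal{E}\to L^2(\mathbb{R},\mathcal{K})$ with $\psi(\mathcal{E}_+)=H^2(\mathbb{C}_+,\mathcal{K})$ and $\psi U_t=S_t\psi$ for all $t\in\mathbb{R}$, where $(S_tf)(x)=e^{itx}f(x)$. $F$ is called rational, $F\in\mathrm{Rat}(\mathcal{H})$, if there are a self-adjoint $C\in B(\mathcal{H})$, positive semidefinite $D,A_1,\dots,A_m\in B(\mathcal{H})$ and pairwise distinct $\lambda_1,\dots,\lambda_m\in\mathbb{R}$ with $F(z)=C+zD+\sum_{j=1}^m\frac1{\lambda_j-z}A_j$; then $\deg F:=\operatorname{rk}(D)+\sum_{j=1}^m\operatorname{rk}(A_j)$. For $F\notin\mathrm{Rat}(\mathcal{H})$, $\deg F:=\infty$. *)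

theory Defs
  imports "HOL-Analysis.Analysis"
begin

section \<open>Complex normed spaces and complex Hilbert spaces\<close>

class complex_normed_vector = real_normed_vector +
  fixes scaleC :: "complex \<Rightarrow> 'a \<Rightarrow> 'a"  (infixr \<open>*\<^sub>C\<close> 75)
  assumes scaleC_add_right: "a *\<^sub>C (x + y) = a *\<^sub>C x + a *\<^sub>C y"
    and scaleC_add_left: "(a + b) *\<^sub>C x = a *\<^sub>C x + b *\<^sub>C x"
    and scaleC_scaleC: "a *\<^sub>C (b *\<^sub>C x) = (a * b) *\<^sub>C x"
    and scaleC_of_real: "complex_of_real r *\<^sub>C x = r *\<^sub>R x"
    and norm_scaleC: "norm (a *\<^sub>C x) = cmod a * norm x"

lemma scaleC_one [simp]: "1 *\<^sub>C x = (x::'a::complex_normed_vector)"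
  using scaleC_of_real[of 1 x] by simp

global_interpretation complex_vector:
  vector_space "scaleC :: complex \<Rightarrow> 'a \<Rightarrow> 'a::complex_normed_vector"
  by unfold_locales (simp_all add: scaleC_add_right scaleC_add_left scaleC_scaleC)

text \<open>The complex inner product is antilinear in its first and linear in its second argument.\<close>

class complex_inner = complex_normed_vector + real_inner +
  fixes cinner :: "'a \<Rightarrow> 'a \<Rightarrow> complex"
  assumes cinner_commute: "cinner x y = cnj (cinner y x)"
    and cinner_add_right: "cinner x (y + z) = cinner x y + cinner x z"
    and cinner_scaleC_right: "cinner x (a *\<^sub>C y) = a * cinner x y"
    and inner_eq_Re_cinner: "inner x y = Re (cinner x y)"

class complex_hilbert = complex_inner + banach

class separable_complex_hilbert = complex_hilbert + second_countable_topology

instantiation complex :: separable_complex_hilbert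
begin

definition scaleC_complex :: "complex \<Rightarrow> complex \<Rightarrow> complex"
  where "scaleC_complex a x = a * x"

definition cinner_complex :: "complex \<Rightarrow> complex \<Rightarrow> complex"
  where "cinner_complex x y = cnj x * y"

instance
  by standard
    (auto simp: scaleC_complex_def cinner_complex_def algebra_simps scaleR_conv_of_real
      norm_mult inner_complex_def)

end

text \<open>\<^typ>\<open>'a \<Rightarrow>\<^sub>L 'b\<close> consists of the bounded real-linear maps; pointwise multiples turn it into
  a complex normed space. The algebra of bounded operators on a complex Hilbert space is its
  closed subspace of complex-linear maps, see \<open>complex_linear\<close> below.\<close>

lemma bounded_linear_scaleC: "bounded_linear (\<lambda>x::'a::complex_normed_vector. a *\<^sub>C x)"
proof (rule bounded_linear_intro[where K = "cmod a"])
  fix x y :: 'a and r :: real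
  show "a *\<^sub>C (x + y) = a *\<^sub>C x + a *\<^sub>C y" by (rule scaleC_add_right)
  show "a *\<^sub>C r *\<^sub>R x = r *\<^sub>R a *\<^sub>C x"
    by (metis mult.commute scaleC_of_real scaleC_scaleC)
  show "norm (a *\<^sub>C x) \<le> norm x * cmod a" by (simp add: norm_scaleC mult.commute)
qed

instantiation blinfun :: (real_normed_vector, complex_normed_vector) complex_normed_vector
begin

lift_definition scaleC_blinfun :: "complex \<Rightarrow> 'a \<Rightarrow>\<^sub>L 'b \<Rightarrow> 'a \<Rightarrow>\<^sub>L 'b"
  is "\<lambda>a f x. a *\<^sub>C f x"
  by (rule bounded_linear_compose[OF bounded_linear_scaleC])

instance
proof
  fix a b :: complex and r :: real and A B :: "'a \<Rightarrow>\<^sub>L 'b"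
  show "a *\<^sub>C (A + B) = a *\<^sub>C A + a *\<^sub>C B"
    by transfer (simp add: scaleC_add_right)
  show "(a + b) *\<^sub>C A = a *\<^sub>C A + b *\<^sub>C A"
    by transfer (simp add: scaleC_add_left)
  show assoc: "a *\<^sub>C (b *\<^sub>C A) = (a * b) *\<^sub>C A" for a b and A :: "'a \<Rightarrow>\<^sub>L 'b"
    by transfer (simp add: scaleC_scaleC)
  have scaleC1: "1 *\<^sub>C A = A" and scaleC0: "0 *\<^sub>C A = 0" for A :: "'a \<Rightarrow>\<^sub>L 'b"
    by (transfer, simp)+
  show "complex_of_real r *\<^sub>C A = r *\<^sub>R A"
    by transfer (simp add: scaleC_of_real)
  show "norm (a *\<^sub>C A) = cmod a * norm A"
  proof (cases "a = 0")
    case True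
    then have "a *\<^sub>C A = 0"
      using scaleC0 by simp
    then show ?thesis using True by simp
  next
    case False
    have le: "norm (c *\<^sub>C T) \<le> cmod c * norm T" for c and T :: "'a \<Rightarrow>\<^sub>L 'b"
    proof (rule norm_blinfun_bound)
      fix x
      have "norm ((c *\<^sub>C T) x) = cmod c * norm (T x)"
        by transfer (simp add: norm_scaleC)
      then show "norm ((c *\<^sub>C T) x) \<le> cmod c * norm T * norm x"
        by (simp add: mult.assoc mult_left_mono norm_blinfun)
    qed simp
    have "norm A = norm (inverse a *\<^sub>C (a *\<^sub>C A))"
      unfolding assoc using False scaleC1 by simp
    also have "\<dots> \<le> inverse (cmod a) * norm (a *\<^sub>C A)"
      using le[of "inverse a" "a *\<^sub>C A"] by (simp add: norm_inverse)
    finally have "cmod a * norm A \<le> norm (a *\<^sub>C A)"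
      using False by (simp add: field_simps)
    with le[of a A] show ?thesis by linarith
  qed
qed

end

lemma cinner_add_left: "cinner (x + y) z = cinner x z + cinner y (z::'a::complex_inner)"
  by (metis cinner_add_right cinner_commute complex_cnj_add)

lemma cinner_scaleC_left: "cinner (a *\<^sub>C x) y = cnj a * cinner x (y::'a::complex_inner)"
  by (metis cinner_commute cinner_scaleC_right complex_cnj_mult)

lemma cinner_eq_Complex:
  "cinner x y = Complex (inner x y) (inner (\<i> *\<^sub>C x) (y::'a::complex_inner))"
  by (simp add: complex_eq_iff inner_eq_Re_cinner cinner_scaleC_left)

section \<open>The Hilbert space of square integrable vector-valued functions on the real line\<close>

definition sq_integrable :: "(real \<Rightarrow> 'a::separable_complex_hilbert) \<Rightarrow> bool"
  where "sq_integrable f \<longleftrightarrow>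
    f \<in> borel_measurable lborel \<and> integrable lborel (\<lambda>x. (norm (f x))\<^sup>2)"

definition l2_rel :: "(real \<Rightarrow> 'a::separable_complex_hilbert) \<Rightarrow> (real \<Rightarrow> 'a) \<Rightarrow> bool"
  where "l2_rel f g \<longleftrightarrow> sq_integrable f \<and> sq_integrable g \<and> (AE x in lborel. f x = g x)"

lemma sq_integrable_zero: "sq_integrable (\<lambda>_. 0)"
  by (simp add: sq_integrable_def)

lemma sq_integrable_add:
  assumes "sq_integrable f" "sq_integrable g"
  shows "sq_integrable (\<lambda>x. f x + g x)"
proof -
  have [measurable]: "f \<in> borel_measurable lborel" "g \<in> borel_measurable lborel"
    using assms by (auto simp: sq_integrable_def)
  have bound: "(norm (f x + g x))\<^sup>2 \<le> 2 * (norm (f x))\<^sup>2 + 2 * (norm (g x))\<^sup>2" for x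
  proof -
    have "(norm (f x + g x))\<^sup>2 \<le> (norm (f x) + norm (g x))\<^sup>2"
      by (simp add: norm_triangle_ineq power_mono)
    also have "\<dots> \<le> 2 * (norm (f x))\<^sup>2 + 2 * (norm (g x))\<^sup>2"
      using sum_squares_bound[of "norm (f x)" "norm (g x)"]
      by (simp add: power2_sum)
    finally show ?thesis .
  qed
  have "integrable lborel (\<lambda>x. (norm (f x + g x))\<^sup>2)"
  proof (rule Bochner_Integration.integrable_bound)
    show "integrable lborel (\<lambda>x. 2 * (norm (f x))\<^sup>2 + 2 * (norm (g x))\<^sup>2)"
      using assms by (auto simp: sq_integrable_def)
    show "AE x in lborel. norm ((norm (f x + g x))\<^sup>2)
        \<le> norm (2 * (norm (f x))\<^sup>2 + 2 * (norm (g x))\<^sup>2)"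
      using bound by (intro AE_I2) (simp add: abs_of_nonneg)
  qed measurable
  then show ?thesis by (simp add: sq_integrable_def)
qed

lemma borel_measurable_scaleC:
  assumes "f \<in> borel_measurable M"
  shows "(\<lambda>x. a *\<^sub>C (f x :: 'a::{complex_normed_vector, second_countable_topology}))
    \<in> borel_measurable M"
  using assms
  by (rule borel_measurable_continuous_on[OF linear_continuous_on[OF bounded_linear_scaleC]])

lemma sq_integrable_scaleC:
  assumes "sq_integrable f"
  shows "sq_integrable (\<lambda>x. a *\<^sub>C f x)"
  using assms by (auto simp: sq_integrable_def norm_scaleC power_mult_distrib
      intro!: borel_measurable_scaleC)

lemma sq_integrable_scaleR: "sq_integrable f \<Longrightarrow> sq_integrable (\<lambda>x. r *\<^sub>R f x)"
  using sq_integrable_scaleC[of f "complex_of_real r"] by (simp add: scaleC_of_real)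

lemma sq_integrable_uminus: "sq_integrable f \<Longrightarrow> sq_integrable (\<lambda>x. - f x)"
  using sq_integrable_scaleR[of f "-1"] by simp

lemma sq_integrable_diff:
  "sq_integrable f \<Longrightarrow> sq_integrable g \<Longrightarrow> sq_integrable (\<lambda>x. f x - g x)"
  using sq_integrable_add[of f "\<lambda>x. - g x"] sq_integrable_uminus[of g] by simp

lemma integrable_inner:
  assumes "sq_integrable f" "sq_integrable g"
  shows "integrable lborel (\<lambda>x. inner (f x) (g x))"
proof (rule Bochner_Integration.integrable_bound)
  have [measurable]: "f \<in> borel_measurable lborel" "g \<in> borel_measurable lborel"
    using assms by (auto simp: sq_integrable_def)
  show "(\<lambda>x. inner (f x) (g x)) \<in> borel_measurable lborel" by measurable
  show "integrable lborel (\<lambda>x. (norm (f x))\<^sup>2 + (norm (g x))\<^sup>2)"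
    using assms by (auto simp: sq_integrable_def)
  have "\<bar>inner (f x) (g x)\<bar> \<le> (norm (f x))\<^sup>2 + (norm (g x))\<^sup>2" for x
  proof -
    have "\<bar>inner (f x) (g x)\<bar> \<le> norm (f x) * norm (g x)"
      by (rule Cauchy_Schwarz_ineq2)
    also have "\<dots> \<le> 2 * norm (f x) * norm (g x)" by simp
    also have "\<dots> \<le> (norm (f x))\<^sup>2 + (norm (g x))\<^sup>2"
      by (rule sum_squares_bound)
    finally show ?thesis .
  qed
  then show "AE x in lborel. norm (inner (f x) (g x))
      \<le> norm ((norm (f x))\<^sup>2 + (norm (g x))\<^sup>2)"
    by (intro AE_I2) simp
qed

lemma integrable_cinner:
  assumes "sq_integrable f" "sq_integrable g"
  shows "integrable lborel (\<lambda>x. cinner (f x) (g x))"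
proof -
  have "integrable lborel (\<lambda>x. complex_of_real (inner (f x) (g x)) +
      \<i> * complex_of_real (inner (\<i> *\<^sub>C f x) (g x)))"
    by (intro Bochner_Integration.integrable_add integrable_mult_right integrable_of_real
        integrable_inner sq_integrable_scaleC assms)
  then show ?thesis by (simp add: cinner_eq_Complex Complex_eq)
qed

text \<open>Elements are classes of almost everywhere equal Borel measurable functions; as the value
  space is separable, this gives the same space as Lebesgue or strong measurability.\<close>

quotient_type (overloaded) 'a L2 = "real \<Rightarrow> 'a::separable_complex_hilbert" / partial: l2_rel
proof (rule part_equivpI)
  show "\<exists>f. l2_rel f f"
    by (rule exI[of _ "\<lambda>_. 0"]) (simp add: l2_rel_def sq_integrable_zero)
  show "symp l2_rel"
    by (auto intro!: sympI simp: l2_rel_def elim!: AE_mp)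
  show "transp l2_rel"
    by (auto intro!: transpI simp: l2_rel_def elim!: AE_mp)
qed

lemma l2_rel_integral_inner:
  assumes "l2_rel f f'" "l2_rel g g'"
  shows "(\<integral>x. inner (f x) (g x) \<partial>lborel) = (\<integral>x. inner (f' x) (g' x) \<partial>lborel)"
proof (rule integral_cong_AE)
  show "(\<lambda>x. inner (f x) (g x)) \<in> borel_measurable lborel"
    "(\<lambda>x. inner (f' x) (g' x)) \<in> borel_measurable lborel"
    using assms unfolding l2_rel_def by (blast intro: borel_measurable_integrable integrable_inner)+
  show "AE x in lborel. inner (f x) (g x) = inner (f' x) (g' x)"
    using assms by (auto simp: l2_rel_def elim!: AE_mp)
qed

lemma l2_rel_integral_cinner:
  assumes "l2_rel f f'" "l2_rel g g'"
  shows "(\<integral>x. cinner (f x) (g x) \<partial>lborel) = (\<integral>x. cinner (f' x) (g' x) \<partial>lborel)"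
proof (rule integral_cong_AE)
  show "(\<lambda>x. cinner (f x) (g x)) \<in> borel_measurable lborel"
    "(\<lambda>x. cinner (f' x) (g' x)) \<in> borel_measurable lborel"
    using assms unfolding l2_rel_def by (blast intro: borel_measurable_integrable integrable_cinner)+
  show "AE x in lborel. cinner (f x) (g x) = cinner (f' x) (g' x)"
    using assms by (auto simp: l2_rel_def elim!: AE_mp)
qed

instantiation L2 :: (separable_complex_hilbert) real_vector
begin

lift_definition zero_L2 :: "'a L2" is "\<lambda>_. 0"
  by (simp add: l2_rel_def sq_integrable_zero)

lift_definition plus_L2 :: "'a L2 \<Rightarrow> 'a L2 \<Rightarrow> 'a L2" is "\<lambda>f g x. f x + g x"
  by (auto simp: l2_rel_def intro!: sq_integrable_add elim!: AE_mp)

lift_definition minus_L2 :: "'a L2 \<Rightarrow> 'a L2 \<Rightarrow> 'a L2" is "\<lambda>f g x. f x - g x"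
  by (auto simp: l2_rel_def intro!: sq_integrable_diff elim!: AE_mp)

lift_definition uminus_L2 :: "'a L2 \<Rightarrow> 'a L2" is "\<lambda>f x. - f x"
  by (auto simp: l2_rel_def intro!: sq_integrable_uminus elim!: AE_mp)

lift_definition scaleR_L2 :: "real \<Rightarrow> 'a L2 \<Rightarrow> 'a L2" is "\<lambda>r f x. r *\<^sub>R f x"
  by (auto simp: l2_rel_def intro!: sq_integrable_scaleR elim!: AE_mp)

instance
  by standard
    (transfer; auto simp: l2_rel_def algebra_simps
      intro: sq_integrable_add sq_integrable_scaleR sq_integrable_diff sq_integrable_zero
        sq_integrable_uminus)+

end

instantiation L2 :: (separable_complex_hilbert) real_inner
begin

lift_definition inner_L2 :: "'a L2 \<Rightarrow> 'a L2 \<Rightarrow> real"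
  is "\<lambda>f g. \<integral>x. inner (f x) (g x) \<partial>lborel"
  by (rule l2_rel_integral_inner)

definition norm_L2 :: "'a L2 \<Rightarrow> real"
  where "norm_L2 u = sqrt (inner u u)"

definition sgn_L2 :: "'a L2 \<Rightarrow> 'a L2"
  where "sgn_L2 u = u /\<^sub>R norm u"

definition dist_L2 :: "'a L2 \<Rightarrow> 'a L2 \<Rightarrow> real"
  where "dist_L2 u v = norm (u - v)"

definition uniformity_L2 :: "('a L2 \<times> 'a L2) filter"
  where [code del]: "uniformity_L2 = (INF e\<in>{0<..}. principal {(u, v). dist u v < e})"

definition open_L2 :: "'a L2 set \<Rightarrow> bool"
  where [code del]: "open_L2 S \<longleftrightarrow> (\<forall>u\<in>S. \<forall>\<^sub>F (u', v) in uniformity. u' = u \<longrightarrow> v \<in> S)"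

instance
proof
  fix r :: real and u v w :: "'a L2" and S :: "'a L2 set"
  show "dist u v = norm (u - v)" by (rule dist_L2_def)
  show "sgn u = u /\<^sub>R norm u" by (rule sgn_L2_def)
  show "uniformity = (INF e\<in>{0<..}. principal {(u :: 'a L2, v). dist u v < e})"
    by (rule uniformity_L2_def)
  show "open S \<longleftrightarrow> (\<forall>u\<in>S. \<forall>\<^sub>F (u', v) in uniformity. u' = u \<longrightarrow> v \<in> S)"
    by (rule open_L2_def)
  show "norm u = sqrt (inner u u)" by (rule norm_L2_def)
  show "inner u v = inner v u"
    by transfer (simp add: inner_commute)
  show "inner (u + v) w = inner u w + inner v w"
  proof transfer
    fix f g h :: "real \<Rightarrow> 'a"
    assume "l2_rel f f" "l2_rel g g" "l2_rel h h"
    then show "(\<integral>x. inner (f x + g x) (h x) \<partial>lborel) =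
        (\<integral>x. inner (f x) (h x) \<partial>lborel) + (\<integral>x. inner (g x) (h x) \<partial>lborel)"
      unfolding inner_add_left l2_rel_def
      by (intro Bochner_Integration.integral_add integrable_inner) auto
  qed
  show "inner (r *\<^sub>R u) v = r * inner u v"
    by transfer simp
  show "0 \<le> inner u u"
    by transfer simp
  show "inner u u = 0 \<longleftrightarrow> u = 0"
  proof transfer
    fix f :: "real \<Rightarrow> 'a"
    assume "l2_rel f f"
    then have f: "sq_integrable f" by (simp add: l2_rel_def)
    have "(\<integral>x. inner (f x) (f x) \<partial>lborel) = 0 \<longleftrightarrow> (AE x in lborel. inner (f x) (f x) = 0)"
      by (rule integral_nonneg_eq_0_iff_AE[OF integrable_inner[OF f f]]) simp
    then show "(\<integral>x. inner (f x) (f x) \<partial>lborel) = 0 \<longleftrightarrow> l2_rel f (\<lambda>_. 0)"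
      using f by (simp add: l2_rel_def sq_integrable_zero)
  qed
qed

end

instantiation L2 :: (separable_complex_hilbert) complex_inner
begin

lift_definition scaleC_L2 :: "complex \<Rightarrow> 'a L2 \<Rightarrow> 'a L2" is "\<lambda>a f x. a *\<^sub>C f x"
  by (auto simp: l2_rel_def intro!: sq_integrable_scaleC elim!: AE_mp)

lift_definition cinner_L2 :: "'a L2 \<Rightarrow> 'a L2 \<Rightarrow> complex"
  is "\<lambda>f g. \<integral>x. cinner (f x) (g x) \<partial>lborel"
  by (rule l2_rel_integral_cinner)

instance
proof
  fix a b :: complex and r :: real and u v w :: "'a L2"
  show "a *\<^sub>C (u + v) = a *\<^sub>C u + a *\<^sub>C v"
    by transfer (auto simp: l2_rel_def scaleC_add_right intro: sq_integrable_add sq_integrable_scaleC)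
  show "(a + b) *\<^sub>C u = a *\<^sub>C u + b *\<^sub>C u"
    by transfer (auto simp: l2_rel_def scaleC_add_left intro: sq_integrable_add sq_integrable_scaleC)
  show "a *\<^sub>C (b *\<^sub>C u) = (a * b) *\<^sub>C u"
    by transfer (auto simp: l2_rel_def scaleC_scaleC intro: sq_integrable_scaleC)
  show "complex_of_real r *\<^sub>C u = r *\<^sub>R u"
    by transfer (auto simp: l2_rel_def scaleC_of_real intro: sq_integrable_scaleR)
  show "cinner u v = cnj (cinner v u)"
    by transfer (subst cinner_commute, simp)
  show "cinner u (v + w) = cinner u v + cinner u w"
  proof transfer
    fix f g h :: "real \<Rightarrow> 'a"
    assume "l2_rel f f" "l2_rel g g" "l2_rel h h"
    then show "(\<integral>x. cinner (f x) (g x + h x) \<partial>lborel) =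
        (\<integral>x. cinner (f x) (g x) \<partial>lborel) + (\<integral>x. cinner (f x) (h x) \<partial>lborel)"
      unfolding cinner_add_right l2_rel_def
      by (intro Bochner_Integration.integral_add integrable_cinner) auto
  qed
  show "cinner u (a *\<^sub>C v) = a * cinner u v"
    by transfer (simp add: cinner_scaleC_right)
  show "inner u v = Re (cinner u v)"
  proof transfer
    fix f g :: "real \<Rightarrow> 'a"
    assume "l2_rel f f" "l2_rel g g"
    then have "integrable lborel (\<lambda>x. cinner (f x) (g x))"
      unfolding l2_rel_def by (intro integrable_cinner) auto
    then show "(\<integral>x. inner (f x) (g x) \<partial>lborel) = Re (\<integral>x. cinner (f x) (g x) \<partial>lborel)"
      by (simp add: inner_eq_Re_cinner)
  qed
  have "inner (a *\<^sub>C u) (a *\<^sub>C u) = (cmod a)\<^sup>2 * inner u u"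
    by transfer (simp add: norm_scaleC power_mult_distrib flip: power2_norm_eq_inner)
  then show "norm (a *\<^sub>C u) = cmod a * norm u"
    by (simp add: norm_eq_sqrt_inner real_sqrt_mult)
qed

end

lemma sq_integrable_rep_L2: "sq_integrable (rep_L2 u)"
  using Quotient_rel_rep[OF Quotient_L2, of u u] by (simp add: l2_rel_def)

lemma abs_L2_rep_L2: "abs_L2 (rep_L2 u) = u"
  by (rule Quotient_abs_rep[OF Quotient_L2])

lemma rep_L2_abs_L2: "sq_integrable f \<Longrightarrow> AE x in lborel. rep_L2 (abs_L2 f) x = f x"
  using Quotient_rep_abs[OF Quotient_L2, of f] by (simp add: l2_rel_def)

lemma abs_L2_eq_iff:
  "sq_integrable f \<Longrightarrow> sq_integrable g \<Longrightarrow> abs_L2 f = abs_L2 g \<longleftrightarrow> (AE x in lborel. f x = g x)"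
  using Quotient_rel[OF Quotient_L2, of f g] by (simp add: l2_rel_def)

lemma minus_abs_L2:
  "sq_integrable f \<Longrightarrow> sq_integrable g \<Longrightarrow> abs_L2 f - abs_L2 g = abs_L2 (\<lambda>x. f x - g x)"
  by (simp add: minus_L2.abs_eq l2_rel_def)

lemma norm_abs_L2:
  assumes "sq_integrable f"
  shows "ennreal ((norm (abs_L2 f))\<^sup>2) = (\<integral>\<^sup>+x. ennreal ((norm (f x))\<^sup>2) \<partial>lborel)"
proof -
  have "(norm (abs_L2 f))\<^sup>2 = (\<integral>x. inner (f x) (f x) \<partial>lborel)"
    using assms by (simp add: power2_norm_eq_inner inner_L2.abs_eq l2_rel_def)
  also have "\<dots> = (\<integral>x. (norm (f x))\<^sup>2 \<partial>lborel)"
    by (simp add: power2_norm_eq_inner)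
  finally show ?thesis
    using assms by (subst nn_integral_eq_integral) (auto simp: sq_integrable_def)
qed

instance L2 :: (separable_complex_hilbert) complex_hilbert
proof
  fix X :: "nat \<Rightarrow> 'a L2"
  assume X: "Cauchy X"
  define f where "f n = rep_L2 (X n)" for n
  have f: "sq_integrable (f n)" and Xf: "X n = abs_L2 (f n)" for n
    by (simp_all add: f_def sq_integrable_rep_L2 abs_L2_rep_L2)
  have f_meas[measurable]: "f n \<in> borel_measurable lborel" for n
    using f by (auto simp: sq_integrable_def)
  have dist: "(\<integral>\<^sup>+x. ennreal ((norm (f m x - f n x))\<^sup>2) \<partial>lborel) = ennreal ((norm (X m - X n))\<^sup>2)"
    for m n
    by (simp add: Xf minus_abs_L2 f norm_abs_L2 sq_integrable_diff)
  have "\<exists>N. \<forall>m\<ge>N. \<forall>n\<ge>N. norm (X m - X n) < (1/2)^k" for k :: nat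
    using CauchyD[OF X, of "(1/2)^k"] by simp
  then obtain N where N: "\<And>k m n. m \<ge> N k \<Longrightarrow> n \<ge> N k \<Longrightarrow> norm (X m - X n) < (1/2)^k"
    by metis
  define r where "r k = (\<Sum>i\<le>k. N i) + k" for k
  have rN: "r k \<ge> N k" "r (Suc k) \<ge> N k" for k
  proof -
    have "N k \<le> (\<Sum>i\<le>k. N i)" by (rule member_le_sum) auto
    then show "r k \<ge> N k" "r (Suc k) \<ge> N k" by (simp_all add: r_def)
  qed
  have rk: "r k \<ge> k" for k by (simp add: r_def)
  have "AE x in lborel. (\<Sum>k. ennreal (2^k * (norm (f (r (Suc k)) x - f (r k) x))\<^sup>2)) \<noteq> \<infinity>"
  proof (rule nn_integral_PInf_AE)
    have "(\<integral>\<^sup>+x. (\<Sum>k. ennreal (2^k * (norm (f (r (Suc k)) x - f (r k) x))\<^sup>2)) \<partial>lborel)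
        = (\<Sum>k. ennreal (2^k) * ennreal ((norm (X (r (Suc k)) - X (r k)))\<^sup>2))"
      by (subst nn_integral_suminf) (auto simp: ennreal_mult nn_integral_cmult dist)
    also have "\<dots> \<le> (\<Sum>k. ennreal ((1/2)^k))"
    proof (intro suminf_le summableI)
      fix k
      have "2^k * (norm (X (r (Suc k)) - X (r k)))\<^sup>2 \<le> 2^k * ((1/2)^k)\<^sup>2"
        using N[OF rN(2) rN(1), of k] by (intro mult_left_mono power_mono) auto
      also have "\<dots> = (1/2::real)^k"
        by (simp add: power2_eq_square power_divide)
      finally show "ennreal (2^k) * ennreal ((norm (X (r (Suc k)) - X (r k)))\<^sup>2) \<le> ennreal ((1/2)^k)"
        by (simp flip: ennreal_mult add: ennreal_leI)
    qed
    also have "\<dots> = ennreal (\<Sum>k. (1/2)^k)"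
      by (intro suminf_ennreal2 summable_geometric) auto
    also have "\<dots> < \<infinity>" by simp
    finally show "(\<integral>\<^sup>+x. (\<Sum>k. ennreal (2^k * (norm (f (r (Suc k)) x - f (r k) x))\<^sup>2)) \<partial>lborel) \<noteq> \<infinity>"
      by simp
  qed measurable
  then have conv: "AE x in lborel. convergent (\<lambda>k. f (r k) x)"
  proof eventually_elim
    fix x
    let ?d = "\<lambda>k. norm (f (r (Suc k)) x - f (r k) x)"
    assume fin: "(\<Sum>k. ennreal (2^k * (?d k)\<^sup>2)) \<noteq> \<infinity>"
    have "summable (\<lambda>k. 2^k * (?d k)\<^sup>2)"
      by (rule summable_suminf_not_top) (use fin in auto)
    then have "Bseq (\<lambda>k. 2^k * (?d k)\<^sup>2)"
      by (intro convergent_imp_Bseq convergentI[OF summable_LIMSEQ_zero])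
    then obtain C where C: "\<And>k. norm (2^k * (?d k)\<^sup>2) \<le> C"
      by (rule BseqE) blast
    have C0: "C \<ge> 0" using C[of 0] by (meson norm_ge_zero order_trans)
    have d: "?d k \<le> sqrt C * (sqrt (1/2))^k" for k
    proof (rule power2_le_imp_le)
      have "2^k * (?d k)\<^sup>2 \<le> C" using C[of k] by simp
      then have "(?d k)\<^sup>2 \<le> C * (1/2)^k"
        by (simp add: field_simps power_divide)
      also have "\<dots> = (sqrt C * (sqrt (1/2))^k)\<^sup>2"
      proof -
        have "((sqrt (1/2))^k)\<^sup>2 = ((sqrt (1/2))\<^sup>2)^k"
          by (simp only: power_mult[symmetric] mult.commute)
        also have "\<dots> = (1/2)^k"
          by (simp add: real_sqrt_pow2)
        finally show ?thesis using C0 by (simp only: power_mult_distrib real_sqrt_pow2)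
      qed
      finally show "(?d k)\<^sup>2 \<le> (sqrt C * (sqrt (1/2))^k)\<^sup>2" .
    qed (use C0 in simp)
    have "sqrt (1/2) < sqrt 1" by (rule real_sqrt_less_mono) simp
    then have "summable (\<lambda>k. sqrt C * (sqrt (1/2))^k)"
      by (intro summable_mult summable_geometric) simp
    then have "summable (\<lambda>k. f (r (Suc k)) x - f (r k) x)"
      by (rule summable_comparison_test') (rule d)
    then have "convergent (\<lambda>n. \<Sum>k<n. f (r (Suc k)) x - f (r k) x)"
      by (simp add: summable_iff_convergent)
    then have "convergent (\<lambda>n. (f (r n) x - f (r 0) x) + f (r 0) x)"
      unfolding sum_lessThan_telescope[of "\<lambda>n. f (r n) x"]
      by (intro convergent_add convergent_const)
    then show "convergent (\<lambda>k. f (r k) x)" by simp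
  qed
  define g where "g x = lim (\<lambda>k. f (r k) x)" for x
  have [measurable]: "g \<in> borel_measurable lborel"
    unfolding g_def by measurable
  have close: "(\<integral>\<^sup>+x. ennreal ((norm (g x - f n x))\<^sup>2) \<partial>lborel) \<le> ennreal (((1/2)^j)\<^sup>2)"
    if n: "n \<ge> N j" for n j
  proof -
    have "(\<integral>\<^sup>+x. ennreal ((norm (g x - f n x))\<^sup>2) \<partial>lborel)
        = (\<integral>\<^sup>+x. liminf (\<lambda>k. ennreal ((norm (f (r k) x - f n x))\<^sup>2)) \<partial>lborel)"
    proof (rule nn_integral_cong_AE)
      show "AE x in lborel. ennreal ((norm (g x - f n x))\<^sup>2)
          = liminf (\<lambda>k. ennreal ((norm (f (r k) x - f n x))\<^sup>2))"
        using conv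
      proof eventually_elim
        fix x
        assume "convergent (\<lambda>k. f (r k) x)"
        then have "(\<lambda>k. f (r k) x) \<longlonglongrightarrow> g x"
          by (simp add: g_def convergent_LIMSEQ_iff)
        then have "(\<lambda>k. ennreal ((norm (f (r k) x - f n x))\<^sup>2)) \<longlonglongrightarrow> ennreal ((norm (g x - f n x))\<^sup>2)"
          by (intro tendsto_intros)
        then show "ennreal ((norm (g x - f n x))\<^sup>2)
            = liminf (\<lambda>k. ennreal ((norm (f (r k) x - f n x))\<^sup>2))"
          by (intro lim_imp_Liminf[symmetric]) auto
      qed
    qed
    also have "\<dots> \<le> liminf (\<lambda>k. \<integral>\<^sup>+x. ennreal ((norm (f (r k) x - f n x))\<^sup>2) \<partial>lborel)"
      by (intro nn_integral_liminf) measurable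
    also have "\<dots> = liminf (\<lambda>k. ennreal ((norm (X (r k) - X n))\<^sup>2))"
      by (simp add: dist)
    also have "\<dots> \<le> ennreal (((1/2)^j)\<^sup>2)"
    proof (rule Liminf_le)
      show "\<forall>\<^sub>F k in sequentially. ennreal ((norm (X (r k) - X n))\<^sup>2) \<le> ennreal (((1/2)^j)\<^sup>2)"
        using eventually_ge_at_top[of "N j"]
      proof eventually_elim
        fix k assume "N j \<le> k"
        then have "norm (X (r k) - X n) < (1/2)^j"
          using rk[of k] n by (intro N) auto
        then show "ennreal ((norm (X (r k) - X n))\<^sup>2) \<le> ennreal (((1/2)^j)\<^sup>2)"
          by (intro ennreal_leI power_mono) auto
      qed
    qed simp
    finally show ?thesis .
  qed
  have diff: "sq_integrable (\<lambda>x. g x - f (N j) x)" for j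
    unfolding sq_integrable_def
  proof
    show "integrable lborel (\<lambda>x. (norm (g x - f (N j) x))\<^sup>2)"
      using close[of j "N j"] by (intro integrableI_bounded) (auto simp: order_le_less_trans)
  qed measurable
  have g: "sq_integrable g"
    using sq_integrable_add[OF diff[of 0] f[of "N 0"]] by simp
  have "X \<longlonglongrightarrow> abs_L2 g"
  proof (rule LIMSEQ_I)
    fix e :: real assume "0 < e"
    then obtain j where j: "(1/2)^j < e"
      using real_arch_pow_inv[of e "1/2"] by auto
    have "norm (X n - abs_L2 g) < e" if "n \<ge> N j" for n
    proof -
      have "ennreal ((norm (abs_L2 g - X n))\<^sup>2) \<le> ennreal (((1/2)^j)\<^sup>2)"
        using close[OF that] by (simp add: Xf minus_abs_L2 f g norm_abs_L2 sq_integrable_diff)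
      then have "(norm (abs_L2 g - X n))\<^sup>2 \<le> ((1/2)^j)\<^sup>2"
        by (simp add: ennreal_le_iff)
      then have "norm (abs_L2 g - X n) \<le> (1/2)^j"
        by (rule power2_le_imp_le) simp
      then show ?thesis using j by (simp add: norm_minus_commute)
    qed
    then show "\<exists>no. \<forall>n\<ge>no. norm (X n - abs_L2 g) < e" by blast
  qed
  then show "convergent X" by (auto simp: convergent_def)
qed


section \<open>Operators\<close>

definition complex_linear :: "('a::complex_normed_vector \<Rightarrow>\<^sub>L 'b::complex_normed_vector) \<Rightarrow> bool"
  where "complex_linear A \<longleftrightarrow> (\<forall>a x. A (a *\<^sub>C x) = a *\<^sub>C A x)"

definition is_adjoint ::
    "('a::complex_inner \<Rightarrow>\<^sub>L 'b::complex_inner) \<Rightarrow> ('b \<Rightarrow>\<^sub>L 'a) \<Rightarrow> bool"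
  where "is_adjoint A B \<longleftrightarrow> (\<forall>x y. cinner (A x) y = cinner x (B y))"

definition cadjoint :: "('a::complex_hilbert \<Rightarrow>\<^sub>L 'b::complex_hilbert) \<Rightarrow> 'b \<Rightarrow>\<^sub>L 'a"
  where "cadjoint A = (THE B. is_adjoint A B)"

lemma cadjoint_eqI: "is_adjoint A B \<Longrightarrow> cadjoint A = B"
  unfolding cadjoint_def
proof (rule the_equality)
  fix B'
  assume A: "is_adjoint A B" "is_adjoint A B'"
  have "inner x (B' y - B y) = 0" for x y
    using A by (simp add: is_adjoint_def inner_eq_Re_cinner[of x] inner_diff_right)
  then have "B' y - B y = 0" for y
    by (metis inner_eq_zero_iff)
  then show "B' = B" by (intro blinfun_eqI) simp
qed

definition selfadjoint_op :: "('a::complex_hilbert \<Rightarrow>\<^sub>L 'a) \<Rightarrow> bool"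
  where "selfadjoint_op A \<longleftrightarrow> complex_linear A \<and> is_adjoint A A"

definition positive_op :: "('a::complex_hilbert \<Rightarrow>\<^sub>L 'a) \<Rightarrow> bool"
  where "positive_op A \<longleftrightarrow>
    complex_linear A \<and> (\<forall>x. cinner x (A x) \<in> \<real> \<and> 0 \<le> Re (cinner x (A x)))"

definition op_rank :: "('a::complex_normed_vector \<Rightarrow>\<^sub>L 'b::complex_normed_vector) \<Rightarrow> nat"
  where "op_rank A = complex_vector.dim (range (blinfun_apply A))"

definition op_exp :: "('a::complex_hilbert \<Rightarrow>\<^sub>L 'a) \<Rightarrow> 'a \<Rightarrow>\<^sub>L 'a"
  where "op_exp A = (\<Sum>n. (1 / fact n) *\<^sub>R ((\<lambda>B. A o\<^sub>L B) ^^ n) id_blinfun)"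

definition unitary :: "('a::complex_inner \<Rightarrow> 'b::complex_inner) \<Rightarrow> bool"
  where "unitary T \<longleftrightarrow>
    (\<forall>x y. T (x + y) = T x + T y) \<and> (\<forall>a x. T (a *\<^sub>C x) = a *\<^sub>C T x) \<and>
    (\<forall>x y. cinner (T x) (T y) = cinner x y) \<and> surj T"

section \<open>Dimension of Hilbert spaces\<close>

definition finite_dimensional :: "'a::complex_normed_vector itself \<Rightarrow> bool"
  where "finite_dimensional _ \<longleftrightarrow> (\<exists>B::'a set. finite B \<and> complex_vector.span B = UNIV)"

definition orthonormal_basis :: "'a::complex_inner set \<Rightarrow> bool"
  where "orthonormal_basis B \<longleftrightarrow>
    (\<forall>x\<in>B. \<forall>y\<in>B. cinner x y = (if x = y then 1 else 0)) \<and>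
    closure (complex_vector.span B) = UNIV"

text \<open>The common cardinality of all orthonormal bases; as the space is separable, the value
  \<open>\<infinity>\<close> means countably infinite dimension.\<close>

definition hilbert_dim :: "'a::separable_complex_hilbert itself \<Rightarrow> enat"
  where "hilbert_dim _ =
    (THE d. \<exists>B::'a set. orthonormal_basis B \<and> d = (if finite B then enat (card B) else \<infinity>))"

text \<open>The space \<open>\<ell>\<^sup>2(I)\<close>, realised inside the complex sequences; for \<open>I = {..<n}\<close> this is
  \<open>\<complex>\<^sup>n\<close> with its standard inner product.\<close>

definition ell2 :: "nat set \<Rightarrow> (nat \<Rightarrow> complex) set"
  where "ell2 I = {c. (\<forall>i. i \<notin> I \<longrightarrow> c i = 0) \<and> summable (\<lambda>i. (cmod (c i))\<^sup>2)}"

definition isomorphic_ell2 :: "'a::complex_inner itself \<Rightarrow> nat set \<Rightarrow> bool"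
  where "isomorphic_ell2 _ I \<longleftrightarrow> (\<exists>T :: 'a \<Rightarrow> nat \<Rightarrow> complex.
    (\<forall>x y i. T (x + y) i = T x i + T y i) \<and> (\<forall>a x i. T (a *\<^sub>C x) i = a * T x i) \<and>
    bij_betw T UNIV (ell2 I) \<and>
    (\<forall>x y. (\<lambda>i. cnj (T x i) * T y i) sums cinner x y))"

section \<open>Hardy spaces\<close>

definition upper_half_plane :: "complex set"
  where "upper_half_plane = {z. Im z > 0}"

definition vholomorphic_on :: "(complex \<Rightarrow> 'a::complex_normed_vector) \<Rightarrow> complex set \<Rightarrow> bool"
  where "vholomorphic_on f S \<longleftrightarrow>
    (\<forall>z\<in>S. \<exists>D. ((\<lambda>w. (1 / (w - z)) *\<^sub>C (f w - f z)) \<longlongrightarrow> D) (at z within S))"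

text \<open>The closed subspace of \<open>L\<^sup>2\<close> consisting of the boundary values of Hardy functions.\<close>

definition H2 :: "'a::separable_complex_hilbert L2 set"
  where "H2 = {u. \<exists>f. vholomorphic_on f upper_half_plane \<and>
    (SUP y\<in>{0<..}. \<integral>\<^sup>+x. ennreal ((norm (f (Complex x y)))\<^sup>2) \<partial>lborel) < \<infinity> \<and>
    (AE x in lborel. ((\<lambda>y. f (Complex x y)) \<longlongrightarrow> rep_L2 u x) (at_right 0))}"

text \<open>Multiplication by \<open>g\<close>; only meaningful where the pointwise product is again measurable and
  square integrable.\<close>

definition mult_op :: "(real \<Rightarrow> 'a \<Rightarrow>\<^sub>L 'b) \<Rightarrow>
    'a::separable_complex_hilbert L2 \<Rightarrow> 'b::separable_complex_hilbert L2"
  where "mult_op g u = abs_L2 (\<lambda>x. g x (rep_L2 u x))"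

definition shift_group :: "real \<Rightarrow> 'a::separable_complex_hilbert L2 \<Rightarrow> 'a L2"
  where "shift_group t = mult_op (\<lambda>x. exp (\<i> * of_real (t * x)) *\<^sub>C id_blinfun)"

section \<open>Complex regular one-parameter groups\<close>

text \<open>The ambient Hilbert space of the triple is the whole type \<^typ>\<open>'e\<close>.\<close>

definition ropg :: "'e::complex_hilbert set \<Rightarrow> (real \<Rightarrow> 'e \<Rightarrow> 'e) \<Rightarrow> bool"
  where "ropg E U \<longleftrightarrow>
    complex_vector.subspace E \<and> closed E \<and>
    (\<forall>t. unitary (U t)) \<and> (\<forall>u. U 0 u = u) \<and> (\<forall>s t u. U (s + t) u = U s (U t u)) \<and>
    (\<forall>u. continuous_on UNIV (\<lambda>t. U t u)) \<and>
    (\<forall>t\<ge>0. U t ` E \<subseteq> E) \<and> (\<Inter>t. U t ` E) = {0} \<and> closure (\<Union>t. U t ` E) = UNIV"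

definition multiplicity_space ::
    "'k::separable_complex_hilbert itself \<Rightarrow> 'e::complex_hilbert set \<Rightarrow> (real \<Rightarrow> 'e \<Rightarrow> 'e) \<Rightarrow> bool"
  where "multiplicity_space _ E U \<longleftrightarrow> (\<exists>\<psi> :: 'e \<Rightarrow> 'k L2.
    unitary \<psi> \<and> \<psi> ` E = H2 \<and> (\<forall>t u. \<psi> (U t u) = shift_group t (\<psi> u)))"

section \<open>Operator-valued Pick functions\<close>

text \<open>Membership only concerns the values on the upper half-plane.\<close>

definition pick_R :: "(complex \<Rightarrow> 'h::separable_complex_hilbert \<Rightarrow>\<^sub>L 'h) set"
  where "pick_R = {F.
    (\<forall>z\<in>upper_half_plane. complex_linear (F z)) \<and>
    vholomorphic_on F upper_half_plane \<and>
    (\<forall>z\<in>upper_half_plane. positive_op ((1 / (2 * \<i>)) *\<^sub>C (F z - cadjoint (F z)))) \<and>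
    (AE x in lborel. \<exists>A. selfadjoint_op A \<and> ((\<lambda>e. F (Complex x e)) \<longlongrightarrow> A) (at_right 0))}"

definition boundary_value :: "(complex \<Rightarrow> 'h::separable_complex_hilbert \<Rightarrow>\<^sub>L 'h) \<Rightarrow> real \<Rightarrow> 'h \<Rightarrow>\<^sub>L 'h"
  where "boundary_value F x = Lim (at_right 0) (\<lambda>e. F (Complex x e))"

definition pick_group ::
    "(complex \<Rightarrow> 'h::separable_complex_hilbert \<Rightarrow>\<^sub>L 'h) \<Rightarrow> real \<Rightarrow> 'h L2 \<Rightarrow> 'h L2"
  where "pick_group F t = mult_op (\<lambda>x. op_exp ((\<i> * of_real t) *\<^sub>C boundary_value F x))"

definition pick_regular :: "(complex \<Rightarrow> 'h::separable_complex_hilbert \<Rightarrow>\<^sub>L 'h) \<Rightarrow> bool"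
  where "pick_regular F \<longleftrightarrow> ropg H2 (pick_group F)"

definition rational_representation ::
    "(complex \<Rightarrow> 'h::separable_complex_hilbert \<Rightarrow>\<^sub>L 'h) \<Rightarrow>
      'h \<Rightarrow>\<^sub>L 'h \<Rightarrow> 'h \<Rightarrow>\<^sub>L 'h \<Rightarrow> nat \<Rightarrow> (nat \<Rightarrow> real) \<Rightarrow> (nat \<Rightarrow> 'h \<Rightarrow>\<^sub>L 'h) \<Rightarrow> bool"
  where "rational_representation F C D m l A \<longleftrightarrow>
    selfadjoint_op C \<and> positive_op D \<and> (\<forall>j\<in>{1..m}. positive_op (A j)) \<and> inj_on l {1..m} \<and>
    (\<forall>z\<in>upper_half_plane.
      F z = C + z *\<^sub>C D + (\<Sum>j=1..m. (1 / (of_real (l j) - z)) *\<^sub>C A j))"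

definition Rat :: "(complex \<Rightarrow> 'h::separable_complex_hilbert \<Rightarrow>\<^sub>L 'h) set"
  where "Rat = {F. \<exists>C D m l A. rational_representation F C D m l A}"

text \<open>A representation is unique up to the order of the summands and vanishing \<open>A j\<close>, so the
  degree does not depend on its choice.\<close>

definition pick_degree :: "(complex \<Rightarrow> 'h::separable_complex_hilbert \<Rightarrow>\<^sub>L 'h) \<Rightarrow> enat"
  where "pick_degree F = (if F \<in> Rat
    then enat (THE d. \<exists>C D m l A. rational_representation F C D m l A \<and>
      d = op_rank D + (\<Sum>j=1..m. op_rank (A j)))
    else \<infinity>)"

end

theory Submission
  imports Defs "HOL-Complex_Analysis.Complex_Analysis" "HOL-Real_Asymp.Real_Asymp"
    "HOL-Computational_Algebra.Fundamental_Theorem_Algebra"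
begin

text \<open>
  Put \<open>J = (F + i)\<inverse>\<close>. The Cayley transform \<open>W = 1 - 2 i J\<close> is the cogenerator of the group
  \<open>exp (i t F)\<close>, just as \<open>(x - i) / (x + i)\<close> is that of \<open>exp (i t x)\<close>, so the intertwining
  unitary \<open>\<psi>\<close> also intertwines these two multiplications; this follows from the difference
  quotients of the groups by Fatou's lemma. Hence \<open>\<psi>\<close> maps the orthogonal complement \<open>M\<close> of
  \<open>W H\<^sup>2\<close> in \<open>H\<^sup>2\<close> onto the functions \<open>k / (x + i)\<close>, which makes \<open>M\<close> isomorphic to the
  multiplicity space.

  By the Cauchy formula \<open>M\<close> is spanned by the kernels
  \<open>J z (F z - (F w)\<^sup>*) k / (z - cnj w)\<close>. For rational \<open>F\<close> the quotient of \<open>F z - (F w)\<^sup>*\<close> by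
  \<open>z - cnj w\<close> expands in \<open>1\<close> and \<open>1 / (\<lambda>\<^sub>j - z)\<close>, and bases of the ranges of \<open>D\<close> and \<open>A\<^sub>j\<close> give
  a basis of \<open>M\<close> with \<open>deg F\<close> elements. Conversely, if \<open>M\<close> is finite-dimensional, then finitely
  many kernels are linearly dependent, so a scalar polynomial times \<open>F\<close> is a polynomial;
  nonnegativity of the imaginary part then forces the poles of \<open>F\<close> to be real and simple and
  its growth to be at most linear, so \<open>F\<close> is rational.
\<close>

text \<open>The generators are in general unbounded, and a given vector need not lie in their
  domain. \<open>J\<close> is the tame substitute: dissipativity makes it a holomorphic contraction,
  so it maps H2 into itself, and every \<open>J u\<close> lies in the domain of the generator. On
  the model side (x - i) / (x + i) has its only zero at i, which is why the kernel at that one point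
  describes the orthogonal complement. The kernels come from (1 - W(z) V(w)) / (z - cnj w), with
  V(w) the adjoint of W(w), which is up to a constant the reproducing kernel of \<open>M\<close>.
  Applied to (G - i) k, where G is the adjoint of F(w), the inverse of G - i cancels and the
  numerator becomes -2 i J(z) (F(z) - G) k. The obstacle is that a Hardy function is given only by
  uniform L2 bounds on horizontal lines and radial limits almost everywhere, not by convergence in
  norm. The Cauchy formula therefore rests on a weak convergence argument, and identities in H2 are
  compared through Cauchy integrals. That the degree does not depend on the representation is a
  consequence: each representation yields a basis of the same multiplicity space.\<close>

lemma cinner_scaleR_right: "cinner x (r *\<^sub>R y) = of_real r * cinner x (y::'a::complex_inner)"
  by (simp flip: scaleC_of_real add: cinner_scaleC_right)

lemma cinner_scaleR_left: "cinner (r *\<^sub>R x) y = of_real r * cinner x (y::'a::complex_inner)"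
  by (simp flip: scaleC_of_real add: cinner_scaleC_left)

lemma cinner_zero_right [simp]: "cinner x (0::'a::complex_inner) = 0"
  using cinner_scaleC_right[of x 0 0] by simp

lemma cinner_zero_left [simp]: "cinner (0::'a::complex_inner) x = 0"
  using cinner_scaleC_left[of 0 0 x] by simp

lemma cnj_mult_self: "cnj z * z = of_real ((cmod z)\<^sup>2)"
  by (metis complex_norm_square mult.commute)

lemma cinner_self: "cinner x x = of_real ((norm (x::'a::complex_inner))\<^sup>2)"
proof -
  have "Im (cinner x x) = 0"
    using arg_cong[OF cinner_commute[of x x], of Im] by simp
  then show ?thesis
    by (simp add: complex_eq_iff power2_norm_eq_inner inner_eq_Re_cinner)
qed

lemma cinner_self_eq_0_iff [simp]: "cinner x x = 0 \<longleftrightarrow> (x::'a::complex_inner) = 0"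
  by (simp add: cinner_self)

text \<open>The real Cauchy-Schwarz inequality applies once the unimodular factor \<open>a\<close>
  has rotated \<open>y\<close> so that the inner product becomes its modulus.\<close>

lemma norm_cinner_le: "cmod (cinner x y) \<le> norm x * norm (y::'a::complex_inner)"
proof (cases "cinner x y = 0")
  case False
  define a where "a = cnj (cinner x y) / cmod (cinner x y)"
  have "cmod a = 1" using False by (simp add: a_def norm_divide)
  have "inner x (a *\<^sub>C y) = Re (a * cinner x y)"
    by (simp add: inner_eq_Re_cinner cinner_scaleC_right)
  also have "a * cinner x y = of_real (cmod (cinner x y))"
    using False by (simp add: a_def complex_norm_square[symmetric] power2_eq_square mult.commute)
  finally have "cmod (cinner x y) = inner x (a *\<^sub>C y)" by simp
  also have "\<dots> \<le> norm x * norm (a *\<^sub>C y)" by (rule norm_cauchy_schwarz)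
  finally show ?thesis using \<open>cmod a = 1\<close> by (simp add: norm_scaleC)
qed simp

lemma bounded_bilinear_cinner: "bounded_bilinear (cinner :: 'a::complex_inner \<Rightarrow> 'a \<Rightarrow> complex)"
  by unfold_locales
    (auto simp: cinner_add_left cinner_add_right cinner_scaleR_left cinner_scaleR_right
      scaleR_conv_of_real intro!: exI[of _ 1] norm_cinner_le)

lemma bounded_bilinear_scaleC:
  "bounded_bilinear (scaleC :: complex \<Rightarrow> 'a::complex_normed_vector \<Rightarrow> 'a)"
  by unfold_locales
    (auto simp: scaleC_add_left scaleC_add_right norm_scaleC scaleR_conv_of_real mult.commute
      simp flip: scaleC_of_real simp: scaleC_scaleC intro!: exI[of _ 1])

lemmas cinner_diff_left = bounded_bilinear.diff_left[OF bounded_bilinear_cinner]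
  and cinner_diff_right = bounded_bilinear.diff_right[OF bounded_bilinear_cinner]
  and cinner_minus_right = bounded_bilinear.minus_right[OF bounded_bilinear_cinner]
  and cinner_sum_left = bounded_bilinear.sum_left[OF bounded_bilinear_cinner]
  and cinner_sum_right = bounded_bilinear.sum_right[OF bounded_bilinear_cinner]
  and tendsto_cinner [tendsto_intros] = bounded_bilinear.tendsto[OF bounded_bilinear_cinner]
  and scaleC_diff_left = bounded_bilinear.diff_left[OF bounded_bilinear_scaleC]
  and scaleC_diff_right = bounded_bilinear.diff_right[OF bounded_bilinear_scaleC]
  and scaleC_minus_left = bounded_bilinear.minus_left[OF bounded_bilinear_scaleC]
  and scaleC_minus_right = bounded_bilinear.minus_right[OF bounded_bilinear_scaleC]
  and scaleC_sum_left = bounded_bilinear.sum_left[OF bounded_bilinear_scaleC]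
  and scaleC_sum_right = bounded_bilinear.sum_right[OF bounded_bilinear_scaleC]
  and scaleC_zero_left [simp] = bounded_bilinear.zero_left[OF bounded_bilinear_scaleC]
  and scaleC_zero_right [simp] = bounded_bilinear.zero_right[OF bounded_bilinear_scaleC]
  and tendsto_scaleC [tendsto_intros] = bounded_bilinear.tendsto[OF bounded_bilinear_scaleC]

lemma cinner_eqI: "(\<And>y. cinner y x = cinner y x') \<Longrightarrow> x = (x'::'a::complex_inner)"
  using cinner_self_eq_0_iff[of "x - x'"] by (simp add: cinner_diff_right)

subsection \<open>Orthonormal sets\<close>

definition orthonormal :: "'a::complex_inner set \<Rightarrow> bool"
  where "orthonormal B \<longleftrightarrow> (\<forall>x\<in>B. \<forall>y\<in>B. cinner x y = (if x = y then 1 else 0))"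

lemma orthonormalD: "orthonormal B \<Longrightarrow> x \<in> B \<Longrightarrow> y \<in> B \<Longrightarrow> cinner x y = (if x = y then 1 else 0)"
  by (simp add: orthonormal_def)

lemma orthonormal_norm: "orthonormal B \<Longrightarrow> x \<in> B \<Longrightarrow> norm x = 1"
proof -
  assume "orthonormal B" "x \<in> B"
  then have "complex_of_real ((norm x)\<^sup>2) = 1"
    using orthonormalD[of B x x] by (simp add: cinner_self)
  then have "(norm x)\<^sup>2 = 1" using of_real_eq_1_iff by blast
  then show ?thesis by (metis norm_ge_zero power2_eq_1_iff abs_of_nonneg abs_minus_cancel abs_1)
qed

lemma orthonormal_cinner_sum:
  assumes "orthonormal B" "finite B'" "B' \<subseteq> B" "b \<in> B"
  shows "cinner b (\<Sum>x\<in>B'. c x *\<^sub>C x) = (if b \<in> B' then c b else 0)"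
proof -
  have "cinner b (\<Sum>x\<in>B'. c x *\<^sub>C x) = (\<Sum>x\<in>B'. if b = x then c x else 0)"
    unfolding cinner_sum_right
    by (intro sum.cong) (use assms in \<open>auto simp: cinner_scaleC_right orthonormalD subset_iff\<close>)
  then show ?thesis using assms by simp
qed


lemma orthonormal_independent:
  assumes "orthonormal B"
  shows "complex_vector.independent B"
  unfolding complex_vector.dependent_explicit
proof (safe)
  fix S f x
  assume "finite S" "S \<subseteq> B" "(\<Sum>x\<in>S. f x *\<^sub>C x) = 0" "x \<in> S" "f x \<noteq> 0"
  then show False
    using orthonormal_cinner_sum[OF assms, of S x f] by auto
qed

definition proj_on :: "'a::complex_inner set \<Rightarrow> 'a \<Rightarrow> 'a"
  where "proj_on B x = (\<Sum>b\<in>B. cinner b x *\<^sub>C b)"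

lemma proj_on_in_span: "proj_on B x \<in> complex_vector.span B"
  unfolding proj_on_def
  by (intro complex_vector.span_sum complex_vector.span_scale complex_vector.span_base)

lemma cinner_proj_on_diff:
  assumes "orthonormal B" "finite B" "y \<in> complex_vector.span B"
  shows "cinner y (x - proj_on B x) = 0"
  using assms(3)
proof (induction rule: complex_vector.span_induct_alt)
  case (step c b y)
  have "cinner b (x - proj_on B x) = 0"
    using orthonormal_cinner_sum[OF assms(1,2) subset_refl step(1)] step(1)
    by (simp add: cinner_diff_right proj_on_def)
  then show ?case using step by (simp add: cinner_add_left cinner_scaleC_left)
qed simp

lemma proj_on_span:
  assumes "orthonormal B" "finite B" "x \<in> complex_vector.span B"
  shows "proj_on B x = x"
proof -
  have "x - proj_on B x \<in> complex_vector.span B"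
    using assms proj_on_in_span complex_vector.span_diff by blast
  from cinner_proj_on_diff[OF assms(1,2) this, of x] show ?thesis by simp
qed

lemma orthonormal_insert:
  assumes "orthonormal B" "r \<noteq> 0" "\<And>b. b \<in> B \<Longrightarrow> cinner b r = 0"
  shows "orthonormal (insert ((1 / norm r) *\<^sub>R r) B)" "(1 / norm r) *\<^sub>R r \<notin> B"
proof -
  let ?e = "(1 / norm r) *\<^sub>R r"
  have e: "cinner ?e ?e = 1" using assms(2) by (simp add: cinner_self)
  have eb: "cinner b ?e = 0" if "b \<in> B" for b
    using assms(3)[OF that] by (simp add: cinner_scaleR_right)
  then have be: "cinner ?e b = 0" if "b \<in> B" for b
    using that by (metis cinner_commute complex_cnj_zero)
  show "?e \<notin> B" using e eb by fastforce
  then show "orthonormal (insert ?e B)"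
    using assms(1) e eb be unfolding orthonormal_def by (auto split: if_splits)
qed

text \<open>Independence is not assumed: a vector whose remainder \<open>r\<close> vanishes is
  dropped, so the span is kept but not the number of vectors.\<close>

lemma gram_schmidt:
  assumes "finite S"
  shows "\<exists>B::'a::complex_inner set. finite B \<and> orthonormal B \<and>
    complex_vector.span B = complex_vector.span S"
  using assms
proof (induction S)
  case empty
  then show ?case by (intro exI[of _ "{}"]) (simp add: orthonormal_def)
next
  case (insert x S)
  then obtain B where B: "finite B" "orthonormal B"
    "complex_vector.span B = complex_vector.span S" by auto
  define r where "r = x - proj_on B x"
  have x: "x = proj_on B x + r" by (simp add: r_def)
  have spx: "complex_vector.span (insert x S) = complex_vector.span (insert r B)"
  proof -
    have "complex_vector.span (insert x S) = complex_vector.span (insert x B)"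
      using B(3) by (metis complex_vector.span_insert)
    also have "\<dots> = complex_vector.span (insert r B)"
      unfolding r_def by (rule complex_vector.eq_span_insert_eq)
        (use proj_on_in_span[of B x] in simp)
    finally show ?thesis .
  qed
  show ?case
  proof (cases "r = 0")
    case True
    then show ?thesis using B spx by (auto simp: complex_vector.span_insert_0)
  next
    case False
    let ?e = "(1 / norm r) *\<^sub>R r"
    have "orthonormal (insert ?e B)"
      using orthonormal_insert(1)[OF B(2) False] cinner_proj_on_diff[OF B(2,1), of _ x]
      by (auto simp: r_def complex_vector.span_base)
    moreover have "complex_vector.span (insert ?e B) = complex_vector.span (insert r B)"
    proof (rule complex_vector.span_eq[THEN iffD2], safe)
      fix y assume "y \<in> B"
      then show "y \<in> complex_vector.span (insert ?e B)" "y \<in> complex_vector.span (insert r B)"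
        by (auto intro: complex_vector.span_base)
    next
      show "?e \<in> complex_vector.span (insert r B)"
        unfolding scaleC_of_real[symmetric]
        by (intro complex_vector.span_scale complex_vector.span_base) simp
      have "r = of_real (norm r) *\<^sub>C ?e"
        using False by (simp add: scaleC_of_real)
      also have "\<dots> \<in> complex_vector.span (insert ?e B)"
        by (intro complex_vector.span_scale complex_vector.span_base) simp
      finally show "r \<in> complex_vector.span (insert ?e B)" .
    qed
    ultimately show ?thesis using B spx by (intro exI[of _ "insert ?e B"]) auto
  qed
qed

text \<open>The projection onto a finite orthonormal set with the same span is continuous and fixes
  the span, hence also the limits of vectors in it.\<close>

lemma closure_span_finite:
  assumes "finite S"
  shows "closure (complex_vector.span S) = complex_vector.span (S :: 'a::complex_inner set)"
proof -
  obtain B where B: "finite B" "orthonormal B" "complex_vector.span B = complex_vector.span S"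
    using gram_schmidt[OF assms] by blast
  have "x \<in> complex_vector.span B" if x: "x \<in> closure (complex_vector.span B)" for x
  proof -
    obtain f where f: "\<And>n. f n \<in> complex_vector.span B" "f \<longlonglongrightarrow> x"
      using closure_sequential[THEN iffD1, OF x] by metis
    have "(\<lambda>n. proj_on B (f n)) \<longlonglongrightarrow> proj_on B x"
      unfolding proj_on_def
      by (intro tendsto_sum tendsto_scaleC tendsto_cinner tendsto_const f(2))
    moreover have "proj_on B (f n) = f n" for n
      by (rule proj_on_span[OF B(2,1) f(1)])
    ultimately have "f \<longlonglongrightarrow> proj_on B x" by simp
    then have "proj_on B x = x" using f(2) LIMSEQ_unique by blast
    then show ?thesis using proj_on_in_span[of B x] by simp
  qed
  then have "closure (complex_vector.span B) \<subseteq> complex_vector.span B" by (rule subsetI)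
  then show ?thesis unfolding B(3)[symmetric] by (rule subset_antisym) (rule closure_subset)
qed

section \<open>Hilbert dimension and coordinates\<close>

lemma hilbert_dim_eqI:
  fixes B :: "'a::separable_complex_hilbert set"
  assumes "orthonormal_basis B"
  shows "hilbert_dim TYPE('a) = (if finite B then enat (card B) else \<infinity>)"
  unfolding hilbert_dim_def
proof (rule the_equality)
  \<comment> \<open>\<open>B\<close> and \<open>C\<close> are rebound so that their roles can be
    exchanged: in the infinite case a finite second basis would make the first one finite.\<close>
  have *: "finite C" "card C = card B" if "orthonormal_basis B" "orthonormal_basis C" "finite B"
    for B C :: "'a set"
  proof -
    have B: "complex_vector.span B = UNIV"
      using that closure_span_finite[of B] by (simp add: orthonormal_basis_def)
    have ind: "complex_vector.independent B" "complex_vector.independent C"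
      using that by (auto simp: orthonormal_basis_def orthonormal_def intro!: orthonormal_independent)
    have fin: "finite C \<and> card C \<le> card B"
      using complex_vector.independent_span_bound[OF that(3) ind(2)] B by simp
    then show "finite C" by simp
    then have "complex_vector.span C = UNIV"
      using that closure_span_finite[of C] by (simp add: orthonormal_basis_def)
    then have "card B \<le> card C"
      using complex_vector.independent_span_bound[OF \<open>finite C\<close> ind(1)] by simp
    then show "card C = card B" using fin by simp
  qed
  show "\<exists>C::'a set. orthonormal_basis C \<and>
      (if finite B then enat (card B) else \<infinity>) = (if finite C then enat (card C) else \<infinity>)"
    using assms by (intro exI[of _ B]) simp
  fix d assume "\<exists>C::'a set. orthonormal_basis C \<and> d = (if finite C then enat (card C) else \<infinity>)"
  then obtain C :: "'a set" where C: "orthonormal_basis C" "d = (if finite C then enat (card C) else \<infinity>)"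
    by blast
  show "d = (if finite B then enat (card B) else \<infinity>)"
  proof (cases "finite B")
    case True
    then show ?thesis using *[OF assms C(1) True] C(2) by simp
  next
    case False
    then have "infinite C" using *(1)[OF C(1) assms] by blast
    then show ?thesis using C(2) False by simp
  qed
qed

text \<open>Gram-Schmidt alone does not control the number of vectors, but \<open>S\<close> is
  independent and spans, so both sets have the cardinality given by the dimension. Coordinates in
  the orthonormal set are the isomorphism.\<close>

lemma hilbert_dim_finite:
  fixes S :: "'a::separable_complex_hilbert set"
  assumes "finite S" "complex_vector.independent S" "complex_vector.span S = UNIV"
  shows "hilbert_dim TYPE('a) = enat (card S)" "isomorphic_ell2 TYPE('a) {..<card S}"
proof -
  obtain B where B: "finite B" "orthonormal B" "complex_vector.span B = (UNIV :: 'a set)"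
    using gram_schmidt[OF assms(1)] assms(3) by auto
  have card: "card B = card S"
    using complex_vector.dim_eq_card_independent[OF orthonormal_independent[OF B(2)]]
      complex_vector.dim_eq_card_independent[OF assms(2)] B assms(3)
    by (metis complex_vector.dim_span)
  have ob: "orthonormal_basis B"
    using B by (simp add: orthonormal_basis_def orthonormal_def)
  show "hilbert_dim TYPE('a) = enat (card S)"
    using hilbert_dim_eqI[OF ob] B card by simp
  obtain e where e: "bij_betw e {..<card S} B"
    using ex_bij_betw_nat_finite[OF B(1)] card by (auto simp: atLeast0LessThan)
  define T where "T x i = (if i < card S then cinner (e i) x else 0)" for x i
  have eB: "i < card S \<Longrightarrow> e i \<in> B" for i using e by (auto simp: bij_betw_def)
  have sum_e: "(\<Sum>b\<in>B. f b) = (\<Sum>i<card S. f (e i))" for f :: "'a \<Rightarrow> 'c::comm_monoid_add"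
    using sum.reindex_bij_betw[OF e, of f] by simp
  have expand: "x = (\<Sum>i<card S. cinner (e i) x *\<^sub>C e i)" for x
    using proj_on_span[OF B(2,1), of x] B(3) by (simp add: proj_on_def sum_e)
  have ee: "cinner (e i) (e j) = (if i = j then 1 else 0)" if "i < card S" "j < card S" for i j
    using orthonormalD[OF B(2) eB[OF that(1)] eB[OF that(2)]] e that
    by (auto simp: bij_betw_def inj_on_def)
  have "bij_betw T UNIV (ell2 {..<card S})"
    unfolding bij_betw_def
  proof
    show "inj T"
    proof (rule injI)
      fix x y assume "T x = T y"
      then have "cinner (e i) x = cinner (e i) y" if "i < card S" for i
        using that by (metis T_def)
      then show "x = y" by (subst expand[of x], subst expand[of y]) simp
    qed
    show "range T = ell2 {..<card S}"
    proof (intro equalityI subsetI)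
      fix c assume "c \<in> range T"
      then show "c \<in> ell2 {..<card S}"
        by (fastforce simp: ell2_def T_def intro!: summable_finite[of "{..<card S}"] split: if_splits)
    next
      fix c assume c: "c \<in> ell2 {..<card S}"
      have "T (\<Sum>i<card S. c i *\<^sub>C e i) = c"
      proof
        fix j show "T (\<Sum>i<card S. c i *\<^sub>C e i) j = c j"
        proof (cases "j < card S")
          case True
          have "cinner (e j) (\<Sum>i<card S. c i *\<^sub>C e i) = (\<Sum>i<card S. if j = i then c i else 0)"
            unfolding cinner_sum_right
            by (intro sum.cong) (use ee True in \<open>auto simp: cinner_scaleC_right\<close>)
          then show ?thesis using True by (simp add: T_def)
        qed (use c in \<open>auto simp: T_def ell2_def\<close>)
      qed
      then show "c \<in> range T" by (metis rangeI)
    qed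
  qed
  moreover have "(\<lambda>i. cnj (T x i) * T y i) sums cinner x y" for x y
  proof -
    have "cinner x y = (\<Sum>i<card S. cnj (T x i) * T y i)"
      by (subst expand[of x])
        (simp add: cinner_sum_left cinner_scaleC_left T_def)
    then show ?thesis
      by (metis (no_types, lifting) sums_finite[of "{..<card S}" "\<lambda>i. cnj (T x i) * T y i"] T_def
        finite_lessThan lessThan_iff mult_zero_right)
  qed
  ultimately show "isomorphic_ell2 TYPE('a) {..<card S}"
    unfolding isomorphic_ell2_def
    by (intro exI[of _ T]) (auto simp: T_def cinner_add_right cinner_scaleC_right)
qed

lemma norm_sum_orthonormal:
  assumes "\<And>i j. cinner (e i) (e j) = (if i = j then 1 else (0::complex))" "finite A"
  shows "(norm (\<Sum>i\<in>A. c i *\<^sub>C (e i :: 'a::complex_inner)))\<^sup>2 = (\<Sum>i\<in>A. (cmod (c i))\<^sup>2)"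
proof -
  have "complex_of_real ((norm (\<Sum>i\<in>A. c i *\<^sub>C e i))\<^sup>2)
      = (\<Sum>i\<in>A. \<Sum>j\<in>A. if i = j then cnj (c j) * c i else 0)"
    unfolding cinner_self[symmetric] cinner_sum_right cinner_sum_left cinner_scaleC_left
      cinner_scaleC_right assms
    by (intro sum.cong refl) (simp add: assms(2) mult_delta_right)
  also have "\<dots> = (\<Sum>i\<in>A. cnj (c i) * c i)"
    using assms(2) by simp
  also have "\<dots> = complex_of_real (\<Sum>i\<in>A. (cmod (c i))\<^sup>2)"
    by (simp only: cnj_mult_self of_real_sum)
  finally show ?thesis using of_real_eq_iff by blast
qed

text \<open>By Pythagoras the squared norm of a block of the series is the block of the squared
  coefficients, so the Cauchy criterion carries over; completeness does the rest.\<close>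

lemma summable_orthonormal:
  fixes e :: "nat \<Rightarrow> 'a::complex_hilbert"
  assumes e: "\<And>i j. cinner (e i) (e j) = (if i = j then 1 else 0)"
    and c: "summable (\<lambda>i. (cmod (c i))\<^sup>2)"
  shows "summable (\<lambda>i. c i *\<^sub>C e i)"
  unfolding summable_Cauchy
proof (intro allI impI)
  fix \<epsilon> :: real assume \<epsilon>: "0 < \<epsilon>"
  obtain N where N: "\<And>m n. m \<ge> N \<Longrightarrow> norm (\<Sum>i=m..<n. (cmod (c i))\<^sup>2) < \<epsilon>\<^sup>2"
    using c \<epsilon> unfolding summable_Cauchy by (meson zero_less_power)
  have "norm (\<Sum>i=m..<n. c i *\<^sub>C e i) < \<epsilon>" if "m \<ge> N" for m n
  proof -
    have "(norm (\<Sum>i=m..<n. c i *\<^sub>C e i))\<^sup>2 < \<epsilon>\<^sup>2"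
      using N[OF that, of n] norm_sum_orthonormal[OF e, of "{m..<n}" c] by auto
    then show ?thesis using \<epsilon> by (simp add: power2_less_imp_less)
  qed
  then show "\<exists>N. \<forall>m\<ge>N. \<forall>n. norm (\<Sum>i=m..<n. c i *\<^sub>C e i) < \<epsilon>" by blast
qed

lemma cinner_suminf_right:
  assumes "summable f"
  shows "(\<lambda>i. cinner x (f i)) sums cinner x (suminf f :: 'a::complex_hilbert)"
  using bounded_linear.sums[OF bounded_bilinear.bounded_linear_right[OF bounded_bilinear_cinner]
      summable_sums[OF assms]] .

text \<open>Cancels one factor \<open>norm x\<close> in estimates that come out of the
  Cauchy-Schwarz inequality.\<close>

lemma norm_le_of_square: "(norm x)\<^sup>2 \<le> norm x * c \<Longrightarrow> 0 \<le> c \<Longrightarrow> norm x \<le> c"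
  by (cases "norm x = 0") (simp_all add: power2_eq_square)

text \<open>The partial sum \<open>?p\<close> is a projection of \<open>x\<close>: its squared norm
  equals \<open>cinner ?p x\<close>, so Cauchy-Schwarz bounds it by the norm of
  \<open>x\<close>.\<close>

lemma bessel_summable:
  fixes e :: "nat \<Rightarrow> 'a::complex_inner"
  assumes e: "\<And>i j. cinner (e i) (e j) = (if i = j then 1 else 0)"
  shows "summable (\<lambda>i. (cmod (cinner (e i) x))\<^sup>2)"
proof (rule bounded_imp_summable[of _ "(norm x)\<^sup>2"])
  fix n
  let ?p = "\<Sum>i\<le>n. cinner (e i) x *\<^sub>C e i"
  have n: "(norm ?p)\<^sup>2 = (\<Sum>i\<le>n. (cmod (cinner (e i) x))\<^sup>2)"
    by (rule norm_sum_orthonormal[OF e]) simp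
  have "cinner ?p x = of_real (\<Sum>i\<le>n. (cmod (cinner (e i) x))\<^sup>2)"
    by (simp only: cinner_sum_left cinner_scaleC_left cnj_mult_self of_real_sum)
  then have "of_real ((norm ?p)\<^sup>2) = cinner ?p x" using n by simp
  then have "(norm ?p)\<^sup>2 \<le> norm ?p * norm x"
    using norm_cinner_le[of ?p x] by (metis abs_of_nonneg norm_of_real zero_le_power2)
  then have "norm ?p \<le> norm x"
    by (rule norm_le_of_square) simp
  then show "(\<Sum>i\<le>n. (cmod (cinner (e i) x))\<^sup>2) \<le> (norm x)\<^sup>2"
    unfolding n[symmetric] by (rule power_mono) simp
qed simp

text \<open>Distinct orthonormal vectors have distance \<open>sqrt 2\<close>, so points of a
  countable dense set within 1/2 of them are distinct as well.\<close>

lemma orthonormal_countable: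
  fixes B :: "'a::{complex_inner, second_countable_topology} set"
  assumes "orthonormal B"
  shows "countable B"
proof -
  obtain D :: "'a set" where D: "countable D" "\<And>X. open X \<Longrightarrow> X \<noteq> {} \<Longrightarrow> \<exists>d\<in>D. d \<in> X"
    using countable_dense_setE by blast
  have "\<exists>d\<in>D. dist b d < 1/2" for b
    using D(2)[of "ball b (1/2)"] by auto
  then obtain d where d: "\<And>b. d b \<in> D" "\<And>b. dist b (d b) < 1/2" by metis
  have "inj_on d B"
  proof (rule inj_onI, rule ccontr)
    fix x y assume xy: "x \<in> B" "y \<in> B" "d x = d y" "x \<noteq> y"
    have "(norm (x - y))\<^sup>2 = (norm x)\<^sup>2 + (norm y)\<^sup>2 - 2 * inner x y"
      by (simp add: power2_norm_eq_inner inner_diff_left inner_diff_right inner_commute)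
    also have "\<dots> = 2"
      using xy orthonormalD[OF assms, of x y] orthonormal_norm[OF assms]
      by (simp add: inner_eq_Re_cinner)
    finally have "(norm (x - y))\<^sup>2 = 2" .
    moreover have "dist x y < 1"
      using d(2)[of x] d(2)[of y] xy(3) dist_triangle_half_l[of "x" "d x" 1 y] by simp
    then have "(norm (x - y))\<^sup>2 < 1" by (simp add: dist_norm power_less_one_iff abs_square_less_1)
    ultimately show False by simp
  qed
  then show ?thesis
    using D(1) d(1) by (metis countable_image_inj_on countable_subset image_subset_iff)
qed

text \<open>Zorn's lemma gives a maximal orthonormal set, to which only 0 is orthogonal. It is
  infinite, since otherwise the projection would put every vector into its span, and countable by
  separability. The remainder of a series expansion is orthogonal to the whole set and therefore
  vanishes.\<close>

lemma hilbert_dim_infinite: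
  assumes "\<not> finite_dimensional TYPE('a::separable_complex_hilbert)"
  shows "hilbert_dim TYPE('a) = \<infinity>" "isomorphic_ell2 TYPE('a) UNIV"
proof -
  have "\<exists>B\<in>{B::'a set. orthonormal B}. \<forall>X\<in>{B. orthonormal B}. B \<subseteq> X \<longrightarrow> X = B"
  proof (rule subset_Zorn')
    fix C :: "'a set set" assume C: "subset.chain {B. orthonormal B} C"
    show "\<Union>C \<in> {B. orthonormal B}"
      unfolding orthonormal_def mem_Collect_eq
    proof (intro ballI)
      fix x y assume "x \<in> \<Union>C" "y \<in> \<Union>C"
      then obtain X Y where XY: "X \<in> C" "Y \<in> C" "x \<in> X" "y \<in> Y" by blast
      then have "X \<subseteq> Y \<or> Y \<subseteq> X" "orthonormal X" "orthonormal Y"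
        using C by (auto simp: subset.chain_def)
      then show "cinner x y = (if x = y then 1 else 0)"
        using XY by (metis orthonormalD subsetD)
    qed
  qed
  then obtain B :: "'a set" where B: "orthonormal B" "\<And>X. orthonormal X \<Longrightarrow> B \<subseteq> X \<Longrightarrow> X = B"
    by blast
  have perp: "r = 0" if "\<And>b. b \<in> B \<Longrightarrow> cinner b r = 0" for r
  proof (rule ccontr)
    assume "r \<noteq> 0"
    from orthonormal_insert[OF B(1) this that] B(2) show False by (metis insertI1 subset_insertI)
  qed
  have inf: "infinite B"
  proof
    assume "finite B"
    have "x \<in> complex_vector.span B" for x
      using perp[of "x - proj_on B x"] cinner_proj_on_diff[OF B(1) \<open>finite B\<close>, of _ x]
        proj_on_in_span[of B x] by (simp add: complex_vector.span_base)
    then show False using assms \<open>finite B\<close> unfolding finite_dimensional_def by blast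
  qed
  define e where "e = from_nat_into B"
  have e: "bij_betw e UNIV B"
    unfolding e_def by (rule bij_betw_from_nat_into[OF orthonormal_countable[OF B(1)] inf])
  have eB: "e i \<in> B" for i using e by (auto simp: bij_betw_def)
  have ee: "cinner (e i) (e j) = (if i = j then 1 else 0)" for i j
    using orthonormalD[OF B(1) eB eB, of i j] e by (auto simp: bij_betw_def inj_on_def)
  have eB': "\<exists>i. b = e i" if "b \<in> B" for b
    using e that by (auto simp: bij_betw_def)
  have coef: "cinner (e j) (\<Sum>i. c i *\<^sub>C e i) = c j" if "summable (\<lambda>i. c i *\<^sub>C e i)" for c j
  proof -
    have "(\<lambda>i. cinner (e j) (c i *\<^sub>C e i)) sums cinner (e j) (\<Sum>i. c i *\<^sub>C e i)"
      by (rule cinner_suminf_right[OF that])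
    moreover have "(\<lambda>i. cinner (e j) (c i *\<^sub>C e i)) = (\<lambda>i. if i = j then c i else 0)"
      by (auto simp: cinner_scaleC_right ee)
    then have "(\<lambda>i. cinner (e j) (c i *\<^sub>C e i)) sums c j"
      using sums_single[of j c] by simp
    ultimately show ?thesis using sums_unique2 by blast
  qed
  have summ: "summable (\<lambda>i. cinner (e i) x *\<^sub>C e i)" for x
    by (rule summable_orthonormal[OF ee bessel_summable[OF ee]])
  have expand: "(\<Sum>i. cinner (e i) x *\<^sub>C e i) = x" for x
  proof -
    have "x - (\<Sum>i. cinner (e i) x *\<^sub>C e i) = 0"
    proof (rule perp)
      fix b assume "b \<in> B"
      then obtain i where "b = e i" using eB' by blast
      then show "cinner b (x - (\<Sum>i. cinner (e i) x *\<^sub>C e i)) = 0"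
        using coef[OF summ[of x], of i] by (simp only: cinner_diff_right diff_self)
    qed
    then show ?thesis by simp
  qed
  have "closure (complex_vector.span B) = UNIV"
  proof -
    have "x \<in> closure (complex_vector.span B)" for x
      unfolding closure_sequential
    proof (intro exI[of _ "\<lambda>n. \<Sum>i<n. cinner (e i) x *\<^sub>C e i"] conjI allI)
      show "(\<lambda>n. \<Sum>i<n. cinner (e i) x *\<^sub>C e i) \<longlonglongrightarrow> x"
        using summable_LIMSEQ[OF summ[of x]] expand by simp
      show "(\<Sum>i<n. cinner (e i) x *\<^sub>C e i) \<in> complex_vector.span B" for n
        using eB by (intro complex_vector.span_sum complex_vector.span_scale complex_vector.span_base)
    qed
    then show ?thesis by blast
  qed
  then have "orthonormal_basis B"
    using B(1) by (simp add: orthonormal_basis_def orthonormal_def)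
  from hilbert_dim_eqI[OF this] show "hilbert_dim TYPE('a) = \<infinity>" using inf by simp
  define T where "T x i = cinner (e i) x" for x i
  have "bij_betw T UNIV (ell2 UNIV)"
    unfolding bij_betw_def
  proof
    show "inj T"
    proof (rule injI)
      fix x y assume "T x = T y"
      then have "cinner (e i) x = cinner (e i) y" for i
        unfolding T_def by (rule fun_cong)
      then have "(\<Sum>i. cinner (e i) x *\<^sub>C e i) = (\<Sum>i. cinner (e i) y *\<^sub>C e i)"
        by (simp only:)
      then show "x = y" unfolding expand .
    qed
    show "range T = ell2 UNIV"
    proof (intro equalityI subsetI)
      fix c assume "c \<in> ell2 UNIV"
      then have "summable (\<lambda>i. c i *\<^sub>C e i)"
        by (intro summable_orthonormal ee) (simp add: ell2_def)
      then have "T (\<Sum>i. c i *\<^sub>C e i) = c"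
        unfolding T_def by (intro ext coef)
      then show "c \<in> range T" by (metis rangeI)
    qed (auto simp: ell2_def T_def bessel_summable[OF ee])
  qed
  moreover have "(\<lambda>i. cnj (T x i) * T y i) sums cinner x y" for x y
  proof -
    have "(\<lambda>i. cinner x (cinner (e i) y *\<^sub>C e i)) sums cinner x y"
      using cinner_suminf_right[OF summ[of y], of x] expand by simp
    moreover have "cinner x (cinner (e i) y *\<^sub>C e i) = cnj (T x i) * T y i" for i
      by (simp add: cinner_scaleC_right T_def cinner_commute[of x "e i"])
    ultimately show ?thesis by simp
  qed
  ultimately show "isomorphic_ell2 TYPE('a) UNIV"
    unfolding isomorphic_ell2_def
    by (intro exI[of _ T]) (auto simp: T_def cinner_add_right cinner_scaleC_right)
qed

subsection \<open>Square integrable multiples of weakly convergent sequences\<close>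

lemma integrable_inverse_1_plus_square: "integrable lborel (\<lambda>x::real. 1 / (1 + x\<^sup>2))"
proof -
  let ?f = "\<lambda>x::real. 1 / (1 + x\<^sup>2)"
  have [measurable]: "?f \<in> borel_measurable borel" by measurable
  have pos: "1 + x\<^sup>2 > 0" for x :: real
    by (simp add: add_pos_nonneg)
  have A: "(\<integral>\<^sup>+x. ennreal (?f x) * indicator {0..} x \<partial>lborel) = ennreal (pi / 2 - arctan 0)"
    by (rule nn_integral_FTC_atLeast)
      (auto intro!: derivative_eq_intros tendsto_arctan_at_top simp: inverse_eq_divide)
  have "(\<integral>\<^sup>+x. ennreal (?f x) * indicator {..0} x \<partial>lborel)
      = (\<integral>\<^sup>+x. ennreal (?f (-x)) * indicator {..0} (-x) \<partial>lborel)"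
    using nn_integral_real_affine[of "\<lambda>x. ennreal (?f x) * indicator {..0} x" "-1" 0] by simp
  also have "\<dots> = (\<integral>\<^sup>+x. ennreal (?f x) * indicator {0..} x \<partial>lborel)"
    by (intro nn_integral_cong) (auto simp: indicator_def)
  finally have B: "(\<integral>\<^sup>+x. ennreal (?f x) * indicator {..0} x \<partial>lborel) = ennreal (pi / 2)"
    using A by simp
  have "(\<integral>\<^sup>+x. ennreal (?f x) \<partial>lborel)
      \<le> (\<integral>\<^sup>+x. ennreal (?f x) * indicator {0..} x + ennreal (?f x) * indicator {..0} x \<partial>lborel)"
    by (intro nn_integral_mono) (auto simp: indicator_def)
  also have "\<dots> = ennreal (pi / 2) + ennreal (pi / 2)"
    using A B by (subst nn_integral_add) auto
  also have "\<dots> < \<infinity>" by simp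
  finally show ?thesis
    using pos by (intro integrableI_bounded) (auto simp: less_imp_le)
qed

lemma integrable_inverse_shift_square:
  assumes "s > 0"
  shows "integrable lborel (\<lambda>x::real. 1 / ((x - a)\<^sup>2 + s\<^sup>2))"
proof -
  have "integrable lborel (\<lambda>x::real. (1 / s\<^sup>2) * (1 / (1 + (- a / s + (1 / s) * x)\<^sup>2)))"
    using lborel_integrable_real_affine[OF integrable_inverse_1_plus_square, of "1/s" "-a/s"] assms
    by (intro integrable_mult_right) simp
  moreover have "(1 / s\<^sup>2) * (1 / (1 + (- a / s + (1 / s) * x)\<^sup>2)) = 1 / ((x - a)\<^sup>2 + s\<^sup>2)" for x
  proof -
    have "s\<^sup>2 * (1 + (- a / s + (1 / s) * x)\<^sup>2) = (x - a)\<^sup>2 + s\<^sup>2"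
      using assms by (simp add: field_simps power2_eq_square)
    then show ?thesis by simp
  qed
  ultimately show ?thesis by simp
qed

lemma integrable_mult_L2:
  fixes u v :: "real \<Rightarrow> complex"
  assumes [measurable]: "u \<in> borel_measurable lborel" "v \<in> borel_measurable lborel"
    and "integrable lborel (\<lambda>x. (cmod (u x))\<^sup>2)" "integrable lborel (\<lambda>x. (cmod (v x))\<^sup>2)"
  shows "integrable lborel (\<lambda>x. u x * v x)"
proof (rule Bochner_Integration.integrable_bound)
  show "integrable lborel (\<lambda>x. (cmod (u x))\<^sup>2 + (cmod (v x))\<^sup>2)"
    using assms by auto
  have "cmod (u x * v x) \<le> (cmod (u x))\<^sup>2 + (cmod (v x))\<^sup>2" for x
  proof -
    have "2 * cmod (u x) * cmod (v x) \<le> (cmod (u x))\<^sup>2 + (cmod (v x))\<^sup>2"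
      by (rule sum_squares_bound)
    moreover have "0 \<le> cmod (u x) * cmod (v x)" by simp
    ultimately show ?thesis unfolding norm_mult by linarith
  qed
  then show "AE x in lborel. cmod (u x * v x) \<le> norm ((cmod (u x))\<^sup>2 + (cmod (v x))\<^sup>2)"
    by (intro AE_I2) simp
qed measurable

lemma integrable_of_nn_bound:
  fixes u :: "real \<Rightarrow> 'a::{second_countable_topology, real_normed_vector}"
  assumes [measurable]: "u \<in> borel_measurable lborel"
    and "(\<integral>\<^sup>+x. ennreal ((norm (u x))\<^sup>2) \<partial>lborel) \<le> ennreal C" "0 \<le> C"
  shows "integrable lborel (\<lambda>x. (norm (u x))\<^sup>2)" "(\<integral>x. (norm (u x))\<^sup>2 \<partial>lborel) \<le> C"
proof -
  show i: "integrable lborel (\<lambda>x. (norm (u x))\<^sup>2)"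
    using assms(2) by (intro integrableI_bounded) (auto simp: order_le_less_trans)
  show "(\<integral>x. (norm (u x))\<^sup>2 \<partial>lborel) \<le> C"
    using assms(2,3) nn_integral_eq_integral[OF i] by simp
qed

text \<open>Rescaling instead of a cut-off keeps the truncation continuous in the truncated value.\<close>

definition trunc :: "real \<Rightarrow> complex \<Rightarrow> complex"
  where "trunc m z = z / of_real (max 1 (cmod z / m))"

text \<open>The removed part vanishes unless \<open>cmod z > m\<close>, and then
  \<open>cmod z\<close> is at most \<open>(cmod z)\<^sup>2 / m\<close>. The square is what a uniform
  L2 bound controls.\<close>

lemma trunc_bounds:
  assumes "m > 0"
  shows "cmod (trunc m z) \<le> m" "cmod (z - trunc m z) \<le> (cmod z)\<^sup>2 / m"
proof -
  have n: "cmod (trunc m z) = cmod z / max 1 (cmod z / m)"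
    by (simp add: trunc_def norm_divide)
  have "cmod z = m * (cmod z / m)" using assms by simp
  also have "\<dots> \<le> m * max 1 (cmod z / m)"
    using assms by (intro mult_left_mono) auto
  finally have le: "cmod z \<le> m * max 1 (cmod z / m)" .
  show "cmod (trunc m z) \<le> m"
    unfolding n using le by (subst pos_divide_le_eq) (simp_all add: less_max_iff_disj)
  show "cmod (z - trunc m z) \<le> (cmod z)\<^sup>2 / m"
  proof (cases "cmod z / m \<le> 1")
    case True
    then have "max 1 (cmod z / m) = 1" by (rule max_absorb1)
    then have "trunc m z = z" by (simp add: trunc_def)
    then show ?thesis using assms by simp
  next
    case False
    then have le: "m \<le> cmod z" using assms by (simp add: field_simps)
    then have z: "cmod z > 0" using assms by linarith
    have "max 1 (cmod z / m) = cmod z / m"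
      by (rule max_absorb2) (use False in simp)
    then have "trunc m z = z / of_real (cmod z / m)"
      by (simp only: trunc_def)
    then have "z - trunc m z = of_real (1 - m / cmod z) * z"
      by (simp add: algebra_simps)
    then have "cmod (z - trunc m z) = \<bar>1 - m / cmod z\<bar> * cmod z"
      by (simp only: norm_mult norm_of_real)
    also have "\<bar>1 - m / cmod z\<bar> \<le> 1" using le z assms by (simp add: abs_le_iff field_simps)
    then have "\<bar>1 - m / cmod z\<bar> * cmod z \<le> cmod z" using z by (simp add: mult_le_cancel_right1)
    also have "\<dots> \<le> (cmod z)\<^sup>2 / m"
      using le assms z by (simp add: field_simps power2_eq_square)
    finally show ?thesis .
  qed
qed

lemma continuous_trunc:
  assumes "m \<noteq> 0"
  shows "continuous_on UNIV (trunc m)"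
proof -
  have "complex_of_real (max 1 (cmod z / m)) \<noteq> 0" for z
    unfolding of_real_eq_0_iff using max.cobounded1[of 1 "cmod z / m"] by linarith
  then show ?thesis unfolding trunc_def using assms by (intro continuous_intros) auto
qed

text \<open>The functions \<open>h n\<close> are bounded in L2 and converge almost everywhere, which
  is too little for dominated convergence. Truncating them at the level \<open>M * p x\<close> costs
  at most \<open>C / M\<close>, uniformly in \<open>n\<close>, and leaves products dominated by
  \<open>M * (p x)\<^sup>2\<close>. The level depends on \<open>x\<close> because the measure is
  infinite.\<close>

lemma integral_mult_tendsto:
  fixes h q :: "nat \<Rightarrow> real \<Rightarrow> complex" and H q0 :: "real \<Rightarrow> complex" and p :: "real \<Rightarrow> real"
  assumes meas: "\<And>n. h n \<in> borel_measurable lborel" "H \<in> borel_measurable lborel"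
      "\<And>n. q n \<in> borel_measurable lborel" "q0 \<in> borel_measurable lborel"
      "p \<in> borel_measurable lborel"
    and bd: "\<And>n. (\<integral>\<^sup>+x. ennreal ((cmod (h n x))\<^sup>2) \<partial>lborel) \<le> ennreal C" "0 \<le> C"
    and lim: "AE x in lborel. (\<lambda>n. h n x) \<longlonglongrightarrow> H x" "\<And>x. (\<lambda>n. q n x) \<longlonglongrightarrow> q0 x"
    and p: "\<And>n x. cmod (q n x) \<le> p x" "\<And>x. p x > 0" "integrable lborel (\<lambda>x. (p x)\<^sup>2)"
  shows "(\<lambda>n. \<integral>x. h n x * q n x \<partial>lborel) \<longlonglongrightarrow> (\<integral>x. H x * q0 x \<partial>lborel)"
proof -
  note [measurable] = meas
  have q0: "cmod (q0 x) \<le> p x" for x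
    by (rule LIMSEQ_le_const2[OF tendsto_norm[OF lim(2)]]) (use p in auto)
  \<comment> \<open>Fatou's lemma passes the uniform bound on to the limit, so that
    \<open>close\<close> applies to it too.\<close>
  have H: "(\<integral>\<^sup>+x. ennreal ((cmod (H x))\<^sup>2) \<partial>lborel) \<le> ennreal C"
  proof -
    have "(\<integral>\<^sup>+x. ennreal ((cmod (H x))\<^sup>2) \<partial>lborel)
        = (\<integral>\<^sup>+x. liminf (\<lambda>n. ennreal ((cmod (h n x))\<^sup>2)) \<partial>lborel)"
      using lim(1)
      by (intro nn_integral_cong_AE, eventually_elim)
        (intro lim_imp_Liminf[symmetric] tendsto_intros; simp)
    also have "\<dots> \<le> liminf (\<lambda>n. \<integral>\<^sup>+x. ennreal ((cmod (h n x))\<^sup>2) \<partial>lborel)"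
      by (intro nn_integral_liminf) measurable
    also have "\<dots> \<le> ennreal C"
      by (rule Liminf_le) (use bd in auto)
    finally show ?thesis .
  qed
  have ip: "integrable lborel (\<lambda>x. (cmod (complex_of_real (p x)))\<^sup>2)"
    using p(3) by simp
  have close: "integrable lborel (\<lambda>x. g x * r x)"
      "integrable lborel (\<lambda>x. trunc (M * p x) (g x) * r x)"
      "cmod ((\<integral>x. g x * r x \<partial>lborel) - (\<integral>x. trunc (M * p x) (g x) * r x \<partial>lborel)) \<le> C / M"
    if [measurable]: "g \<in> borel_measurable lborel" "r \<in> borel_measurable lborel"
      and g: "(\<integral>\<^sup>+x. ennreal ((cmod (g x))\<^sup>2) \<partial>lborel) \<le> ennreal C" and r: "\<And>x. cmod (r x) \<le> p x"
      and M: "M > 0" for g r M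
  proof -
    note ig = integrable_of_nn_bound[OF that(1) g bd(2)]
    have ir: "integrable lborel (\<lambda>x. (cmod (r x))\<^sup>2)"
      by (rule Bochner_Integration.integrable_bound[OF p(3)])
        (use r in \<open>auto intro!: power_mono\<close>)
    show i1: "integrable lborel (\<lambda>x. g x * r x)"
      by (rule integrable_mult_L2[OF that(1,2) ig(1) ir])
    have [measurable]: "(\<lambda>x. trunc (M * p x) (g x)) \<in> borel_measurable lborel"
      unfolding trunc_def by measurable
    show i2: "integrable lborel (\<lambda>x. trunc (M * p x) (g x) * r x)"
    proof (rule Bochner_Integration.integrable_bound)
      show "integrable lborel (\<lambda>x. M * (p x)\<^sup>2)" using p(3) by simp
      have "cmod (trunc (M * p x) (g x) * r x) \<le> M * p x * p x" for x
        unfolding norm_mult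
        by (intro mult_mono trunc_bounds r) (use M p(2)[of x] in auto)
      then show "AE x in lborel. norm (trunc (M * p x) (g x) * r x) \<le> norm (M * (p x)\<^sup>2)"
        using M by (intro AE_I2) (simp add: power2_eq_square mult.assoc)
    qed measurable
    have "cmod ((\<integral>x. g x * r x \<partial>lborel) - (\<integral>x. trunc (M * p x) (g x) * r x \<partial>lborel))
        = cmod (\<integral>x. g x * r x - trunc (M * p x) (g x) * r x \<partial>lborel)"
      using i1 i2 by simp
    also have "\<dots> \<le> (\<integral>x. (cmod (g x))\<^sup>2 / M \<partial>lborel)"
    proof (rule Bochner_Integration.integral_norm_bound_integral)
      show "integrable lborel (\<lambda>x. g x * r x - trunc (M * p x) (g x) * r x)" using i1 i2 by simp
      show "integrable lborel (\<lambda>x. (cmod (g x))\<^sup>2 / M)" using ig by simp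
      fix x
      have "cmod (g x * r x - trunc (M * p x) (g x) * r x) = cmod (g x - trunc (M * p x) (g x)) * cmod (r x)"
        by (simp only: left_diff_distrib[symmetric] norm_mult)
      also have "\<dots> \<le> ((cmod (g x))\<^sup>2 / (M * p x)) * p x"
        by (intro mult_mono trunc_bounds r) (use M p(2)[of x] in auto)
      also have "\<dots> = (cmod (g x))\<^sup>2 / M" using M p(2)[of x] by simp
      finally show "norm (g x * r x - trunc (M * p x) (g x) * r x) \<le> (cmod (g x))\<^sup>2 / M" .
    qed
    also have "\<dots> \<le> C / M" using ig(2) M by (simp add: divide_right_mono)
    finally show "cmod ((\<integral>x. g x * r x \<partial>lborel) - (\<integral>x. trunc (M * p x) (g x) * r x \<partial>lborel)) \<le> C / M" .
  qed
  have conv: "(\<lambda>n. \<integral>x. trunc (M * p x) (h n x) * q n x \<partial>lborel)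
      \<longlonglongrightarrow> (\<integral>x. trunc (M * p x) (H x) * q0 x \<partial>lborel)" if M: "M > 0" for M
  proof (rule integral_dominated_convergence)
    show "(\<lambda>x. trunc (M * p x) (H x) * q0 x) \<in> borel_measurable lborel"
      "(\<lambda>x. trunc (M * p x) (h n x) * q n x) \<in> borel_measurable lborel" for n
      unfolding trunc_def by measurable
    show "integrable lborel (\<lambda>x. M * (p x)\<^sup>2)" using p(3) by simp
    show "AE x in lborel. (\<lambda>n. trunc (M * p x) (h n x) * q n x) \<longlonglongrightarrow> trunc (M * p x) (H x) * q0 x"
      using lim(1)
    proof eventually_elim
      case (elim x)
      have "isCont (trunc (M * p x)) (H x)"
        using continuous_trunc[of "M * p x"] M p(2)[of x] by (simp add: continuous_on_eq_continuous_at)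
      then show ?case by (intro tendsto_mult lim(2) isCont_tendsto_compose[OF _ elim])
    qed
    have "cmod (trunc (M * p x) (h n x) * q n x) \<le> M * p x * p x" for n x
      unfolding norm_mult
      by (intro mult_mono trunc_bounds p) (use M p(2)[of x] in auto)
    then show "AE x in lborel. norm (trunc (M * p x) (h n x) * q n x) \<le> M * (p x)\<^sup>2" for n
      by (intro AE_I2) (simp add: power2_eq_square mult.assoc)
  qed
  show ?thesis
  proof (rule LIMSEQ_I)
    fix e :: real assume e: "0 < e"
    \<comment> \<open>\<open>C + 1\<close> keeps \<open>M\<close> positive when
      \<open>C = 0\<close>; the factor 4 leaves \<open>C / M\<close> strictly below
      \<open>e / 3\<close>.\<close>
    define M where "M = 4 * (C + 1) / e"
    have M: "M > 0" and CM: "C / M < e / 3" using e bd(2)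
      by (auto simp: M_def field_simps intro: add_nonneg_pos)
    obtain N where N: "\<And>n. n \<ge> N \<Longrightarrow> cmod ((\<integral>x. trunc (M * p x) (h n x) * q n x \<partial>lborel)
        - (\<integral>x. trunc (M * p x) (H x) * q0 x \<partial>lborel)) < e / 3"
      using LIMSEQ_D[OF conv[OF M], of "e/3"] e by auto
    have "cmod ((\<integral>x. h n x * q n x \<partial>lborel) - (\<integral>x. H x * q0 x \<partial>lborel)) < e" if "n \<ge> N" for n
    proof -
      let ?a = "\<integral>x. h n x * q n x \<partial>lborel" and ?b = "\<integral>x. trunc (M * p x) (h n x) * q n x \<partial>lborel"
        and ?c = "\<integral>x. trunc (M * p x) (H x) * q0 x \<partial>lborel" and ?d = "\<integral>x. H x * q0 x \<partial>lborel"
      have "cmod (?a - ?b) < e / 3"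
        using close(3)[OF meas(1,3) bd(1) p(1) M, of n n] CM by linarith
      moreover have "cmod (?d - ?c) < e / 3"
        using close(3)[OF meas(2,4) H q0 M] CM by linarith
      moreover have "cmod (?a - ?d) \<le> cmod (?a - ?b) + cmod (?b - ?c) + cmod (?d - ?c)"
        by norm
      ultimately show ?thesis using N[OF that] by linarith
    qed
    then show "\<exists>no. \<forall>n\<ge>no. norm ((\<integral>x. h n x * q n x \<partial>lborel) - (\<integral>x. H x * q0 x \<partial>lborel)) < e"
      by blast
  qed
qed

subsection \<open>The Cauchy formula for scalar Hardy functions\<close>

lemma upper_half_plane_iff [simp]: "z \<in> upper_half_plane \<longleftrightarrow> Im z > 0"
  by (simp add: upper_half_plane_def)

lemma open_upper_half_plane: "open upper_half_plane"
  unfolding upper_half_plane_def by (rule open_halfspace_Im_gt)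

lemma convex_upper_half_plane: "convex upper_half_plane"
  unfolding upper_half_plane_def by (rule convex_halfspace_Im_gt)

lemma contour_integral_horizontal:
  assumes "a < b"
  shows "contour_integral (linepath (Complex a c) (Complex b c)) f = integral {a..b} (\<lambda>x. f (Complex x c))"
proof -
  have eq: "Complex x c = of_real x + \<i> * of_real c" for x by (simp add: Complex_eq)
  have "linepath (Complex a c) (Complex b c) t = linepath (of_real a) (of_real b) t + \<i> * of_real c" for t
    by (simp add: linepath_def eq algebra_simps scaleR_conv_of_real)
  then have "contour_integral (linepath (Complex a c) (Complex b c)) f
      = contour_integral (linepath (of_real a) (of_real b)) (\<lambda>z. f (z + \<i> * of_real c))"
    unfolding contour_integral_integral by (simp add: eq)
  also have "\<dots> = integral {a..b} (\<lambda>x. f (Complex x c))"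
    using contour_integral_linepath_Reals_eq[of "of_real a" "of_real b" "\<lambda>z. f (z + \<i> * of_real c)"] assms
    by (simp add: eq)
  finally show ?thesis .
qed

text \<open>The Cauchy formula with the sides written out as real integrals, so that each can be
  sent to its limit separately. The top and the left side are traversed backwards, hence the minus
  signs.\<close>

lemma Cauchy_rectangle:
  assumes g: "g holomorphic_on upper_half_plane"
    and "0 < \<eta>" "\<eta> < Im w" "Im w < Y" "L < Re w" "Re w < R"
  defines "k \<equiv> \<lambda>z. g z / (z - w)"
  shows "integral {L..R} (\<lambda>x. k (Complex x \<eta>)) + \<i> * integral {\<eta>..Y} (\<lambda>y. k (Complex R y))
    - integral {L..R} (\<lambda>x. k (Complex x Y)) - \<i> * integral {\<eta>..Y} (\<lambda>y. k (Complex L y))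
    = 2 * pi * \<i> * g w"
proof -
  let ?a = "Complex L \<eta>" and ?b = "Complex R \<eta>" and ?c = "Complex R Y" and ?d = "Complex L Y"
  have wbox: "w \<in> box ?a ?c" using assms by (simp add: in_box_complex_iff)
  have pi: "path_image (rectpath ?a ?c) \<subseteq> upper_half_plane - {w}"
  proof -
    have "path_image (rectpath ?a ?c) = cbox ?a ?c - box ?a ?c"
      using assms by (intro path_image_rectpath_cbox_minus_box) auto
    moreover have "cbox ?a ?c \<subseteq> upper_half_plane"
      using assms by (auto simp: in_cbox_complex_iff)
    ultimately show ?thesis using wbox by blast
  qed
  have int: "(k has_contour_integral (2 * pi * \<i> * winding_number (rectpath ?a ?c) w * g w)) (rectpath ?a ?c)"
    unfolding k_def
    by (rule Cauchy_integral_formula_convex_simple[OF convex_upper_half_plane g])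
      (use assms pi open_upper_half_plane in \<open>auto simp: interior_open\<close>)
  have cont: "continuous_on (upper_half_plane - {w}) k"
    unfolding k_def using holomorphic_on_imp_continuous_on[OF g]
    by (intro continuous_intros) (auto intro: continuous_on_subset)
  have segs: "closed_segment ?a ?b \<union> closed_segment ?b ?c \<union> closed_segment ?c ?d \<union> closed_segment ?d ?a
      \<subseteq> upper_half_plane - {w}"
    using pi by (auto simp: rectpath_def Let_def path_image_join)
  have ci: "k contour_integrable_on linepath ?a ?b" "k contour_integrable_on linepath ?b ?c"
    "k contour_integrable_on linepath ?c ?d" "k contour_integrable_on linepath ?d ?a"
    using segs by (auto intro!: contour_integrable_continuous_linepath continuous_on_subset[OF cont])
  have "2 * pi * \<i> * g w = contour_integral (rectpath ?a ?c) k"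
    using contour_integral_unique[OF int] winding_number_rectpath[OF wbox] by simp
  also have "\<dots> = contour_integral (linepath ?a ?b) k + contour_integral (linepath ?b ?c) k
      + contour_integral (linepath ?c ?d) k + contour_integral (linepath ?d ?a) k"
    using ci by (simp add: rectpath_def Let_def contour_integral_join contour_integrable_join add.assoc)
  also have "contour_integral (linepath ?c ?d) k = - contour_integral (linepath ?d ?c) k"
    using contour_integral_reversepath[of "linepath ?d ?c" k] by simp
  also have "contour_integral (linepath ?d ?a) k = - contour_integral (linepath ?a ?d) k"
    using contour_integral_reversepath[of "linepath ?a ?d" k] by simp
  also have "contour_integral (linepath ?a ?b) k = integral {L..R} (\<lambda>x. k (Complex x \<eta>))"
    by (rule contour_integral_horizontal) (use assms in simp)
  also have "contour_integral (linepath ?d ?c) k = integral {L..R} (\<lambda>x. k (Complex x Y))"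
    by (rule contour_integral_horizontal) (use assms in simp)
  also have "contour_integral (linepath ?b ?c) k = \<i> * integral {\<eta>..Y} (\<lambda>y. k (Complex R y))"
    by (rule contour_integral_linepath_same_Re) (use assms in simp_all)
  also have "contour_integral (linepath ?a ?d) k = \<i> * integral {\<eta>..Y} (\<lambda>y. k (Complex L y))"
    by (rule contour_integral_linepath_same_Re) (use assms in simp_all)
  finally show ?thesis by (simp add: algebra_simps)
qed

lemma emeasure_lborel_half_lines:
  "emeasure lborel {a::real..} = \<infinity>" "emeasure lborel {..a::real} = \<infinity>"
proof -
  have "of_nat n \<le> emeasure lborel {a..}" "of_nat n \<le> emeasure lborel {..a}" for n :: nat
    using emeasure_mono[of "{a..a + real n}" "{a..}" lborel]
      emeasure_mono[of "{a - real n..a}" "{..a}" lborel]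
    by (simp_all add: ennreal_of_nat_eq_real_of_nat)
  then show "emeasure lborel {a..} = \<infinity>" "emeasure lborel {..a} = \<infinity>"
    using ennreal_Ex_less_of_nat by (metis infinity_ennreal_def less_top not_le)+
qed

text \<open>Otherwise \<open>W\<close> exceeds 1 throughout \<open>S\<close> and its integral is
  infinite. This is how vertical sides are placed where \<open>g\<close> is small on average,
  without any knowledge of pointwise decay.\<close>

lemma nn_integral_small_value:
  assumes "W \<in> borel_measurable M" "(\<integral>\<^sup>+x. W x \<partial>M) < \<infinity>" "S \<in> sets M" "emeasure M S = \<infinity>"
  shows "\<exists>x\<in>S. W x \<le> (1::ennreal)"
proof (rule ccontr)
  assume "\<not> ?thesis"
  then have "indicator S x \<le> W x" for x
    by (auto simp: indicator_def not_le less_imp_le)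
  then have "emeasure M S \<le> (\<integral>\<^sup>+x. W x \<partial>M)"
    using nn_integral_mono[of M "indicator S" W] assms(3) by simp
  then show False using assms by auto
qed

lemma le_half_power2_plus_1: "t \<le> (t\<^sup>2 + 1) / (2::real)"
  using sum_squares_bound[of t 1] by simp

text \<open>\<open>s\<close> times the difference of the two sides is the square of
  \<open>s * a - b\<close>. Choosing the weight afterwards turns this into a substitute for
  Cauchy-Schwarz under the integral.\<close>

lemma young_weighted: "s > 0 \<Longrightarrow> 2 * (a * b) \<le> s * a\<^sup>2 + b\<^sup>2 / (s::real)"
proof -
  assume s: "s > 0"
  have "s * (s * a\<^sup>2 + b\<^sup>2 / s) - s * (2 * (a * b)) = (s * a - b)\<^sup>2"
    using s by (simp add: power2_eq_square algebra_simps)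
  then have "s * (2 * (a * b)) \<le> s * (s * a\<^sup>2 + b\<^sup>2 / s)"
    using zero_le_power2[of "s * a - b"] by linarith
  then show ?thesis using s by (rule mult_left_le_imp_le)
qed

lemma resolvent_L2:
  assumes "y \<noteq> Im w"
  shows "(\<lambda>x. 1 / (Complex x y - w)) \<in> borel_measurable lborel"
    "(cmod (1 / (Complex x y - w)))\<^sup>2 = 1 / ((x - Re w)\<^sup>2 + (y - Im w)\<^sup>2)"
    "integrable lborel (\<lambda>x. (cmod (1 / (Complex x y - w)))\<^sup>2)"
proof -
  have ne: "Complex x y - w \<noteq> 0" for x using assms by (auto simp: complex_eq_iff)
  have "continuous_on UNIV (\<lambda>x. 1 / (Complex x y - w))"
    using ne by (intro continuous_intros) (auto simp: Complex_eq intro!: continuous_intros)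
  then show "(\<lambda>x. 1 / (Complex x y - w)) \<in> borel_measurable lborel"
    using borel_measurable_continuous_onI by simp
  show *: "(cmod (1 / (Complex x y - w)))\<^sup>2 = 1 / ((x - Re w)\<^sup>2 + (y - Im w)\<^sup>2)" for x
    by (simp add: norm_divide power_divide cmod_power2)
  have "\<bar>y - Im w\<bar> > 0" using assms by simp
  from integrable_inverse_shift_square[OF this, of "Re w"]
  show "integrable lborel (\<lambda>x. (cmod (1 / (Complex x y - w)))\<^sup>2)"
    unfolding * by simp
qed

lemma integral_growing_intervals:
  fixes f :: "real \<Rightarrow> complex"
  assumes "integrable lborel f" "filterlim R at_top sequentially" "filterlim L at_bot sequentially"
  shows "(\<lambda>n. integral {L n..R n} f) \<longlonglongrightarrow> (\<integral>x. f x \<partial>lborel)"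
proof -
  have [measurable]: "f \<in> borel_measurable lborel" using assms(1) by auto
  have si: "set_integrable lborel {L n..R n} f" for n
    unfolding set_integrable_def by (rule integrable_mult_indicator[OF _ assms(1)]) simp
  have "(\<lambda>n. \<integral>x. indicator {L n..R n} x *\<^sub>R f x \<partial>lborel) \<longlonglongrightarrow> (\<integral>x. f x \<partial>lborel)"
  proof (rule integral_dominated_convergence[where w = "\<lambda>x. norm (f x)"])
    show "AE x in lborel. (\<lambda>n. indicator {L n..R n} x *\<^sub>R f x) \<longlonglongrightarrow> f x"
    proof (intro AE_I2 tendsto_eventually)
      fix x
      have "eventually (\<lambda>n. x \<le> R n) sequentially" "eventually (\<lambda>n. L n \<le> x) sequentially"
        using assms(2,3) by (simp_all add: filterlim_at_top filterlim_at_bot)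
      then show "\<forall>\<^sub>F n in sequentially. indicator {L n..R n} x *\<^sub>R f x = f x"
        by eventually_elim simp
    qed
  qed (use assms(1) in \<open>auto simp: indicator_def\<close>)
  then show ?thesis
    using set_borel_integral_eq_integral(2)[OF si] by (simp add: set_lebesgue_integral_def)
qed

context
  fixes g :: "complex \<Rightarrow> complex" and C :: real
  assumes hol: "g holomorphic_on upper_half_plane"
    and bound: "\<And>y. y > 0 \<Longrightarrow> (\<integral>\<^sup>+x. ennreal ((cmod (g (Complex x y)))\<^sup>2) \<partial>lborel) \<le> ennreal C"
    and C: "0 \<le> C"
begin

lemma hardy_line_measurable: "y > 0 \<Longrightarrow> (\<lambda>x. g (Complex x y)) \<in> borel_measurable lborel"
proof -
  assume "y > 0"
  then have "continuous_on UNIV (\<lambda>x. g (Complex x y))"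
    by (intro continuous_on_compose2[OF holomorphic_on_imp_continuous_on[OF hol]])
      (auto intro!: continuous_intros simp: Complex_eq)
  then show ?thesis using borel_measurable_continuous_onI by simp
qed

lemma hardy_integrable:
  assumes "y > 0" "y \<noteq> Im w"
  shows "integrable lborel (\<lambda>x. g (Complex x y) * (1 / (Complex x y - w)))"
  by (intro integrable_mult_L2 hardy_line_measurable resolvent_L2 integrable_of_nn_bound(1)[OF _ bound C] assms)

text \<open>By Tonelli the integrals over the vertical segments of the strip have a finite integral
  over all abscissas, so they cannot exceed 1 on all of a set of infinite measure.\<close>

lemma hardy_good_abscissa:
  assumes "0 < \<eta>" "\<eta> < Y" "S \<in> sets borel" "emeasure lborel S = \<infinity>"
  shows "\<exists>x\<in>S. (\<integral>y. indicator {\<eta>..Y} y *\<^sub>R (cmod (g (Complex x y)))\<^sup>2 \<partial>lborel) \<le> 1"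
proof -
  let ?G = "\<lambda>x y. indicator {\<eta>..Y} y *\<^sub>R (cmod (g (Complex x y)))\<^sup>2"
  have "continuous_on (UNIV \<times> {\<eta>..Y}) (\<lambda>p. (cmod (g (Complex (fst p) (snd p))))\<^sup>2)"
    using assms by (intro continuous_on_power continuous_on_norm
        continuous_on_compose2[OF holomorphic_on_imp_continuous_on[OF hol]])
      (auto intro!: continuous_intros simp: Complex_eq)
  moreover have "UNIV \<times> {\<eta>..Y} \<in> sets (borel :: (real \<times> real) measure)"
    by (intro borel_closed closed_Times) auto
  ultimately have "(\<lambda>p. indicator (UNIV \<times> {\<eta>..Y}) p *\<^sub>R (cmod (g (Complex (fst p) (snd p))))\<^sup>2)
      \<in> borel_measurable borel"
    by (rule borel_measurable_continuous_on_indicator[rotated])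
  moreover have "(\<lambda>p. indicator (UNIV \<times> {\<eta>..Y}) p *\<^sub>R (cmod (g (Complex (fst p) (snd p))))\<^sup>2)
      = (\<lambda>p. ?G (fst p) (snd p))"
    by (auto simp: indicator_def)
  ultimately have m: "(\<lambda>(x, y). ?G x y) \<in> borel_measurable (lborel \<Otimes>\<^sub>M lborel)"
    by (simp add: case_prod_beta' lborel_prod)
  then have m': "(\<lambda>(x, y). ennreal (?G x y)) \<in> borel_measurable (lborel \<Otimes>\<^sub>M lborel)"
    by (simp add: case_prod_beta')
  have "(\<integral>\<^sup>+x. \<integral>\<^sup>+y. ennreal (?G x y) \<partial>lborel \<partial>lborel) = (\<integral>\<^sup>+y. \<integral>\<^sup>+x. ennreal (?G x y) \<partial>lborel \<partial>lborel)"
    by (rule lborel_pair.Fubini'[OF m', symmetric])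
  also have "\<dots> \<le> (\<integral>\<^sup>+y. ennreal C * indicator {\<eta>..Y} y \<partial>lborel)"
    by (intro nn_integral_mono) (use bound assms in \<open>auto simp: indicator_def\<close>)
  also have "\<dots> < \<infinity>"
    using assms by (simp add: nn_integral_cmult ennreal_mult_less_top)
  finally have fin: "(\<integral>\<^sup>+x. \<integral>\<^sup>+y. ennreal (?G x y) \<partial>lborel \<partial>lborel) < \<infinity>" .
  have "(\<lambda>x. \<integral>\<^sup>+y. ennreal (?G x y) \<partial>lborel) \<in> borel_measurable lborel"
    using lborel.borel_measurable_nn_integral[OF m'] by simp
  from nn_integral_small_value[OF this fin _ assms(4)] assms(3)
  obtain x where x: "x \<in> S" "(\<integral>\<^sup>+y. ennreal (?G x y) \<partial>lborel) \<le> 1" by auto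
  have meas: "(\<lambda>y. ?G x y) \<in> borel_measurable lborel"
    using measurable_Pair2[OF m, of x] by simp
  have "integrable lborel (\<lambda>y. ?G x y)"
    by (rule integrableI_bounded[OF meas]) (use order_le_less_trans[OF x(2), of \<infinity>] in auto)
  from nn_integral_eq_integral[OF this] x(2)
  have "(\<integral>y. ?G x y \<partial>lborel) \<le> 1" by (simp add: ennreal_le_1)
  with x(1) show ?thesis by blast
qed

text \<open>The first power of \<open>cmod (g z)\<close> is at most half of its square plus 1, so a
  good abscissa controls it; the resolvent contributes the factor \<open>1 / d\<close>.\<close>

lemma hardy_side_bound:
  assumes "0 < \<eta>" "\<eta> < Y" "(\<integral>y. indicator {\<eta>..Y} y *\<^sub>R (cmod (g (Complex x y)))\<^sup>2 \<partial>lborel) \<le> 1"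
    and d: "d > 0" "d \<le> \<bar>x - Re w\<bar>"
  shows "cmod (integral {\<eta>..Y} (\<lambda>y. g (Complex x y) / (Complex x y - w))) \<le> (1 + (Y - \<eta>)) / (2 * d)"
proof -
  have ne: "Complex x y \<noteq> w" for y using d by auto
  have cg: "continuous_on {\<eta>..Y} (\<lambda>y. g (Complex x y))"
    using assms by (intro continuous_on_compose2[OF holomorphic_on_imp_continuous_on[OF hol]])
      (auto intro!: continuous_intros simp: Complex_eq)
  have cc: "continuous_on {\<eta>..Y} (\<lambda>y. Complex x y)"
    by (auto intro!: continuous_intros simp: Complex_eq)
  have c1: "(\<lambda>y. g (Complex x y) / (Complex x y - w)) integrable_on {\<eta>..Y}"
    by (intro integrable_continuous_real continuous_intros cg cc) (use ne in auto)
  have c2: "(\<lambda>y. (cmod (g (Complex x y)))\<^sup>2) integrable_on {\<eta>..Y}"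
    by (intro integrable_continuous_real continuous_intros cg)
  have si: "set_integrable lborel {\<eta>..Y} (\<lambda>y. (cmod (g (Complex x y)))\<^sup>2)"
    by (intro borel_integrable_atLeastAtMost' continuous_intros cg)
  have le1: "integral {\<eta>..Y} (\<lambda>y. (cmod (g (Complex x y)))\<^sup>2) \<le> 1"
    using set_borel_integral_eq_integral(2)[OF si] assms(3) by (simp add: set_lebesgue_integral_def)
  have "cmod (integral {\<eta>..Y} (\<lambda>y. g (Complex x y) / (Complex x y - w)))
      \<le> integral {\<eta>..Y} (\<lambda>y. ((cmod (g (Complex x y)))\<^sup>2 + 1) * (1 / (2 * d)))"
  proof (rule Henstock_Kurzweil_Integration.integral_norm_bound_integral[OF c1])
    show "(\<lambda>y. ((cmod (g (Complex x y)))\<^sup>2 + 1) * (1 / (2 * d))) integrable_on {\<eta>..Y}"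
      by (intro integrable_continuous_real continuous_intros cg)
    fix y
    have "d \<le> cmod (Complex x y - w)"
      using d(2) abs_Re_le_cmod[of "Complex x y - w"] by simp
    then have "cmod (g (Complex x y) / (Complex x y - w)) \<le> cmod (g (Complex x y)) / d"
      unfolding norm_divide using d(1) by (intro frac_le) auto
    also have "\<dots> \<le> ((cmod (g (Complex x y)))\<^sup>2 + 1) / 2 / d"
      using d(1) by (intro divide_right_mono le_half_power2_plus_1) auto
    finally show "cmod (g (Complex x y) / (Complex x y - w)) \<le> ((cmod (g (Complex x y)))\<^sup>2 + 1) * (1 / (2 * d))"
      by simp
  qed
  also have "\<dots> = (integral {\<eta>..Y} (\<lambda>y. (cmod (g (Complex x y)))\<^sup>2) + (Y - \<eta>)) * (1 / (2 * d))"
    using assms c2 by (simp add: Henstock_Kurzweil_Integration.integral_add integrable_const_ivl)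
  also have "\<dots> \<le> (1 + (Y - \<eta>)) * (1 / (2 * d))"
    using d le1 by (intro mult_right_mono) auto
  finally show ?thesis by simp
qed

lemma hardy_strip:
  assumes "0 < \<eta>" "\<eta> < Im w" "Im w < Y"
  shows "(\<integral>x. g (Complex x \<eta>) * (1 / (Complex x \<eta> - w)) \<partial>lborel)
    - (\<integral>x. g (Complex x Y) * (1 / (Complex x Y - w)) \<partial>lborel) = 2 * pi * \<i> * g w"
proof -
  have Y: "\<eta> < Y" using assms by simp
  let ?I = "\<lambda>x. (\<integral>y. indicator {\<eta>..Y} y *\<^sub>R (cmod (g (Complex x y)))\<^sup>2 \<partial>lborel)"
  \<comment> \<open>The vertical sides lie at good abscissas at distance at least
    \<open>Suc n\<close> from \<open>Re w\<close>. This is positive already for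
    \<open>n = 0\<close>, and the side integrals decay like its reciprocal.\<close>
  have "\<exists>x\<in>{Re w + Suc n..}. ?I x \<le> 1" for n :: nat
    by (rule hardy_good_abscissa[OF assms(1) Y]) (auto simp: emeasure_lborel_half_lines)
  then obtain R where R: "\<And>n. Re w + Suc n \<le> R n" "\<And>n. ?I (R n) \<le> 1"
    by (auto simp: Bex_def) metis
  have "\<exists>x\<in>{..Re w - Suc n}. ?I x \<le> 1" for n :: nat
    by (rule hardy_good_abscissa[OF assms(1) Y]) (auto simp: emeasure_lborel_half_lines)
  then obtain L where L: "\<And>n. L n \<le> Re w - Suc n" "\<And>n. ?I (L n) \<le> 1"
    by (auto simp: Bex_def) metis
  have Rlim: "filterlim R at_top sequentially"
  proof (rule filterlim_at_top_mono[OF _ eventuallyI])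
    show "filterlim (\<lambda>n. Re w + real (Suc n)) at_top sequentially" by real_asymp
  qed (use R in auto)
  have Llim: "filterlim L at_bot sequentially"
    unfolding filterlim_uminus_at_bot
  proof (rule filterlim_at_top_mono[OF _ eventuallyI])
    show "filterlim (\<lambda>n. - Re w + real (Suc n)) at_top sequentially" by real_asymp
    show "- Re w + real (Suc n) \<le> - L n" for n using L(1)[of n] by linarith
  qed
  let ?k = "\<lambda>z. g z / (z - w)"
  have lim0: "(\<lambda>n. (1 + (Y - \<eta>)) / (2 * real (Suc n))) \<longlonglongrightarrow> 0"
    by real_asymp
  have sR: "(\<lambda>n. integral {\<eta>..Y} (\<lambda>y. ?k (Complex (R n) y))) \<longlonglongrightarrow> 0"
  proof (rule Lim_null_comparison[OF _ lim0], intro eventuallyI)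
    fix n show "cmod (integral {\<eta>..Y} (\<lambda>y. ?k (Complex (R n) y))) \<le> (1 + (Y - \<eta>)) / (2 * real (Suc n))"
      by (rule hardy_side_bound[OF assms(1) Y R(2)]) (use R(1)[of n] in auto)
  qed
  have sL: "(\<lambda>n. integral {\<eta>..Y} (\<lambda>y. ?k (Complex (L n) y))) \<longlonglongrightarrow> 0"
  proof (rule Lim_null_comparison[OF _ lim0], intro eventuallyI)
    fix n show "cmod (integral {\<eta>..Y} (\<lambda>y. ?k (Complex (L n) y))) \<le> (1 + (Y - \<eta>)) / (2 * real (Suc n))"
      by (rule hardy_side_bound[OF assms(1) Y L(2)]) (use L(1)[of n] in auto)
  qed
  have hor: "(\<lambda>n. integral {L n..R n} (\<lambda>x. ?k (Complex x y)))
      \<longlonglongrightarrow> (\<integral>x. g (Complex x y) * (1 / (Complex x y - w)) \<partial>lborel)" if "y > 0" "y \<noteq> Im w" for y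
    using integral_growing_intervals[OF hardy_integrable[OF that] Rlim Llim] by simp
  have "(\<lambda>n. integral {L n..R n} (\<lambda>x. ?k (Complex x \<eta>)) + \<i> * integral {\<eta>..Y} (\<lambda>y. ?k (Complex (R n) y))
      - integral {L n..R n} (\<lambda>x. ?k (Complex x Y)) - \<i> * integral {\<eta>..Y} (\<lambda>y. ?k (Complex (L n) y)))
    \<longlonglongrightarrow> (\<integral>x. g (Complex x \<eta>) * (1 / (Complex x \<eta> - w)) \<partial>lborel) + \<i> * 0
      - (\<integral>x. g (Complex x Y) * (1 / (Complex x Y - w)) \<partial>lborel) - \<i> * 0"
    by (intro tendsto_intros hor sR sL) (use assms in auto)
  moreover have "integral {L n..R n} (\<lambda>x. ?k (Complex x \<eta>)) + \<i> * integral {\<eta>..Y} (\<lambda>y. ?k (Complex (R n) y))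
      - integral {L n..R n} (\<lambda>x. ?k (Complex x Y)) - \<i> * integral {\<eta>..Y} (\<lambda>y. ?k (Complex (L n) y))
      = 2 * pi * \<i> * g w" for n
    by (rule Cauchy_rectangle[OF hol]) (use assms R(1)[of n] L(1)[of n] in auto)
  ultimately show ?thesis by (simp add: LIMSEQ_const_iff)
qed

text \<open>On rising lines the L2 norm of \<open>g\<close> stays bounded while the squared norm
  \<open>J n\<close> of the resolvent tends to 0.\<close>

lemma hardy_top_tendsto:
  "(\<lambda>n. \<integral>x. g (Complex x (Im w + Suc n)) * (1 / (Complex x (Im w + Suc n) - w)) \<partial>lborel) \<longlonglongrightarrow> 0"
  if w: "Im w > 0"
proof -
  define J where "J n = (\<integral>x. 1 / ((x - Re w)\<^sup>2 + (real (Suc n))\<^sup>2) \<partial>lborel)" for n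
  have J: "J \<longlonglongrightarrow> 0"
  proof -
    have "J \<longlonglongrightarrow> (\<integral>(x::real). 0 \<partial>lborel)"
      unfolding J_def
    proof (rule integral_dominated_convergence)
      show "integrable lborel (\<lambda>x. 1 / ((x - Re w)\<^sup>2 + 1\<^sup>2))"
        by (rule integrable_inverse_shift_square) simp
      show "AE x in lborel. (\<lambda>n. 1 / ((x - Re w)\<^sup>2 + (real (Suc n))\<^sup>2)) \<longlonglongrightarrow> 0"
        by (intro AE_I2) real_asymp
      show "AE x in lborel. norm (1 / ((x - Re w)\<^sup>2 + (real (Suc n))\<^sup>2)) \<le> 1 / ((x - Re w)\<^sup>2 + 1\<^sup>2)" for n
      proof (intro AE_I2)
        fix x
        have "(1::real)\<^sup>2 \<le> (real (Suc n))\<^sup>2" by (rule power_mono) auto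
        then show "norm (1 / ((x - Re w)\<^sup>2 + (real (Suc n))\<^sup>2)) \<le> 1 / ((x - Re w)\<^sup>2 + 1\<^sup>2)"
          by (auto intro!: divide_left_mono add_nonneg_pos simp: add_nonneg_pos)
      qed
    qed auto
    then show ?thesis by simp
  qed
  have J0: "J n \<ge> 0" for n unfolding J_def by (intro integral_nonneg_AE AE_I2) auto
  show ?thesis
  proof (rule Lim_null_comparison)
    show "(\<lambda>n. sqrt (J n) * (C + 1)) \<longlonglongrightarrow> 0"
      using tendsto_mult_left_zero[OF tendsto_real_sqrt[OF J, simplified], of "C + 1"] by simp
    show "\<forall>\<^sub>F n in sequentially. cmod (\<integral>x. g (Complex x (Im w + Suc n)) * (1 / (Complex x (Im w + Suc n) - w)) \<partial>lborel)
        \<le> sqrt (J n) * (C + 1)"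
    proof (intro eventuallyI)
      fix n
      let ?y = "Im w + Suc n"
      have y: "?y > 0" "?y \<noteq> Im w" using w by auto
      note ig = integrable_of_nn_bound[OF hardy_line_measurable[OF y(1)] bound[OF y(1)] C]
      have Jn: "J n = (\<integral>x. (cmod (1 / (Complex x ?y - w)))\<^sup>2 \<partial>lborel)"
        unfolding resolvent_L2(2)[OF y(2)] J_def by simp
      \<comment> \<open>With this weight both terms of Young's inequality are of order
        \<open>s\<close>, namely \<open>s * C\<close> and \<open>J n / s = s\<close>. Positivity of
        \<open>s\<close> means that the resolvent does not vanish almost everywhere.\<close>
      define s where "s = sqrt (J n)"
      have s: "0 < s"
      proof -
        have "J n \<noteq> 0"
        proof
          assume "J n = 0"
          then have "AE x in lborel. (cmod (1 / (Complex x ?y - w)))\<^sup>2 = 0"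
            unfolding Jn by (subst (asm) integral_nonneg_eq_0_iff_AE[OF resolvent_L2(3)[OF y(2)]]) auto
          moreover have "Complex x ?y - w \<noteq> 0" for x
            using y(2) by (auto simp: complex_eq_iff)
          ultimately have "AE x::real in lborel. False" by simp
          then show False by (simp add: AE_iff_null null_sets_def)
        qed
        then show ?thesis using J0[of n] by (simp add: s_def)
      qed
      have "cmod (\<integral>x. g (Complex x ?y) * (1 / (Complex x ?y - w)) \<partial>lborel)
          \<le> (\<integral>x. (s * (cmod (g (Complex x ?y)))\<^sup>2 + (cmod (1 / (Complex x ?y - w)))\<^sup>2 / s) \<partial>lborel)"
      proof (rule Bochner_Integration.integral_norm_bound_integral)
        show "integrable lborel (\<lambda>x. s * (cmod (g (Complex x ?y)))\<^sup>2 + (cmod (1 / (Complex x ?y - w)))\<^sup>2 / s)"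
          by (intro Bochner_Integration.integrable_add integrable_mult_right integrable_divide ig resolvent_L2 y)
        fix x
        let ?u = "cmod (g (Complex x ?y))" and ?v = "cmod (1 / (Complex x ?y - w))"
        have "2 * (?u * ?v) \<le> s * ?u\<^sup>2 + ?v\<^sup>2 / s" by (rule young_weighted[OF s])
        moreover have "0 \<le> ?u * ?v" by simp
        ultimately show "norm (g (Complex x ?y) * (1 / (Complex x ?y - w))) \<le> s * ?u\<^sup>2 + ?v\<^sup>2 / s"
          unfolding norm_mult by linarith
      qed (rule hardy_integrable[OF y])
      also have "\<dots> = s * (\<integral>x. (cmod (g (Complex x ?y)))\<^sup>2 \<partial>lborel) + J n / s"
        unfolding Jn using ig(1) resolvent_L2(3)[OF y(2)]
        by (subst Bochner_Integration.integral_add) auto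
      also have "\<dots> \<le> s * C + s"
        using ig(2) s J0[of n] by (intro add_mono mult_left_mono) (auto simp: s_def real_div_sqrt)
      finally show "cmod (\<integral>x. g (Complex x ?y) * (1 / (Complex x ?y - w)) \<partial>lborel) \<le> sqrt (J n) * (C + 1)"
        by (simp add: s_def algebra_simps)
    qed
  qed
qed

lemma hardy_line:
  assumes "0 < \<eta>" "\<eta> < Im w"
  shows "(\<integral>x. g (Complex x \<eta>) * (1 / (Complex x \<eta> - w)) \<partial>lborel) = 2 * pi * \<i> * g w"
proof -
  let ?I = "\<integral>x. g (Complex x \<eta>) * (1 / (Complex x \<eta> - w)) \<partial>lborel"
  have "(\<lambda>n. ?I - (\<integral>x. g (Complex x (Im w + Suc n)) * (1 / (Complex x (Im w + Suc n) - w)) \<partial>lborel)) \<longlonglongrightarrow> ?I - 0"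
    by (intro tendsto_diff tendsto_const hardy_top_tendsto) (use assms in simp)
  moreover have "?I - (\<integral>x. g (Complex x (Im w + Suc n)) * (1 / (Complex x (Im w + Suc n) - w)) \<partial>lborel)
      = 2 * pi * \<i> * g w" for n
    by (rule hardy_strip) (use assms in auto)
  ultimately show ?thesis by (simp add: LIMSEQ_const_iff)
qed

text \<open>The line of integration is lowered to the real axis. \<open>g\<close> converges there
  only almost everywhere, so the limit is taken by \<open>integral_mult_tendsto\<close>, with the
  resolvents as the dominated factor.\<close>

lemma hardy_cauchy:
  fixes u :: "real \<Rightarrow> complex"
  assumes "u \<in> borel_measurable lborel" "Im w > 0"
    and lim: "AE x in lborel. ((\<lambda>y. g (Complex x y)) \<longlongrightarrow> u x) (at_right 0)"
  shows "(\<integral>x. u x * (1 / (of_real x - w)) \<partial>lborel) = 2 * pi * \<i> * g w"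
proof -
  \<comment> \<open>Half of \<open>Im w\<close>: all lines used stay at least \<open>s\<close> below
    the pole, which yields one dominating function for all resolvents.\<close>
  define s where "s = Im w / 2"
  have s: "s > 0" using assms by (simp add: s_def)
  define \<eta> where "\<eta> n = s / real (Suc n)" for n
  have \<eta>: "0 < \<eta> n" "\<eta> n \<le> s" "\<eta> n < Im w" for n
    using s by (auto simp: \<eta>_def field_simps s_def add_pos_nonneg)
  have \<eta>0: "\<eta> \<longlonglongrightarrow> 0" unfolding \<eta>_def by real_asymp
  then have \<eta>r: "filterlim \<eta> (at_right 0) sequentially"
    using \<eta> less_imp_neq[OF \<eta>(1)] by (auto simp: filterlim_at intro!: eventuallyI)
  have "(\<lambda>n. \<integral>x. g (Complex x (\<eta> n)) * (1 / (Complex x (\<eta> n) - w)) \<partial>lborel)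
      \<longlonglongrightarrow> (\<integral>x. u x * (1 / (Complex x 0 - w)) \<partial>lborel)"
  proof (rule integral_mult_tendsto[where p = "\<lambda>x. sqrt (1 / ((x - Re w)\<^sup>2 + s\<^sup>2))" and C = C])
    show "AE x in lborel. (\<lambda>n. g (Complex x (\<eta> n))) \<longlonglongrightarrow> u x"
      using lim by eventually_elim (rule filterlim_compose[OF _ \<eta>r])
    show "(\<lambda>n. 1 / (Complex x (\<eta> n) - w)) \<longlonglongrightarrow> 1 / (Complex x 0 - w)" for x
      by (intro tendsto_intros tendsto_Complex \<eta>0) (use assms in \<open>auto simp: complex_eq_iff\<close>)
    show "cmod (1 / (Complex x (\<eta> n) - w)) \<le> sqrt (1 / ((x - Re w)\<^sup>2 + s\<^sup>2))" for n x
    proof (rule real_le_rsqrt)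
      have "s \<le> Im w - \<eta> n" using \<eta>(2)[of n] by (simp add: s_def)
      then have "s\<^sup>2 \<le> (\<eta> n - Im w)\<^sup>2" using s by (subst power2_commute) (rule power_mono, auto)
      then show "(cmod (1 / (Complex x (\<eta> n) - w)))\<^sup>2 \<le> 1 / ((x - Re w)\<^sup>2 + s\<^sup>2)"
        using s \<eta>(3)[of n] by (subst resolvent_L2(2)) (auto intro!: divide_left_mono mult_pos_pos add_nonneg_pos)
    qed
    show "0 < sqrt (1 / ((x - Re w)\<^sup>2 + s\<^sup>2))" for x
      using s by (simp add: add_nonneg_pos)
    show "integrable lborel (\<lambda>x. (sqrt (1 / ((x - Re w)\<^sup>2 + s\<^sup>2)))\<^sup>2)"
      using integrable_inverse_shift_square[OF s, of "Re w"] by simp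
    show "(\<lambda>x. 1 / (Complex x (\<eta> n) - w)) \<in> borel_measurable lborel" for n
      using \<eta>(3)[of n] by (intro resolvent_L2) simp
    show "(\<lambda>x. 1 / (Complex x 0 - w)) \<in> borel_measurable lborel"
      using assms by (intro resolvent_L2) simp
  qed (use assms \<eta> bound C hardy_line_measurable in auto)
  moreover have "(\<integral>x. g (Complex x (\<eta> n)) * (1 / (Complex x (\<eta> n) - w)) \<partial>lborel) = 2 * pi * \<i> * g w" for n
    by (rule hardy_line) (use \<eta> in auto)
  ultimately have "(\<integral>x. u x * (1 / (Complex x 0 - w)) \<partial>lborel) = 2 * pi * \<i> * g w"
    by (simp add: LIMSEQ_const_iff)
  then show ?thesis by (simp add: Complex_eq)
qed

end

subsection \<open>Square integrable functions and their classes\<close>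

text \<open>\<open>rep_L2\<close> picks some representative of each class, so it commutes with the
  vector operations only almost everywhere.\<close>

lemma AE_rep_plus: "AE x in lborel. rep_L2 (u + v) x = rep_L2 u x + rep_L2 v x"
proof -
  have "u + v = abs_L2 (\<lambda>x. rep_L2 u x + rep_L2 v x)"
    using plus_L2.abs_eq[of "rep_L2 u" "rep_L2 v"]
    by (simp add: l2_rel_def sq_integrable_rep_L2 abs_L2_rep_L2)
  then show ?thesis
    using rep_L2_abs_L2[OF sq_integrable_add[OF sq_integrable_rep_L2 sq_integrable_rep_L2]] by simp
qed

lemma AE_rep_minus: "AE x in lborel. rep_L2 (u - v) x = rep_L2 u x - rep_L2 v x"
proof -
  have "u - v = abs_L2 (\<lambda>x. rep_L2 u x - rep_L2 v x)"
    using minus_L2.abs_eq[of "rep_L2 u" "rep_L2 v"]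
    by (simp add: l2_rel_def sq_integrable_rep_L2 abs_L2_rep_L2)
  then show ?thesis
    using rep_L2_abs_L2[OF sq_integrable_diff[OF sq_integrable_rep_L2 sq_integrable_rep_L2]] by simp
qed

lemma AE_rep_scaleC: "AE x in lborel. rep_L2 (a *\<^sub>C u) x = a *\<^sub>C rep_L2 u x"
proof -
  have "a *\<^sub>C u = abs_L2 (\<lambda>x. a *\<^sub>C rep_L2 u x)"
    using scaleC_L2.abs_eq[of "rep_L2 u"]
    by (simp add: l2_rel_def sq_integrable_rep_L2 abs_L2_rep_L2)
  then show ?thesis
    using rep_L2_abs_L2[OF sq_integrable_scaleC[OF sq_integrable_rep_L2]] by simp
qed

lemma AE_rep_zero: "AE x in lborel. rep_L2 (0::'a::separable_complex_hilbert L2) x = 0"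
  using rep_L2_abs_L2[OF sq_integrable_zero] by (simp add: zero_L2_def)

lemma L2_eqI: "(AE x in lborel. rep_L2 u x = rep_L2 v x) \<Longrightarrow> u = v"
  using abs_L2_eq_iff[OF sq_integrable_rep_L2 sq_integrable_rep_L2, of u v] by (simp add: abs_L2_rep_L2)

lemma cinner_L2_rep: "cinner u v = (\<integral>x. cinner (rep_L2 u x) (rep_L2 v x) \<partial>lborel)"
  using cinner_L2.abs_eq[of "rep_L2 u" "rep_L2 v"]
  by (simp add: l2_rel_def sq_integrable_rep_L2 abs_L2_rep_L2)

lemma measurable_rep_L2 [measurable]: "rep_L2 u \<in> borel_measurable lborel"
  using sq_integrable_rep_L2 by (auto simp: sq_integrable_def)

lemma borel_measurable_cinner:
  assumes [measurable]: "f \<in> borel_measurable M" "g \<in> borel_measurable M"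
  shows "(\<lambda>x. cinner (f x) (g x :: 'a::{complex_inner, second_countable_topology})) \<in> borel_measurable M"
proof -
  have [measurable]: "(\<lambda>x. \<i> *\<^sub>C f x) \<in> borel_measurable M"
    by (rule borel_measurable_scaleC) fact
  have "(\<lambda>x. complex_of_real (inner (f x) (g x)) + \<i> * complex_of_real (inner (\<i> *\<^sub>C f x) (g x)))
      \<in> borel_measurable M"
    by measurable
  then show ?thesis by (simp add: cinner_eq_Complex Complex_eq)
qed

lemma cinner_L2_cong:
  assumes "AE x in lborel. cinner (rep_L2 u x) (rep_L2 v x) = cinner (rep_L2 u' x) (rep_L2 v' x)"
  shows "cinner u v = cinner u' v'"
  unfolding cinner_L2_rep
  by (rule integral_cong_AE) (use assms borel_measurable_cinner measurable_rep_L2 in blast)+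

lemma sq_integrable_bound:
  assumes "sq_integrable f" "g \<in> borel_measurable lborel" "AE x in lborel. norm (g x) \<le> norm (f x)"
  shows "sq_integrable g"
  unfolding sq_integrable_def
proof
  show "integrable lborel (\<lambda>x. (norm (g x))\<^sup>2)"
  proof (rule Bochner_Integration.integrable_bound)
    show "integrable lborel (\<lambda>x. (norm (f x))\<^sup>2)" using assms by (simp add: sq_integrable_def)
    show "AE x in lborel. norm ((norm (g x))\<^sup>2) \<le> norm ((norm (f x))\<^sup>2)"
      using assms(3) by eventually_elim (simp add: power_mono)
  qed (use assms in measurable)
qed (rule assms)

subsection \<open>Reproducing kernels of the Hardy space\<close>

text \<open>Names the witness hidden in \<open>H2\<close>, so that the holomorphic function and the
  boundary class can be transformed together.\<close>

definition hardy :: "(complex \<Rightarrow> 'a::separable_complex_hilbert) \<Rightarrow> 'a L2 \<Rightarrow> bool"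
  where "hardy f u \<longleftrightarrow> vholomorphic_on f upper_half_plane \<and>
    (SUP y\<in>{0<..}. \<integral>\<^sup>+x. ennreal ((norm (f (Complex x y)))\<^sup>2) \<partial>lborel) < \<infinity> \<and>
    (AE x in lborel. ((\<lambda>y. f (Complex x y)) \<longlongrightarrow> rep_L2 u x) (at_right 0))"

lemma H2_iff_hardy: "u \<in> H2 \<longleftrightarrow> (\<exists>f. hardy f u)"
  by (simp add: H2_def hardy_def)

text \<open>Up to a constant the Szego kernel at \<open>w\<close> in the direction \<open>k\<close>;
  its pole \<open>cnj w\<close> lies in the lower half-plane.\<close>

definition hker :: "complex \<Rightarrow> 'a \<Rightarrow> 'a::separable_complex_hilbert L2"
  where "hker w k = abs_L2 (\<lambda>x. (1 / (of_real x - cnj w)) *\<^sub>C k)"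

lemma resolvent_cnj_L2:
  assumes "Im w > 0"
  shows "(\<lambda>x. 1 / (complex_of_real x - cnj w)) \<in> borel_measurable lborel"
    "integrable lborel (\<lambda>x. (cmod (1 / (complex_of_real x - cnj w)))\<^sup>2)"
  using resolvent_L2(1,3)[of 0 "cnj w"] assms by (simp_all add: Complex_eq)

lemma sq_integrable_hker:
  assumes "Im w > 0"
  shows "sq_integrable (\<lambda>x. (1 / (of_real x - cnj w)) *\<^sub>C (k::'a::separable_complex_hilbert))"
  unfolding sq_integrable_def
proof
  have "continuous_on UNIV (\<lambda>z::complex. z *\<^sub>C k)"
    by (intro linear_continuous_on bounded_bilinear.bounded_linear_left[OF bounded_bilinear_scaleC])
  then show "(\<lambda>x. (1 / (of_real x - cnj w)) *\<^sub>C k) \<in> borel_measurable lborel"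
    by (rule borel_measurable_continuous_on) (rule resolvent_cnj_L2[OF assms])
  show "integrable lborel (\<lambda>x. (norm ((1 / (of_real x - cnj w)) *\<^sub>C k))\<^sup>2)"
    unfolding norm_scaleC power_mult_distrib
    by (rule integrable_mult_left) (rule resolvent_cnj_L2[OF assms])
qed

lemma rep_hker:
  "Im w > 0 \<Longrightarrow> AE x in lborel. rep_L2 (hker w k) x = (1 / (of_real x - cnj w)) *\<^sub>C k"
  unfolding hker_def by (rule rep_L2_abs_L2[OF sq_integrable_hker])

lemma norm_cnj_diff_ge: "Im z > 0 \<Longrightarrow> Im w > 0 \<Longrightarrow> Im w \<le> cmod (z - cnj w)"
  using abs_Im_le_cmod[of "z - cnj w"] by simp

lemma cnj_diff_ne: "Im z > 0 \<Longrightarrow> Im w > 0 \<Longrightarrow> z - cnj w \<noteq> 0"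
  using norm_cnj_diff_ge[of z w] by force

lemma vholomorphic_onI_deriv:
  assumes "\<And>z. z \<in> S \<Longrightarrow> (g has_field_derivative g' z) (at z within S)"
  shows "vholomorphic_on (\<lambda>z. g z *\<^sub>C k) S"
  unfolding vholomorphic_on_def
proof (intro ballI exI)
  fix z assume "z \<in> S"
  from assms[OF this] have "((\<lambda>w. (g w - g z) / (w - z)) \<longlongrightarrow> g' z) (at z within S)"
    by (simp add: has_field_derivative_iff)
  from tendsto_scaleC[OF this tendsto_const[of k]]
  show "((\<lambda>w. (1 / (w - z)) *\<^sub>C (g w *\<^sub>C k - g z *\<^sub>C k)) \<longlongrightarrow> g' z *\<^sub>C k) (at z within S)"
    by (simp add: scaleC_diff_left[symmetric] scaleC_scaleC)
qed

text \<open>Moving up only increases the distance to the pole \<open>cnj w\<close>, so the real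
  line, where that distance is at least \<open>Im w\<close>, bounds all horizontal
  integrals.\<close>

lemma hardy_hker:
  assumes w: "Im w > 0"
  shows "hardy (\<lambda>z. (1 / (z - cnj w)) *\<^sub>C k) (hker w k)"
  unfolding hardy_def
proof (intro conjI)
  show "vholomorphic_on (\<lambda>z. (1 / (z - cnj w)) *\<^sub>C k) upper_half_plane"
  proof (rule vholomorphic_onI_deriv)
    fix z assume "z \<in> upper_half_plane"
    then have "z - cnj w \<noteq> 0" using w cnj_diff_ne by simp
    then show "((\<lambda>z. 1 / (z - cnj w)) has_field_derivative - 1 / (z - cnj w)\<^sup>2) (at z within upper_half_plane)"
      by (auto intro!: derivative_eq_intros simp: power2_eq_square)
  qed
  let ?I = "\<integral>\<^sup>+x. ennreal ((norm k)\<^sup>2 * (1 / ((x - Re w)\<^sup>2 + (Im w)\<^sup>2))) \<partial>lborel"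
  have "(SUP y\<in>{0<..}. \<integral>\<^sup>+x. ennreal ((norm ((1 / (Complex x y - cnj w)) *\<^sub>C k))\<^sup>2) \<partial>lborel) \<le> ?I"
  proof (intro SUP_least nn_integral_mono ennreal_leI)
    fix y x :: real assume y: "y \<in> {0<..}"
    have "(Im w)\<^sup>2 \<le> (y - Im (cnj w))\<^sup>2" using y w by (intro power_mono) auto
    moreover have "0 < (Im w)\<^sup>2" using w by simp
    ultimately have "1 / ((x - Re (cnj w))\<^sup>2 + (y - Im (cnj w))\<^sup>2) \<le> 1 / ((x - Re w)\<^sup>2 + (Im w)\<^sup>2)"
      by (intro frac_le) (auto intro: add_nonneg_pos)
    then have "(cmod (1 / (Complex x y - cnj w)))\<^sup>2 \<le> 1 / ((x - Re w)\<^sup>2 + (Im w)\<^sup>2)"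
      using resolvent_L2(2)[of y "cnj w" x] y w by simp
    then show "(norm ((1 / (Complex x y - cnj w)) *\<^sub>C k))\<^sup>2 \<le> (norm k)\<^sup>2 * (1 / ((x - Re w)\<^sup>2 + (Im w)\<^sup>2))"
      unfolding norm_scaleC power_mult_distrib mult.commute[of _ "(norm k)\<^sup>2"]
      by (intro mult_left_mono) auto
  qed
  also have "\<dots> < \<infinity>"
    using integrable_inverse_shift_square[OF w, of "Re w"]
    by (subst nn_integral_eq_integral) (auto simp del: times_divide_eq_right)
  finally show "(SUP y\<in>{0<..}. \<integral>\<^sup>+x. ennreal ((norm ((1 / (Complex x y - cnj w)) *\<^sub>C k))\<^sup>2) \<partial>lborel) < \<infinity>" .
  show "AE x in lborel. ((\<lambda>y. (1 / (Complex x y - cnj w)) *\<^sub>C k) \<longlongrightarrow> rep_L2 (hker w k) x) (at_right 0)"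
    using rep_hker[OF w, of k]
  proof eventually_elim
    case (elim x)
    have "((\<lambda>y. Complex x y) \<longlongrightarrow> Complex x 0) (at_right 0)"
      by (intro tendsto_Complex tendsto_const tendsto_ident_at)
    then have "((\<lambda>y. (1 / (Complex x y - cnj w)) *\<^sub>C k) \<longlongrightarrow> (1 / (Complex x 0 - cnj w)) *\<^sub>C k) (at_right 0)"
      using w by (intro tendsto_intros) (auto simp: complex_eq_iff)
    then show ?case unfolding elim by (simp add: Complex_eq)
  qed
qed

text \<open>\<open>hardy_ext f u\<close>: the function \<open>f\<close> is the Cauchy integral of \<open>u\<close>.\<close>

definition hardy_ext :: "(complex \<Rightarrow> 'a::separable_complex_hilbert) \<Rightarrow> 'a L2 \<Rightarrow> bool"
  where "hardy_ext f u \<longleftrightarrow>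
    (\<forall>w k. Im w > 0 \<longrightarrow> cinner (hker w k) u = 2 * pi * \<i> * cinner k (f w))"

lemma vholomorphic_continuous_on:
  assumes "vholomorphic_on f S"
  shows "continuous_on S f"
  unfolding continuous_on_def
proof
  fix z assume z: "z \<in> S"
  then obtain D where D: "((\<lambda>w. (1 / (w - z)) *\<^sub>C (f w - f z)) \<longlongrightarrow> D) (at z within S)"
    using assms by (auto simp: vholomorphic_on_def)
  have "((\<lambda>w. f z + (w - z) *\<^sub>C ((1 / (w - z)) *\<^sub>C (f w - f z))) \<longlongrightarrow> f z + (z - z) *\<^sub>C D) (at z within S)"
    by (intro tendsto_add tendsto_scaleC tendsto_diff tendsto_const tendsto_ident_at D)
  moreover have "\<forall>\<^sub>F w in at z within S. f z + (w - z) *\<^sub>C ((1 / (w - z)) *\<^sub>C (f w - f z)) = f w"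
    by (auto simp: eventually_at_filter scaleC_scaleC)
  ultimately show "(f \<longlongrightarrow> f z) (at z within S)"
    by (simp add: filterlim_cong)
qed

lemma vholomorphic_line_continuous:
  assumes "vholomorphic_on f upper_half_plane" "y > 0"
  shows "continuous_on UNIV (\<lambda>x. f (Complex x y))"
  by (rule continuous_on_compose2[OF vholomorphic_continuous_on[OF assms(1)]])
    (use assms in \<open>auto intro!: continuous_intros simp: Complex_eq\<close>)

lemma vholomorphic_line_measurable:
  assumes "vholomorphic_on f upper_half_plane" "y > 0"
  shows "(\<lambda>x. f (Complex x y)) \<in> borel_measurable lborel"
  using borel_measurable_continuous_onI[OF vholomorphic_line_continuous[OF assms]] by simp

lemma vholomorphic_cinner:
  assumes "vholomorphic_on f upper_half_plane"
  shows "(\<lambda>z. cinner k (f z)) holomorphic_on upper_half_plane"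
  unfolding holomorphic_on_def
proof
  fix z assume "z \<in> upper_half_plane"
  then obtain D where D: "((\<lambda>w. (1 / (w - z)) *\<^sub>C (f w - f z)) \<longlongrightarrow> D) (at z within upper_half_plane)"
    using assms unfolding vholomorphic_on_def by blast
  from tendsto_cinner[OF tendsto_const[of k] this]
  have "((\<lambda>z. cinner k (f z)) has_field_derivative cinner k D) (at z within upper_half_plane)"
    by (simp add: has_field_derivative_iff cinner_scaleC_right cinner_diff_right)
  then show "(\<lambda>z. cinner k (f z)) field_differentiable at z within upper_half_plane"
    by (auto simp: field_differentiable_def)
qed

text \<open>Pairing with a fixed \<open>k\<close> reduces the claim to the scalar Cauchy formula; by
  Cauchy-Schwarz the Hardy bound \<open>S\<close> becomes the constant \<open>C\<close>.\<close>

lemma hardy_imp_ext: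
  fixes f :: "complex \<Rightarrow> 'a::separable_complex_hilbert"
  assumes "hardy f u"
  shows "hardy_ext f u"
  unfolding hardy_ext_def
proof (intro allI impI)
  fix w :: complex and k :: 'a assume w: "Im w > 0"
  from assms have hol: "vholomorphic_on f upper_half_plane"
    and sup: "(SUP y\<in>{0<..}. \<integral>\<^sup>+x. ennreal ((norm (f (Complex x y)))\<^sup>2) \<partial>lborel) < \<infinity>"
    and lim: "AE x in lborel. ((\<lambda>y. f (Complex x y)) \<longlongrightarrow> rep_L2 u x) (at_right 0)"
    by (auto simp: hardy_def)
  define S where "S = (SUP y\<in>{0<..}. \<integral>\<^sup>+x. ennreal ((norm (f (Complex x y)))\<^sup>2) \<partial>lborel)"
  have S: "S < \<infinity>" "\<And>y. y > 0 \<Longrightarrow> (\<integral>\<^sup>+x. ennreal ((norm (f (Complex x y)))\<^sup>2) \<partial>lborel) \<le> S"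
    using sup by (auto simp: S_def intro!: SUP_upper)
  define g where "g z = cinner k (f z)" for z
  define C where "C = enn2real ((ennreal ((norm k)\<^sup>2)) * S)"
  have "ennreal C = ennreal ((norm k)\<^sup>2) * S"
    unfolding C_def using S(1) by (intro ennreal_enn2real) (simp add: ennreal_mult_less_top)
  have g: "g holomorphic_on upper_half_plane"
    unfolding g_def by (rule vholomorphic_cinner[OF hol])
  have bound: "(\<integral>\<^sup>+x. ennreal ((cmod (g (Complex x y)))\<^sup>2) \<partial>lborel) \<le> ennreal C" if y: "y > 0" for y
  proof -
    have ms: "(\<lambda>x. ennreal ((norm (f (Complex x y)))\<^sup>2)) \<in> borel_measurable lborel"
    proof -
      have "(\<lambda>x. f (Complex x y)) \<in> borel_measurable lborel"
        by (rule vholomorphic_line_measurable[OF hol y])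
      then show ?thesis by measurable
    qed
    have "(\<integral>\<^sup>+x. ennreal ((cmod (g (Complex x y)))\<^sup>2) \<partial>lborel)
        \<le> (\<integral>\<^sup>+x. ennreal ((norm k)\<^sup>2) * ennreal ((norm (f (Complex x y)))\<^sup>2) \<partial>lborel)"
      unfolding g_def
      by (intro nn_integral_mono)
        (simp flip: ennreal_mult power_mult_distrib add: power_mono norm_cinner_le ennreal_leI)
    also have "\<dots> = ennreal ((norm k)\<^sup>2) * (\<integral>\<^sup>+x. ennreal ((norm (f (Complex x y)))\<^sup>2) \<partial>lborel)"
      by (rule nn_integral_cmult[OF ms])
    also have "\<dots> \<le> ennreal ((norm k)\<^sup>2) * S" by (intro mult_left_mono S y) simp
    also have "\<dots> = ennreal C" by (rule \<open>ennreal C = ennreal ((norm k)\<^sup>2) * S\<close>[symmetric])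
    finally show ?thesis .
  qed
  have "(\<integral>x. cinner k (rep_L2 u x) * (1 / (of_real x - w)) \<partial>lborel) = 2 * pi * \<i> * g w"
  proof (rule hardy_cauchy[OF g bound _ _ w])
    show "0 \<le> C" by (simp add: C_def)
    show "(\<lambda>x. cinner k (rep_L2 u x)) \<in> borel_measurable lborel"
      by (intro borel_measurable_cinner) auto
    show "AE x in lborel. ((\<lambda>y. g (Complex x y)) \<longlongrightarrow> cinner k (rep_L2 u x)) (at_right 0)"
      using lim by eventually_elim (simp add: g_def tendsto_cinner)
  qed
  moreover have "cinner (hker w k) u = (\<integral>x. cinner k (rep_L2 u x) * (1 / (of_real x - w)) \<partial>lborel)"
    unfolding cinner_L2_rep
  proof (rule integral_cong_AE)
    show "AE x in lborel. cinner (rep_L2 (hker w k) x) (rep_L2 u x) = cinner k (rep_L2 u x) * (1 / (of_real x - w))"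
      using rep_hker[OF w, of k] by eventually_elim (simp add: cinner_scaleC_left)
    show "(\<lambda>x. cinner k (rep_L2 u x) * (1 / (of_real x - w))) \<in> borel_measurable lborel"
      by (intro borel_measurable_times borel_measurable_cinner borel_measurable_const measurable_rep_L2)
        measurable
  qed (intro borel_measurable_cinner measurable_rep_L2)
  ultimately show "cinner (hker w k) u = 2 * pi * \<i> * cinner k (f w)" by (simp add: g_def)
qed

lemma hardy_ext_unique:
  assumes "hardy_ext f u" "hardy_ext g u" "Im w > 0"
  shows "f w = g w"
  by (rule cinner_eqI) (use assms in \<open>simp add: hardy_ext_def\<close>)

lemma H2_eqI:
  assumes "hardy f u" "hardy g v" "\<And>w. Im w > 0 \<Longrightarrow> f w = g w"
  shows "u = v"
proof (rule L2_eqI)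
  have f: "AE x in lborel. ((\<lambda>y. f (Complex x y)) \<longlongrightarrow> rep_L2 u x) (at_right 0)"
    and g: "AE x in lborel. ((\<lambda>y. g (Complex x y)) \<longlongrightarrow> rep_L2 v x) (at_right 0)"
    using assms by (auto simp: hardy_def)
  from f g show "AE x in lborel. rep_L2 u x = rep_L2 v x"
  proof eventually_elim
    case (elim x)
    have "\<forall>\<^sub>F y in at_right 0. f (Complex x y) = g (Complex x y)"
      using eventually_at_right_less[of "0::real"] by eventually_elim (simp add: assms(3))
    then have "((\<lambda>y. f (Complex x y)) \<longlongrightarrow> rep_L2 v x) (at_right 0)"
      using elim(2) by (simp add: filterlim_cong)
    with elim(1) show ?case by (intro tendsto_unique) auto
  qed
qed

text \<open>Membership in \<open>H2\<close> supplies a genuine Hardy function, which agrees with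
  \<open>f\<close> because both are Cauchy integrals of \<open>u\<close>. So \<open>f\<close> can be
  computed formally, without checking its growth or its radial limits.\<close>

lemma H2_ext_zero:
  assumes "u \<in> H2" "hardy_ext f u" "\<And>w. Im w > 0 \<Longrightarrow> f w = 0"
  shows "(u :: 'a::separable_complex_hilbert L2) = 0"
proof -
  obtain g where g: "hardy g u" using assms(1) by (auto simp: H2_iff_hardy)
  have "hardy (\<lambda>_. 0) (0 :: 'a L2)"
    using AE_rep_zero[where ?'a = 'a] by (auto simp: hardy_def vholomorphic_on_def elim!: eventually_mono)
  moreover have "g w = 0" if "Im w > 0" for w
    using hardy_ext_unique[OF hardy_imp_ext[OF g] assms(2) that] assms(3)[OF that] by simp
  ultimately show ?thesis using H2_eqI[OF g] by blast
qed

text \<open>Only a pointwise comparison with \<open>f\<close> enters, which covers scalar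
  multipliers and the operator-valued resolvent at once.\<close>

lemma hardy_bounded_multiple:
  assumes f: "hardy f u" and hol: "vholomorphic_on h upper_half_plane" and c: "0 \<le> c"
    and le: "\<And>z. Im z > 0 \<Longrightarrow> norm (h z) \<le> c * norm (f z)"
    and lim: "AE x in lborel. ((\<lambda>y. h (Complex x y)) \<longlongrightarrow> rep_L2 v x) (at_right 0)"
  shows "hardy h v"
  unfolding hardy_def
proof (intro conjI hol lim)
  define S where "S = (SUP y\<in>{0<..}. \<integral>\<^sup>+x. ennreal ((norm (f (Complex x y)))\<^sup>2) \<partial>lborel)"
  have S: "S < \<infinity>" "\<And>y. y > 0 \<Longrightarrow> (\<integral>\<^sup>+x. ennreal ((norm (f (Complex x y)))\<^sup>2) \<partial>lborel) \<le> S"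
    using f by (auto simp: S_def hardy_def intro!: SUP_upper)
  have "(SUP y\<in>{0<..}. \<integral>\<^sup>+x. ennreal ((norm (h (Complex x y)))\<^sup>2) \<partial>lborel) \<le> ennreal (c\<^sup>2) * S"
  proof (rule SUP_least)
    fix y :: real assume y: "y \<in> {0<..}"
    then have [measurable]: "(\<lambda>x. f (Complex x y)) \<in> borel_measurable lborel" using f vholomorphic_line_measurable[of f y] by (simp add: hardy_def)
    have "(\<integral>\<^sup>+x. ennreal ((norm (h (Complex x y)))\<^sup>2) \<partial>lborel)
        \<le> (\<integral>\<^sup>+x. ennreal (c\<^sup>2) * ennreal ((norm (f (Complex x y)))\<^sup>2) \<partial>lborel)"
      using y le
      by (intro nn_integral_mono) (simp flip: ennreal_mult power_mult_distrib add: power_mono ennreal_leI)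
    also have "\<dots> = ennreal (c\<^sup>2) * (\<integral>\<^sup>+x. ennreal ((norm (f (Complex x y)))\<^sup>2) \<partial>lborel)"
      by (rule nn_integral_cmult) measurable
    also have "\<dots> \<le> ennreal (c\<^sup>2) * S" using y by (intro mult_left_mono S) auto
    finally show "(\<integral>\<^sup>+x. ennreal ((norm (h (Complex x y)))\<^sup>2) \<partial>lborel) \<le> ennreal (c\<^sup>2) * S" .
  qed
  also have "\<dots> < \<infinity>" using S(1) by (simp add: ennreal_mult_less_top)
  finally show "(SUP y\<in>{0<..}. \<integral>\<^sup>+x. ennreal ((norm (h (Complex x y)))\<^sup>2) \<partial>lborel) < \<infinity>" .
qed

subsection \<open>Operators on a finite-dimensional Hilbert space\<close>

lemma finite_dimensional_orthonormal:
  assumes "finite_dimensional TYPE('h::separable_complex_hilbert)"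
  obtains E :: "'h::separable_complex_hilbert set" where "finite E" "orthonormal E" "complex_vector.span E = UNIV"
    "\<And>x. x = (\<Sum>e\<in>E. cinner e x *\<^sub>C e)"
proof -
  from assms obtain B :: "'h set" where B: "finite B" "complex_vector.span B = UNIV"
    by (auto simp: finite_dimensional_def)
  obtain E :: "'h set" where E: "finite E" "orthonormal E" "complex_vector.span E = UNIV"
    using gram_schmidt[OF B(1)] B(2) by auto
  have "x = (\<Sum>e\<in>E. cinner e x *\<^sub>C e)" for x
    using proj_on_span[OF E(2,1), of x] E(3) by (simp add: proj_on_def)
  with E that show ?thesis by blast
qed

lemma complex_linear_sum:
  assumes "complex_linear A"
  shows "A (\<Sum>i\<in>I. c i *\<^sub>C x i) = (\<Sum>i\<in>I. c i *\<^sub>C A (x i))"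
  using assms by (simp add: blinfun.sum_right complex_linear_def)

lemma is_adjoint_complex_linear:
  assumes "is_adjoint A B"
  shows "complex_linear B"
  unfolding complex_linear_def
proof (rule allI, rule allI, rule cinner_eqI)
  fix a x y
  have *: "cinner y (B z) = cinner (A y) z" for z using assms by (simp add: is_adjoint_def)
  show "cinner y (B (a *\<^sub>C x)) = cinner y (a *\<^sub>C B x)"
    unfolding * cinner_scaleC_right ..
qed

text \<open>\<open>cadjoint\<close> is a description, so some adjoint has to be exhibited before it
  says anything; coordinates in an orthonormal basis provide one.\<close>

lemma is_adjoint_cadjoint:
  fixes A :: "'h::separable_complex_hilbert \<Rightarrow>\<^sub>L 'h"
  assumes "finite_dimensional TYPE('h)" "complex_linear A"
  shows "is_adjoint A (cadjoint A)"
proof -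
  obtain E :: "'h set" where E0: "finite E" "orthonormal E" "complex_vector.span E = UNIV"
    and E: "\<And>x. x = (\<Sum>e\<in>E. cinner e x *\<^sub>C e)"
    by (rule finite_dimensional_orthonormal[OF assms(1)], rule that)
  let ?B = "\<lambda>y. \<Sum>e\<in>E. cinner (A e) y *\<^sub>C e"
  have "bounded_linear ?B"
    by (intro bounded_linear_sum bounded_linear_compose[OF
          bounded_bilinear.bounded_linear_left[OF bounded_bilinear_scaleC]
          bounded_bilinear.bounded_linear_right[OF bounded_bilinear_cinner]])
  then have B: "blinfun_apply (Blinfun ?B) = ?B" by (rule bounded_linear_Blinfun_apply)
  have "is_adjoint A (Blinfun ?B)"
    unfolding is_adjoint_def B
  proof (intro allI)
    fix x y
    have "cinner (A x) y = cinner (\<Sum>e\<in>E. cinner e x *\<^sub>C A e) y"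
      by (subst E[of x]) (simp only: complex_linear_sum[OF assms(2)])
    also have "\<dots> = (\<Sum>e\<in>E. cnj (cinner e x) * cinner (A e) y)"
      by (simp add: cinner_sum_left cinner_scaleC_left)
    also have "\<dots> = cinner x (?B y)"
      by (simp add: cinner_sum_right cinner_scaleC_right mult.commute flip: cinner_commute[of x])
    finally show "cinner (A x) y = cinner x (?B y)" .
  qed
  then show ?thesis using cadjoint_eqI[of A "Blinfun ?B"] by simp
qed

text \<open>The image of a basis stays independent and has as many elements as the dimension, so it
  spans. A plain function is taken in order to cover \<open>A + i\<close> and the shifted adjoint
  alike.\<close>

lemma injective_imp_surjective:
  fixes f :: "'h::separable_complex_hilbert \<Rightarrow> 'h"
  assumes "finite_dimensional TYPE('h)"
    and add: "\<And>x y. f (x + y) = f x + f y" and scale: "\<And>a x. f (a *\<^sub>C x) = a *\<^sub>C f x"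
    and inj: "\<And>x. f x = 0 \<Longrightarrow> x = 0"
  shows "\<exists>x. f x = y"
proof -
  obtain E :: "'h set" where E: "finite E" "orthonormal E" "complex_vector.span E = UNIV"
    by (rule finite_dimensional_orthonormal[OF assms(1)], rule that)
  interpret p: vector_space_pair "scaleC :: complex \<Rightarrow> 'h \<Rightarrow> 'h" "scaleC :: complex \<Rightarrow> 'h \<Rightarrow> 'h" ..
  have lin: "Vector_Spaces.linear scaleC scaleC f"
    by unfold_locales (simp_all add: add scale)
  have "inj f"
  proof (rule injI)
    fix x y assume "f x = f y"
    then have "f (x - y) = 0" using p.linear_diff[OF lin] by simp
    then show "x = y" using inj by fastforce
  qed
  then have ind: "complex_vector.independent (f ` E)"
    using p.linear_independent_injective_image[OF lin orthonormal_independent[OF E(2)]]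
    by (auto intro: inj_on_subset)
  have card: "card (f ` E) = card E"
    using \<open>inj f\<close> by (simp add: card_image inj_on_subset)
  have "y \<in> complex_vector.span (f ` E)"
  proof (rule ccontr)
    assume y: "y \<notin> complex_vector.span (f ` E)"
    then have "complex_vector.independent (insert y (f ` E))"
      using ind by (simp add: complex_vector.independent_insert)
    then have "card (insert y (f ` E)) \<le> card E"
      using complex_vector.independent_span_bound[OF E(1), of "insert y (f ` E)"] E(3) by simp
    moreover have "y \<notin> f ` E" using y complex_vector.span_base[of y "f ` E"] by auto
    ultimately show False using E(1) card by simp
  qed
  also have "complex_vector.span (f ` E) = range f"
    using p.linear_span_image[OF lin, of E] E(3) by simp
  finally show ?thesis by auto
qed

text \<open>For values of a Pick function this is the positivity condition with the adjoint
  eliminated. Self-adjoint operators are included, so one resolvent serves the half-plane and its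
  boundary.\<close>

definition dissipative :: "('h::complex_hilbert \<Rightarrow>\<^sub>L 'h) \<Rightarrow> bool"
  where "dissipative A \<longleftrightarrow> complex_linear A \<and> (\<forall>x. 0 \<le> Im (cinner x (A x)))"

text \<open>The imaginary part of the inner product of \<open>x\<close> with
  \<open>A x + i x\<close> is at least the squared norm of \<open>x\<close>, and Cauchy-Schwarz
  bounds it from above.\<close>

lemma dissipative_bound:
  assumes "dissipative A"
  shows "norm x \<le> norm (A x + \<i> *\<^sub>C x)"
proof (rule norm_le_of_square)
  have "(norm x)\<^sup>2 \<le> Im (cinner x (A x)) + (norm x)\<^sup>2"
    using assms by (simp add: dissipative_def)
  also have "\<dots> = Im (cinner x (A x + \<i> *\<^sub>C x))"
    by (simp add: cinner_add_right cinner_scaleC_right cinner_self)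
  also have "\<dots> \<le> cmod (cinner x (A x + \<i> *\<^sub>C x))"
    using abs_Im_le_cmod abs_ge_self order_trans by blast
  also have "\<dots> \<le> norm x * norm (A x + \<i> *\<^sub>C x)" by (rule norm_cinner_le)
  finally show "(norm x)\<^sup>2 \<le> norm x * norm (A x + \<i> *\<^sub>C x)" .
qed simp

lemma dissipative_inj:
  assumes "dissipative A" "A x + \<i> *\<^sub>C x = A y + \<i> *\<^sub>C y"
  shows "x = y"
proof -
  have "A (x - y) + \<i> *\<^sub>C (x - y) = 0"
    using assms(2) by (simp add: blinfun.diff_right scaleC_diff_right algebra_simps)
  then show ?thesis using dissipative_bound[OF assms(1), of "x - y"] by simp
qed

lemma dissipative_surj:
  fixes A :: "'h::separable_complex_hilbert \<Rightarrow>\<^sub>L 'h"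
  assumes "finite_dimensional TYPE('h)" "dissipative A"
  shows "\<exists>x. A x + \<i> *\<^sub>C x = y"
proof (rule injective_imp_surjective[OF assms(1)])
  fix x assume "A x + \<i> *\<^sub>C x = 0"
  then show "x = 0" using dissipative_bound[OF assms(2), of x] by simp
qed (use assms(2) in \<open>auto simp: dissipative_def complex_linear_def blinfun.add_right
      scaleC_add_right scaleC_scaleC mult.commute\<close>)

text \<open>A vector in the kernel of \<open>G - i\<close> is orthogonal to the range of
  \<open>A + i\<close>, which is everything.\<close>

lemma dissipative_adjoint_surj:
  fixes A :: "'h::separable_complex_hilbert \<Rightarrow>\<^sub>L 'h"
  assumes fd: "finite_dimensional TYPE('h)" and A: "dissipative A" and G: "is_adjoint A G"
  shows "\<exists>x. G x - \<i> *\<^sub>C x = y"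
proof (rule injective_imp_surjective[OF fd])
  fix k assume k: "G k - \<i> *\<^sub>C k = 0"
  have "cinner (A x + \<i> *\<^sub>C x) k = cinner x (G k - \<i> *\<^sub>C k)" for x
    using G by (simp add: is_adjoint_def cinner_add_left cinner_diff_right cinner_scaleC_left cinner_scaleC_right)
  then have "cinner y k = 0" for y
    using dissipative_surj[OF fd A, of y] k by auto
  then show "k = 0" using cinner_self_eq_0_iff by blast
qed (use is_adjoint_complex_linear[OF G] in \<open>auto simp: complex_linear_def blinfun.add_right
      scaleC_add_right scaleC_diff_right scaleC_scaleC mult.commute\<close>)

text \<open>The operator \<open>J\<close> of the overview at a single point. For dissipative
  \<open>A\<close> in finite dimension the description is proper by \<open>dissipative_surj\<close>
  and \<open>dissipative_inj\<close>.\<close>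

definition resolv :: "('h::complex_hilbert \<Rightarrow>\<^sub>L 'h) \<Rightarrow> 'h \<Rightarrow> 'h"
  where "resolv A y = (THE x. A x + \<i> *\<^sub>C x = y)"

context
  fixes A :: "'h::separable_complex_hilbert \<Rightarrow>\<^sub>L 'h"
  assumes fd: "finite_dimensional TYPE('h)" and A: "dissipative A"
begin

lemma resolv_apply [simp]: "A (resolv A y) + \<i> *\<^sub>C resolv A y = y"
  unfolding resolv_def
proof (rule theI')
  obtain x where x: "A x + \<i> *\<^sub>C x = y" using dissipative_surj[OF fd A] by blast
  show "\<exists>!x. A x + \<i> *\<^sub>C x = y"
  proof (rule ex1I[of _ x])
    show "A x + \<i> *\<^sub>C x = y" by (rule x)
    fix x' assume "A x' + \<i> *\<^sub>C x' = y"
    with x have "A x' + \<i> *\<^sub>C x' = A x + \<i> *\<^sub>C x" by (simp only:)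
    then show "x' = x" by (rule dissipative_inj[OF A])
  qed
qed

lemma resolv_eqI: "A x + \<i> *\<^sub>C x = y \<Longrightarrow> resolv A y = x"
  by (rule dissipative_inj[OF A]) simp

lemma norm_resolv_le: "norm (resolv A y) \<le> norm y"
  using dissipative_bound[OF A, of "resolv A y"] by simp

lemma resolv_add: "resolv A (x + y) = resolv A x + resolv A y"
proof (rule resolv_eqI)
  show "A (resolv A x + resolv A y) + \<i> *\<^sub>C (resolv A x + resolv A y) = x + y"
  proof -
    have "A (resolv A x + resolv A y) + \<i> *\<^sub>C (resolv A x + resolv A y)
        = (A (resolv A x) + \<i> *\<^sub>C resolv A x) + (A (resolv A y) + \<i> *\<^sub>C resolv A y)"
      by (simp only: blinfun.add_right scaleC_add_right ac_simps)
    then show ?thesis by simp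
  qed
qed

lemma resolv_scaleC: "resolv A (a *\<^sub>C x) = a *\<^sub>C resolv A x"
proof (rule resolv_eqI)
  have "A (a *\<^sub>C resolv A x) + \<i> *\<^sub>C (a *\<^sub>C resolv A x) = a *\<^sub>C (A (resolv A x) + \<i> *\<^sub>C resolv A x)"
    using A by (simp add: dissipative_def complex_linear_def scaleC_add_right scaleC_scaleC mult.commute
        del: resolv_apply)
  then show "A (a *\<^sub>C resolv A x) + \<i> *\<^sub>C (a *\<^sub>C resolv A x) = a *\<^sub>C x" by simp
qed

lemma resolv_eq_0_iff: "resolv A y = 0 \<longleftrightarrow> y = 0"
proof
  assume "resolv A y = 0"
  then show "y = 0" using resolv_apply[of y] by (simp only: blinfun.zero_right scaleC_zero_right) simp
next
  show "y = 0 \<Longrightarrow> resolv A y = 0" using resolv_eqI[of 0 0] by (simp add: blinfun.zero_right)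
qed

lemma resolv_diff: "resolv A (x - y) = resolv A x - resolv A y"
  using resolv_add[of "x - y" y] by (simp add: algebra_simps)

end

text \<open>With the limit \<open>v\<close> held fixed, the error
  \<open>resolv (A w) (f w) - v\<close> is the resolvent of \<open>A w\<close> applied to
  \<open>f w - (A w v + i v)\<close>, which tends to 0; all these resolvents are
  contractions.\<close>

lemma resolv_tendsto:
  fixes A :: "'b \<Rightarrow> 'h::separable_complex_hilbert \<Rightarrow>\<^sub>L 'h" and A0 :: "'h \<Rightarrow>\<^sub>L 'h"
  assumes fd: "finite_dimensional TYPE('h)" and dis: "\<forall>\<^sub>F w in F. dissipative (A w)"
    and f: "(f \<longlongrightarrow> A0 v + \<i> *\<^sub>C v) F" and A: "(A \<longlongrightarrow> A0) F"
  shows "((\<lambda>w. resolv (A w) (f w)) \<longlongrightarrow> v) F"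
proof (rule LIM_zero_cancel, rule Lim_null_comparison)
  have "((\<lambda>w. norm (f w - (A w v + \<i> *\<^sub>C v))) \<longlongrightarrow> norm (A0 v + \<i> *\<^sub>C v - (A0 v + \<i> *\<^sub>C v))) F"
    by (intro tendsto_norm tendsto_diff f tendsto_add blinfun.tendsto A tendsto_const)
  then show "((\<lambda>w. norm (f w - (A w v + \<i> *\<^sub>C v))) \<longlongrightarrow> 0) F" by simp
  show "\<forall>\<^sub>F w in F. norm (resolv (A w) (f w) - v) \<le> norm (f w - (A w v + \<i> *\<^sub>C v))"
    using dis
  proof eventually_elim
    case (elim w)
    have "resolv (A w) (f w) - v = resolv (A w) (f w - (A w v + \<i> *\<^sub>C v))"
      using resolv_eqI[OF fd elim refl, of v] by (simp add: resolv_diff[OF fd elim])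
    then show ?case using norm_resolv_le[OF fd elim] by simp
  qed
qed

text \<open>The difference quotient is again a resolvent, applied to the difference quotient of
  \<open>f\<close> minus that of \<open>F\<close> at the vector \<open>a\<close>, so
  \<open>resolv_tendsto\<close> yields its limit.\<close>

lemma vholomorphic_resolv:
  fixes F :: "complex \<Rightarrow> 'h::separable_complex_hilbert \<Rightarrow>\<^sub>L 'h"
  assumes fd: "finite_dimensional TYPE('h)" and dis: "\<And>z. z \<in> S \<Longrightarrow> dissipative (F z)"
    and F: "vholomorphic_on F S" and f: "vholomorphic_on f S"
  shows "vholomorphic_on (\<lambda>z. resolv (F z) (f z)) S"
  unfolding vholomorphic_on_def
proof
  fix z assume z: "z \<in> S"
  obtain D1 where D1: "((\<lambda>w. (1 / (w - z)) *\<^sub>C (F w - F z)) \<longlongrightarrow> D1) (at z within S)"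
    using F z unfolding vholomorphic_on_def by blast
  obtain D2 where D2: "((\<lambda>w. (1 / (w - z)) *\<^sub>C (f w - f z)) \<longlongrightarrow> D2) (at z within S)"
    using f z unfolding vholomorphic_on_def by blast
  define a where "a = resolv (F z) (f z)"
  define v where "v = resolv (F z) (D2 - D1 a)"
  have ev: "\<forall>\<^sub>F w in at z within S. w \<in> S \<and> w \<noteq> z"
    by (auto simp: eventually_at_filter)
  have "((\<lambda>w. resolv (F w) ((1 / (w - z)) *\<^sub>C (f w - f z) - ((1 / (w - z)) *\<^sub>C (F w - F z)) a)) \<longlongrightarrow> v) (at z within S)"
  proof (rule resolv_tendsto[OF fd])
    show "\<forall>\<^sub>F w in at z within S. dissipative (F w)"
      using ev by eventually_elim (use dis in auto)
    show "(F \<longlongrightarrow> F z) (at z within S)"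
      using vholomorphic_continuous_on[OF F] z by (simp add: continuous_on_def)
    have "F z v + \<i> *\<^sub>C v = D2 - D1 a" unfolding v_def by (rule resolv_apply[OF fd dis[OF z]])
    then show "((\<lambda>w. (1 / (w - z)) *\<^sub>C (f w - f z) - ((1 / (w - z)) *\<^sub>C (F w - F z)) a) \<longlongrightarrow> F z v + \<i> *\<^sub>C v) (at z within S)"
      by (auto intro!: tendsto_diff D2 blinfun.tendsto D1 tendsto_const)
  qed
  moreover have "\<forall>\<^sub>F w in at z within S.
      resolv (F w) ((1 / (w - z)) *\<^sub>C (f w - f z) - ((1 / (w - z)) *\<^sub>C (F w - F z)) a)
      = (1 / (w - z)) *\<^sub>C (resolv (F w) (f w) - resolv (F z) (f z))"
    using ev
  proof eventually_elim
    case (elim w)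
    then have d: "dissipative (F w)" using dis by simp
    have fz: "f z = F z a + \<i> *\<^sub>C a" unfolding a_def by (simp add: fd dis z)
    have "resolv (F w) (f w) - a = resolv (F w) (f w - (F w a + \<i> *\<^sub>C a))"
      using resolv_eqI[OF fd d refl, of a] by (simp add: resolv_diff[OF fd d])
    also have "f w - (F w a + \<i> *\<^sub>C a) = (f w - f z) - (F w - F z) a"
      unfolding fz by (simp add: blinfun.diff_left)
    finally have *: "resolv (F w) (f w) - a = resolv (F w) ((f w - f z) - (F w - F z) a)" .
    have "((1 / (w - z)) *\<^sub>C (F w - F z)) a = (1 / (w - z)) *\<^sub>C ((F w - F z) a)"
      by (simp add: scaleC_blinfun.rep_eq)
    then have "(1 / (w - z)) *\<^sub>C (f w - f z) - ((1 / (w - z)) *\<^sub>C (F w - F z)) a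
        = (1 / (w - z)) *\<^sub>C ((f w - f z) - (F w - F z) a)"
      by (simp add: scaleC_diff_right)
    then show ?case unfolding a_def[symmetric] * by (simp add: resolv_scaleC[OF fd d])
  qed
  ultimately have "((\<lambda>w. (1 / (w - z)) *\<^sub>C (resolv (F w) (f w) - resolv (F z) (f z))) \<longlongrightarrow> v) (at z within S)"
    by (rule Lim_transform_eventually)
  then show "\<exists>D. ((\<lambda>w. (1 / (w - z)) *\<^sub>C (resolv (F w) (f w) - resolv (F z) (f z))) \<longlongrightarrow> D) (at z within S)"
    by (rule exI)
qed

subsection \<open>The unitary group generated by a self-adjoint operator\<close>

lemma op_pow_apply:
  fixes A :: "'a::real_normed_vector \<Rightarrow>\<^sub>L 'a"
  shows "blinfun_apply (((\<lambda>B. A o\<^sub>L B) ^^ n) id_blinfun) v = (blinfun_apply A ^^ n) v"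
  by (induction n) simp_all

lemma norm_op_pow_le:
  fixes A :: "'a::real_normed_vector \<Rightarrow>\<^sub>L 'a"
  shows "norm ((blinfun_apply A ^^ n) v) \<le> norm A ^ n * norm v"
proof (induction n)
  case (Suc n)
  have "norm ((blinfun_apply A ^^ Suc n) v) \<le> norm A * norm ((blinfun_apply A ^^ n) v)"
    by (simp add: norm_blinfun)
  also have "\<dots> \<le> norm A * (norm A ^ n * norm v)"
    using Suc by (rule mult_left_mono) simp
  finally show ?case by (simp add: mult.assoc)
qed simp

lemma op_exp_sums: "(\<lambda>n. (1 / fact n) *\<^sub>R (blinfun_apply A ^^ n) v) sums op_exp A v"
proof -
  let ?P = "\<lambda>n. ((\<lambda>B. A o\<^sub>L B) ^^ n) id_blinfun"
  have "norm (?P n) \<le> norm A ^ n" for n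
    by (rule norm_blinfun_bound) (auto simp: op_pow_apply norm_op_pow_le)
  then have "norm ((1 / fact n) *\<^sub>R ?P n) \<le> inverse (fact n) * norm A ^ n" for n
    by (simp add: divide_inverse mult.commute[of _ "inverse (fact n)"] mult_left_mono)
  then have "summable (\<lambda>n. (1 / fact n) *\<^sub>R ?P n)"
    by (intro summable_comparison_test'[OF summable_exp])
  then have "(\<lambda>n. (1 / fact n) *\<^sub>R ?P n) sums op_exp A"
    unfolding op_exp_def by (rule summable_sums)
  from bounded_linear.sums[OF blinfun.bounded_linear_left this, of v]
  show ?thesis by (simp add: blinfun.scaleR_left op_pow_apply)
qed

context
  fixes B :: "'h::separable_complex_hilbert \<Rightarrow>\<^sub>L 'h"
  assumes fd: "finite_dimensional TYPE('h)" and B: "selfadjoint_op B"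
begin

lemma op_pow_scaleC:
  "(blinfun_apply (a *\<^sub>C B) ^^ n) v = a ^ n *\<^sub>C (blinfun_apply B ^^ n) v"
  by (induction n)
    (use B in \<open>auto simp: scaleC_blinfun.rep_eq selfadjoint_op_def complex_linear_def scaleC_scaleC\<close>)

definition op_flow :: "'h \<Rightarrow> real \<Rightarrow> 'h"
  where "op_flow v t = op_exp ((\<i> * of_real t) *\<^sub>C B) v"

lemma op_flow_sums:
  "(\<lambda>n. (\<i> ^ n / fact n * of_real t ^ n) *\<^sub>C (blinfun_apply B ^^ n) v) sums op_flow v t"
proof -
  have "(1 / fact n) *\<^sub>R (blinfun_apply ((\<i> * of_real t) *\<^sub>C B) ^^ n) v
      = (\<i> ^ n / fact n * of_real t ^ n) *\<^sub>C (blinfun_apply B ^^ n) v" for n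
    unfolding op_pow_scaleC scaleC_of_real[symmetric] scaleC_scaleC
    by (simp add: power_mult_distrib)
  then show ?thesis using op_exp_sums[of "(\<i> * of_real t) *\<^sub>C B" v] by (simp add: op_flow_def)
qed

lemma op_flow_0: "op_flow v 0 = v"
proof -
  have "(\<lambda>n. (\<i> ^ n / fact n * of_real 0 ^ n) *\<^sub>C (blinfun_apply B ^^ n) v)
      = (\<lambda>n. if n = 0 then v else 0)"
    by (auto simp: fun_eq_iff)
  with op_flow_sums[of 0 v] have "(\<lambda>n. if n = 0 then v else 0) sums op_flow v 0" by simp
  then show ?thesis using sums_single[of 0 "\<lambda>_. v"] by (rule sums_unique2)
qed

lemma op_flow_commute: "B (op_flow v t) = op_flow (B v) t"
proof -
  have "(\<lambda>n. B ((\<i> ^ n / fact n * of_real t ^ n) *\<^sub>C (blinfun_apply B ^^ n) v)) sums B (op_flow v t)"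
    by (rule bounded_linear.sums[OF blinfun.bounded_linear_right op_flow_sums])
  moreover have "B ((\<i> ^ n / fact n * of_real t ^ n) *\<^sub>C (blinfun_apply B ^^ n) v)
      = (\<i> ^ n / fact n * of_real t ^ n) *\<^sub>C (blinfun_apply B ^^ n) (B v)" for n
    using B by (simp add: selfadjoint_op_def complex_linear_def funpow_swap1)
  ultimately show ?thesis using op_flow_sums[of t "B v"] sums_unique2 by auto
qed

text \<open>Paired with \<open>e\<close>, the exponential is a scalar power series in
  \<open>t\<close> and can be differentiated termwise; the vector statement is assembled from this
  over an orthonormal basis.\<close>

lemma cinner_op_flow_derivative:
  "((\<lambda>t. cinner e (op_flow v t)) has_vector_derivative \<i> * cinner e (op_flow (B v) t)) (at t)"
proof -
  define c where "c u n = \<i> ^ n / fact n * cinner e ((blinfun_apply B ^^ n) u)" for u n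
  have sums: "(\<lambda>n. c u n * of_real s ^ n) sums cinner e (op_flow u s)" for u s
    using bounded_linear.sums[OF bounded_bilinear.bounded_linear_right[OF bounded_bilinear_cinner]
        op_flow_sums[of s u], of e] by (simp add: c_def cinner_scaleC_right mult_ac)
  have summ: "summable (\<lambda>n. c v n * z ^ n)" for z
  proof (rule summable_comparison_test')
    show "summable (\<lambda>n. norm e * norm v * (inverse (fact n) * (norm B * cmod z) ^ n))"
      by (intro summable_mult summable_exp)
    fix n
    have "cmod (cinner e ((blinfun_apply B ^^ n) v)) \<le> norm e * (norm B ^ n * norm v)"
      by (rule order_trans[OF norm_cinner_le mult_left_mono[OF norm_op_pow_le]]) simp
    then have "cmod (cinner e ((blinfun_apply B ^^ n) v)) * (inverse (fact n) * cmod z ^ n)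
        \<le> norm e * (norm B ^ n * norm v) * (inverse (fact n) * cmod z ^ n)"
      by (rule mult_right_mono) simp
    then show "norm (c v n * z ^ n) \<le> norm e * norm v * (inverse (fact n) * (norm B * cmod z) ^ n)"
      by (simp add: c_def norm_mult norm_power norm_divide norm_inverse power_mult_distrib divide_inverse mult_ac)
  qed
  \<comment> \<open>Differentiation shifts the exponential series by one index, which amounts to a
    factor \<open>\<i>\<close> and the replacement of \<open>v\<close> by
    \<open>B v\<close>.\<close>
  have diffs: "diffs (c v) n = \<i> * c (B v) n" for n
    by (simp add: diffs_def c_def funpow_swap1 field_simps del: of_nat_Suc)
  have "((\<lambda>z. \<Sum>n. c v n * z ^ n) has_field_derivative (\<Sum>n. diffs (c v) n * of_real t ^ n)) (at (of_real t))"
    by (rule termdiffs_strong_converges_everywhere[OF summ])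
  also have "(\<Sum>n. diffs (c v) n * of_real t ^ n) = \<i> * cinner e (op_flow (B v) t)"
    unfolding diffs mult.assoc using sums_mult[OF sums[of "B v" t], of \<i>] by (simp add: sums_iff)
  finally have "((\<lambda>t. \<Sum>n. c v n * of_real t ^ n) has_vector_derivative \<i> * cinner e (op_flow (B v) t)) (at t)"
    by (rule has_vector_derivative_real_field)
  moreover have "(\<Sum>n. c v n * of_real s ^ n) = cinner e (op_flow v s)" for s
    using sums by (simp add: sums_iff)
  ultimately show ?thesis by simp
qed

lemma op_flow_derivative:
  "(op_flow v has_vector_derivative \<i> *\<^sub>C op_flow (B v) t) (at t)"
proof -
  obtain E :: "'h set" where E0: "finite E" "orthonormal E" "complex_vector.span E = UNIV"
    and E: "\<And>x. x = (\<Sum>e\<in>E. cinner e x *\<^sub>C e)"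
    by (rule finite_dimensional_orthonormal[OF fd], rule that)
  have "((\<lambda>t. \<Sum>e\<in>E. cinner e (op_flow v t) *\<^sub>C e) has_vector_derivative
      (\<Sum>e\<in>E. (\<i> * cinner e (op_flow (B v) t)) *\<^sub>C e)) (at t)"
    by (intro has_vector_derivative_sum bounded_linear.has_vector_derivative[OF
        bounded_bilinear.bounded_linear_left[OF bounded_bilinear_scaleC]] cinner_op_flow_derivative)
  also have "(\<lambda>t. \<Sum>e\<in>E. cinner e (op_flow v t) *\<^sub>C e) = op_flow v"
    by (simp only: E[symmetric])
  also have "(\<Sum>e\<in>E. (\<i> * cinner e (op_flow (B v) t)) *\<^sub>C e) = \<i> *\<^sub>C op_flow (B v) t"
    unfolding scaleC_scaleC[symmetric] scaleC_sum_right[symmetric]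
    by (simp only: E[symmetric])
  finally show ?thesis .
qed

lemma selfadjoint_cinner_real: "Im (cinner x (B x)) = 0"
proof -
  have "cinner x (B x) = cnj (cinner x (B x))"
    using B cinner_commute[of "B x" x] by (simp add: selfadjoint_op_def is_adjoint_def)
  from arg_cong[OF this, of Im] show ?thesis by simp
qed

text \<open>The derivative of the squared norm is twice the real part of \<open>i\<close> times a
  real number, by self-adjointness.\<close>

lemma norm_op_flow: "norm (op_flow v t) = norm v"
proof -
  have "((\<lambda>t. inner (op_flow v t) (op_flow v t)) has_vector_derivative 0) (at t)" for t
  proof -
    have "((\<lambda>t. inner (op_flow v t) (op_flow v t)) has_vector_derivative
        inner (op_flow v t) (\<i> *\<^sub>C op_flow (B v) t) + inner (\<i> *\<^sub>C op_flow (B v) t) (op_flow v t)) (at t)"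
      by (rule bounded_bilinear.has_vector_derivative[OF bounded_bilinear_inner
            op_flow_derivative op_flow_derivative])
    moreover have "inner (op_flow v t) (\<i> *\<^sub>C op_flow (B v) t) = 0"
      using selfadjoint_cinner_real[of "op_flow v t"]
      by (simp add: inner_eq_Re_cinner cinner_scaleC_right op_flow_commute)
    ultimately show ?thesis by (simp add: inner_commute)
  qed
  then obtain c where "\<And>t. inner (op_flow v t) (op_flow v t) = c"
    using has_vector_derivative_zero_constant[of UNIV "\<lambda>t. inner (op_flow v t) (op_flow v t)"] by auto
  then have "inner (op_flow v t) (op_flow v t) = inner (op_flow v 0) (op_flow v 0)" by simp
  then show ?thesis by (simp add: op_flow_0 norm_eq_sqrt_inner)
qed

text \<open>The mean value inequality, as the flow has speed \<open>norm (B v)\<close> at all times.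
  It dominates the difference quotients of the group.\<close>

lemma op_flow_diff_bound: "norm (op_flow v t - v) \<le> \<bar>t\<bar> * norm (B v)"
proof -
  have "norm (op_flow v t - op_flow v 0) \<le> norm (B v) * norm (t - 0)"
  proof (rule differentiable_bound[of UNIV])
    show "(op_flow v has_derivative (\<lambda>h. h *\<^sub>R (\<i> *\<^sub>C op_flow (B v) x))) (at x within UNIV)" for x
      using op_flow_derivative[of v x] by (simp add: has_vector_derivative_def)
    show "onorm (\<lambda>h::real. h *\<^sub>R (\<i> *\<^sub>C op_flow (B v) x)) \<le> norm (B v)" for x
      by (rule onorm_le) (simp add: norm_scaleC norm_op_flow mult.commute)
  qed auto
  then show ?thesis by (simp add: op_flow_0 mult.commute)
qed

lemma op_flow_quotient: "((\<lambda>h. (1 / h) *\<^sub>R (op_flow v h - v)) \<longlongrightarrow> \<i> *\<^sub>C B v) (at 0)"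
proof -
  have "(op_flow v has_vector_derivative \<i> *\<^sub>C B v) (at 0)"
    using op_flow_derivative[of v 0] by (simp add: op_flow_0)
  then have "((\<lambda>h. norm (op_flow v h - v - h *\<^sub>R (\<i> *\<^sub>C B v)) / norm h) \<longlongrightarrow> 0) (at 0)"
    unfolding has_vector_derivative_def has_derivative_at by (simp add: op_flow_0)
  moreover have "norm (op_flow v h - v - h *\<^sub>R (\<i> *\<^sub>C B v)) / norm h
      = norm ((1 / h) *\<^sub>R (op_flow v h - v) - \<i> *\<^sub>C B v)" if "h \<noteq> 0" for h
  proof -
    have "(1 / h) *\<^sub>R (op_flow v h - v) - \<i> *\<^sub>C B v
        = (1 / h) *\<^sub>R (op_flow v h - v - h *\<^sub>R (\<i> *\<^sub>C B v))"
      using that by (simp add: scaleR_diff_right)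
    then show ?thesis by (simp add: divide_inverse mult.commute)
  qed
  then have "\<forall>\<^sub>F h in at 0. norm (op_flow v h - v - h *\<^sub>R (\<i> *\<^sub>C B v)) / norm h
      = norm ((1 / h) *\<^sub>R (op_flow v h - v) - \<i> *\<^sub>C B v)"
    by (simp add: eventually_at_filter)
  ultimately have "((\<lambda>h. norm ((1 / h) *\<^sub>R (op_flow v h - v) - \<i> *\<^sub>C B v)) \<longlongrightarrow> 0) (at 0)"
    by (rule Lim_transform_eventually)
  then show ?thesis by (rule LIM_zero_cancel[OF tendsto_norm_zero_cancel])
qed

end


subsection \<open>Measurability of the boundary values\<close>

text \<open>Expand \<open>u x\<close> in an orthonormal basis. The maps \<open>T x\<close> are only
  real-linear, so each complex coefficient is split into real and imaginary part.\<close>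

lemma borel_measurable_blinfun_apply:
  fixes T :: "'b \<Rightarrow> 'h::separable_complex_hilbert \<Rightarrow>\<^sub>L 'h"
  assumes fd: "finite_dimensional TYPE('h)" and T: "\<And>v. (\<lambda>x. T x v) \<in> borel_measurable M"
    and u: "u \<in> borel_measurable M"
  shows "(\<lambda>x. T x (u x)) \<in> borel_measurable M"
proof -
  obtain E :: "'h set" where E0: "finite E" "orthonormal E" "complex_vector.span E = UNIV"
    and E: "\<And>x. x = (\<Sum>e\<in>E. cinner e x *\<^sub>C e)"
    by (rule finite_dimensional_orthonormal[OF fd], rule that)
  have c: "(\<lambda>x. cinner e (u x)) \<in> borel_measurable M" for e
    by (intro borel_measurable_cinner u) simp
  have cR: "(\<lambda>x. Re (cinner e (u x))) \<in> borel_measurable M" "(\<lambda>x. Im (cinner e (u x))) \<in> borel_measurable M" for e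
    using c[of e] by measurable
  have dec: "c *\<^sub>C e = Re c *\<^sub>R e + Im c *\<^sub>R (\<i> *\<^sub>C e)" for c :: complex and e :: 'h
  proof -
    have "c *\<^sub>C e = (of_real (Re c) + of_real (Im c) * \<i>) *\<^sub>C e"
      by (simp add: complex_eq[of c, symmetric] mult.commute)
    then show ?thesis by (simp only: scaleC_add_left scaleC_scaleC[symmetric] scaleC_of_real)
  qed
  have "T x (cinner e (u x) *\<^sub>C e)
      = Re (cinner e (u x)) *\<^sub>R T x e + Im (cinner e (u x)) *\<^sub>R T x (\<i> *\<^sub>C e)" for x e
    by (subst dec[of "cinner e (u x)" e]) (simp only: blinfun.add_right blinfun.scaleR_right)
  then have "T x (u x) = (\<Sum>e\<in>E. Re (cinner e (u x)) *\<^sub>R T x e + Im (cinner e (u x)) *\<^sub>R T x (\<i> *\<^sub>C e))" for x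
    by (subst E[of "u x"]) (simp add: blinfun.sum_right)
  moreover have "(\<lambda>x. \<Sum>e\<in>E. Re (cinner e (u x)) *\<^sub>R T x e + Im (cinner e (u x)) *\<^sub>R T x (\<i> *\<^sub>C e))
      \<in> borel_measurable M"
    by (intro borel_measurable_sum borel_measurable_add borel_measurable_scaleR T cR)
  ultimately show ?thesis by simp
qed

lemma borel_measurable_op_exp:
  fixes T :: "'b \<Rightarrow> 'h::separable_complex_hilbert \<Rightarrow>\<^sub>L 'h"
  assumes fd: "finite_dimensional TYPE('h)" and T: "\<And>v. (\<lambda>x. T x v) \<in> borel_measurable M"
  shows "(\<lambda>x. op_exp (a *\<^sub>C T x) v) \<in> borel_measurable M"
proof (rule borel_measurable_LIMSEQ_metric)
  have aT: "(\<lambda>x. (a *\<^sub>C T x) v) \<in> borel_measurable M" for v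
    unfolding scaleC_blinfun.rep_eq by (intro borel_measurable_scaleC T)
  have "(\<lambda>x. (blinfun_apply (a *\<^sub>C T x) ^^ n) v) \<in> borel_measurable M" for n
  proof (induction n)
    case (Suc n)
    then show ?case using borel_measurable_blinfun_apply[OF fd aT Suc] by simp
  qed simp
  then show "(\<lambda>x. \<Sum>n<N. (1 / fact n) *\<^sub>R (blinfun_apply (a *\<^sub>C T x) ^^ n) v) \<in> borel_measurable M" for N
    by (intro borel_measurable_sum borel_measurable_scaleR) auto
  show "(\<lambda>N. \<Sum>n<N. (1 / fact n) *\<^sub>R (blinfun_apply (a *\<^sub>C T x) ^^ n) v) \<longlonglongrightarrow> op_exp (a *\<^sub>C T x) v" for x
    using op_exp_sums[of "a *\<^sub>C T x" v] by (simp add: sums_def)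
qed

text \<open>A Cauchy criterion over rational heights involves only countably many conditions;
  continuity carries it over to real heights. It serves to show that the set of convergence is
  measurable.\<close>

lemma line_limit_exists:
  fixes f :: "real \<Rightarrow> 'a::banach"
  assumes c: "continuous_on {0<..} f"
    and C: "\<And>n::nat. \<exists>m::nat. \<forall>p q::rat. 0 < p \<and> p < 1 / of_nat (Suc m) \<and> 0 < q \<and> q < 1 / of_nat (Suc m)
      \<longrightarrow> norm (f (of_rat p) - f (of_rat q)) \<le> 1 / real (Suc n)"
  shows "\<exists>l. (f \<longlongrightarrow> l) (at_right 0)"
proof -
  have dense: "norm (f p - f q) \<le> c" if s: "0 < p" "p < s" "0 < q" "q < s"
      and le: "\<And>p q::rat. 0 < p \<Longrightarrow> of_rat p < s \<Longrightarrow> 0 < q \<Longrightarrow> of_rat q < s \<Longrightarrow> norm (f (of_rat p) - f (of_rat q)) \<le> c"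
    for p q s c
  proof -
    have app: "\<exists>r::nat \<Rightarrow> rat. (\<forall>n. 0 < r n \<and> of_rat (r n) < s) \<and> (\<lambda>n. of_rat (r n) :: real) \<longlonglongrightarrow> p"
      if p: "0 < p" "p < s" for p
    proof -
      have "\<exists>r::rat. max 0 (p - 1 / Suc n) < of_rat r \<and> of_rat r < p" for n :: nat
        using p by (intro of_rat_dense) auto
      then obtain r :: "nat \<Rightarrow> rat" where r: "\<And>n. max 0 (p - 1 / Suc n) < of_rat (r n)" "\<And>n. of_rat (r n) < p"
        by metis
      have "(\<lambda>n. of_rat (r n)) \<longlonglongrightarrow> p"
      proof (rule tendsto_sandwich[of "\<lambda>n. p - 1 / Suc n" _ _ "\<lambda>_. p"])
        have "(\<lambda>n. p - 1 / Suc n) \<longlonglongrightarrow> p - 0"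
          by (intro tendsto_diff tendsto_const LIMSEQ_Suc[OF lim_1_over_n])
        then show "(\<lambda>n. p - 1 / Suc n) \<longlonglongrightarrow> p" by simp
        show "\<forall>\<^sub>F n in sequentially. p - 1 / real (Suc n) \<le> of_rat (r n)"
          using r(1) by (auto intro!: eventuallyI less_imp_le)
        show "\<forall>\<^sub>F n in sequentially. of_rat (r n) \<le> p"
          using r(2) by (auto intro!: eventuallyI less_imp_le)
      qed simp
      moreover have "0 < r n \<and> of_rat (r n) < s" for n
      proof -
        have "0 < (of_rat (r n) :: real)" using r(1)[of n] by simp
        then have "0 < r n" by (simp only: zero_less_of_rat_iff)
        then show ?thesis using r(2)[of n] p by simp
      qed
      ultimately show ?thesis by blast
    qed
    obtain r1 :: "nat \<Rightarrow> rat" where r1: "\<And>n. 0 < r1 n \<and> of_rat (r1 n) < s" "(\<lambda>n. of_rat (r1 n) :: real) \<longlonglongrightarrow> p"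
      using app[of p] s by blast
    obtain r2 :: "nat \<Rightarrow> rat" where r2: "\<And>n. 0 < r2 n \<and> of_rat (r2 n) < s" "(\<lambda>n. of_rat (r2 n) :: real) \<longlonglongrightarrow> q"
      using app[of q] s by blast
    have cont: "isCont f p" "isCont f q"
      using c s by (auto simp: continuous_on_eq_continuous_at)
    have "(\<lambda>n. norm (f (of_rat (r1 n)) - f (of_rat (r2 n)))) \<longlonglongrightarrow> norm (f p - f q)"
      by (intro tendsto_norm tendsto_diff isCont_tendsto_compose[OF cont(1) r1(2)]
          isCont_tendsto_compose[OF cont(2) r2(2)])
    then show ?thesis
      by (rule LIMSEQ_le_const2) (use le r1(1) r2(1) in blast)
  qed
  have Cr: "\<exists>m::nat. \<forall>p q. 0 < p \<and> p < 1 / Suc m \<and> 0 < q \<and> q < 1 / Suc m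
      \<longrightarrow> norm (f p - f q) \<le> 1 / real (Suc n)" for n
  proof -
    obtain m :: nat where m: "\<forall>p q::rat. 0 < p \<and> p < 1 / of_nat (Suc m) \<and> 0 < q \<and> q < 1 / of_nat (Suc m)
      \<longrightarrow> norm (f (of_rat p) - f (of_rat q)) \<le> 1 / real (Suc n)"
      using C[of n] by blast
    have conv: "p < 1 / of_nat (Suc m)" if "of_rat p < 1 / real (Suc m)" for p :: rat
    proof -
      have "of_rat (1 / of_nat (Suc m)) = 1 / real (Suc m)"
        by (simp only: of_rat_divide of_rat_1 of_rat_of_nat_eq)
      then show ?thesis using that by (metis of_rat_less)
    qed
    have "norm (f p - f q) \<le> 1 / real (Suc n)" if "0 < p \<and> p < 1 / Suc m \<and> 0 < q \<and> q < 1 / Suc m" for p q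
      by (rule dense[of p "1 / Suc m" q]) (use that m conv in auto)
    then show ?thesis by blast
  qed
  define s where "s k = f (1 / Suc k)" for k
  have "Cauchy s"
  proof (rule CauchyI)
    fix e :: real assume "0 < e"
    then obtain n where n: "1 / real (Suc n) < e" using nat_approx_posE by blast
    obtain m where m: "\<And>p q. 0 < p \<and> p < 1 / Suc m \<and> 0 < q \<and> q < 1 / Suc m \<Longrightarrow> norm (f p - f q) \<le> 1 / real (Suc n)"
      using Cr[of n] by blast
    have "norm (s i - s j) < e" if "i \<ge> Suc m" "j \<ge> Suc m" for i j
      unfolding s_def using that n by (intro order_le_less_trans[OF m n]) (auto simp: field_simps)
    then show "\<exists>M. \<forall>i\<ge>M. \<forall>j\<ge>M. norm (s i - s j) < e" by blast
  qed
  then obtain l where l: "s \<longlonglongrightarrow> l" using Cauchy_convergent_iff convergent_def by blast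
  have "(f \<longlongrightarrow> l) (at_right 0)"
    unfolding tendsto_iff
  proof (intro allI impI)
    fix e :: real assume "0 < e"
    then obtain n where n: "1 / real (Suc n) < e" using nat_approx_posE by blast
    obtain m where m: "\<And>p q. 0 < p \<and> p < 1 / Suc m \<and> 0 < q \<and> q < 1 / Suc m \<Longrightarrow> norm (f p - f q) \<le> 1 / real (Suc n)"
      using Cr[of n] by blast
    have "norm (f p - l) \<le> 1 / real (Suc n)" if p: "0 < p" "p < 1 / Suc m" for p
    proof (rule LIMSEQ_le_const2[OF tendsto_norm[OF tendsto_diff[OF tendsto_const l]]])
      show "\<exists>N. \<forall>k\<ge>N. norm (f p - s k) \<le> 1 / real (Suc n)"
        unfolding s_def using p by (intro exI[of _ "Suc m"] allI impI m) (auto simp: field_simps)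
    qed
    moreover have "\<forall>\<^sub>F p in at_right 0. 0 < p \<and> p < 1 / Suc m"
      by (auto simp: eventually_at_right_field intro!: exI[of _ "1 / Suc m"])
    ultimately show "\<forall>\<^sub>F p in at_right 0. dist (f p) l < e"
      by (auto simp: dist_norm elim!: eventually_mono intro: order_le_less_trans[OF _ n])
  qed
  then show ?thesis by blast
qed

text \<open>The set \<open>L\<close> of convergence is Borel by the countable criterion. On
  \<open>L\<close> the boundary value is a limit of continuous functions, and off \<open>L\<close>
  it is constant.\<close>

lemma borel_measurable_boundary_value:
  fixes F :: "complex \<Rightarrow> 'h::separable_complex_hilbert \<Rightarrow>\<^sub>L 'h"
  assumes F: "vholomorphic_on F upper_half_plane"
  shows "(\<lambda>x. boundary_value F x v) \<in> borel_measurable borel"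
proof -
  define L where "L = {x. \<exists>l. ((\<lambda>e. F (Complex x e)) \<longlongrightarrow> l) (at_right 0)}"
  define P where "P n m p q x \<longleftrightarrow> (0 < p \<and> p < 1 / of_nat (Suc m) \<and> 0 < q \<and> q < 1 / of_nat (Suc m)
      \<longrightarrow> norm (F (Complex x (of_rat p)) - F (Complex x (of_rat q))) \<le> 1 / real (Suc n))"
    for n m :: nat and p q :: rat and x :: real
  have L: "L = {x. \<forall>n. \<exists>m. \<forall>p q. P n m p q x}"
  proof (intro equalityI subsetI; simp)
    fix x assume "\<forall>n. \<exists>m. \<forall>p q. P n m p q x"
    moreover have "continuous_on {0<..} (\<lambda>e. F (Complex x e))"
      by (rule continuous_on_compose2[OF vholomorphic_continuous_on[OF F]])
        (auto intro!: continuous_intros simp: Complex_eq)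
    ultimately show "x \<in> L" unfolding P_def L_def mem_Collect_eq by (intro line_limit_exists) auto
  next
    fix x assume "x \<in> L"
    then obtain l where l: "((\<lambda>e. F (Complex x e)) \<longlongrightarrow> l) (at_right 0)" by (auto simp: L_def)
    show "\<forall>n. \<exists>m. \<forall>p q. P n m p q x"
    proof
      fix n
      have "\<forall>\<^sub>F e in at_right 0. dist (F (Complex x e)) l < 1 / real (Suc n) / 2"
        using tendstoD[OF l, of "1 / real (Suc n) / 2"] by simp
      then obtain b where b: "b > 0" "\<And>e. 0 < e \<Longrightarrow> e < b \<Longrightarrow> dist (F (Complex x e)) l < 1 / real (Suc n) / 2"
        by (auto simp: eventually_at_right_field)
      obtain m where m: "1 / real (Suc m) < b" using nat_approx_posE[OF b(1)] by blast
      have "P n m p q x" for p q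
        unfolding P_def
      proof (intro impI)
        assume pq: "0 < p \<and> p < 1 / of_nat (Suc m) \<and> 0 < q \<and> q < 1 / of_nat (Suc m)"
        have conv: "of_rat r < b" if "r < 1 / of_nat (Suc m)" for r :: rat
        proof -
          have "of_rat r < (of_rat (1 / of_nat (Suc m)) :: real)" using that by (simp only: of_rat_less)
          also have "\<dots> = 1 / real (Suc m)"
            by (simp only: of_rat_divide of_rat_1 of_rat_of_nat_eq)
          finally show ?thesis using m by simp
        qed
        have "dist (F (Complex x (of_rat p))) (F (Complex x (of_rat q))) < 1 / real (Suc n)"
          by (rule dist_triangle_half_l[of _ l]; rule b(2)) (use pq conv in auto)
        then show "norm (F (Complex x (of_rat p)) - F (Complex x (of_rat q))) \<le> 1 / real (Suc n)"
          by (simp add: dist_norm)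
      qed
      then show "\<exists>m. \<forall>p q. P n m p q x" by blast
    qed
  qed
  have Pm: "{x \<in> space borel. P n m p q x} \<in> sets borel" for n m p q
  proof (cases "0 < p \<and> p < 1 / of_nat (Suc m) \<and> 0 < q \<and> q < 1 / of_nat (Suc m)")
    case True
    have "continuous_on UNIV (\<lambda>x. norm (F (Complex x (of_rat p)) - F (Complex x (of_rat q))))"
      using True by (intro continuous_on_norm continuous_on_diff vholomorphic_line_continuous[OF F]) auto
    then have "closed {x. norm (F (Complex x (of_rat p)) - F (Complex x (of_rat q))) \<le> 1 / real (Suc n)}"
      by (intro closed_Collect_le) auto
    then show ?thesis using True by (simp add: P_def)
  next
    case False
    then have "P n m p q x" for x unfolding P_def by blast
    then show ?thesis by simp
  qed
  have "{x \<in> space borel. \<forall>n. \<exists>m. \<forall>p q. P n m p q x} \<in> sets borel"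
    by (intro sets.sets_Collect_countable_All sets.sets_Collect_countable_Ex Pm)
  then have Lm: "L \<in> sets borel" unfolding L by simp
  \<comment> \<open>Off \<open>L\<close> the description behind \<open>Lim\<close> has no witness,
    so it denotes the same unspecified operator at all these points.\<close>
  define c0 :: "'h \<Rightarrow>\<^sub>L 'h" where "c0 = (THE l. False)"
  have "boundary_value F x v
      = (if x \<in> L then lim (\<lambda>n. F (Complex x (1 / real (Suc n))) v) else c0 v)" for x
  proof (cases "x \<in> L")
    case True
    then obtain l where l: "((\<lambda>e. F (Complex x e)) \<longlongrightarrow> l) (at_right 0)" by (auto simp: L_def)
    have "filterlim (\<lambda>n. 1 / real (Suc n)) (at_right 0) sequentially"
      unfolding filterlim_at using LIMSEQ_Suc[OF lim_1_over_n]
      by (auto intro!: eventuallyI)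
    from filterlim_compose[OF l this] have "(\<lambda>n. F (Complex x (1 / real (Suc n))) v) \<longlonglongrightarrow> l v"
      by (intro blinfun.tendsto tendsto_const)
    then have "lim (\<lambda>n. F (Complex x (1 / real (Suc n))) v) = l v" by (rule limI)
    moreover have "boundary_value F x = l"
      unfolding boundary_value_def by (rule tendsto_Lim[OF _ l]) simp
    ultimately show ?thesis using True by simp
  next
    case False
    then have "boundary_value F x = c0"
      by (simp add: boundary_value_def Topological_Spaces.Lim_def c0_def L_def)
    then show ?thesis using False by simp
  qed
  moreover have "(\<lambda>x. if x \<in> L then lim (\<lambda>n. F (Complex x (1 / real (Suc n))) v) else c0 v) \<in> borel_measurable borel"
  proof (rule measurable_If_set)
    have "continuous_on UNIV (\<lambda>x. F (Complex x (1 / real (Suc n))) v)" for n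
      by (intro blinfun.continuous_on vholomorphic_line_continuous[OF F] continuous_on_const) simp
    then show "(\<lambda>x. lim (\<lambda>n. F (Complex x (1 / real (Suc n))) v)) \<in> borel_measurable borel"
      by (intro borel_measurable_lim_metric borel_measurable_continuous_onI)
  qed (use Lm in auto)
  ultimately show ?thesis by simp
qed

subsection \<open>Convergence of difference quotients in \<open>L\<^sup>2\<close>\<close>

lemma norm_L2_nn_integral: "ennreal ((norm u)\<^sup>2) = (\<integral>\<^sup>+x. ennreal ((norm (rep_L2 u x))\<^sup>2) \<partial>lborel)"
  using norm_abs_L2[OF sq_integrable_rep_L2, of u] by (simp add: abs_L2_rep_L2)

lemma integrable_rep_L2: "integrable lborel (\<lambda>x. (norm (rep_L2 u x))\<^sup>2)"
  using sq_integrable_rep_L2[of u] by (simp add: sq_integrable_def)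

lemma norm_L2_integral: "(norm u)\<^sup>2 = (\<integral>x. (norm (rep_L2 u x))\<^sup>2 \<partial>lborel)"
proof -
  have "ennreal ((norm u)\<^sup>2) = ennreal (\<integral>x. (norm (rep_L2 u x))\<^sup>2 \<partial>lborel)"
    unfolding norm_L2_nn_integral by (rule nn_integral_eq_integral[OF integrable_rep_L2]) simp
  then show ?thesis by (subst (asm) ennreal_inj) (auto intro!: integral_nonneg_AE)
qed

lemma L2_dominated_convergence:
  fixes d :: "nat \<Rightarrow> 'a::separable_complex_hilbert L2"
  assumes lim: "AE x in lborel. (\<lambda>n. rep_L2 (d n) x) \<longlonglongrightarrow> rep_L2 g x"
    and bd: "\<And>n. AE x in lborel. norm (rep_L2 (d n) x) \<le> norm (rep_L2 b x)"
  shows "d \<longlonglongrightarrow> g"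
proof -
  have bd': "AE x in lborel. \<forall>n. norm (rep_L2 (d n) x) \<le> norm (rep_L2 b x)"
    using bd by (simp add: AE_all_countable)
  have "(\<lambda>n. \<integral>x. (norm (rep_L2 (d n - g) x))\<^sup>2 \<partial>lborel) \<longlonglongrightarrow> (\<integral>(x::real). 0 \<partial>lborel)"
  proof (rule integral_dominated_convergence)
    show "integrable lborel (\<lambda>x. 4 * (norm (rep_L2 b x))\<^sup>2)"
      by (intro integrable_mult_right integrable_rep_L2)
    have D: "AE x in lborel. \<forall>n. rep_L2 (d n - g) x = rep_L2 (d n) x - rep_L2 g x"
      unfolding AE_all_countable by (intro allI AE_rep_minus)
    show "AE x in lborel. (\<lambda>n. (norm (rep_L2 (d n - g) x))\<^sup>2) \<longlonglongrightarrow> 0"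
      using lim D
    proof eventually_elim
      case (elim x)
      have "(\<lambda>n. (norm (rep_L2 (d n) x - rep_L2 g x))\<^sup>2) \<longlonglongrightarrow> (norm (rep_L2 g x - rep_L2 g x))\<^sup>2"
        by (intro tendsto_power tendsto_norm tendsto_diff tendsto_const elim(1))
      then show ?case using elim(2) by simp
    qed
    show "AE x in lborel. norm ((norm (rep_L2 (d n - g) x))\<^sup>2) \<le> 4 * (norm (rep_L2 b x))\<^sup>2" for n
      using lim D bd'
    proof eventually_elim
      case (elim x)
      have "norm (rep_L2 g x) \<le> norm (rep_L2 b x)"
        by (rule LIMSEQ_le_const2[OF tendsto_norm[OF elim(1)]]) (use elim(3) in auto)
      then have "norm (rep_L2 (d n) x - rep_L2 g x) \<le> 2 * norm (rep_L2 b x)"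
        using elim(3) norm_triangle_ineq4[of "rep_L2 (d n) x" "rep_L2 g x"] by (smt (verit))
      then have "(norm (rep_L2 (d n) x - rep_L2 g x))\<^sup>2 \<le> (2 * norm (rep_L2 b x))\<^sup>2"
        by (rule power_mono) simp
      then show ?case using elim(2) by (simp add: power_mult_distrib)
    qed
  qed auto
  then have "(\<lambda>n. (norm (d n - g))\<^sup>2) \<longlonglongrightarrow> 0" by (simp add: norm_L2_integral)
  then have "(\<lambda>n. sqrt ((norm (d n - g))\<^sup>2)) \<longlonglongrightarrow> sqrt 0" by (rule tendsto_real_sqrt)
  then have "(\<lambda>n. norm (d n - g)) \<longlonglongrightarrow> 0" by simp
  then show ?thesis by (rule LIM_zero_cancel[OF tendsto_norm_zero_cancel])
qed

lemma continuous_on_UNIV_lborel: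
  fixes f :: "'a::euclidean_space \<Rightarrow> 'b::topological_space"
  shows "continuous_on UNIV f \<Longrightarrow> f \<in> borel_measurable lborel"
  by (simp add: borel_measurable_continuous_onI)

lemma borel_measurable_scaleC_fun:
  assumes "a \<in> borel_measurable M" "f \<in> borel_measurable M"
  shows "(\<lambda>x. a x *\<^sub>C (f x :: 'a::separable_complex_hilbert)) \<in> borel_measurable M"
proof (rule borel_measurable_continuous_Pair[OF assms])
  show "continuous_on UNIV (\<lambda>x::complex \<times> 'a. fst x *\<^sub>C snd x)"
    unfolding continuous_on_def
    by (intro ballI tendsto_scaleC tendsto_fst tendsto_snd tendsto_ident_at)
qed

lemma AE_rep_shift_group:
  "AE x in lborel. rep_L2 (shift_group t u) x = exp (\<i> * of_real (t * x)) *\<^sub>C rep_L2 u x"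
proof -
  have eq: "(\<lambda>x. (exp (\<i> * of_real (t * x)) *\<^sub>C id_blinfun) (rep_L2 u x)) = (\<lambda>x. exp (\<i> * of_real (t * x)) *\<^sub>C rep_L2 u x)"
    by (simp add: scaleC_blinfun.rep_eq)
  have sq: "sq_integrable (\<lambda>x. exp (\<i> * of_real (t * x)) *\<^sub>C rep_L2 u x)"
  proof (rule sq_integrable_bound[OF sq_integrable_rep_L2[of u]])
    have "continuous_on UNIV (\<lambda>x::real. exp (\<i> * complex_of_real (t * x)))"
      by (intro continuous_intros)
    then show "(\<lambda>x. exp (\<i> * of_real (t * x)) *\<^sub>C rep_L2 u x) \<in> borel_measurable lborel"
      by (intro borel_measurable_scaleC_fun measurable_rep_L2) (rule continuous_on_UNIV_lborel)
  qed (simp add: norm_scaleC)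
  show ?thesis
    unfolding shift_group_def mult_op_def eq by (rule rep_L2_abs_L2[OF sq])
qed

text \<open>A fixed sequence of times instead of a real parameter, because Fatou's lemma and
  dominated convergence are used for sequences.\<close>

definition step :: "nat \<Rightarrow> real"
  where "step n = 1 / real (Suc n)"

lemma step_pos: "step n > 0"
  by (simp add: step_def)

lemma step_tendsto: "step \<longlonglongrightarrow> 0"
  unfolding step_def by (rule LIMSEQ_Suc[OF lim_1_over_n])

lemma step_tendsto_at: "filterlim step (at 0) sequentially" "filterlim step (at_right 0) sequentially"
  using step_tendsto step_pos less_imp_neq[OF step_pos]
  by (auto simp: filterlim_at intro!: eventuallyI)

text \<open>No dominating function is known for the quotients of an arbitrary \<open>y\<close>.
  Fatou's lemma suffices: the integral of the squared distance between the pointwise limit and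
  \<open>g\<close> is at most the lower limit of squared L2 distances, which is 0.\<close>

lemma shift_group_generator:
  fixes y g :: "'k::separable_complex_hilbert L2"
  assumes "(\<lambda>n. (1 / step n) *\<^sub>R (shift_group (step n) y - y)) \<longlonglongrightarrow> g"
  shows "AE x in lborel. (\<i> * of_real x) *\<^sub>C rep_L2 y x = rep_L2 g x"
proof -
  let ?d = "\<lambda>n. (1 / step n) *\<^sub>R (shift_group (step n) y - y)"
  let ?q = "\<lambda>n x. ((1 / of_real (step n)) * (exp (\<i> * of_real (step n * x)) - 1)) *\<^sub>C rep_L2 y x - rep_L2 g x"
  have rep: "AE x in lborel. rep_L2 (?d n - g) x = ?q n x" for n
    using AE_rep_minus[of "?d n" g] AE_rep_scaleC[of "of_real (1 / step n)" "shift_group (step n) y - y"]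
      AE_rep_minus[of "shift_group (step n) y" y] AE_rep_shift_group[of "step n" y]
    by eventually_elim
      (simp add: scaleC_of_real[symmetric] scaleC_diff_left[symmetric] scaleC_scaleC scaleC_diff_right
        right_diff_distrib del: of_real_mult of_real_divide, simp add: scaleC_diff_left)
  have lim: "(\<lambda>n. ennreal ((norm (?q n x))\<^sup>2))
      \<longlonglongrightarrow> ennreal ((norm ((\<i> * of_real x) *\<^sub>C rep_L2 y x - rep_L2 g x))\<^sup>2)" for x
  proof -
    have "((\<lambda>s. exp (\<i> * of_real x * s)) has_field_derivative \<i> * of_real x) (at 0)"
      by (auto intro!: derivative_eq_intros)
    then have "((\<lambda>s. (exp (\<i> * of_real x * s) - 1) / s) \<longlongrightarrow> \<i> * of_real x) (at 0)"
      by (simp add: has_field_derivative_iff)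
    moreover have "filterlim (\<lambda>n. complex_of_real (step n)) (at 0) sequentially"
      unfolding filterlim_at using tendsto_of_real[OF step_tendsto, where 'a = complex] less_imp_neq[OF step_pos]
      by (auto intro!: eventuallyI) 
    ultimately have "(\<lambda>n. (exp (\<i> * of_real x * of_real (step n)) - 1) / of_real (step n)) \<longlonglongrightarrow> \<i> * of_real x"
      by (rule filterlim_compose)
    then have "(\<lambda>n. (1 / of_real (step n)) * (exp (\<i> * of_real (step n * x)) - 1)) \<longlonglongrightarrow> \<i> * of_real x"
      by (simp add: mult_ac)
    then show ?thesis by (intro tendsto_ennrealI tendsto_power tendsto_norm tendsto_diff tendsto_scaleC tendsto_const)
  qed
  have "(\<integral>\<^sup>+x. ennreal ((norm ((\<i> * of_real x) *\<^sub>C rep_L2 y x - rep_L2 g x))\<^sup>2) \<partial>lborel)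
      = (\<integral>\<^sup>+x. liminf (\<lambda>n. ennreal ((norm (?q n x))\<^sup>2)) \<partial>lborel)"
    by (intro nn_integral_cong lim_imp_Liminf[symmetric] lim) simp
  also have "\<dots> \<le> liminf (\<lambda>n. \<integral>\<^sup>+x. ennreal ((norm (?q n x))\<^sup>2) \<partial>lborel)"
  proof (rule nn_integral_liminf)
    fix n
    have "continuous_on UNIV (\<lambda>x::real. (1 / complex_of_real (step n)) * (exp (\<i> * of_real (step n * x)) - 1))"
      by (intro continuous_intros)
    then have "(\<lambda>x. ?q n x) \<in> borel_measurable lborel"
      by (intro borel_measurable_diff borel_measurable_scaleC_fun measurable_rep_L2)
        (rule continuous_on_UNIV_lborel)
    then show "(\<lambda>x. ennreal ((norm (?q n x))\<^sup>2)) \<in> borel_measurable lborel" by measurable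
  qed
  also have "\<dots> = liminf (\<lambda>n. ennreal ((norm (?d n - g))\<^sup>2))"
  proof -
    have "(\<integral>\<^sup>+x. ennreal ((norm (?q n x))\<^sup>2) \<partial>lborel) = ennreal ((norm (?d n - g))\<^sup>2)" for n
      unfolding norm_L2_nn_integral
      by (rule nn_integral_cong_AE) (use rep[of n] in \<open>eventually_elim, simp only:\<close>)
    then show ?thesis by (simp only:)
  qed
  also have "\<dots> = 0"
  proof (rule lim_imp_Liminf)
    have "(\<lambda>n. ennreal ((norm (?d n - g))\<^sup>2)) \<longlonglongrightarrow> ennreal ((norm (g - g))\<^sup>2)"
      by (intro tendsto_ennrealI tendsto_power tendsto_norm tendsto_diff tendsto_const assms)
    then show "(\<lambda>n. ennreal ((norm (?d n - g))\<^sup>2)) \<longlonglongrightarrow> 0" by simp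
  qed simp
  finally have "(\<integral>\<^sup>+x. ennreal ((norm ((\<i> * of_real x) *\<^sub>C rep_L2 y x - rep_L2 g x))\<^sup>2) \<partial>lborel) = 0"
    by simp
  moreover have "continuous_on UNIV (\<lambda>x::real. \<i> * complex_of_real x)"
    by (intro continuous_intros)
  then have "(\<lambda>x. (\<i> * of_real x) *\<^sub>C rep_L2 y x - rep_L2 g x) \<in> borel_measurable lborel"
    by (intro borel_measurable_diff borel_measurable_scaleC_fun measurable_rep_L2)
      (rule continuous_on_UNIV_lborel)
  then have "(\<lambda>x. ennreal ((norm ((\<i> * of_real x) *\<^sub>C rep_L2 y x - rep_L2 g x))\<^sup>2)) \<in> borel_measurable lborel"
    by measurable
  ultimately have "AE x in lborel. ennreal ((norm ((\<i> * of_real x) *\<^sub>C rep_L2 y x - rep_L2 g x))\<^sup>2) = 0"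
    by (subst (asm) nn_integral_0_iff_AE)
  then show ?thesis by eventually_elim (simp add: ennreal_eq_0_iff)
qed

subsection \<open>The resolvent of the group generated by a Pick function\<close>

text \<open>A choice of class, so that measurability of the pointwise resolvent is dealt with once,
  in \<open>AE_rep_Jop\<close>.\<close>

definition Jop :: "(complex \<Rightarrow> 'h::separable_complex_hilbert \<Rightarrow>\<^sub>L 'h) \<Rightarrow> 'h L2 \<Rightarrow> 'h L2"
  where "Jop F u = (SOME v. AE x in lborel. rep_L2 v x = resolv (boundary_value F x) (rep_L2 u x))"

lemma selfadjoint_dissipative: "selfadjoint_op B \<Longrightarrow> dissipative B"
proof -
  assume B: "selfadjoint_op B"
  have "Im (cinner x (B x)) = 0" for x
  proof -
    have "cinner x (B x) = cnj (cinner x (B x))"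
      using B cinner_commute[of "B x" x] by (simp add: selfadjoint_op_def is_adjoint_def)
    from arg_cong[OF this, of Im] show ?thesis by simp
  qed
  then show ?thesis using B by (simp add: dissipative_def selfadjoint_op_def)
qed

lemma vholomorphic_const: "vholomorphic_on (\<lambda>_. c) S"
  by (auto simp: vholomorphic_on_def)

locale pick_function =
  fixes F :: "complex \<Rightarrow> 'h::separable_complex_hilbert \<Rightarrow>\<^sub>L 'h"
  assumes fd: "finite_dimensional TYPE('h)" and pick: "F \<in> pick_R"
begin

lemma F_complex_linear: "Im z > 0 \<Longrightarrow> complex_linear (F z)"
  and F_vholomorphic: "vholomorphic_on F upper_half_plane"
  using pick by (auto simp: pick_R_def)

lemma F_adjoint: "Im z > 0 \<Longrightarrow> is_adjoint (F z) (cadjoint (F z))"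
  by (rule is_adjoint_cadjoint[OF fd F_complex_linear])

lemma F_dissipative:
  assumes "Im z > 0"
  shows "dissipative (F z)"
  unfolding dissipative_def
proof (intro conjI allI F_complex_linear assms)
  fix x
  have "positive_op ((1 / (2 * \<i>)) *\<^sub>C (F z - cadjoint (F z)))"
    using pick assms by (simp add: pick_R_def)
  then have "0 \<le> Re (cinner x (((1 / (2 * \<i>)) *\<^sub>C (F z - cadjoint (F z))) x))"
    by (simp add: positive_op_def)
  also have "cinner x (((1 / (2 * \<i>)) *\<^sub>C (F z - cadjoint (F z))) x)
      = (1 / (2 * \<i>)) * (cinner x (F z x) - cinner x (cadjoint (F z) x))"
    by (simp only: scaleC_blinfun.rep_eq cinner_scaleC_right blinfun.diff_left cinner_diff_right)
  also have "cinner x (cadjoint (F z) x) = cnj (cinner x (F z x))"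
    using F_adjoint[OF assms] cinner_commute[of "F z x" x] by (simp add: is_adjoint_def)
  also have "(1 / (2 * \<i>)) * (cinner x (F z x) - cnj (cinner x (F z x))) = of_real (Im (cinner x (F z x)))"
    by (simp add: complex_eq_iff)
  finally show "0 \<le> Im (cinner x (F z x))" by simp
qed

abbreviation B :: "real \<Rightarrow> 'h \<Rightarrow>\<^sub>L 'h"
  where "B \<equiv> boundary_value F"

lemma AE_boundary:
  "AE x in lborel. selfadjoint_op (B x) \<and> ((\<lambda>e. F (Complex x e)) \<longlongrightarrow> B x) (at_right 0)"
proof -
  have "AE x in lborel. \<exists>A. selfadjoint_op A \<and> ((\<lambda>e. F (Complex x e)) \<longlongrightarrow> A) (at_right 0)"
    using pick by (simp add: pick_R_def)
  then show ?thesis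
  proof eventually_elim
    case (elim x)
    then obtain A where A: "selfadjoint_op A" "((\<lambda>e. F (Complex x e)) \<longlongrightarrow> A) (at_right 0)" by blast
    have "B x = A" unfolding boundary_value_def by (rule tendsto_Lim[OF _ A(2)]) simp
    with A show ?case by simp
  qed
qed

lemma resolv_boundary_tendsto:
  assumes "((\<lambda>y. F (Complex x y)) \<longlongrightarrow> B x) (at_right 0)" "selfadjoint_op (B x)"
    and "(f \<longlongrightarrow> v) (at_right 0)"
  shows "((\<lambda>y. resolv (F (Complex x y)) (f y)) \<longlongrightarrow> resolv (B x) v) (at_right 0)"
proof (rule resolv_tendsto[OF fd _ _ assms(1)])
  show "\<forall>\<^sub>F y in at_right 0. dissipative (F (Complex x y))"
    using eventually_at_right_less[of "0::real"] by eventually_elim (simp add: F_dissipative)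
  show "(f \<longlongrightarrow> B x (resolv (B x) v) + \<i> *\<^sub>C resolv (B x) v) (at_right 0)"
    using assms(3) by (simp add: resolv_apply[OF fd selfadjoint_dissipative[OF assms(2)]])
qed

text \<open>The boundary resolvent is measurable as a limit of resolvents along horizontal lines,
  where they are continuous; contractivity keeps the product square integrable.\<close>

lemma AE_rep_Jop: "AE x in lborel. rep_L2 (Jop F u) x = resolv (B x) (rep_L2 u x)"
proof -
  obtain E :: "'h set" where E0: "finite E" "orthonormal E" "complex_vector.span E = UNIV"
    and E: "\<And>x. x = (\<Sum>e\<in>E. cinner e x *\<^sub>C e)"
    by (rule finite_dimensional_orthonormal[OF fd], rule that)
  define r where "r e x = lim (\<lambda>n. resolv (F (Complex x (step n))) e)" for e x
  define w where "w x = (\<Sum>e\<in>E. cinner e (rep_L2 u x) *\<^sub>C r e x)" for x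
  have rm: "r e \<in> borel_measurable lborel" for e
  proof -
    have "vholomorphic_on (\<lambda>z. resolv (F z) e) upper_half_plane"
      by (rule vholomorphic_resolv[OF fd _ F_vholomorphic vholomorphic_const]) (simp add: F_dissipative)
    then have "(\<lambda>x. resolv (F (Complex x (step n))) e) \<in> borel_measurable lborel" for n
      by (rule vholomorphic_line_measurable[OF _ step_pos])
    then show ?thesis unfolding r_def by (rule borel_measurable_lim_metric)
  qed
  have eq: "AE x in lborel. w x = resolv (B x) (rep_L2 u x) \<and> norm (w x) \<le> norm (rep_L2 u x)"
    using AE_boundary
  proof eventually_elim
    case (elim x)
    note d = selfadjoint_dissipative[OF conjunct1[OF elim]]
    have "r e x = resolv (B x) e" for e
      unfolding r_def
      by (rule limI, rule filterlim_compose[OF resolv_boundary_tendsto[OF conjunct2[OF elim] conjunct1[OF elim] tendsto_const]])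
        (rule step_tendsto_at)
    then have "w x = (\<Sum>e\<in>E. resolv (B x) (cinner e (rep_L2 u x) *\<^sub>C e))"
      unfolding w_def by (simp add: resolv_scaleC[OF fd d])
    also have "\<dots> = resolv (B x) (\<Sum>e\<in>E. cinner e (rep_L2 u x) *\<^sub>C e)"
    proof -
      have "resolv (B x) (\<Sum>e\<in>E'. g e) = (\<Sum>e\<in>E'. resolv (B x) (g e))" if "finite E'" for E' and g :: "'h \<Rightarrow> 'h"
        using that
        by (induction E') (simp_all add: resolv_add[OF fd d] resolv_eq_0_iff[OF fd d])
      then show ?thesis using E0(1) by simp
    qed
    also have "\<dots> = resolv (B x) (rep_L2 u x)"
      by (simp only: E[of "rep_L2 u x", symmetric])
    finally show ?case using norm_resolv_le[OF fd d, of "rep_L2 u x"] by simp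
  qed
  have "sq_integrable w"
  proof (rule sq_integrable_bound[OF sq_integrable_rep_L2[of u]])
    show "w \<in> borel_measurable lborel"
      unfolding w_def
      by (intro borel_measurable_sum borel_measurable_scaleC_fun borel_measurable_cinner measurable_rep_L2 rm)
        simp
    show "AE x in lborel. norm (w x) \<le> norm (rep_L2 u x)" using eq by eventually_elim (rule conjunct2)
  qed
  from rep_L2_abs_L2[OF this] eq
  have "AE x in lborel. rep_L2 (abs_L2 w) x = resolv (B x) (rep_L2 u x)"
    by eventually_elim simp
  then show ?thesis unfolding Jop_def by (rule someI)
qed

lemma AE_Jop:
  "AE x in lborel. B x (rep_L2 (Jop F u) x) + \<i> *\<^sub>C rep_L2 (Jop F u) x = rep_L2 u x"
  using AE_rep_Jop[of u] AE_boundary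
  by eventually_elim (simp add: resolv_apply[OF fd selfadjoint_dissipative])

text \<open>The boundary resolvent extends holomorphically by the resolvent inside the half-plane,
  which is a contraction, so the Hardy bound survives.\<close>

lemma hardy_Jop:
  assumes f: "hardy f u"
  shows "hardy (\<lambda>z. resolv (F z) (f z)) (Jop F u)"
proof (rule hardy_bounded_multiple[OF f, of _ 1])
  show "vholomorphic_on (\<lambda>z. resolv (F z) (f z)) upper_half_plane"
    by (rule vholomorphic_resolv[OF fd _ F_vholomorphic])
      (use f in \<open>auto simp: hardy_def F_dissipative\<close>)
  show "norm (resolv (F z) (f z)) \<le> 1 * norm (f z)" if "Im z > 0" for z
    using norm_resolv_le[OF fd F_dissipative[OF that], of "f z"] by simp
  have "AE x in lborel. ((\<lambda>y. f (Complex x y)) \<longlongrightarrow> rep_L2 u x) (at_right 0)"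
    using f by (simp add: hardy_def)
  then show "AE x in lborel. ((\<lambda>y. resolv (F (Complex x y)) (f (Complex x y))) \<longlongrightarrow> rep_L2 (Jop F u) x) (at_right 0)"
    using AE_boundary AE_rep_Jop[of u]
    by eventually_elim (simp add: resolv_boundary_tendsto)
qed simp

lemma AE_rep_pick_group:
  "AE x in lborel. rep_L2 (pick_group F t u) x = op_flow (B x) (rep_L2 u x) t"
proof -
  have "sq_integrable (\<lambda>x. op_exp ((\<i> * of_real t) *\<^sub>C B x) (rep_L2 u x))"
  proof (rule sq_integrable_bound[OF sq_integrable_rep_L2[of u]])
    have "(\<lambda>x. B x v) \<in> borel_measurable lborel" for v
      using borel_measurable_boundary_value[OF F_vholomorphic] by simp
    then have "(\<lambda>x. op_exp ((\<i> * of_real t) *\<^sub>C B x) v) \<in> borel_measurable lborel" for v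
      by (rule borel_measurable_op_exp[OF fd])
    then show "(\<lambda>x. op_exp ((\<i> * of_real t) *\<^sub>C B x) (rep_L2 u x)) \<in> borel_measurable lborel"
      by (rule borel_measurable_blinfun_apply[OF fd _ measurable_rep_L2])
    show "AE x in lborel. norm (op_exp ((\<i> * of_real t) *\<^sub>C B x) (rep_L2 u x)) \<le> norm (rep_L2 u x)"
      using AE_boundary
    proof eventually_elim
      case (elim x)
      show ?case using norm_op_flow[OF fd conjunct1[OF elim], of "rep_L2 u x" t]
        by (simp add: op_flow_def[OF fd conjunct1[OF elim]])
    qed
  qed
  from rep_L2_abs_L2[OF this]
  have "AE x in lborel. rep_L2 (pick_group F t u) x = op_exp ((\<i> * of_real t) *\<^sub>C B x) (rep_L2 u x)"
    by (simp add: pick_group_def mult_op_def)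
  then show ?thesis
    using AE_boundary by eventually_elim (simp add: op_flow_def[OF fd])
qed

text \<open>Elements \<open>J u\<close> lie in the domain of the generator:
  \<open>B (J u) = u - i J u\<close> is again square integrable and, by
  \<open>op_flow_diff_bound\<close>, dominates the quotients. Multiplied by \<open>i\<close> it is
  the stated limit.\<close>

lemma pick_group_generator:
  "(\<lambda>n. (1 / step n) *\<^sub>R (pick_group F (step n) (Jop F u) - Jop F u)) \<longlonglongrightarrow> \<i> *\<^sub>C u + Jop F u"
proof (rule L2_dominated_convergence[where b = "\<i> *\<^sub>C u + Jop F u"])
  let ?v = "Jop F u"
  let ?d = "\<lambda>n. (1 / step n) *\<^sub>R (pick_group F (step n) ?v - ?v)"
  have rep: "AE x in lborel. rep_L2 (?d n) x = (1 / step n) *\<^sub>R (op_flow (B x) (rep_L2 ?v x) (step n) - rep_L2 ?v x)" for n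
    using AE_rep_scaleC[of "of_real (1 / step n)" "pick_group F (step n) ?v - ?v"]
      AE_rep_minus[of "pick_group F (step n) ?v" ?v] AE_rep_pick_group[of "step n" ?v]
    by eventually_elim (simp only: scaleC_of_real)
  have lim: "AE x in lborel. rep_L2 (\<i> *\<^sub>C u + ?v) x = \<i> *\<^sub>C B x (rep_L2 ?v x)"
    using AE_rep_plus[of "\<i> *\<^sub>C u" ?v] AE_rep_scaleC[of "\<i>" u] AE_Jop[of u]
  proof eventually_elim
    case (elim x)
    have "\<i> *\<^sub>C rep_L2 u x + rep_L2 ?v x = \<i> *\<^sub>C B x (rep_L2 ?v x)"
      unfolding elim(3)[symmetric] by (simp add: scaleC_add_right scaleC_scaleC scaleC_minus_left)
    then show ?case using elim by simp
  qed
  have "AE x in lborel. \<forall>n. rep_L2 (?d n) x = (1 / step n) *\<^sub>R (op_flow (B x) (rep_L2 ?v x) (step n) - rep_L2 ?v x)"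
    unfolding AE_all_countable using rep by blast
  then show "AE x in lborel. (\<lambda>n. rep_L2 (?d n) x) \<longlonglongrightarrow> rep_L2 (\<i> *\<^sub>C u + ?v) x"
    using lim AE_boundary
  proof eventually_elim
    case (elim x)
    show ?case unfolding elim(2) spec[OF elim(1)]
      by (rule filterlim_compose[OF op_flow_quotient[OF fd conjunct1[OF elim(3)]] step_tendsto_at(1)])
  qed
  show "AE x in lborel. norm (rep_L2 (?d n) x) \<le> norm (rep_L2 (\<i> *\<^sub>C u + ?v) x)" for n
    using rep[of n] lim AE_boundary
  proof eventually_elim
    case (elim x)
    have "norm (op_flow (B x) (rep_L2 ?v x) (step n) - rep_L2 ?v x) \<le> \<bar>step n\<bar> * norm (B x (rep_L2 ?v x))"
      by (rule op_flow_diff_bound[OF fd conjunct1[OF elim(3)]])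
    then show ?case unfolding elim using step_pos[of n]
      by (simp add: norm_scaleC divide_le_eq mult.commute)
  qed
qed

definition Wop :: "'h L2 \<Rightarrow> 'h L2"
  where "Wop u = u - (2 * \<i>) *\<^sub>C Jop F u"

definition M :: "'h L2 set"
  where "M = {u \<in> H2. \<forall>v\<in>H2. cinner u (Wop v) = 0}"


end

subsection \<open>Linear isometries of \<open>L\<^sup>2\<close> spaces\<close>

context
  fixes \<psi> :: "'a::complex_inner \<Rightarrow> 'b::complex_inner"
  assumes \<psi>: "unitary \<psi>"
begin

lemma unitary_add: "\<psi> (x + y) = \<psi> x + \<psi> y"
  and unitary_scaleC: "\<psi> (a *\<^sub>C x) = a *\<^sub>C \<psi> x"
  and unitary_cinner: "cinner (\<psi> x) (\<psi> y) = cinner x y"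
  using \<psi> by (auto simp: unitary_def)

lemma unitary_zero: "\<psi> 0 = 0"
  using unitary_scaleC[of 0 0] by simp

lemma unitary_diff: "\<psi> (x - y) = \<psi> x - \<psi> y"
  using unitary_add[of "x - y" y] by (simp add: algebra_simps)

lemma unitary_scaleR: "\<psi> (r *\<^sub>R x) = r *\<^sub>R \<psi> x"
  unfolding scaleC_of_real[symmetric] by (rule unitary_scaleC)

lemma unitary_norm: "norm (\<psi> x) = norm x"
  by (simp add: norm_eq_sqrt_inner inner_eq_Re_cinner unitary_cinner)

lemma unitary_inj: "\<psi> x = \<psi> y \<Longrightarrow> x = y"
  using unitary_norm[of "x - y"] by (simp add: unitary_diff)

lemma unitary_surj: "\<exists>x. y = \<psi> x"
  using \<psi> by (auto simp: unitary_def surj_def)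

lemma unitary_tendsto:
  assumes "f \<longlonglongrightarrow> l"
  shows "(\<lambda>n. \<psi> (f n)) \<longlonglongrightarrow> \<psi> l"
proof (rule LIM_zero_cancel, rule tendsto_norm_zero_cancel)
  have "(\<lambda>n. norm (f n - l)) \<longlonglongrightarrow> 0" using assms by (simp add: LIM_zero tendsto_norm_zero)
  then show "(\<lambda>n. norm (\<psi> (f n) - \<psi> l)) \<longlonglongrightarrow> 0"
    by (simp add: unitary_diff[symmetric] unitary_norm)
qed

end

lemma hker_add: "Im w > 0 \<Longrightarrow> hker w (k + l) = hker w k + hker w l"
proof (rule L2_eqI)
  assume w: "Im w > 0"
  show "AE x in lborel. rep_L2 (hker w (k + l)) x = rep_L2 (hker w k + hker w l) x"
    using rep_hker[OF w, of "k + l"] rep_hker[OF w, of k] rep_hker[OF w, of l]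
      AE_rep_plus[of "hker w k" "hker w l"]
    by eventually_elim (simp add: scaleC_add_right)
qed

lemma hker_scaleC: "Im w > 0 \<Longrightarrow> hker w (a *\<^sub>C k) = a *\<^sub>C hker w k"
proof (rule L2_eqI)
  assume w: "Im w > 0"
  show "AE x in lborel. rep_L2 (hker w (a *\<^sub>C k)) x = rep_L2 (a *\<^sub>C hker w k) x"
    using rep_hker[OF w, of "a *\<^sub>C k"] rep_hker[OF w, of k] AE_rep_scaleC[of a "hker w k"]
    by eventually_elim (simp add: scaleC_scaleC mult.commute)
qed

lemma hker_diff: "Im w > 0 \<Longrightarrow> hker w (k - l) = hker w k - hker w l"
  using hker_add[of w "k - l" l] by (simp add: algebra_simps)

text \<open>The Cauchy integral of the kernel, evaluated at \<open>w\<close> itself, is a nonzero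
  multiple of \<open>k\<close>.\<close>

lemma hker_ne_zero:
  assumes w: "Im w > 0" and "hker w k = 0"
  shows "k = 0"
proof -
  have "cinner k ((1 / (w - cnj w)) *\<^sub>C k) = 0"
    using hardy_imp_ext[OF hardy_hker[OF w, of k]] assms by (simp add: hardy_ext_def)
  then show ?thesis using cnj_diff_ne[OF w w] by (simp add: cinner_scaleC_right)
qed

lemma hardy_scalar_multiple:
  fixes hb :: "real \<Rightarrow> complex"
  assumes f: "hardy f u" and h: "h holomorphic_on upper_half_plane" and c: "0 \<le> c"
    and le: "\<And>z. Im z > 0 \<Longrightarrow> cmod (h z) \<le> c"
    and lim: "AE x in lborel. ((\<lambda>y. h (Complex x y)) \<longlongrightarrow> hb x) (at_right 0)"
    and v: "AE x in lborel. rep_L2 v x = hb x *\<^sub>C rep_L2 u x"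
  shows "hardy (\<lambda>z. h z *\<^sub>C f z) v"
proof (rule hardy_bounded_multiple[OF f _ c])
  show "vholomorphic_on (\<lambda>z. h z *\<^sub>C f z) upper_half_plane"
    unfolding vholomorphic_on_def
  proof
    fix z assume z: "z \<in> upper_half_plane"
    obtain D where D: "((\<lambda>w. (1 / (w - z)) *\<^sub>C (f w - f z)) \<longlongrightarrow> D) (at z within upper_half_plane)"
      using f z unfolding hardy_def vholomorphic_on_def by blast
    obtain d where d: "((\<lambda>w. (h w - h z) / (w - z)) \<longlongrightarrow> d) (at z within upper_half_plane)"
      using h z unfolding holomorphic_on_def field_differentiable_def has_field_derivative_iff by blast
    have c: "(h \<longlongrightarrow> h z) (at z within upper_half_plane)"
      using holomorphic_on_imp_continuous_on[OF h] z by (simp add: continuous_on_def)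
    have "((\<lambda>w. h w *\<^sub>C ((1 / (w - z)) *\<^sub>C (f w - f z)) + ((h w - h z) / (w - z)) *\<^sub>C f z)
        \<longlongrightarrow> h z *\<^sub>C D + d *\<^sub>C f z) (at z within upper_half_plane)"
      by (intro tendsto_add tendsto_scaleC c D d tendsto_const)
    moreover have "h w *\<^sub>C ((1 / (w - z)) *\<^sub>C (f w - f z)) + ((h w - h z) / (w - z)) *\<^sub>C f z
        = (1 / (w - z)) *\<^sub>C (h w *\<^sub>C f w - h z *\<^sub>C f z)" for w
      by (simp add: scaleC_diff_right scaleC_diff_left scaleC_scaleC diff_divide_distrib)
    ultimately show "\<exists>D. ((\<lambda>w. (1 / (w - z)) *\<^sub>C (h w *\<^sub>C f w - h z *\<^sub>C f z)) \<longlongrightarrow> D) (at z within upper_half_plane)"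
      by (auto intro!: exI)
  qed
  show "norm (h z *\<^sub>C f z) \<le> c * norm (f z)" if "Im z > 0" for z
    using le[OF that] by (simp add: norm_scaleC mult_right_mono)
  have "AE x in lborel. ((\<lambda>y. f (Complex x y)) \<longlongrightarrow> rep_L2 u x) (at_right 0)"
    using f by (simp add: hardy_def)
  then show "AE x in lborel. ((\<lambda>y. h (Complex x y) *\<^sub>C f (Complex x y)) \<longlongrightarrow> rep_L2 v x) (at_right 0)"
    using lim v by eventually_elim (simp add: tendsto_scaleC)
qed

lemma hardy_ext_diff: "hardy_ext f u \<Longrightarrow> hardy_ext g v \<Longrightarrow> hardy_ext (\<lambda>z. f z - g z) (u - v)"
  by (auto simp: hardy_ext_def cinner_diff_right algebra_simps)

lemma hardy_ext_scaleC: "hardy_ext f u \<Longrightarrow> hardy_ext (\<lambda>z. a *\<^sub>C f z) (a *\<^sub>C u)"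
  by (auto simp: hardy_ext_def cinner_scaleC_right)

lemma hardy_ext_sum:
  "(\<And>i. i \<in> I \<Longrightarrow> hardy_ext (f i) (u i)) \<Longrightarrow> hardy_ext (\<lambda>z. \<Sum>i\<in>I. f i z) (\<Sum>i\<in>I. u i)"
  by (auto simp: hardy_ext_def cinner_sum_right sum_distrib_left)

section \<open>The intertwiner and the complement \<open>M\<close>\<close>

locale pick_multiplicity = pick_function F
  for F :: "complex \<Rightarrow> 'h::separable_complex_hilbert \<Rightarrow>\<^sub>L 'h" +
  fixes \<psi> :: "'h L2 \<Rightarrow> 'k::separable_complex_hilbert L2"
  assumes subspace_H2: "complex_vector.subspace (H2 :: 'h L2 set)"
    and unitary: "unitary \<psi>" and image_H2: "\<psi> ` H2 = H2"
    and intertwines: "\<psi> (pick_group F t u) = shift_group t (\<psi> u)"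
begin

lemmas \<psi>_simps = unitary_add[OF unitary] unitary_diff[OF unitary] unitary_scaleC[OF unitary]
  unitary_scaleR[OF unitary]

text \<open>\<open>\<psi>\<close> carries the difference quotients of the Pick group to those of the
  shift group and preserves their convergence. With \<open>y = \<psi> (J u)\<close> the generator of
  the shift thus gives \<open>i x y = i \<psi> u + y\<close>, that is,
  \<open>(x + i) y = \<psi> u\<close>.\<close>

lemma AE_psi_Jop:
  "AE x in lborel. (of_real x + \<i>) *\<^sub>C rep_L2 (\<psi> (Jop F u)) x = rep_L2 (\<psi> u) x"
proof -
  let ?y = "\<psi> (Jop F u)" and ?g = "\<psi> (\<i> *\<^sub>C u + Jop F u)"
  have "(\<lambda>n. (1 / step n) *\<^sub>R (shift_group (step n) ?y - ?y)) \<longlonglongrightarrow> ?g"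
    using unitary_tendsto[OF unitary pick_group_generator[of u]] by (simp only: \<psi>_simps intertwines)
  from shift_group_generator[OF this]
  have "AE x in lborel. (\<i> * of_real x) *\<^sub>C rep_L2 ?y x = rep_L2 ?g x" .
  then show ?thesis
    using AE_rep_plus[of "\<psi> (\<i> *\<^sub>C u)" ?y] AE_rep_scaleC[of \<i> "\<psi> u"]
  proof eventually_elim
    case (elim x)
    have "(\<i> * of_real x) *\<^sub>C rep_L2 ?y x = \<i> *\<^sub>C rep_L2 (\<psi> u) x + rep_L2 ?y x"
      using elim by (simp add: \<psi>_simps)
    from arg_cong[OF this, of "\<lambda>v. (- \<i>) *\<^sub>C v"]
    have "of_real x *\<^sub>C rep_L2 ?y x = rep_L2 (\<psi> u) x - \<i> *\<^sub>C rep_L2 ?y x"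
      by (simp add: scaleC_add_right scaleC_scaleC scaleC_minus_left)
    then show ?case by (simp add: scaleC_add_left)
  qed
qed

lemma AE_psi_Wop:
  "AE x in lborel. rep_L2 (\<psi> (Wop u)) x = (of_real x - \<i>) *\<^sub>C rep_L2 (\<psi> (Jop F u)) x"
  using AE_psi_Jop[of u] AE_rep_minus[of "\<psi> u" "\<psi> ((2 * \<i>) *\<^sub>C Jop F u)"]
    AE_rep_scaleC[of "2 * \<i>" "\<psi> (Jop F u)"]
proof eventually_elim
  case (elim x)
  have "rep_L2 (\<psi> (Wop u)) x = rep_L2 (\<psi> u) x - (2 * \<i>) *\<^sub>C rep_L2 (\<psi> (Jop F u)) x"
    using elim(2,3) by (simp add: Wop_def \<psi>_simps)
  also have "\<dots> = (of_real x - \<i>) *\<^sub>C rep_L2 (\<psi> (Jop F u)) x"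
    unfolding elim(1)[symmetric] scaleC_diff_left[symmetric] by simp
  finally show ?case .
qed

text \<open>Read off on the model side, where the factors \<open>x - i\<close> and
  \<open>x + i\<close> have the same modulus for real \<open>x\<close>.\<close>

lemma cinner_Wop: "cinner (Wop u) (Wop v) = cinner u v"
proof -
  have "cinner (\<psi> (Wop u)) (\<psi> (Wop v)) = cinner (\<psi> u) (\<psi> v)"
  proof (rule cinner_L2_cong)
    show "AE x in lborel. cinner (rep_L2 (\<psi> (Wop u)) x) (rep_L2 (\<psi> (Wop v)) x)
        = cinner (rep_L2 (\<psi> u) x) (rep_L2 (\<psi> v) x)"
      using AE_psi_Wop[of u] AE_psi_Wop[of v] AE_psi_Jop[of u] AE_psi_Jop[of v]
    proof eventually_elim
      case (elim x)
      show ?case unfolding elim(1,2) elim(3,4)[symmetric] cinner_scaleC_left cinner_scaleC_right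
        by (simp add: algebra_simps)
    qed
  qed
  then show ?thesis by (simp add: unitary_cinner[OF unitary])
qed

lemma psi_H2: "u \<in> H2 \<longleftrightarrow> \<psi> u \<in> H2"
  using image_H2 unitary_inj[OF unitary] by (metis imageE imageI)

lemma Jop_H2: "u \<in> H2 \<Longrightarrow> Jop F u \<in> H2"
  using hardy_Jop by (auto simp: H2_iff_hardy)

text \<open>Elements of the shifted Hardy space have the factor \<open>z - i\<close> and so vanish
  at \<open>i\<close>, which makes them orthogonal to the kernel at \<open>i\<close>. Conversely,
  orthogonality to the shifted kernel at \<open>w\<close>, a combination of the kernels at
  \<open>i\<close> and \<open>w\<close>, expresses \<open>g w\<close> by
  \<open>g \<i>\<close>.\<close>

lemma M_iff: "u \<in> M \<longleftrightarrow> (\<exists>k. \<psi> u = hker \<i> k)"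
proof
  assume "\<exists>k. \<psi> u = hker \<i> k"
  then obtain k where k: "\<psi> u = hker \<i> k" by blast
  have "hker \<i> k \<in> H2" using hardy_hker[of \<i> k] by (auto simp: H2_iff_hardy)
  then have "u \<in> H2" using k psi_H2 by simp
  moreover have "cinner u (Wop v) = 0" if v: "v \<in> H2" for v
  proof -
    obtain g where g: "hardy g (\<psi> v)" using v psi_H2 by (auto simp: H2_iff_hardy)
    have "hardy (\<lambda>z. ((z - \<i>) / (z + \<i>)) *\<^sub>C g z) (\<psi> (Wop v))"
    proof (rule hardy_scalar_multiple[OF g _ zero_le_one, where hb = "\<lambda>x. (of_real x - \<i>) / (of_real x + \<i>)"])
      have ne: "z + \<i> \<noteq> 0" if "Im z \<ge> 0" for z using that by (auto simp: complex_eq_iff)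
      then show "(\<lambda>z. (z - \<i>) / (z + \<i>)) holomorphic_on upper_half_plane"
        by (intro holomorphic_intros) auto
      show "cmod ((z - \<i>) / (z + \<i>)) \<le> 1" if "Im z > 0" for z
      proof -
        have "cmod (z - \<i>) \<le> cmod (z + \<i>)"
        proof (rule power2_le_imp_le)
          show "(cmod (z - \<i>))\<^sup>2 \<le> (cmod (z + \<i>))\<^sup>2"
            unfolding cmod_power2 using that by (simp add: power2_eq_square algebra_simps)
        qed simp
        then show ?thesis using ne[of z] that by (simp add: norm_divide divide_le_eq)
      qed
      show "AE x in lborel. ((\<lambda>y. (Complex x y - \<i>) / (Complex x y + \<i>)) \<longlongrightarrow> (of_real x - \<i>) / (of_real x + \<i>)) (at_right 0)"
      proof (intro AE_I2)
        fix x
        have "((\<lambda>y. Complex x y) \<longlongrightarrow> Complex x 0) (at_right 0)"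
          by (intro tendsto_Complex tendsto_const tendsto_ident_at)
        then have "((\<lambda>y. Complex x y) \<longlongrightarrow> of_real x) (at_right 0)" by (simp add: complex_of_real_def)
        then show "((\<lambda>y. (Complex x y - \<i>) / (Complex x y + \<i>)) \<longlongrightarrow> (of_real x - \<i>) / (of_real x + \<i>)) (at_right 0)"
          by (intro tendsto_intros ne) auto
      qed
      show "AE x in lborel. rep_L2 (\<psi> (Wop v)) x = ((of_real x - \<i>) / (of_real x + \<i>)) *\<^sub>C rep_L2 (\<psi> v) x"
        using AE_psi_Wop[of v] AE_psi_Jop[of v]
      proof eventually_elim
        case (elim x)
        have "of_real x + \<i> \<noteq> 0" by (rule ne) simp
        then show ?case unfolding elim(1) elim(2)[symmetric] by (simp add: scaleC_scaleC)
      qed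
    qed
    from hardy_imp_ext[OF this] have "cinner (hker \<i> k) (\<psi> (Wop v)) = 0"
      by (simp add: hardy_ext_def)
    then show ?thesis using k unitary_cinner[OF unitary] by metis
  qed
  ultimately show "u \<in> M" by (simp add: M_def)
next
  assume u: "u \<in> M"
  then obtain g where g: "hardy g (\<psi> u)" using psi_H2 by (auto simp: M_def H2_iff_hardy)
  have "g w = (1 / (w + \<i>)) *\<^sub>C ((2 * \<i>) *\<^sub>C g \<i>)" if w: "Im w > 0" for w
  proof (cases "w = \<i>")
    \<comment> \<open>Here the two poles coincide and partial fractions degenerate, but the formula
      is trivial because \<open>w + \<i> = 2 * \<i>\<close>.\<close>
    case True
    then show ?thesis by (simp add: scaleC_scaleC)
  next
    case False
    \<comment> \<open>\<open>\<alpha>\<close> and \<open>\<beta>\<close> are the coefficients of the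
      partial fraction decomposition of the shifted kernel, see \<open>pf\<close>.\<close>
    define \<alpha> where "\<alpha> = 2 * \<i> / (cnj w + \<i>)"
    define \<beta> where "\<beta> = (cnj w - \<i>) / (cnj w + \<i>)"
    have ne: "cnj w + \<i> \<noteq> 0" using False by (auto simp: complex_eq_iff)
    have pf: "(of_real x - \<i>) / ((of_real x + \<i>) * (of_real x - cnj w))
        = \<alpha> * (1 / (of_real x + \<i>)) + \<beta> * (1 / (of_real x - cnj w))" for x
    proof -
      have "of_real x + \<i> \<noteq> 0" "of_real x - cnj w \<noteq> 0" using w by (auto simp: complex_eq_iff)
      then show ?thesis using ne by (simp add: \<alpha>_def \<beta>_def divide_simps) (simp add: algebra_simps)
    qed
    have "cnj \<alpha> * cinner k (g \<i>) + cnj \<beta> * cinner k (g w) = 0" for k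
    proof -
      have "hker w k \<in> H2" using hardy_hker[OF w, of k] by (auto simp: H2_iff_hardy)
      then obtain v where v: "v \<in> H2" "\<psi> v = hker w k" using image_H2 by (metis imageE)
      have "\<psi> (Wop v) = \<alpha> *\<^sub>C hker \<i> k + \<beta> *\<^sub>C hker w k"
      proof (rule L2_eqI)
        show "AE x in lborel. rep_L2 (\<psi> (Wop v)) x = rep_L2 (\<alpha> *\<^sub>C hker \<i> k + \<beta> *\<^sub>C hker w k) x"
          using AE_psi_Wop[of v] AE_psi_Jop[of v] rep_hker[OF w, of k] rep_hker[of \<i> k, simplified]
            AE_rep_plus[of "\<alpha> *\<^sub>C hker \<i> k" "\<beta> *\<^sub>C hker w k"]
            AE_rep_scaleC[of \<alpha> "hker \<i> k"] AE_rep_scaleC[of \<beta> "hker w k"]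
        proof eventually_elim
          case (elim x)
          have xi: "of_real x + \<i> \<noteq> 0" by (auto simp: complex_eq_iff)
          have "rep_L2 (\<psi> (Jop F v)) x = (1 / (of_real x + \<i>)) *\<^sub>C ((of_real x + \<i>) *\<^sub>C rep_L2 (\<psi> (Jop F v)) x)"
            using xi by (simp add: scaleC_scaleC)
          also have "\<dots> = (1 / ((of_real x + \<i>) * (of_real x - cnj w))) *\<^sub>C k"
            unfolding elim(2) v(2) elim(3) by (simp add: scaleC_scaleC)
          finally have "rep_L2 (\<psi> (Wop v)) x = ((of_real x - \<i>) / ((of_real x + \<i>) * (of_real x - cnj w))) *\<^sub>C k"
            using elim(1) by (simp add: scaleC_scaleC)
          also have "\<dots> = rep_L2 (\<alpha> *\<^sub>C hker \<i> k + \<beta> *\<^sub>C hker w k) x"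
            unfolding pf elim(5) elim(6) elim(7) elim(3) elim(4) by (simp add: scaleC_add_left scaleC_scaleC)
          finally show ?case .
        qed
      qed
      moreover have "cinner (\<psi> (Wop v)) (\<psi> u) = 0"
        using u v(1) cinner_commute[of "Wop v" u] by (simp add: M_def unitary_cinner[OF unitary])
      ultimately have "cnj \<alpha> * cinner (hker \<i> k) (\<psi> u) + cnj \<beta> * cinner (hker w k) (\<psi> u) = 0"
        by (simp add: cinner_add_left cinner_scaleC_left)
      then have "(2 * pi * \<i>) * (cnj \<alpha> * cinner k (g \<i>) + cnj \<beta> * cinner k (g w)) = 0"
        using hardy_imp_ext[OF g] w by (simp add: hardy_ext_def algebra_simps)
      then show ?thesis by simp
    qed
    then have "cinner k (cnj \<alpha> *\<^sub>C g \<i> + cnj \<beta> *\<^sub>C g w) = cinner k 0" for k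
      by (simp add: cinner_add_right cinner_scaleC_right)
    then have "cnj \<alpha> *\<^sub>C g \<i> + cnj \<beta> *\<^sub>C g w = 0" by (rule cinner_eqI)
    then have eq: "cnj \<beta> *\<^sub>C g w = - (cnj \<alpha> *\<^sub>C g \<i>)" by (metis add.commute add_eq_0_iff)
    have n1: "w - \<i> \<noteq> 0" "w + \<i> \<noteq> 0" using False w by (auto simp: complex_eq_iff)
    have b: "cnj \<beta> = (w + \<i>) / (w - \<i>)" "cnj \<alpha> = - 2 * \<i> / (w - \<i>)"
      by (simp_all add: \<alpha>_def \<beta>_def)
    have "g w = ((w - \<i>) / (w + \<i>)) *\<^sub>C (cnj \<beta> *\<^sub>C g w)"
      using n1 by (simp add: b scaleC_scaleC)
    also have "\<dots> = (2 * \<i> / (w + \<i>)) *\<^sub>C g \<i>"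
    proof -
      have "((w - \<i>) / (w + \<i>)) *\<^sub>C (- (cnj \<alpha> *\<^sub>C g \<i>)) = (- ((w - \<i>) / (w + \<i>) * cnj \<alpha>)) *\<^sub>C g \<i>"
        by (simp only: scaleC_minus_right scaleC_minus_left scaleC_scaleC)
      also have "- ((w - \<i>) / (w + \<i>) * cnj \<alpha>) = 2 * \<i> / (w + \<i>)"
        unfolding b using n1 by simp
      finally show ?thesis unfolding eq .
    qed
    finally show ?thesis by (simp add: scaleC_scaleC)
  qed
  then have *: "g w = (1 / (w - cnj \<i>)) *\<^sub>C ((2 * \<i>) *\<^sub>C g \<i>)" if "Im w > 0" for w
    using that by (simp only: complex_cnj_i diff_minus_eq_add)
  have "\<psi> u = hker \<i> ((2 * \<i>) *\<^sub>C g \<i>)"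
    by (rule H2_eqI[OF g hardy_hker *]) simp_all
  then show "\<exists>k. \<psi> u = hker \<i> k" by blast
qed

text \<open>The inverse of \<open>\<psi>\<close> on the kernels at \<open>i\<close>. It is isometric
  up to a constant only; counting dimensions takes no more than a linear bijection onto
  \<open>M\<close>.\<close>

definition \<Phi> :: "'k \<Rightarrow> 'h L2"
  where "\<Phi> k = (SOME u. \<psi> u = hker \<i> k)"

lemma psi_Phi: "\<psi> (\<Phi> k) = hker \<i> k"
proof -
  obtain u where "\<psi> u = hker \<i> k" using unitary_surj[OF unitary, of "hker \<i> k"] by metis
  then show ?thesis unfolding \<Phi>_def by (rule someI)
qed

lemma Phi_add: "\<Phi> (k + l) = \<Phi> k + \<Phi> l"
  by (rule unitary_inj[OF unitary]) (simp add: \<psi>_simps psi_Phi hker_add)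

lemma Phi_scaleC: "\<Phi> (a *\<^sub>C k) = a *\<^sub>C \<Phi> k"
  by (rule unitary_inj[OF unitary]) (simp add: \<psi>_simps psi_Phi hker_scaleC)

lemma Phi_eq_0: "\<Phi> k = 0 \<Longrightarrow> k = 0"
  using psi_Phi[of k] unitary_zero[OF unitary] hker_ne_zero[of \<i> k] by simp

lemma range_Phi: "range \<Phi> = M"
proof (intro equalityI subsetI)
  fix u assume "u \<in> M"
  then obtain k where "\<psi> u = hker \<i> k" using M_iff by blast
  then have "\<psi> u = \<psi> (\<Phi> k)" using psi_Phi[of k] by simp
  then have "u = \<Phi> k" by (rule unitary_inj[OF unitary])
  then show "u \<in> range \<Phi>" by simp
next
  fix u assume "u \<in> range \<Phi>"
  then show "u \<in> M" using psi_Phi M_iff by auto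
qed

section \<open>Kernels that span \<open>M\<close>\<close>

abbreviation G :: "complex \<Rightarrow> 'h \<Rightarrow>\<^sub>L 'h"
  where "G w \<equiv> cadjoint (F w)"

text \<open>Up to constants the reproducing kernel of \<open>M\<close> at \<open>w\<close> in the
  direction \<open>G w k - i k\<close>. Parametrizing by \<open>k\<close> avoids the inverse of
  \<open>G w - i\<close> and gives the simple Cauchy integral in \<open>kap_ext\<close>.\<close>

definition kap :: "complex \<Rightarrow> 'h \<Rightarrow> 'h L2"
  where "kap w k = hker w k - Jop F (hker w (G w k + \<i> *\<^sub>C k))"

lemma kap_ext:
  assumes w: "Im w > 0"
  shows "\<exists>f. hardy_ext f (kap w k) \<and>
    (\<forall>z. Im z > 0 \<longrightarrow> f z = (1 / (z - cnj w)) *\<^sub>C resolv (F z) (F z k - G w k))"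
proof (intro exI conjI allI impI)
  let ?d = "G w k + \<i> *\<^sub>C k"
  show "hardy_ext (\<lambda>z. (1 / (z - cnj w)) *\<^sub>C k - resolv (F z) ((1 / (z - cnj w)) *\<^sub>C ?d)) (kap w k)"
    unfolding kap_def
    by (intro hardy_ext_diff hardy_imp_ext hardy_hker w hardy_Jop)
  fix z :: complex assume z: "Im z > 0"
  note d = F_dissipative[OF z]
  have "resolv (F z) (F z k - G w k) = resolv (F z) ((F z k + \<i> *\<^sub>C k) - ?d)" by simp
  also have "\<dots> = k - resolv (F z) ?d"
    unfolding resolv_diff[OF fd d] resolv_eqI[OF fd d refl] ..
  finally show "(1 / (z - cnj w)) *\<^sub>C k - resolv (F z) ((1 / (z - cnj w)) *\<^sub>C ?d)
      = (1 / (z - cnj w)) *\<^sub>C resolv (F z) (F z k - G w k)"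
    by (simp add: resolv_scaleC[OF fd d] scaleC_diff_right)
qed

lemma hker_H2: "Im w > 0 \<Longrightarrow> hker w k \<in> H2"
  using hardy_hker by (auto simp: H2_iff_hardy)

text \<open>The factorized form, a kernel minus an element of \<open>W H2\<close>. Inner products
  with the first term are point evaluations; those with the second are handled by the isometry of
  \<open>W\<close> or by orthogonality.\<close>

lemma kap_eq:
  assumes w: "Im w > 0"
  shows "(- 2 * \<i>) *\<^sub>C kap w k = hker w (G w k - \<i> *\<^sub>C k) - Wop (hker w (G w k + \<i> *\<^sub>C k))"
proof -
  have "hker w (G w k - \<i> *\<^sub>C k) - hker w (G w k + \<i> *\<^sub>C k) = (- 2 * \<i>) *\<^sub>C hker w k"
  proof -
    have "(G w k - \<i> *\<^sub>C k) - (G w k + \<i> *\<^sub>C k) = (- 2 * \<i>) *\<^sub>C k"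
      by (simp add: scaleC_minus_left scaleC_add_left[symmetric] algebra_simps)
    then show ?thesis by (simp only: hker_diff[OF w, symmetric] hker_scaleC[OF w])
  qed
  then show ?thesis unfolding Wop_def kap_def
    by (simp add: scaleC_diff_right scaleC_minus_left algebra_simps)
qed

lemma cinner_kap:
  assumes w: "Im w > 0"
  shows "cinner ((- 2 * \<i>) *\<^sub>C kap w k) u
    = cinner (hker w (G w k - \<i> *\<^sub>C k)) u - cinner (Wop (hker w (G w k + \<i> *\<^sub>C k))) u"
  unfolding kap_eq[OF w] by (rule cinner_diff_left)

text \<open>With \<open>a = J w (g w)\<close> the value of \<open>W v\<close> at \<open>w\<close> is
  \<open>(F w - i) a\<close>, while \<open>g w = (F w + i) a\<close>. Moving \<open>F w\<close> to
  the other side makes the two terms of \<open>cinner_kap\<close> cancel, the second one after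
  removing \<open>W\<close> by \<open>cinner_Wop\<close>.\<close>

lemma kap_in_M:
  assumes w: "Im w > 0"
  shows "kap w k \<in> M"
  unfolding M_def
proof (intro CollectI conjI ballI)
  show "kap w k \<in> H2"
    unfolding kap_def
    by (intro complex_vector.subspace_diff[OF subspace_H2] Jop_H2 hker_H2 w)
  fix v :: "'h L2" assume "v \<in> H2"
  then obtain g where g: "hardy g v" by (auto simp: H2_iff_hardy)
  have W: "hardy_ext (\<lambda>z. g z - (2 * \<i>) *\<^sub>C resolv (F z) (g z)) (Wop v)"
    unfolding Wop_def by (intro hardy_ext_diff hardy_ext_scaleC hardy_imp_ext hardy_Jop g)
  define a where "a = resolv (F w) (g w)"
  have gw: "g w = F w a + \<i> *\<^sub>C a" unfolding a_def by (simp add: fd F_dissipative w)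
  have adj: "cinner (G w k) a = cinner k (F w a)"
    using F_adjoint[OF w] cinner_commute[of "G w k" a] cinner_commute[of k "F w a"]
    by (simp add: is_adjoint_def)
  have "cinner (G w k - \<i> *\<^sub>C k) (g w - (2 * \<i>) *\<^sub>C a) = cinner (G w k + \<i> *\<^sub>C k) (g w)"
  proof -
    have "g w - (2 * \<i>) *\<^sub>C a = F w a - \<i> *\<^sub>C a"
      unfolding gw by (simp add: scaleC_diff_left[symmetric] add_diff_eq[symmetric] scaleC_minus_left)
    then show ?thesis unfolding gw
      by (simp add: cinner_add_left cinner_add_right cinner_diff_left cinner_diff_right
          cinner_scaleC_left cinner_scaleC_right adj algebra_simps)
  qed
  then have "cinner (hker w (G w k - \<i> *\<^sub>C k)) (Wop v) = cinner (hker w (G w k + \<i> *\<^sub>C k)) v"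
    using W hardy_imp_ext[OF g] w unfolding hardy_ext_def a_def by metis
  then have "cinner ((- 2 * \<i>) *\<^sub>C kap w k) (Wop v) = 0"
    unfolding cinner_kap[OF w] by (simp add: cinner_Wop)
  then have "cnj (- 2 * \<i>) * cinner (kap w k) (Wop v) = 0" by (simp only: cinner_scaleC_left)
  then show "cinner (kap w k) (Wop v) = 0" by simp
qed

text \<open>For \<open>u\<close> in \<open>M\<close> the term in \<open>W H2\<close> drops out of
  \<open>cinner_kap\<close>. What is left is evaluation at \<open>w\<close> in the directions
  \<open>G w k - i k\<close>, and these exhaust the space.\<close>

lemma kap_total:
  assumes u: "u \<in> M" and perp: "\<And>w k. Im w > 0 \<Longrightarrow> cinner (kap w k) u = 0"
  shows "u = 0"
proof -
  obtain f where f: "hardy f u" using u by (auto simp: M_def H2_iff_hardy)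
  have "f w = 0" if w: "Im w > 0" for w
  proof -
    have "cinner c (f w) = 0" for c
    proof -
      obtain k where k: "G w k - \<i> *\<^sub>C k = c"
        using dissipative_adjoint_surj[OF fd F_dissipative[OF w] F_adjoint[OF w]] by blast
      have "cinner u (Wop (hker w (G w k + \<i> *\<^sub>C k))) = 0"
        using u hker_H2[OF w] unfolding M_def by blast
      then have 0: "cinner (Wop (hker w (G w k + \<i> *\<^sub>C k))) u = 0"
        using cinner_commute[of "Wop (hker w (G w k + \<i> *\<^sub>C k))" u] by simp
      have "cinner ((- 2 * \<i>) *\<^sub>C kap w k) u = 0"
        unfolding cinner_scaleC_left perp[OF w] by simp
      then have "cinner (hker w c) u = 0"
        unfolding cinner_kap[OF w] 0 k by simp
      then show ?thesis using hardy_imp_ext[OF f] w by (simp add: hardy_ext_def)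
    qed
    then show ?thesis using cinner_self_eq_0_iff by blast
  qed
  then show ?thesis using H2_ext_zero[of u f] u hardy_imp_ext[OF f] by (simp add: M_def)
qed

end

subsection \<open>Vector-valued polynomials\<close>

text \<open>\<open>N\<close> counts coefficients, so the degree is below \<open>N\<close>: division
  by a linear factor lowers the bound by one, and \<open>N = 0\<close> leaves only the zero
  function.\<close>

definition vpoly :: "nat \<Rightarrow> (complex \<Rightarrow> 'a::complex_normed_vector) \<Rightarrow> bool"
  where "vpoly N f \<longleftrightarrow> (\<exists>a. \<forall>z. f z = (\<Sum>i<N. z ^ i *\<^sub>C a i))"

lemma vpoly_Suc_iff: "vpoly (Suc N) f \<longleftrightarrow> (\<exists>c h. vpoly N h \<and> (\<forall>z. f z = c + z *\<^sub>C h z))"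
proof
  assume "vpoly (Suc N) f"
  then obtain a where a: "\<And>z. f z = (\<Sum>i<Suc N. z ^ i *\<^sub>C a i)" by (auto simp: vpoly_def)
  have "f z = a 0 + z *\<^sub>C (\<Sum>i<N. z ^ i *\<^sub>C a (Suc i))" for z
    unfolding a sum.lessThan_Suc_shift scaleC_sum_right by (simp add: scaleC_scaleC)
  then show "\<exists>c h. vpoly N h \<and> (\<forall>z. f z = c + z *\<^sub>C h z)"
    by (intro exI[of _ "a 0"] exI[of _ "\<lambda>z. \<Sum>i<N. z ^ i *\<^sub>C a (Suc i)"]) (auto simp: vpoly_def)
next
  assume "\<exists>c h. vpoly N h \<and> (\<forall>z. f z = c + z *\<^sub>C h z)"
  then obtain c a where f: "\<And>z. f z = c + z *\<^sub>C (\<Sum>i<N. z ^ i *\<^sub>C a i)" by (auto simp: vpoly_def)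
  have "f z = (\<Sum>i<Suc N. z ^ i *\<^sub>C case_nat c a i)" for z
    unfolding f sum.lessThan_Suc_shift scaleC_sum_right by (simp add: scaleC_scaleC)
  then show "vpoly (Suc N) f" unfolding vpoly_def by blast
qed

lemma vpoly_0_iff: "vpoly 0 f \<longleftrightarrow> (\<forall>z. f z = 0)"
  by (simp add: vpoly_def)

lemma vpoly_Suc: "vpoly N f \<Longrightarrow> vpoly (Suc N) f"
proof -
  assume "vpoly N f"
  then obtain a where a: "\<And>z. f z = (\<Sum>i<N. z ^ i *\<^sub>C a i)" by (auto simp: vpoly_def)
  have "f z = (\<Sum>i<Suc N. z ^ i *\<^sub>C (a(N := 0)) i)" for z
    unfolding a by simp
  then show ?thesis unfolding vpoly_def by blast
qed

lemma vpoly_mono: "N \<le> M \<Longrightarrow> vpoly N f \<Longrightarrow> vpoly M f"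
  by (induction M rule: dec_induct) (auto intro: vpoly_Suc)

lemma vpoly_add:
  assumes "vpoly N f" "vpoly N g"
  shows "vpoly N (\<lambda>z. f z + g z)"
proof -
  from assms obtain a b where "\<And>z. f z = (\<Sum>i<N. z ^ i *\<^sub>C a i)" "\<And>z. g z = (\<Sum>i<N. z ^ i *\<^sub>C b i)"
    by (auto simp: vpoly_def)
  then have "f z + g z = (\<Sum>i<N. z ^ i *\<^sub>C (a i + b i))" for z
    by (simp add: scaleC_add_right sum.distrib)
  then show ?thesis unfolding vpoly_def by (intro exI allI)
qed

lemma vpoly_map:
  assumes "vpoly N f" and add: "\<And>x y. T (x + y) = T x + T y" and scale: "\<And>a x. T (a *\<^sub>C x) = a *\<^sub>C T x"
  shows "vpoly N (\<lambda>z. T (f z))"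
proof -
  from assms(1) obtain a where f: "\<And>z. f z = (\<Sum>i<N. z ^ i *\<^sub>C a i)"
    by (auto simp: vpoly_def)
  have T0: "T 0 = 0" using scale[of 0 0] by simp
  have "T (\<Sum>i<n. z ^ i *\<^sub>C a i) = (\<Sum>i<n. z ^ i *\<^sub>C T (a i))" for z n
    by (induction n) (simp_all add: T0 add scale)
  then have "T (f z) = (\<Sum>i<N. z ^ i *\<^sub>C T (a i))" for z
    by (simp add: f)
  then show ?thesis unfolding vpoly_def by (intro exI allI)
qed

definition ispoly :: "(complex \<Rightarrow> 'a::complex_normed_vector) \<Rightarrow> bool"
  where "ispoly f \<longleftrightarrow> (\<exists>N. vpoly N f)"

lemma ispoly_add: "ispoly f \<Longrightarrow> ispoly g \<Longrightarrow> ispoly (\<lambda>z. f z + g z)"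
  unfolding ispoly_def using vpoly_mono vpoly_add by (metis max.cobounded1 max.cobounded2)

lemma ispoly_map:
  "ispoly f \<Longrightarrow> (\<And>x y. T (x + y) = T x + T y) \<Longrightarrow> (\<And>a x. T (a *\<^sub>C x) = a *\<^sub>C T x) \<Longrightarrow>
    ispoly (\<lambda>z. T (f z))"
  unfolding ispoly_def using vpoly_map by blast

lemma ispoly_const: "ispoly (\<lambda>_. c)"
  unfolding ispoly_def vpoly_def by (intro exI[of _ 1] exI[of _ "\<lambda>_. c"]) simp

lemma ispoly_scaleC: "ispoly f \<Longrightarrow> ispoly (\<lambda>z. c *\<^sub>C f z)"
  by (rule ispoly_map) (simp_all add: scaleC_add_right scaleC_scaleC mult.commute)

lemma ispoly_mult_ident: "ispoly f \<Longrightarrow> ispoly (\<lambda>z. z *\<^sub>C f z)"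
  unfolding ispoly_def using vpoly_Suc_iff[of _ "\<lambda>z. z *\<^sub>C f z"] by (metis add_0)

lemma ispoly_sum: "(\<And>i. i \<in> I \<Longrightarrow> ispoly (f i)) \<Longrightarrow> ispoly (\<lambda>z. \<Sum>i\<in>I. f i z)"
  by (induction I rule: infinite_finite_induct) (simp_all add: ispoly_const ispoly_add)

lemma ispoly_mult_poly: "ispoly f \<Longrightarrow> ispoly (\<lambda>z. poly p z *\<^sub>C f z)"
proof (induction p)
  case 0
  then show ?case by (simp add: ispoly_const)
next
  case (pCons a p)
  have "ispoly (\<lambda>z. a *\<^sub>C f z + z *\<^sub>C (poly p z *\<^sub>C f z))"
    using pCons by (intro ispoly_add ispoly_scaleC ispoly_mult_ident) auto
  then show ?case by (simp add: scaleC_add_left scaleC_scaleC)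
qed

text \<open>Roots form a list, so that multiplicities can be counted and a single root can be
  cancelled.\<close>

definition qlist :: "complex list \<Rightarrow> complex \<Rightarrow> complex"
  where "qlist rs z = prod_list (map (\<lambda>r. z - r) rs)"

lemma qlist_simps [simp]: "qlist [] z = 1" "qlist (r # rs) z = (z - r) * qlist rs z"
  by (simp_all add: qlist_def)

lemma qlist_eq_0_iff: "qlist rs z = 0 \<longleftrightarrow> z \<in> set rs"
  by (induction rs) auto

lemma qlist_remove: "r \<in> set rs \<Longrightarrow> qlist rs z = (z - r) * qlist (remove1 r rs) z"
  by (induction rs) auto

lemma distinct_if_count_list_le_1: "(\<And>r. count_list rs r \<le> 1) \<Longrightarrow> distinct rs"
proof (induction rs)
  case (Cons s rs)
  have "count_list rs r \<le> 1" for r using Cons.prems[of r] by (simp split: if_splits)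
  moreover have "count_list rs s = 0" using Cons.prems[of s] by simp
  ultimately show ?case using Cons.IH by (simp add: count_list_0_iff)
qed simp

lemma qlist_cnj: "qlist (map cnj rs) z = cnj (qlist rs (cnj z))"
  by (induction rs) auto

lemma qlist_count: "qlist rs z = (z - r) ^ count_list rs r * qlist (filter (\<lambda>s. s \<noteq> r) rs) z"
  by (induction rs) auto

lemma ispoly_mult_qlist: "ispoly f \<Longrightarrow> ispoly (\<lambda>z. qlist rs z *\<^sub>C f z)"
proof (induction rs)
  case (Cons r rs)
  have "ispoly (\<lambda>z. z *\<^sub>C (qlist rs z *\<^sub>C f z) + (- r) *\<^sub>C (qlist rs z *\<^sub>C f z))"
    using Cons by (intro ispoly_add ispoly_scaleC ispoly_mult_ident) auto
  then show ?case by (simp add: scaleC_diff_left scaleC_minus_left scaleC_scaleC left_diff_distrib)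
qed simp

text \<open>Horner's scheme: if \<open>f z = c + z h z\<close> and \<open>h\<close> has the quotient
  \<open>g\<close>, then the quotient of \<open>f\<close> is \<open>h r + z g z\<close>.\<close>

lemma vpoly_divide:
  "vpoly (Suc N) f \<Longrightarrow> \<exists>g. vpoly N g \<and> (\<forall>z. f z = f r + (z - r) *\<^sub>C g z)"
proof (induction N arbitrary: f)
  case 0
  then obtain c h where "vpoly 0 h" "\<And>z. f z = c + z *\<^sub>C h z" unfolding vpoly_Suc_iff[of 0] by blast
  then have "f z = f r" for z by (simp add: vpoly_0_iff)
  then show ?case by (intro exI[of _ "\<lambda>_. 0"]) (simp add: vpoly_0_iff)
next
  case (Suc N)
  then obtain c h where h: "vpoly (Suc N) h" "\<And>z. f z = c + z *\<^sub>C h z"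
    unfolding vpoly_Suc_iff[of "Suc N"] by blast
  from Suc.IH[OF h(1)] obtain g where g: "vpoly N g" "\<And>z. h z = h r + (z - r) *\<^sub>C g z" by blast
  have "vpoly (Suc N) (\<lambda>z. h r + z *\<^sub>C g z)"
    using g(1) vpoly_Suc_iff by blast
  moreover have "f z = f r + (z - r) *\<^sub>C (h r + z *\<^sub>C g z)" for z
  proof -
    have "f z = c + z *\<^sub>C (h r + (z - r) *\<^sub>C g z)" using h(2)[of z] g(2)[of z] by simp
    also have "\<dots> = (c + r *\<^sub>C h r) + (z - r) *\<^sub>C (h r + z *\<^sub>C g z)"
      by (simp add: scaleC_add_right scaleC_diff_left scaleC_diff_right scaleC_scaleC algebra_simps)
    finally show ?thesis using h(2)[of r] by simp
  qed
  ultimately show ?case by (intro exI conjI allI)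
qed

lemma ispoly_divide: "ispoly f \<Longrightarrow> \<exists>g. ispoly g \<and> (\<forall>z. f z = f r + (z - r) *\<^sub>C g z)"
  unfolding ispoly_def using vpoly_divide vpoly_Suc by blast

lemma vpoly_eq_0:
  "vpoly N f \<Longrightarrow> infinite S \<Longrightarrow> (\<And>z. z \<in> S \<Longrightarrow> f z = 0) \<Longrightarrow> f z = 0"
proof (induction N arbitrary: f S z)
  case (Suc N)
  obtain r where r: "r \<in> S" using Suc.prems(2) by (metis ex_in_conv finite.emptyI)
  obtain g where g: "vpoly N g" "\<And>z. f z = f r + (z - r) *\<^sub>C g z"
    using vpoly_divide[OF Suc.prems(1)] by blast
  have "g z = 0" for z
  proof (rule Suc.IH[OF g(1), of "S - {r}"])
    show "infinite (S - {r})" using Suc.prems(2) by simp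
    fix z assume z: "z \<in> S - {r}"
    then have "(z - r) *\<^sub>C g z = 0" using g(2)[of z] Suc.prems(3)[of z] Suc.prems(3)[OF r] by simp
    then show "g z = 0" using z by simp
  qed
  then show ?case using g(2)[of z] Suc.prems(3)[OF r] by simp
qed (simp add: vpoly_0_iff)

lemma ispoly_eqI:
  assumes f: "ispoly f" and g: "ispoly g" and S: "infinite S" and eq: "\<And>z. z \<in> S \<Longrightarrow> f z = g z"
  shows "f z = g z"
proof -
  have "ispoly (\<lambda>z. f z + (- 1) *\<^sub>C g z)" by (intro ispoly_add ispoly_scaleC f g)
  then obtain N where "vpoly N (\<lambda>z. f z + (- 1) *\<^sub>C g z)" by (auto simp: ispoly_def)
  from vpoly_eq_0[OF this S, of z] eq show ?thesis by (simp add: scaleC_minus_left)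
qed

lemma ispoly_tendsto: "ispoly f \<Longrightarrow> (h \<longlongrightarrow> z) A \<Longrightarrow> ((\<lambda>x. f (h x)) \<longlongrightarrow> f z) A"
  unfolding ispoly_def vpoly_def
  by (auto intro!: tendsto_sum tendsto_scaleC tendsto_power tendsto_const)

lemma qlist_tendsto: "(h \<longlongrightarrow> z) A \<Longrightarrow> ((\<lambda>x. qlist rs (h x)) \<longlongrightarrow> qlist rs z) A"
  by (induction rs) (auto intro!: tendsto_intros)

lemma partial_fraction_two:
  fixes a b :: "'a::field"
  assumes "a \<noteq> 0" "b \<noteq> 0" "a - b \<noteq> 0"
  shows "1 / a * (1 / b) = 1 / b * (1 / (a - b)) - 1 / a * (1 / (a - b))"
proof -
  have "1 / b - 1 / a = (a - b) * (1 / a * (1 / b))"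
    using assms by (simp add: field_simps)
  then have "(1 / b - 1 / a) * (1 / (a - b)) = 1 / a * (1 / b)"
    using assms by simp
  then show ?thesis by (simp only: left_diff_distrib)
qed

text \<open>Induction on the poles. Division by a new factor \<open>z - s\<close> acts on the
  polynomial part through \<open>ispoly_divide\<close> and on each old pole through the identity for
  two poles; distinct roots keep \<open>r - s\<close> nonzero.\<close>

lemma partial_fractions:
  assumes "distinct rs" "ispoly f"
  shows "\<exists>g Bs. ispoly g \<and>
    (\<forall>z. z \<notin> set rs \<longrightarrow> (1 / qlist rs z) *\<^sub>C f z = g z + (\<Sum>r\<in>set rs. (1 / (z - r)) *\<^sub>C Bs r))"
  using assms(1)
proof (induction rs)
  case Nil
  then show ?case using assms(2) by auto
next
  case (Cons s rs)
  then obtain g Bs where g: "ispoly g"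
    and eq: "\<And>z. z \<notin> set rs \<Longrightarrow> (1 / qlist rs z) *\<^sub>C f z = g z + (\<Sum>r\<in>set rs. (1 / (z - r)) *\<^sub>C Bs r)"
    by auto
  obtain h where h: "ispoly h" "\<And>z. g z = g s + (z - s) *\<^sub>C h z" using ispoly_divide[OF g] by blast
  \<comment> \<open>The coefficient at \<open>s\<close> collects the value of the old polynomial
    part and what each old pole contributes there.\<close>
  define Bs' where "Bs' r = (if r = s then g s - (\<Sum>r\<in>set rs. (1 / (r - s)) *\<^sub>C Bs r) else (1 / (r - s)) *\<^sub>C Bs r)" for r
  have s: "s \<notin> set rs" using Cons.prems by simp
  have "(1 / qlist (s # rs) z) *\<^sub>C f z = h z + (\<Sum>r\<in>set (s # rs). (1 / (z - r)) *\<^sub>C Bs' r)" if z: "z \<notin> set (s # rs)" for z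
  proof -
    have zs: "z - s \<noteq> 0" using z by simp
    have "(1 / qlist (s # rs) z) *\<^sub>C f z = (1 / (z - s)) *\<^sub>C ((1 / qlist rs z) *\<^sub>C f z)"
      by (simp add: scaleC_scaleC)
    also have "\<dots> = (1 / (z - s)) *\<^sub>C g z + (\<Sum>r\<in>set rs. (1 / (z - s)) *\<^sub>C ((1 / (z - r)) *\<^sub>C Bs r))"
      using eq[of z] z by (simp add: scaleC_add_right scaleC_sum_right)
    also have "(1 / (z - s)) *\<^sub>C g z = (1 / (z - s)) *\<^sub>C g s + h z"
      unfolding h(2)[of z] using zs by (simp add: scaleC_add_right scaleC_scaleC)
    also have "(\<Sum>r\<in>set rs. (1 / (z - s)) *\<^sub>C ((1 / (z - r)) *\<^sub>C Bs r))
        = (\<Sum>r\<in>set rs. (1 / (z - r)) *\<^sub>C ((1 / (r - s)) *\<^sub>C Bs r) - (1 / (z - s)) *\<^sub>C ((1 / (r - s)) *\<^sub>C Bs r))"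
    proof (rule sum.cong[OF refl])
      fix r assume r: "r \<in> set rs"
      then have "r - s \<noteq> 0" "z - r \<noteq> 0" using s z by auto
      then have "1 / (z - s) * (1 / (z - r)) = 1 / (z - r) * (1 / (r - s)) - 1 / (z - s) * (1 / (r - s))"
        using partial_fraction_two[of "z - s" "z - r"] zs by simp
      then show "(1 / (z - s)) *\<^sub>C ((1 / (z - r)) *\<^sub>C Bs r)
          = (1 / (z - r)) *\<^sub>C ((1 / (r - s)) *\<^sub>C Bs r) - (1 / (z - s)) *\<^sub>C ((1 / (r - s)) *\<^sub>C Bs r)"
        by (simp only: scaleC_scaleC scaleC_diff_left[symmetric])
    qed
    also have "\<dots> = (\<Sum>r\<in>set rs. (1 / (z - r)) *\<^sub>C ((1 / (r - s)) *\<^sub>C Bs r))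
        - (1 / (z - s)) *\<^sub>C (\<Sum>r\<in>set rs. (1 / (r - s)) *\<^sub>C Bs r)"
      by (simp only: sum_subtractf scaleC_sum_right)
    also have "(\<Sum>r\<in>set rs. (1 / (z - r)) *\<^sub>C ((1 / (r - s)) *\<^sub>C Bs r)) = (\<Sum>r\<in>set rs. (1 / (z - r)) *\<^sub>C Bs' r)"
      by (rule sum.cong) (use s in \<open>auto simp: Bs'_def\<close>)
    finally show ?thesis using s by (simp add: Bs'_def scaleC_diff_right algebra_simps)
  qed
  then show ?case using h(1) by blast
qed

subsection \<open>Rational Pick functions\<close>

text \<open>The diagonal at \<open>x + y\<close> gives the sum of \<open>T x y\<close> and
  \<open>T y x\<close>, the diagonal at \<open>x + i y\<close> their difference.\<close>

lemma sesquilinear_polarization: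
  fixes T :: "'h::complex_normed_vector \<Rightarrow> 'h \<Rightarrow> complex"
  assumes addl: "\<And>x y z. T (x + y) z = T x z + T y z" and addr: "\<And>x y z. T x (y + z) = T x y + T x z"
    and il: "\<And>x y. T (\<i> *\<^sub>C x) y = - \<i> * T x y" and ir: "\<And>x y. T x (\<i> *\<^sub>C y) = \<i> * T x y"
    and diag: "\<And>x. T x x = 0"
  shows "T x y = 0"
proof -
  have "T x y + T y x = 0" using diag[of "x + y"] diag[of x] diag[of y] by (simp add: addl addr add.commute)
  moreover have "\<i> * T x y - \<i> * T y x = 0"
    using diag[of "x + \<i> *\<^sub>C y"] diag[of x] diag[of y] by (simp add: addl addr il ir)
  then have "T x y = T y x" by (simp add: right_diff_distrib[symmetric])
  ultimately show ?thesis by simp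
qed

lemma complex_linear_eq_0:
  fixes A :: "'h::complex_hilbert \<Rightarrow>\<^sub>L 'h"
  assumes "complex_linear A" "\<And>h. cinner h (A h) = 0"
  shows "A = 0"
proof (rule blinfun_eqI)
  fix y
  have "cinner x (A y) = 0" for x
    by (rule sesquilinear_polarization[of "\<lambda>x y. cinner x (A y)"])
      (use assms in \<open>auto simp: cinner_add_left cinner_add_right blinfun.add_right complex_linear_def
        cinner_scaleC_left cinner_scaleC_right\<close>)
  from this[of "A y"] show "A y = (0 :: 'h \<Rightarrow>\<^sub>L 'h) y" by (simp add: blinfun.zero_left)
qed

lemma positive_selfadjoint:
  fixes A :: "'h::complex_hilbert \<Rightarrow>\<^sub>L 'h"
  assumes "complex_linear A" "\<And>h. Im (cinner h (A h)) = 0"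
  shows "selfadjoint_op A"
proof -
  have "cinner (A x) y - cinner x (A y) = 0" for x y
  proof (rule sesquilinear_polarization[of "\<lambda>x y. cinner (A x) y - cinner x (A y)"])
    fix x
    have "cinner (A x) x = cnj (cinner x (A x))" by (rule cinner_commute)
    then show "cinner (A x) x - cinner x (A x) = 0" using assms(2)[of x] by (simp add: complex_eq_iff)
  qed (use assms(1) in \<open>auto simp: cinner_add_left cinner_add_right blinfun.add_right complex_linear_def
        cinner_scaleC_left cinner_scaleC_right algebra_simps\<close>)
  then show ?thesis using assms(1) by (simp add: selfadjoint_op_def is_adjoint_def)
qed

lemma complex_linear_limit:
  fixes A :: "'b \<Rightarrow> 'h::complex_hilbert \<Rightarrow>\<^sub>L 'h" and L :: "'h \<Rightarrow>\<^sub>L 'h"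
  assumes "\<forall>\<^sub>F w in F. complex_linear (A w)" "(A \<longlongrightarrow> L) F" "F \<noteq> bot"
  shows "complex_linear L"
  unfolding complex_linear_def
proof (intro allI)
  fix a x
  have 1: "((\<lambda>w. A w (a *\<^sub>C x)) \<longlongrightarrow> L (a *\<^sub>C x)) F"
    by (intro blinfun.tendsto assms(2) tendsto_const)
  have 2: "((\<lambda>w. a *\<^sub>C A w x) \<longlongrightarrow> a *\<^sub>C L x) F"
    by (intro tendsto_scaleC blinfun.tendsto assms(2) tendsto_const)
  have "\<forall>\<^sub>F w in F. a *\<^sub>C A w x = A w (a *\<^sub>C x)"
    using assms(1) by eventually_elim (simp add: complex_linear_def)
  with 2 have "((\<lambda>w. A w (a *\<^sub>C x)) \<longlongrightarrow> a *\<^sub>C L x) F"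
    by (rule Lim_transform_eventually)
  from tendsto_unique[OF assms(3) 1 this] show "L (a *\<^sub>C x) = a *\<^sub>C L x" .
qed

text \<open>A leading term \<open>b e\<^sup>-\<^sup>i\<^sup>m\<^sup>\<theta>\<close> keeps its imaginary part nonnegative on a half circle only
  if it makes at most half a turn there.\<close>

lemma half_circle_positive:
  assumes "m \<ge> 1" and pos: "\<And>\<theta>. 0 < \<theta> \<Longrightarrow> \<theta> < pi \<Longrightarrow> 0 \<le> Im (cis (- real m * \<theta>) * b)"
  shows "Im b = 0 \<and> Re b \<le> 0" "m \<ge> 2 \<Longrightarrow> b = 0"
proof -
  have form: "Im (cis (- t) * b) = Im b * cos t - Re b * sin t" for t
    by (simp add: algebra_simps)
  have pos': "0 \<le> Im b * cos t - Re b * sin t" if "0 < t" "t < real m * pi" for t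
    using pos[of "t / m"] assms(1) that form[of t] by (simp add: field_simps)
  have m: "pi \<le> real m * pi" using assms(1) by simp
  have re: "Re b \<le> 0" using pos'[of "pi / 2"] m pi_gt_zero by simp
  \<comment> \<open>At the angles 0 and \<open>pi\<close> the cosine has opposite signs, which
    forces \<open>Im b = 0\<close>. For \<open>m = 1\<close> both lie on the boundary of the
    admissible interval, hence the limits.\<close>
  have lim: "0 \<le> Im b * cos t0 - Re b * sin t0" if A: "A \<noteq> bot" "((\<lambda>t. t) \<longlongrightarrow> t0) A"
    "\<forall>\<^sub>F t in A. 0 < t \<and> t < real m * pi" for t0 A
  proof (rule tendsto_lowerbound[OF _ _ A(1)])
    show "((\<lambda>t. Im b * cos t - Re b * sin t) \<longlongrightarrow> Im b * cos t0 - Re b * sin t0) A"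
      by (intro tendsto_intros A(2))
    show "\<forall>\<^sub>F t in A. 0 \<le> Im b * cos t - Re b * sin t"
      using A(3) by eventually_elim (use pos' in auto)
  qed
  have "0 \<le> Im b * cos 0 - Re b * sin 0"
  proof (rule lim[of "at_right 0"])
    show "\<forall>\<^sub>F t in at_right 0. 0 < t \<and> t < real m * pi"
      using m by (auto simp: eventually_at_right_field intro!: exI[of _ pi] less_le_trans[OF _ m])
  qed (auto intro: tendsto_ident_at)
  moreover have "0 \<le> Im b * cos pi - Re b * sin pi"
  proof (rule lim[of "at_left pi"])
    show "\<forall>\<^sub>F t in at_left pi. 0 < t \<and> t < real m * pi"
      using m by (auto simp: eventually_at_left_field intro!: exI[of _ 0] less_le_trans[OF _ m])
  qed (auto intro: tendsto_ident_at)
  ultimately have im: "Im b = 0" by simp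
  with re show "Im b = 0 \<and> Re b \<le> 0" by simp
  show "b = 0" if "m \<ge> 2"
  proof -
    \<comment> \<open>An angle that is admissible only for \<open>m \<ge> 2\<close>; the sine is -1
      there and reverses the sign condition on \<open>Re b\<close>.\<close>
    have "3 * pi / 2 < real m * pi"
    proof -
      have "2 * pi \<le> real m * pi" using that by (intro mult_right_mono) auto
      then show ?thesis using pi_gt_zero by linarith
    qed
    then have "0 \<le> - Re b * sin (3 * pi / 2)" using pos'[of "3 * pi / 2"] im by simp
    moreover have "sin (3 * pi / 2) = -1"
      using sin_periodic_pi[of "pi / 2"] by (simp add: field_simps)
    ultimately show ?thesis using im re by (simp add: complex_eq_iff)
  qed
qed


lemma selfadjoint_add: "selfadjoint_op A \<Longrightarrow> selfadjoint_op B \<Longrightarrow> selfadjoint_op (A + B)"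
  by (auto simp: selfadjoint_op_def complex_linear_def is_adjoint_def blinfun.add_left
      cinner_add_left cinner_add_right scaleC_add_right)

lemma selfadjoint_scale: "selfadjoint_op A \<Longrightarrow> Im c = 0 \<Longrightarrow> selfadjoint_op (c *\<^sub>C A)"
  by (auto simp: selfadjoint_op_def complex_linear_def is_adjoint_def scaleC_blinfun.rep_eq
      cinner_scaleC_left cinner_scaleC_right scaleC_scaleC mult.commute complex_eq_iff[of "cnj c" c])

lemma selfadjoint_zero: "selfadjoint_op 0"
  by (simp add: selfadjoint_op_def complex_linear_def is_adjoint_def blinfun.zero_left)

lemma selfadjoint_sum:
  "(\<And>i. i \<in> I \<Longrightarrow> selfadjoint_op (A i)) \<Longrightarrow> selfadjoint_op (\<Sum>i\<in>I. A i)"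
  by (induction I rule: infinite_finite_induct)
    (auto intro: selfadjoint_add selfadjoint_zero)

lemma ray_at_infinity: "filterlim (\<lambda>t. of_real t * cis \<theta>) at_infinity at_top"
  unfolding filterlim_at_infinity_conv_norm_at_top
  by (rule filterlim_at_top_mono[OF filterlim_ident])
    (use eventually_ge_at_top[of "0::real"] in \<open>eventually_elim, simp add: norm_mult\<close>)

text \<open>Turns statements about almost every boundary point into infinitely many points, enough
  to identify polynomials.\<close>

lemma AE_lborel_infinite:
  assumes "AE x::real in lborel. P x"
  shows "infinite {x. P x}"
proof
  assume "finite {x. P x}"
  then have "AE x in lborel. x \<notin> {x. P x}"
    by (intro AE_not_in finite_imp_null_set_lborel)
  with assms have "AE x::real in lborel. False" by eventually_elim simp
  then show False by (simp add: AE_iff_null null_sets_def)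
qed

text \<open>The Schwarz reflection conjugates the coefficients; it serves to exclude poles in the
  lower half-plane.\<close>

lemma ispoly_cnj:
  assumes "ispoly (\<phi> :: complex \<Rightarrow> complex)"
  shows "ispoly (\<lambda>z. cnj (\<phi> (cnj z)))"
proof -
  obtain N a where "\<And>z. \<phi> z = (\<Sum>i<N. z ^ i *\<^sub>C a i)" using assms by (auto simp: ispoly_def vpoly_def)
  then have "cnj (\<phi> (cnj z)) = (\<Sum>i<N. z ^ i *\<^sub>C cnj (a i))" for z
    by (simp add: scaleC_complex_def)
  then show ?thesis unfolding ispoly_def vpoly_def by (intro exI allI)
qed

lemma ispoly_form: "ispoly f \<Longrightarrow> ispoly (\<lambda>z. cinner h (blinfun_apply (f z) k))"
  by (rule ispoly_map[of f "\<lambda>A. cinner h (blinfun_apply A k)"])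
    (auto simp: blinfun.add_left cinner_add_right scaleC_blinfun.rep_eq cinner_scaleC_right scaleC_complex_def)

lemma ray_tendsto:
  assumes "Im r = 0" "0 < \<theta>" "\<theta> < pi"
  shows "filterlim (\<lambda>t. r + of_real t * cis \<theta>) (at r within upper_half_plane) (at_right 0)"
  unfolding filterlim_at
proof
  have s: "sin \<theta> > 0" using assms by (simp add: sin_gt_zero)
  show "\<forall>\<^sub>F t in at_right 0. r + of_real t * cis \<theta> \<in> upper_half_plane \<and> r + of_real t * cis \<theta> \<noteq> r"
    using eventually_at_right_less[of "0::real"]
    by eventually_elim (use s assms(1) in \<open>auto simp: complex_eq_iff\<close>)
  have "((\<lambda>t. r + of_real t * cis \<theta>) \<longlongrightarrow> r + of_real 0 * cis \<theta>) (at_right 0)"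
    by (intro tendsto_intros)
  then show "((\<lambda>t. r + of_real t * cis \<theta>) \<longlongrightarrow> r) (at_right 0)" by simp
qed

section \<open>Poles and growth of a Pick function\<close>

context pick_function
begin

text \<open>On the ray of angle \<open>\<theta>\<close> at \<open>r\<close>,
  \<open>(z - r) ^ m\<close> is a positive number times \<open>cis (m * \<theta>)\<close>.
  Nonnegativity of the imaginary part of \<open>F\<close> thus passes to the limit with a phase, and
  \<open>half_circle_positive\<close> fixes the sign of \<open>L\<close> or annihilates it.\<close>

lemma pole_coefficient:
  fixes L :: "'h \<Rightarrow>\<^sub>L 'h"
  assumes r: "Im r = 0" and m: "m \<ge> 1" and H: "(H \<longlongrightarrow> L) (at r within upper_half_plane)"
    and eq: "\<forall>\<^sub>F z in at r within upper_half_plane. (z - r) ^ m *\<^sub>C F z = H z"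
  shows "complex_linear L" "Im (cinner h (L h)) = 0 \<and> Re (cinner h (L h)) \<le> 0" "m \<ge> 2 \<Longrightarrow> L = 0"
proof -
  have L: "((\<lambda>z. (z - r) ^ m *\<^sub>C F z) \<longlongrightarrow> L) (at r within upper_half_plane)"
    using H by (rule Lim_transform_eventually) (use eq in eventually_elim, simp)
  have nb: "at r within upper_half_plane \<noteq> bot"
  proof
    assume "at r within upper_half_plane = bot"
    then have "filterlim (\<lambda>t. r + of_real t * cis (pi / 2)) bot (at_right (0::real))"
      using ray_tendsto[OF r, of "pi / 2"] pi_gt_zero by (simp del: cis_pi_half)
    then have "filtermap (\<lambda>t. r + of_real t * cis (pi / 2)) (at_right (0::real)) = bot"
      unfolding filterlim_def by (rule le_bot)
    then show False by (simp add: filtermap_bot_iff del: cis_pi_half)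
  qed
  show cl: "complex_linear L"
  proof (rule complex_linear_limit[OF _ L nb])
    show "\<forall>\<^sub>F z in at r within upper_half_plane. complex_linear ((z - r) ^ m *\<^sub>C F z)"
    proof -
      have "\<forall>\<^sub>F z in at r within upper_half_plane. Im z > 0"
        by (auto simp: eventually_at_filter)
      then show ?thesis
      proof eventually_elim
        case (elim z)
        show ?case using F_complex_linear[OF elim]
          by (simp add: complex_linear_def scaleC_blinfun.rep_eq scaleC_scaleC mult.commute)
      qed
    qed
  qed
  have pos: "0 \<le> Im (cis (- real m * \<theta>) * cinner h (L h))" if \<theta>: "0 < \<theta>" "\<theta> < pi" for \<theta> h
  proof (rule tendsto_lowerbound)
    let ?z = "\<lambda>t. r + of_real t * cis \<theta>"
    show "((\<lambda>t. Im (cis (- real m * \<theta>) * cinner h (((?z t - r) ^ m *\<^sub>C F (?z t)) h)))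
        \<longlongrightarrow> Im (cis (- real m * \<theta>) * cinner h (L h))) (at_right 0)"
      by (intro tendsto_Im tendsto_mult tendsto_const tendsto_cinner blinfun.tendsto
          filterlim_compose[OF L ray_tendsto[OF r \<theta>]])
    show "\<forall>\<^sub>F t in at_right 0. 0 \<le> Im (cis (- real m * \<theta>) * cinner h (((?z t - r) ^ m *\<^sub>C F (?z t)) h))"
      using eventually_at_right_less[of "0::real"]
    proof eventually_elim
      case (elim t)
      have "Im (?z t) > 0" using elim \<theta> r by (simp add: sin_gt_zero)
      then have "0 \<le> Im (cinner h (F (?z t) h))" using F_dissipative by (simp add: dissipative_def)
      moreover have "cis (- real m * \<theta>) * (?z t - r) ^ m = of_real (t ^ m)"
      proof -
        have "cis (- real m * \<theta>) * cis (real m * \<theta>) = 1" unfolding cis_mult by simp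
        then show ?thesis by (simp add: power_mult_distrib Complex.DeMoivre mult.left_commute)
      qed
      then have "cis (- real m * \<theta>) * cinner h (((?z t - r) ^ m *\<^sub>C F (?z t)) h)
          = of_real (t ^ m) * cinner h (F (?z t) h)"
        by (simp only: scaleC_blinfun.rep_eq cinner_scaleC_right mult.assoc[symmetric])
      ultimately show ?case using elim by simp
    qed
  qed simp
  show "Im (cinner h (L h)) = 0 \<and> Re (cinner h (L h)) \<le> 0"
    by (rule half_circle_positive(1)[OF m]) (rule pos)
  show "L = 0" if "m \<ge> 2"
    by (rule complex_linear_eq_0[OF cl], rule half_circle_positive(2)[OF m _ that]) (rule pos)
qed

text \<open>The argument of \<open>pole_coefficient\<close> on rays to infinity, where the phase
  turns the other way.\<close>

lemma infinity_coefficient: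
  fixes L :: "'h \<Rightarrow>\<^sub>L 'h"
  assumes m: "m \<ge> 1"
    and L: "\<And>\<theta>. 0 < \<theta> \<Longrightarrow> \<theta> < pi \<Longrightarrow>
      ((\<lambda>t. (1 / (of_real t * cis \<theta>) ^ m) *\<^sub>C F (of_real t * cis \<theta>)) \<longlongrightarrow> L) at_top"
  shows "complex_linear L" "Im (cinner h (L h)) = 0 \<and> Re (cinner h (L h)) \<ge> 0" "m \<ge> 2 \<Longrightarrow> L = 0"
proof -
  have im: "\<forall>\<^sub>F t in at_top. t > 0 \<and> Im (of_real t * cis \<theta>) > 0" if "0 < \<theta>" "\<theta> < pi" for \<theta>
    using eventually_gt_at_top[of "0::real"] by eventually_elim (use that in \<open>simp add: sin_gt_zero\<close>)
  have half: "0 < pi / 2" "pi / 2 < pi" using pi_gt_zero by linarith+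
  show cl: "complex_linear L"
  proof (rule complex_linear_limit[OF _ L[OF half]])
    show "\<forall>\<^sub>F t in at_top. complex_linear ((1 / (of_real t * cis (pi / 2)) ^ m) *\<^sub>C F (of_real t * cis (pi / 2)))"
      using im[OF half]
    proof eventually_elim
      case (elim t)
      then have "complex_linear (F (of_real t * cis (pi / 2)))" using F_complex_linear by blast
      then show ?case
        by (simp add: complex_linear_def scaleC_blinfun.rep_eq scaleC_scaleC mult.commute del: cis_pi_half)
    qed
  qed simp
  \<comment> \<open>Minus the conjugate has the same imaginary part after the phase is reversed, as
    \<open>half_circle_positive\<close> demands; the sign also turns its conclusion on the real part
    into nonnegativity.\<close>
  have pos: "0 \<le> Im (cis (- real m * \<theta>) * - cnj (cinner h (L h)))" if \<theta>: "0 < \<theta>" "\<theta> < pi" for \<theta> h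
  proof -
    have "0 \<le> Im (cis (real m * \<theta>) * cinner h (L h))"
    proof (rule tendsto_lowerbound)
      let ?z = "\<lambda>t. of_real t * cis \<theta>"
      show "((\<lambda>t. Im (cis (real m * \<theta>) * cinner h (((1 / ?z t ^ m) *\<^sub>C F (?z t)) h)))
          \<longlongrightarrow> Im (cis (real m * \<theta>) * cinner h (L h))) at_top"
        by (intro tendsto_Im tendsto_mult tendsto_const tendsto_cinner blinfun.tendsto L \<theta>)
      show "\<forall>\<^sub>F t in at_top. 0 \<le> Im (cis (real m * \<theta>) * cinner h (((1 / ?z t ^ m) *\<^sub>C F (?z t)) h))"
        using im[OF \<theta>]
      proof eventually_elim
        case (elim t)
        then have "0 \<le> Im (cinner h (F (?z t) h))" using F_dissipative by (simp add: dissipative_def)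
        moreover have "cis (real m * \<theta>) * (1 / ?z t ^ m) = of_real (1 / t ^ m)"
        proof -
          have "cis \<theta> ^ m = cis (real m * \<theta>)" by (rule Complex.DeMoivre)
          then have "?z t ^ m = of_real (t ^ m) * cis (real m * \<theta>)"
            by (simp only: power_mult_distrib of_real_power)
          then show ?thesis using elim by simp
        qed
        then have "cis (real m * \<theta>) * cinner h (((1 / ?z t ^ m) *\<^sub>C F (?z t)) h)
            = of_real (1 / t ^ m) * cinner h (F (?z t) h)"
          by (simp only: scaleC_blinfun.rep_eq cinner_scaleC_right mult.assoc[symmetric])
        ultimately show ?case using elim by (simp del: of_real_divide)
      qed
    qed simp
    also have "Im (cis (real m * \<theta>) * cinner h (L h)) = Im (cis (- real m * \<theta>) * - cnj (cinner h (L h)))"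
      by (simp add: algebra_simps)
    finally show ?thesis .
  qed
  show "Im (cinner h (L h)) = 0 \<and> Re (cinner h (L h)) \<ge> 0"
    using half_circle_positive(1)[OF m, of "- cnj (cinner h (L h))"] pos by simp
  show "L = 0" if "m \<ge> 2"
  proof (rule complex_linear_eq_0[OF cl])
    show "cinner h (L h) = 0" for h
      using half_circle_positive(2)[OF m, of "- cnj (cinner h (L h))"] pos that by simp
  qed
qed


lemma isCont_F: "Im r > 0 \<Longrightarrow> isCont F r"
  using vholomorphic_continuous_on[OF F_vholomorphic] open_upper_half_plane
  by (simp add: continuous_on_eq_continuous_at)

lemma eventually_at_Im: "Im r > 0 \<Longrightarrow> \<forall>\<^sub>F z in at r. Im z > 0"
  using eventually_at_topological[of "\<lambda>z. Im z > 0" r UNIV] open_upper_half_plane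
  by (auto simp: upper_half_plane_def intro!: exI[of _ upper_half_plane])

text \<open>In a reduced fraction the numerator is nonzero at each root of the denominator.
  Holomorphy then excludes roots in the upper half-plane, reflection those in the lower, and the
  sign of the imaginary part multiple real roots and a polynomial part of degree above 1.\<close>

lemma Rat_if_poly_multiple:
  assumes p: "p \<noteq> 0" and f0: "ispoly f0" and pF: "\<And>z. Im z > 0 \<Longrightarrow> poly p z *\<^sub>C F z = f0 z"
  shows "F \<in> Rat"
proof -
  \<comment> \<open>Number of linear factors in a monic denominator; its least value makes the
    fraction reduced.\<close>
  define P where "P n \<longleftrightarrow> (\<exists>rs f. length rs = n \<and> ispoly f \<and> (\<forall>z. Im z > 0 \<longrightarrow> qlist rs z *\<^sub>C F z = f z))" for n
  have "\<exists>n. P n"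
  proof -
    obtain roots where roots: "mset roots = proots p" using ex_mset by blast
    have "poly p z = lead_coeff p * qlist roots z" for z
    proof -
      have "poly p z = poly (smult (lead_coeff p) (\<Prod>x\<in>#mset roots. [:- x, 1:])) z"
        using complex_poly_decompose_multiset[of p] roots by simp
      also have "\<dots> = lead_coeff p * qlist roots z"
        by (simp add: poly_prod_mset qlist_def prod_mset_prod_list[symmetric] algebra_simps)
      finally show ?thesis .
    qed
    then have "qlist roots z *\<^sub>C F z = (1 / lead_coeff p) *\<^sub>C f0 z" if "Im z > 0" for z
      using pF[OF that, symmetric] p by (simp add: scaleC_scaleC)
    then have "P (length roots)"
      unfolding P_def using ispoly_scaleC[OF f0, of "1 / lead_coeff p"] by (intro exI[of _ roots]) blast
    then show ?thesis by blast
  qed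
  then have "P (LEAST n. P n)" by (rule LeastI_ex)
  then obtain rs f where len: "length rs = (LEAST n. P n)" and f: "ispoly f"
    and eq: "\<And>z. Im z > 0 \<Longrightarrow> qlist rs z *\<^sub>C F z = f z" unfolding P_def by blast
  have minimal: "\<not> P n" if "n < length rs" for n
    using not_less_Least[of n P] that len by simp
  have nz: "f r \<noteq> 0" if r: "r \<in> set rs" for r
  proof
    assume "f r = 0"
    obtain g where g: "ispoly g" "\<And>z. f z = f r + (z - r) *\<^sub>C g z" using ispoly_divide[OF f] by blast
    have ne: "qlist (remove1 r rs) z *\<^sub>C F z = g z" if z: "Im z > 0" "z \<noteq> r" for z
    proof -
      have "(z - r) *\<^sub>C (qlist (remove1 r rs) z *\<^sub>C F z) = (z - r) *\<^sub>C g z"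
        using eq[OF z(1)] g(2)[of z] \<open>f r = 0\<close> qlist_remove[OF r, of z] by (simp add: scaleC_scaleC)
      then show ?thesis
        by (rule complex_vector.scale_left_imp_eq[rotated]) (use z in simp)
    qed
    \<comment> \<open>Cancelling \<open>z - r\<close> leaves out the point \<open>r\<close> itself,
      which may lie in the upper half-plane; continuity fills it in.\<close>
    have "qlist (remove1 r rs) z *\<^sub>C F z = g z" if z: "Im z > 0" for z
    proof (cases "z = r")
      case True
      have 1: "((\<lambda>w. qlist (remove1 r rs) w *\<^sub>C F w) \<longlongrightarrow> qlist (remove1 r rs) r *\<^sub>C F r) (at r)"
        using isCont_F[of r] z True
        by (intro tendsto_scaleC qlist_tendsto tendsto_ident_at) (auto simp: isCont_def)
      have "((\<lambda>w. g w) \<longlongrightarrow> g r) (at r)" by (rule ispoly_tendsto[OF g(1) tendsto_ident_at])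
      moreover have "\<forall>\<^sub>F w in at r. g w = qlist (remove1 r rs) w *\<^sub>C F w"
      proof -
        have "\<forall>\<^sub>F w in at r. w \<noteq> r" by (simp add: eventually_at_filter)
        with eventually_at_Im[of r] z True have "\<forall>\<^sub>F w in at r. Im w > 0 \<and> w \<noteq> r"
          by (simp add: eventually_conj)
        then show ?thesis by eventually_elim (simp add: ne)
      qed
      ultimately have "((\<lambda>w. qlist (remove1 r rs) w *\<^sub>C F w) \<longlongrightarrow> g r) (at r)"
        by (rule Lim_transform_eventually)
      from tendsto_unique[OF _ 1 this] show ?thesis using True by simp
    qed (use z ne in simp)
    then have "P (length (remove1 r rs))" unfolding P_def using g(1) by blast
    moreover have "length (remove1 r rs) < length rs"
    proof -
      have "0 < length rs" using r by (rule length_pos_if_in_set)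
      then show ?thesis using r by (simp only: length_remove1 if_True diff_less zero_less_one)
    qed
    ultimately show False using minimal by blast
  qed
  have not_upper: "\<not> Im r > 0" if r: "r \<in> set rs" for r
    using nz[OF r] eq[of r] r qlist_eq_0_iff[of rs r] by auto
  \<comment> \<open>Almost every real point belongs to \<open>S\<close>, so polynomial identities
    may be tested on it.\<close>
  define S where "S = {x. selfadjoint_op (B x) \<and> qlist rs (of_real x) *\<^sub>C B x = f (of_real x)}"
  have AE_S: "AE x in lborel. selfadjoint_op (B x) \<and> qlist rs (of_real x) *\<^sub>C B x = f (of_real x)"
    using AE_boundary
  proof eventually_elim
    case (elim x)
    have z: "((\<lambda>e. Complex x e) \<longlongrightarrow> of_real x) (at_right 0)"
      unfolding complex_of_real_def by (intro tendsto_Complex tendsto_const tendsto_ident_at)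
    have "((\<lambda>e. qlist rs (Complex x e) *\<^sub>C F (Complex x e)) \<longlongrightarrow> qlist rs (of_real x) *\<^sub>C B x) (at_right 0)"
      by (intro tendsto_scaleC qlist_tendsto z conjunct2[OF elim])
    moreover have "\<forall>\<^sub>F e in at_right 0. qlist rs (Complex x e) *\<^sub>C F (Complex x e) = f (Complex x e)"
      using eventually_at_right_less[of "0::real"] by eventually_elim (simp add: eq)
    ultimately have "((\<lambda>e. f (Complex x e)) \<longlongrightarrow> qlist rs (of_real x) *\<^sub>C B x) (at_right 0)"
      by (rule Lim_transform_eventually)
    from tendsto_unique[OF _ this ispoly_tendsto[OF f z]] elim show ?case by simp
  qed
  then have "infinite S" unfolding S_def by (rule AE_lborel_infinite)
  then have S: "infinite (complex_of_real ` S)" by (simp add: finite_image_iff inj_on_def)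
  \<comment> \<open>On \<open>S\<close> self-adjointness gives a reflection identity between the
    entries of \<open>f\<close>, which extends to all of the plane. At a root \<open>r\<close> in
    the lower half-plane \<open>qlist rs\<close> vanishes while the reflected product does not, as
    \<open>cnj r\<close> is no root; hence \<open>f r = 0\<close>, against reducedness.\<close>
  have not_lower: "\<not> Im r < 0" if r: "r \<in> set rs" for r
  proof
    assume lower: "Im r < 0"
    have "cinner h (f r k) = 0" for h k
    proof -
      have "qlist (map cnj rs) r *\<^sub>C cinner h (f r k) = qlist rs r *\<^sub>C cnj (cinner k (f (cnj r) h))"
      proof (rule ispoly_eqI[OF _ _ S, where z = r
            and f = "\<lambda>z. qlist (map cnj rs) z *\<^sub>C cinner h (f z k)"
            and g = "\<lambda>z. qlist rs z *\<^sub>C cnj (cinner k (f (cnj z) h))"])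
        show "ispoly (\<lambda>z. qlist (map cnj rs) z *\<^sub>C cinner h (f z k))"
          by (rule ispoly_mult_qlist[OF ispoly_form[OF f]])
        show "ispoly (\<lambda>z. qlist rs z *\<^sub>C cnj (cinner k (f (cnj z) h)))"
          by (rule ispoly_mult_qlist[OF ispoly_cnj[OF ispoly_form[OF f]]])
        fix z assume "z \<in> complex_of_real ` S"
        then obtain x where x: "z = of_real x" "selfadjoint_op (B x)" "qlist rs (of_real x) *\<^sub>C B x = f (of_real x)"
          by (auto simp: S_def)
        have "cinner (B x h) k = cinner h (B x k)" using x(2) by (simp add: selfadjoint_op_def is_adjoint_def)
        then have "cnj (cinner k (B x h)) = cinner h (B x k)" by (simp add: cinner_commute[symmetric])
        then show "qlist (map cnj rs) z *\<^sub>C cinner h (f z k) = qlist rs z *\<^sub>C cnj (cinner k (f (cnj z) h))"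
          unfolding x(1) complex_cnj_complex_of_real x(3)[symmetric] qlist_cnj
          by (simp add: scaleC_complex_def scaleC_blinfun.rep_eq cinner_scaleC_right)
      qed
      then have "cnj (qlist rs (cnj r)) * cinner h (f r k) = 0"
        using r qlist_eq_0_iff[of rs r] by (simp add: qlist_cnj scaleC_complex_def)
      moreover have "qlist rs (cnj r) \<noteq> 0"
        using not_upper[of "cnj r"] lower by (auto simp: qlist_eq_0_iff)
      ultimately show ?thesis by simp
    qed
    then have "f r k = 0" for k using cinner_self_eq_0_iff by blast
    then have "f r = 0" by (intro blinfun_eqI) simp
    then show False using nz[OF r] by simp
  qed
  have real: "Im r = 0" if "r \<in> set rs" for r
    using not_upper[OF that] not_lower[OF that] by simp
  have "count_list rs r \<le> 1" for r
  proof (rule ccontr)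
    assume "\<not> count_list rs r \<le> 1"
    then have m: "count_list rs r \<ge> 2" by simp
    then have r: "r \<in> set rs" using count_notin[of r rs] by fastforce
    let ?s = "filter (\<lambda>s. s \<noteq> r) rs"
    have s0: "qlist ?s r \<noteq> 0" by (simp add: qlist_eq_0_iff)
    have "(1 / qlist ?s r) *\<^sub>C f r = 0"
    proof (rule pole_coefficient(3)[OF real[OF r] _ _ _ m])
      show "1 \<le> count_list rs r" using m by simp
      have qt: "((\<lambda>z. qlist ?s z) \<longlongrightarrow> qlist ?s r) (at r within upper_half_plane)"
        by (rule qlist_tendsto[OF tendsto_ident_at])
      show "((\<lambda>z. (1 / qlist ?s z) *\<^sub>C f z) \<longlongrightarrow> (1 / qlist ?s r) *\<^sub>C f r) (at r within upper_half_plane)"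
        by (intro tendsto_scaleC tendsto_divide tendsto_const qt s0 ispoly_tendsto[OF f tendsto_ident_at])
      have "\<forall>\<^sub>F z in at r within upper_half_plane. qlist ?s z \<noteq> 0"
        by (rule tendsto_imp_eventually_ne[OF qt s0])
      moreover have "\<forall>\<^sub>F z in at r within upper_half_plane. Im z > 0"
        by (auto simp: eventually_at_filter)
      ultimately show "\<forall>\<^sub>F z in at r within upper_half_plane.
          (z - r) ^ count_list rs r *\<^sub>C F z = (1 / qlist ?s z) *\<^sub>C f z"
      proof eventually_elim
        case (elim z)
        show ?case
          using eq[OF elim(2)] elim(1) qlist_count[of rs z r]
          by (simp add: scaleC_scaleC eq[OF elim(2), symmetric])
      qed
    qed
    then show False using s0 nz[OF r] by simp
  qed
  then have dist: "distinct rs"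
    by (rule distinct_if_count_list_le_1)
  obtain g Bs where g: "ispoly g"
    and pf: "\<And>z. z \<notin> set rs \<Longrightarrow> (1 / qlist rs z) *\<^sub>C f z = g z + (\<Sum>r\<in>set rs. (1 / (z - r)) *\<^sub>C Bs r)"
    using partial_fractions[OF dist f] by blast
  have notin: "z \<notin> set rs" if "Im z > 0" for z using not_upper that by blast
  have F_eq: "F z = g z + (\<Sum>r\<in>set rs. (1 / (z - r)) *\<^sub>C Bs r)" if z: "Im z > 0" for z
    using pf[OF notin[OF z]] eq[OF z, symmetric] notin[OF z] qlist_eq_0_iff[of rs z] by (simp add: scaleC_scaleC)
  have residue: "complex_linear (Bs r)" "Im (cinner h (Bs r h)) = 0 \<and> Re (cinner h (Bs r h)) \<le> 0"
    if r: "r \<in> set rs" for r h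
  proof -
    \<comment> \<open>\<open>?H z\<close> is \<open>(z - r)\<close> times \<open>F z\<close> with
      the pole at \<open>r\<close> split off; all other terms vanish at \<open>r\<close>, so the
      limit is the residue.\<close>
    let ?H = "\<lambda>z. ((z - r) *\<^sub>C g z + (\<Sum>s\<in>set rs - {r}. ((z - r) / (z - s)) *\<^sub>C Bs s)) + Bs r"
    have "((\<lambda>z. ?H z) \<longlongrightarrow> ((r - r) *\<^sub>C g r + (\<Sum>s\<in>set rs - {r}. ((r - r) / (r - s)) *\<^sub>C Bs s)) + Bs r)
        (at r within upper_half_plane)"
      by (intro tendsto_add tendsto_scaleC tendsto_sum tendsto_divide tendsto_diff tendsto_ident_at tendsto_const
          ispoly_tendsto[OF g]) auto
    then have H: "((\<lambda>z. ?H z) \<longlongrightarrow> Bs r) (at r within upper_half_plane)" by simp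
    have ev: "\<forall>\<^sub>F z in at r within upper_half_plane. (z - r) ^ 1 *\<^sub>C F z = ?H z"
    proof -
      have "\<forall>\<^sub>F z in at r within upper_half_plane. Im z > 0"
        by (auto simp: eventually_at_filter)
      then show ?thesis
      proof eventually_elim
        case (elim z)
        have zr: "z - r \<noteq> 0" using notin[OF elim] r by auto
        have "(z - r) *\<^sub>C (\<Sum>s\<in>set rs. (1 / (z - s)) *\<^sub>C Bs s)
            = (\<Sum>s\<in>set rs. ((z - r) / (z - s)) *\<^sub>C Bs s)"
          by (simp add: scaleC_sum_right scaleC_scaleC)
        also have "\<dots> = ((z - r) / (z - r)) *\<^sub>C Bs r + (\<Sum>s\<in>set rs - {r}. ((z - r) / (z - s)) *\<^sub>C Bs s)"
          by (rule sum.remove[OF _ r]) simp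
        finally show ?case using zr unfolding F_eq[OF elim] by (simp add: scaleC_add_right)
      qed
    qed
    show "complex_linear (Bs r)" "Im (cinner h (Bs r h)) = 0 \<and> Re (cinner h (Bs r h)) \<le> 0"
      by (rule pole_coefficient[OF real[OF r] _ H ev]; simp)+
  qed
  \<comment> \<open>Divided by \<open>z ^ m\<close>, the lower powers and the poles vanish at
    infinity along each ray.\<close>
  have top_coeff: "((\<lambda>t. (1 / (of_real t * cis \<theta>) ^ m) *\<^sub>C F (of_real t * cis \<theta>)) \<longlongrightarrow> a m) at_top"
    if m: "m \<ge> 1" and a: "\<And>z. g z = (\<Sum>i<Suc m. z ^ i *\<^sub>C a i)" and \<theta>: "0 < \<theta>" "\<theta> < pi" for m a \<theta>
  proof -
    let ?z = "\<lambda>t. of_real t * cis \<theta>"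
    have inv: "((\<lambda>t. 1 / (?z t - r)) \<longlongrightarrow> 0) at_top" for r
    proof -
      have "filterlim (\<lambda>t. ?z t + - r) at_infinity at_top"
        by (rule tendsto_add_filterlim_at_infinity'[OF ray_at_infinity tendsto_const])
      from filterlim_compose[OF tendsto_inverse_0 this] show ?thesis by (simp add: inverse_eq_divide)
    qed
    have y: "((\<lambda>t. 1 / ?z t) \<longlongrightarrow> 0) at_top" using inv[of 0] by simp
    have ym: "((\<lambda>t. 1 / ?z t ^ n) \<longlongrightarrow> 0) at_top" if "n \<ge> 1" for n
      using tendsto_power[OF y, of n] that by (simp add: power_one_over power_0_left)
    have lower: "((\<lambda>t. (\<Sum>i<m. (1 / ?z t ^ (m - i)) *\<^sub>C a i)) \<longlongrightarrow> (\<Sum>i<m. 0 *\<^sub>C a i)) at_top"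
      by (intro tendsto_sum tendsto_scaleC tendsto_const ym) auto
    have poles: "((\<lambda>t. (\<Sum>r\<in>set rs. (1 / ?z t ^ m * (1 / (?z t - r))) *\<^sub>C Bs r)) \<longlongrightarrow> (\<Sum>r\<in>set rs. (0 * 0) *\<^sub>C Bs r)) at_top"
      by (intro tendsto_sum tendsto_scaleC tendsto_const tendsto_mult ym m inv)
    have "((\<lambda>t. (\<Sum>i<m. (1 / ?z t ^ (m - i)) *\<^sub>C a i) + a m
        + (\<Sum>r\<in>set rs. (1 / ?z t ^ m * (1 / (?z t - r))) *\<^sub>C Bs r)) \<longlongrightarrow> (\<Sum>i<m. 0 *\<^sub>C a i) + a m + (\<Sum>r\<in>set rs. (0 * 0) *\<^sub>C Bs r)) at_top"
      by (intro tendsto_add lower poles tendsto_const)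
    then have "((\<lambda>t. (\<Sum>i<m. (1 / ?z t ^ (m - i)) *\<^sub>C a i) + a m
        + (\<Sum>r\<in>set rs. (1 / ?z t ^ m * (1 / (?z t - r))) *\<^sub>C Bs r)) \<longlongrightarrow> a m) at_top"
      by simp
    moreover have "\<forall>\<^sub>F t in at_top. (\<Sum>i<m. (1 / ?z t ^ (m - i)) *\<^sub>C a i) + a m
        + (\<Sum>r\<in>set rs. (1 / ?z t ^ m * (1 / (?z t - r))) *\<^sub>C Bs r) = (1 / ?z t ^ m) *\<^sub>C F (?z t)"
      using eventually_gt_at_top[of "0::real"]
    proof eventually_elim
      case (elim t)
      have Im: "Im (?z t) > 0" using elim \<theta> by (simp add: sin_gt_zero)
      have z0: "?z t \<noteq> 0" using elim by simp
      have "(1 / ?z t ^ m) *\<^sub>C g (?z t) = (\<Sum>i<Suc m. (1 / ?z t ^ m * ?z t ^ i) *\<^sub>C a i)"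
        unfolding a scaleC_sum_right scaleC_scaleC ..
      also have "\<dots> = (\<Sum>i<m. (1 / ?z t ^ m * ?z t ^ i) *\<^sub>C a i) + a m"
        using z0 by (simp del: mult_eq_0_iff)
      also have "(\<Sum>i<m. (1 / ?z t ^ m * ?z t ^ i) *\<^sub>C a i) = (\<Sum>i<m. (1 / ?z t ^ (m - i)) *\<^sub>C a i)"
      proof (rule sum.cong[OF refl])
        fix i assume "i \<in> {..<m}"
        then have "?z t ^ m = ?z t ^ (m - i) * ?z t ^ i" by (simp flip: power_add)
        moreover have "1 / (y * u) * u = 1 / y" if "u \<noteq> 0" for y u :: complex
          using that by simp
        ultimately have "1 / ?z t ^ m * ?z t ^ i = 1 / ?z t ^ (m - i)"
          using z0 by (simp only: power_not_zero not_False_eq_True)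
        then show "(1 / ?z t ^ m * ?z t ^ i) *\<^sub>C a i = (1 / ?z t ^ (m - i)) *\<^sub>C a i" by (simp only:)
      qed
      finally show ?case
        unfolding F_eq[OF Im] scaleC_add_right scaleC_sum_right scaleC_scaleC by simp
    qed
    ultimately show ?thesis by (rule Lim_transform_eventually)
  qed
  \<comment> \<open>With \<open>N\<close> minimal, a vanishing coefficient of the highest power is a
    contradiction, and \<open>infinity_coefficient\<close> makes it vanish as soon as that power is
    at least 2.\<close>
  define N where "N = (LEAST n. vpoly n g)"
  have N: "vpoly N g" unfolding N_def using g unfolding ispoly_def by (rule LeastI_ex)
  have "N \<le> 2"
  proof (rule ccontr)
    assume "\<not> N \<le> 2"
    then obtain m where m: "N = Suc m" "m \<ge> 2" by (cases N) auto
    obtain a where a: "\<And>z. g z = (\<Sum>i<Suc m. z ^ i *\<^sub>C a i)" using N unfolding m(1) vpoly_def by blast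
    have "a m = 0"
      by (rule infinity_coefficient(3)[OF _ top_coeff[OF _ a] m(2)]) (use m(2) in auto)
    then have "vpoly m g" unfolding vpoly_def a by auto
    then have "N \<le> m" unfolding N_def by (rule Least_le)
    then show False using m(1) by simp
  qed
  then have "vpoly 2 g" by (rule vpoly_mono[OF _ N])
  then obtain a where a: "\<And>z. g z = (\<Sum>i<Suc 1. z ^ i *\<^sub>C a i)"
    unfolding vpoly_def by (auto simp: numeral_2_eq_2)
  then have ga: "g z = a 0 + z *\<^sub>C a 1" for z by simp
  have tc: "((\<lambda>t. (1 / (of_real t * cis \<theta>) ^ 1) *\<^sub>C F (of_real t * cis \<theta>)) \<longlongrightarrow> a 1) at_top"
    if "0 < \<theta>" "\<theta> < pi" for \<theta>
    by (rule top_coeff[OF le_refl a that])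
  note a1 = infinity_coefficient[OF le_refl tc]
  have posD: "positive_op (a 1)"
    unfolding positive_op_def using a1(1,2) by (auto simp: complex_is_Real_iff)
  have saD: "selfadjoint_op (a 1)"
    by (rule positive_selfadjoint) (use a1(1,2) in auto)
  have saB: "selfadjoint_op (Bs r)" if "r \<in> set rs" for r
    by (rule positive_selfadjoint) (use residue[OF that] in auto)
  \<comment> \<open>The constant term is read off at one real point that is no pole and has a
    self-adjoint boundary value: every other term is self-adjoint there.\<close>
  have saC: "selfadjoint_op (a 0)"
  proof -
    have "infinite (complex_of_real ` S - set rs)" using S by simp
    then obtain z where z: "z \<in> complex_of_real ` S - set rs" by (metis ex_in_conv finite.emptyI)
    then obtain x where x: "z = of_real x" "selfadjoint_op (B x)" "qlist rs z *\<^sub>C B x = f z" "z \<notin> set rs"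
      by (auto simp: S_def)
    have "B x = (1 / qlist rs z) *\<^sub>C f z"
      using x(3)[symmetric] x(4) qlist_eq_0_iff[of rs z] by (simp add: scaleC_scaleC)
    then have "a 0 = B x + ((- z) *\<^sub>C a 1 + (\<Sum>r\<in>set rs. (- (1 / (z - r))) *\<^sub>C Bs r))"
      unfolding pf[OF x(4)] ga by (simp add: scaleC_minus_left sum_negf)
    moreover have "selfadjoint_op (B x + ((- z) *\<^sub>C a 1 + (\<Sum>r\<in>set rs. (- (1 / (z - r))) *\<^sub>C Bs r)))"
      by (intro selfadjoint_add selfadjoint_scale selfadjoint_sum x saD saB)
        (use x(1) real in \<open>auto simp: Im_divide\<close>)
    ultimately show ?thesis by simp
  qed
  obtain e where e: "bij_betw e {1..card (set rs)} (set rs)"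
    using ex_bij_betw_nat_finite_1[of "set rs"] by auto
  have er: "e j \<in> set rs" "of_real (Re (e j)) = e j" if "j \<in> {1..card (set rs)}" for j
  proof -
    show "e j \<in> set rs" using bij_betwE[OF e] that by blast
    from real[OF this] show "of_real (Re (e j)) = e j" by (simp add: complex_eq_iff)
  qed
  \<comment> \<open>Partial fractions use \<open>1 / (z - r)\<close>, the representation
    \<open>1 / (l j - z)\<close>; the sign change turns the nonpositive residues into positive
    operators.\<close>
  have "rational_representation F (a 0) (a 1) (card (set rs)) (\<lambda>j. Re (e j)) (\<lambda>j. - Bs (e j))"
    unfolding rational_representation_def
  proof (intro conjI ballI saC posD)
    show "positive_op (- Bs (e j))" if "j \<in> {1..card (set rs)}" for j
      using residue[OF er(1)[OF that]] unfolding positive_op_def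
      by (auto simp: complex_is_Real_iff blinfun.minus_left cinner_minus_right complex_linear_def scaleC_minus_right)
    show "inj_on (\<lambda>j. Re (e j)) {1..card (set rs)}"
    proof (rule inj_onI)
      fix i j assume ij: "i \<in> {1..card (set rs)}" "j \<in> {1..card (set rs)}" "Re (e i) = Re (e j)"
      have "e i = of_real (Re (e i))" by (rule er(2)[OF ij(1), symmetric])
      also have "\<dots> = of_real (Re (e j))" by (simp only: ij(3))
      also have "\<dots> = e j" by (rule er(2)[OF ij(2)])
      finally have "e i = e j" .
      then show "i = j" by (rule inj_onD[OF bij_betw_imp_inj_on[OF e] _ ij(1,2)])
    qed
    fix z assume "z \<in> upper_half_plane"
    then have z: "Im z > 0" by simp
    have "(\<Sum>r\<in>set rs. (1 / (z - r)) *\<^sub>C Bs r) = (\<Sum>j=1..card (set rs). (1 / (z - e j)) *\<^sub>C Bs (e j))"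
      using sum.reindex_bij_betw[OF e, of "\<lambda>r. (1 / (z - r)) *\<^sub>C Bs r"] by simp
    also have "\<dots> = (\<Sum>j=1..card (set rs). (1 / (of_real (Re (e j)) - z)) *\<^sub>C - Bs (e j))"
    proof (rule sum.cong[OF refl])
      fix j assume j: "j \<in> {1..card (set rs)}"
      have "1 / (e j - z) = - (1 / (z - e j))"
        using minus_divide_right[of 1 "z - e j"] by simp
      then show "(1 / (z - e j)) *\<^sub>C Bs (e j) = (1 / (of_real (Re (e j)) - z)) *\<^sub>C - Bs (e j)"
        unfolding er(2)[OF j] by (simp only: scaleC_minus_left scaleC_minus_right minus_minus)
    qed
    finally show "F z = a 0 + z *\<^sub>C a 1 + (\<Sum>j=1..card (set rs). (1 / (of_real (Re (e j)) - z)) *\<^sub>C - Bs (e j))"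
      unfolding F_eq[OF z] ga by simp
  qed
  then show ?thesis unfolding Rat_def by blast
qed

end

section \<open>Separation of simple poles by finitely many points\<close>

lemma dual_functionals:
  fixes g :: "nat \<Rightarrow> 'x \<Rightarrow> complex"
  assumes "\<And>a. (\<And>x. x \<in> X \<Longrightarrow> (\<Sum>l<m. a l * g l x) = 0) \<Longrightarrow> \<forall>l<m. a l = 0"
  shows "\<exists>S c. finite S \<and> S \<subseteq> X \<and>
    (\<forall>j<m. \<forall>l<m. (\<Sum>x\<in>S. c j x * g l x) = (if l = j then 1 else 0))"
  using assms
proof (induction m)
  case 0
  then show ?case by (intro exI[of _ "{}"]) simp
next
  case (Suc m)
  have "\<exists>S c. finite S \<and> S \<subseteq> X \<and>
    (\<forall>j<m. \<forall>l<m. (\<Sum>x\<in>S. c j x * g l x) = (if l = j then 1 else 0))"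
  proof (rule Suc.IH)
    fix a assume a: "\<And>x. x \<in> X \<Longrightarrow> (\<Sum>l<m. a l * g l x) = 0"
    have "\<forall>l<Suc m. (a(m := 0)) l = 0"
      by (rule Suc.prems) (use a in simp)
    then show "\<forall>l<m. a l = 0" by (metis fun_upd_other less_SucI less_irrefl)
  qed
  then obtain S c where S: "finite S" "S \<subseteq> X"
    and c: "\<And>j l. j < m \<Longrightarrow> l < m \<Longrightarrow> (\<Sum>x\<in>S. c j x * g l x) = (if l = j then 1 else 0)"
    by blast
  \<comment> \<open>A pivot step of Gaussian elimination: \<open>L l\<close> is the multiple of
    \<open>g l\<close> to be removed from the new function. The rest is nonzero at some point
    \<open>x0\<close>, since otherwise it would be a linear relation on \<open>X\<close>.\<close>
  define L where "L l = (\<Sum>x\<in>S. c l x * g m x)" for l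
  have "\<exists>x0\<in>X. g m x0 - (\<Sum>l<m. L l * g l x0) \<noteq> 0"
  proof (rule ccontr)
    assume *: "\<not> ?thesis"
    have "\<forall>l<Suc m. (if l = m then 1 else - L l) = 0"
    proof (rule Suc.prems)
      fix x assume "x \<in> X"
      then have "g m x - (\<Sum>l<m. L l * g l x) = 0" using * by blast
      then show "(\<Sum>l<Suc m. (if l = m then 1 else - L l) * g l x) = 0"
        by (simp add: sum_negf)
    qed
    then show False by (metis lessI zero_neq_one)
  qed
  then obtain x0 where x0: "x0 \<in> X" "g m x0 - (\<Sum>l<m. L l * g l x0) \<noteq> 0" by blast
  define \<mu> where "\<mu> = g m x0 - (\<Sum>l<m. L l * g l x0)"
  have \<mu>: "\<mu> \<noteq> 0" using x0(2) by (simp add: \<mu>_def)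
  let ?T = "insert x0 S"
  \<comment> \<open>Extension by 0 lets all sums run over \<open>?T\<close>, whether or not
    \<open>x0\<close> already belongs to \<open>S\<close>.\<close>
  define c0 where "c0 j x = (if x \<in> S then c j x else 0)" for j x
  have fT: "finite ?T" using S by simp
  have c0: "(\<Sum>x\<in>?T. c0 j x * h x) = (\<Sum>x\<in>S. c j x * h x)" for j h
  proof -
    have "(\<Sum>x\<in>?T. c0 j x * h x) = (\<Sum>x\<in>S. c0 j x * h x)"
      by (rule sum.mono_neutral_right[OF fT]) (auto simp: c0_def)
    also have "\<dots> = (\<Sum>x\<in>S. c j x * h x)" by (rule sum.cong) (auto simp: c0_def)
    finally show ?thesis .
  qed
  \<comment> \<open>Evaluation at the pivot, corrected so that it annihilates the old functions and
    divided by \<open>\<mu>\<close> so that it is 1 on \<open>g m\<close>.\<close>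
  define d where "d x = ((if x = x0 then 1 else 0) - (\<Sum>l<m. g l x0 * c0 l x)) / \<mu>" for x
  have d: "(\<Sum>x\<in>?T. d x * h x) = (h x0 - (\<Sum>l<m. g l x0 * (\<Sum>x\<in>S. c l x * h x))) / \<mu>" for h
  proof -
    have "(\<Sum>x\<in>?T. d x * h x) = ((\<Sum>x\<in>?T. (if x = x0 then 1 else 0) * h x)
        - (\<Sum>x\<in>?T. (\<Sum>l<m. g l x0 * c0 l x) * h x)) / \<mu>"
      by (simp only: d_def times_divide_eq_left sum_divide_distrib[symmetric] left_diff_distrib sum_subtractf)
    also have "(\<Sum>x\<in>?T. (if x = x0 then 1 else 0) * h x) = (\<Sum>x\<in>?T. if x = x0 then h x else 0)"
      by (rule sum.cong) auto
    also have "\<dots> = h x0" using fT by (simp add: sum.delta')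
    also have "(\<Sum>x\<in>?T. (\<Sum>l<m. g l x0 * c0 l x) * h x) = (\<Sum>l<m. g l x0 * (\<Sum>x\<in>?T. c0 l x * h x))"
      unfolding sum_distrib_right sum_distrib_left by (subst sum.swap) (simp only: mult.assoc)
    finally show ?thesis unfolding c0 .
  qed
  have dl: "(\<Sum>x\<in>?T. d x * g l x) = (if l = m then 1 else 0)" if "l < Suc m" for l
  proof (cases "l = m")
    case True
    have "(\<Sum>x\<in>?T. d x * g m x) = \<mu> / \<mu>"
      unfolding d \<mu>_def L_def by (simp only: mult.commute)
    then show ?thesis using True \<mu> by simp
  next
    case False
    then have l: "l < m" using that by simp
    have "(\<Sum>l'<m. g l' x0 * (\<Sum>x\<in>S. c l' x * g l x)) = (\<Sum>l'<m. if l = l' then g l' x0 else 0)"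
      by (rule sum.cong) (use l c in auto)
    also have "\<dots> = g l x0" using l by simp
    finally show ?thesis unfolding d using False by simp
  qed
  \<comment> \<open>Subtracting a multiple of \<open>d\<close> makes the old functionals annihilate
    \<open>g m\<close> too.\<close>
  define c' where "c' j x = (if j = m then d x else c0 j x - L j * d x)" for j x
  have "(\<Sum>x\<in>?T. c' j x * g l x) = (if l = j then 1 else 0)" if jl: "j < Suc m" "l < Suc m" for j l
  proof (cases "j = m")
    case True
    then show ?thesis using dl[OF jl(2)] by (simp only: c'_def simp_thms if_True)
  next
    case False
    then have j: "j < m" using jl by simp
    have "(\<Sum>x\<in>?T. c' j x * g l x) = (\<Sum>x\<in>?T. c0 j x * g l x) - L j * (\<Sum>x\<in>?T. d x * g l x)"
      using False by (simp only: c'_def if_False left_diff_distrib sum_subtractf sum_distrib_left mult.assoc)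
    also have "\<dots> = (\<Sum>x\<in>S. c j x * g l x) - L j * (if l = m then 1 else 0)"
      unfolding c0 dl[OF jl(2)] ..
    also have "\<dots> = (if l = j then 1 else 0)"
    proof (cases "l = m")
      case True
      then show ?thesis using j by (simp add: L_def)
    next
      case False
      then show ?thesis using c[OF j, of l] jl by simp
    qed
    finally show ?thesis .
  qed
  then show ?case using fT S x0 by (intro exI[of _ ?T] exI[of _ c']) auto
qed

text \<open>Multiply by \<open>l i - z\<close> and descend vertically to the real point
  \<open>l i\<close>: only \<open>d i\<close> survives. Once all pole coefficients vanish, the
  relation at \<open>\<i>\<close> leaves \<open>d 0\<close>.\<close>

lemma poles_independent:
  fixes d :: "nat \<Rightarrow> 'a::complex_normed_vector" and l :: "nat \<Rightarrow> real"
  assumes inj: "inj_on l {1..m}"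
    and eq: "\<And>z. Im z > 0 \<Longrightarrow> d 0 + (\<Sum>j=1..m. (1 / (of_real (l j) - z)) *\<^sub>C d j) = 0"
    and i: "i \<le> m"
  shows "d i = 0"
proof -
  have pole: "d i = 0" if i: "i \<in> {1..m}" for i
  proof -
    let ?z = "\<lambda>t. of_real (l i) + of_real t * \<i>"
    let ?H = "\<lambda>z. (of_real (l i) - z) *\<^sub>C d 0 + d i
      + (\<Sum>j\<in>{1..m} - {i}. ((of_real (l i) - z) / (of_real (l j) - z)) *\<^sub>C d j)"
    have z: "(?z \<longlongrightarrow> of_real (l i)) (at_right 0)"
    proof -
      have "(?z \<longlongrightarrow> of_real (l i) + of_real 0 * \<i>) (at_right 0)" by (intro tendsto_intros)
      then show ?thesis by simp
    qed
    have ne0: "complex_of_real (l j) - of_real (l i) \<noteq> 0" if "j \<in> {1..m} - {i}" for j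
      using inj_onD[OF inj, of j i] that i by auto
    have "((\<lambda>t. ?H (?z t)) \<longlongrightarrow> ?H (of_real (l i))) (at_right 0)"
    proof (intro tendsto_add tendsto_const)
      have 0: "((\<lambda>t. of_real (l i) - ?z t) \<longlongrightarrow> of_real (l i) - of_real (l i)) (at_right 0)"
        by (rule tendsto_diff[OF tendsto_const z])
      show "((\<lambda>t. (of_real (l i) - ?z t) *\<^sub>C d 0) \<longlongrightarrow> (of_real (l i) - of_real (l i)) *\<^sub>C d 0) (at_right 0)"
        by (rule tendsto_scaleC[OF 0 tendsto_const])
      show "((\<lambda>t. \<Sum>j\<in>{1..m} - {i}. ((of_real (l i) - ?z t) / (of_real (l j) - ?z t)) *\<^sub>C d j)
          \<longlongrightarrow> (\<Sum>j\<in>{1..m} - {i}. ((of_real (l i) - of_real (l i)) / (of_real (l j) - of_real (l i))) *\<^sub>C d j)) (at_right 0)"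
        by (rule tendsto_sum, rule tendsto_scaleC[OF tendsto_divide[OF 0 tendsto_diff[OF tendsto_const z] ne0] tendsto_const])
    qed
    moreover have "\<forall>\<^sub>F t in at_right 0. ?H (?z t) = 0"
      using eventually_at_right_less[of "0::real"]
    proof eventually_elim
      case (elim t)
      have ne: "of_real (l i) - ?z t \<noteq> 0" using elim by simp
      have "0 = (of_real (l i) - ?z t) *\<^sub>C (d 0 + (\<Sum>j=1..m. (1 / (of_real (l j) - ?z t)) *\<^sub>C d j))"
        using eq[of "?z t"] elim by simp
      also have "\<dots> = (of_real (l i) - ?z t) *\<^sub>C d 0
          + (\<Sum>j=1..m. ((of_real (l i) - ?z t) / (of_real (l j) - ?z t)) *\<^sub>C d j)"
        by (simp only: scaleC_add_right scaleC_sum_right scaleC_scaleC times_divide_eq_right mult_1_right)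
      also have "(\<Sum>j=1..m. ((of_real (l i) - ?z t) / (of_real (l j) - ?z t)) *\<^sub>C d j)
          = ((of_real (l i) - ?z t) / (of_real (l i) - ?z t)) *\<^sub>C d i
            + (\<Sum>j\<in>{1..m} - {i}. ((of_real (l i) - ?z t) / (of_real (l j) - ?z t)) *\<^sub>C d j)"
        by (rule sum.remove[OF _ i]) simp
      finally show ?case unfolding divide_self[OF ne] scaleC_one add.assoc by (rule sym)
    qed
    ultimately have "((\<lambda>_. 0) \<longlongrightarrow> ?H (of_real (l i))) (at_right (0::real))"
      by (rule Lim_transform_eventually)
    then have "?H (of_real (l i)) = 0" by (simp only: tendsto_const_iff[OF trivial_limit_at_right_real])
    then show ?thesis by simp
  qed
  have "d 0 = 0" using eq[of \<i>] pole by simp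
  with pole i show ?thesis by (cases "i = 0") auto
qed

section \<open>Finite multiplicity implies rationality\<close>

lemma finite_dimensional_dependent:
  fixes y :: "nat \<Rightarrow> 'k::complex_normed_vector"
  assumes "finite B" "complex_vector.span B = (UNIV :: 'k set)" and n: "card B \<le> n"
  shows "\<exists>c. (\<exists>i\<le>n. c i \<noteq> 0) \<and> (\<Sum>i\<le>n. c i *\<^sub>C y i) = 0"
proof (cases "inj_on y {..n}")
  case True
  let ?S = "y ` {..n}"
  have "card ?S = Suc n" using card_image[OF True] by simp
  then have "complex_vector.dependent ?S"
    using complex_vector.independent_span_bound[OF assms(1), of ?S] assms(2) n by auto
  then obtain u where u: "\<exists>v\<in>?S. u v \<noteq> 0" "(\<Sum>v\<in>?S. u v *\<^sub>C v) = 0"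
    using complex_vector.dependent_finite[of ?S] by auto
  have "(\<Sum>i\<le>n. u (y i) *\<^sub>C y i) = 0"
    using u(2) by (simp add: sum.reindex[OF True])
  then show ?thesis using u(1) by (intro exI[of _ "\<lambda>i. u (y i)"]) auto
next
  case False
  then obtain i j where ij: "i \<le> n" "j \<le> n" "i \<noteq> j" "y i = y j" by (auto simp: inj_on_def)
  \<comment> \<open>The family may repeat a vector; the repetition is itself a nontrivial
    relation.\<close>
  let ?c = "\<lambda>k. (if k = i then 1 else 0) - (if k = j then 1 else (0::complex))"
  have "(\<Sum>k\<le>n. ?c k *\<^sub>C y k) = (\<Sum>k\<le>n. if k = i then y k else 0) - (\<Sum>k\<le>n. if k = j then y k else 0)"
    unfolding sum_subtractf[symmetric] by (rule sum.cong) (auto simp: scaleC_minus_left)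
  also have "\<dots> = 0" using ij by simp
  finally show ?thesis using ij by (intro exI[of _ ?c]) auto
qed

text \<open>Reassembles an operator from its columns: it is the sum of
  \<open>rank_one e (A e)\<close> over an orthonormal basis.\<close>

definition rank_one :: "'h::complex_hilbert \<Rightarrow> 'h \<Rightarrow> 'h \<Rightarrow>\<^sub>L 'h"
  where "rank_one e v = Blinfun (\<lambda>x. cinner e x *\<^sub>C v)"

lemma rank_one_apply: "rank_one e v x = cinner e x *\<^sub>C v"
proof -
  have "bounded_linear (\<lambda>x. cinner e x *\<^sub>C v)"
    by (rule bounded_linear_compose[OF bounded_bilinear.bounded_linear_left[OF bounded_bilinear_scaleC]
          bounded_bilinear.bounded_linear_right[OF bounded_bilinear_cinner]])
  then show ?thesis by (simp add: rank_one_def bounded_linear_Blinfun_apply)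
qed

lemma rank_one_add: "rank_one e (v + w) = rank_one e v + rank_one e w"
  by (rule blinfun_eqI) (simp add: rank_one_apply blinfun.add_left scaleC_add_right)

lemma rank_one_scaleC: "rank_one e (a *\<^sub>C v) = a *\<^sub>C rank_one e v"
  by (rule blinfun_eqI) (simp add: rank_one_apply scaleC_blinfun.rep_eq scaleC_scaleC mult.commute)

text \<open>The product of the denominators of the columns serves the whole operator; the induction
  runs over the basis vectors already included.\<close>

lemma (in pick_function) Rat_if_columns:
  assumes "\<And>k. \<exists>p f. p \<noteq> 0 \<and> ispoly f \<and> (\<forall>z. Im z > 0 \<longrightarrow> poly p z *\<^sub>C F z k = f z)"
  shows "F \<in> Rat"
proof -
  obtain E :: "'h set" where E0: "finite E" "orthonormal E" "complex_vector.span E = UNIV"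
    and E: "\<And>x. x = (\<Sum>e\<in>E. cinner e x *\<^sub>C e)"
    by (rule finite_dimensional_orthonormal[OF fd], rule that)
  have F: "F z = (\<Sum>e\<in>E. rank_one e (F z e))" if "Im z > 0" for z
  proof (rule blinfun_eqI)
    fix x
    have "F z x = F z (\<Sum>e\<in>E. cinner e x *\<^sub>C e)" by (simp only: E[of x, symmetric])
    also have "\<dots> = (\<Sum>e\<in>E. rank_one e (F z e)) x"
      by (simp add: complex_linear_sum[OF F_complex_linear[OF that]] blinfun.sum_left rank_one_apply)
    finally show "F z x = (\<Sum>e\<in>E. rank_one e (F z e)) x" .
  qed
  have "\<exists>p f. p \<noteq> 0 \<and> ispoly f \<and> (\<forall>z. Im z > 0 \<longrightarrow> poly p z *\<^sub>C (\<Sum>e\<in>E'. rank_one e (F z e)) = f z)"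
    if "finite E'" for E'
    using that
  proof (induction E')
    case empty
    show ?case by (intro exI[of _ 1] exI[of _ "\<lambda>_. 0"]) (simp add: ispoly_const)
  next
    case (insert e E')
    then obtain p f where p: "p \<noteq> 0" "ispoly f" "\<And>z. Im z > 0 \<Longrightarrow> poly p z *\<^sub>C (\<Sum>e\<in>E'. rank_one e (F z e)) = f z"
      by blast
    obtain q g where q: "q \<noteq> 0" "ispoly g" "\<And>z. Im z > 0 \<Longrightarrow> poly q z *\<^sub>C F z e = g z"
      using assms[of e] by blast
    have "ispoly (\<lambda>z. poly p z *\<^sub>C rank_one e (g z) + poly q z *\<^sub>C f z)"
      by (intro ispoly_add ispoly_mult_poly p(2) ispoly_map[OF q(2)] rank_one_add rank_one_scaleC)
    moreover have "poly (p * q) z *\<^sub>C (\<Sum>e\<in>insert e E'. rank_one e (F z e))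
        = poly p z *\<^sub>C rank_one e (g z) + poly q z *\<^sub>C f z" if z: "Im z > 0" for z
      using insert.hyps q(3)[OF z, symmetric] p(3)[OF z, symmetric]
      by (simp add: rank_one_scaleC scaleC_add_right scaleC_scaleC mult.commute)
    ultimately show ?case using p(1) q(1) by (intro exI[of _ "p * q"]) auto
  qed
  from this[OF E0(1)] obtain p f where p: "p \<noteq> 0" "ispoly f"
    "\<And>z. Im z > 0 \<Longrightarrow> poly p z *\<^sub>C (\<Sum>e\<in>E. rank_one e (F z e)) = f z" by blast
  show ?thesis by (rule Rat_if_poly_multiple[OF p(1,2)]) (use p(3) F in simp)
qed

context pick_multiplicity
begin

lemma Phi_sum: "\<Phi> (\<Sum>i\<in>I. c i *\<^sub>C y i) = (\<Sum>i\<in>I. c i *\<^sub>C \<Phi> (y i))"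
proof -
  have "\<Phi> 0 = 0" using Phi_scaleC[of 0 0] by simp
  then show ?thesis by (induction I rule: infinite_finite_induct) (simp_all add: Phi_add Phi_scaleC)
qed

lemma M_subset_H2: "u \<in> M \<Longrightarrow> u \<in> H2"
  by (simp add: M_def)

lemma subspace_M: "complex_vector.subspace M"
  unfolding complex_vector.subspace_def range_Phi[symmetric]
proof (safe)
  show "0 \<in> range \<Phi>" using Phi_scaleC[of 0 0] by (intro range_eqI[of _ _ 0]) simp
  show "\<Phi> k + \<Phi> l \<in> range \<Phi>" for k l unfolding Phi_add[symmetric] by (rule rangeI)
  show "c *\<^sub>C \<Phi> k \<in> range \<Phi>" for c k unfolding Phi_scaleC[symmetric] by (rule rangeI)
qed

text \<open>A relation between kernels in one direction \<open>k\<close> is a relation between their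
  Cauchy integrals. The injective resolvent at \<open>z\<close> can be removed from it, and clearing
  the denominators \<open>z - cnj (w i)\<close> shows that \<open>F z k\<close> is rational in
  \<open>z\<close>.\<close>

lemma Rat_if_finite_dimensional:
  assumes "finite_dimensional TYPE('k)"
  shows "F \<in> Rat"
proof (rule Rat_if_columns)
  fix k
  obtain Bk :: "'k set" where Bk: "finite Bk" "complex_vector.span Bk = UNIV"
    using assms by (auto simp: finite_dimensional_def)
  define n where "n = card Bk"
  \<comment> \<open>Any distinct points of the upper half-plane would do; distinctness makes
    \<open>p\<close> nonzero below.\<close>
  define w where "w i = Complex (real i) 1" for i
  have w: "Im (w i) > 0" for i by (simp add: w_def)
  have "\<exists>y. kap (w i) k = \<Phi> y" for i
    using kap_in_M[OF w[of i], of k] unfolding range_Phi[symmetric] by blast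
  then obtain y where y: "\<And>i. kap (w i) k = \<Phi> (y i)" by metis
  obtain c where c: "\<exists>i\<le>n. c i \<noteq> 0" "(\<Sum>i\<le>n. c i *\<^sub>C y i) = 0"
    using finite_dimensional_dependent[OF Bk, of n y] by (auto simp: n_def)
  have "(\<Sum>i\<le>n. c i *\<^sub>C kap (w i) k) = \<Phi> (\<Sum>i\<le>n. c i *\<^sub>C y i)"
    by (simp only: y Phi_sum)
  then have 0: "(\<Sum>i\<le>n. c i *\<^sub>C kap (w i) k) = 0"
    using c(2) Phi_scaleC[of 0 0] by simp
  obtain h where h: "\<And>i. hardy_ext (h i) (kap (w i) k)"
    "\<And>i z. Im z > 0 \<Longrightarrow> h i z = (1 / (z - cnj (w i))) *\<^sub>C resolv (F z) (F z k - G (w i) k)"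
    using kap_ext[OF w, where k = k] by metis
  have he: "hardy_ext (\<lambda>z. \<Sum>i\<le>n. c i *\<^sub>C h i z) 0"
    unfolding 0[symmetric] by (intro hardy_ext_sum hardy_ext_scaleC h(1))
  then have sum0: "(\<Sum>i\<le>n. c i *\<^sub>C h i z) = 0" if "Im z > 0" for z
  proof -
    have "hardy_ext (\<lambda>_. 0) (0 :: 'h L2)" by (simp add: hardy_ext_def)
    from hardy_ext_unique[OF he this that] show ?thesis .
  qed
  have lin: "(\<Sum>i\<le>n. (c i / (z - cnj (w i))) *\<^sub>C (F z k - G (w i) k)) = 0" if z: "Im z > 0" for z
  proof -
    note d = F_dissipative[OF z]
    have res: "resolv (F z) (\<Sum>i\<in>I. v i) = (\<Sum>i\<in>I. resolv (F z) (v i))" for I and v :: "nat \<Rightarrow> 'h"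
      by (induction I rule: infinite_finite_induct) (simp_all add: resolv_add[OF fd d] resolv_eq_0_iff[OF fd d])
    have "resolv (F z) (\<Sum>i\<le>n. (c i / (z - cnj (w i))) *\<^sub>C (F z k - G (w i) k)) = (\<Sum>i\<le>n. c i *\<^sub>C h i z)"
      unfolding res by (simp add: resolv_scaleC[OF fd d] h(2)[OF z] scaleC_scaleC)
    then show ?thesis using sum0[OF z] resolv_eq_0_iff[OF fd d] by simp
  qed
  \<comment> \<open>After clearing denominators \<open>p\<close> is the coefficient of
    \<open>F z k\<close>, and \<open>f\<close> collects the terms with
    \<open>G (w i) k\<close>.\<close>
  define p where "p = (\<Sum>i\<le>n. smult (c i) (\<Prod>j\<in>{..n} - {i}. [:- cnj (w j), 1:]))"
  define f where "f z = (\<Sum>i\<le>n. poly (smult (c i) (\<Prod>j\<in>{..n} - {i}. [:- cnj (w j), 1:])) z *\<^sub>C G (w i) k)" for z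
  have pw: "poly (\<Prod>j\<in>{..n} - {i}. [:- cnj (w j), 1:]) z = (\<Prod>j\<in>{..n} - {i}. z - cnj (w j))" for i z
    by (simp add: poly_prod)
  have "p \<noteq> 0"
  proof
    assume "p = 0"
    obtain i where i: "i \<le> n" "c i \<noteq> 0" using c(1) by blast
    \<comment> \<open>At \<open>cnj (w i)\<close> every summand of \<open>p\<close> except the
      \<open>i\<close>-th contains a vanishing factor.\<close>
    have "0 = poly p (cnj (w i))" using \<open>p = 0\<close> by simp
    also have "\<dots> = (\<Sum>i'\<le>n. c i' * (\<Prod>j\<in>{..n} - {i'}. cnj (w i) - cnj (w j)))"
      by (simp add: p_def poly_sum pw)
    also have "\<dots> = (\<Sum>i'\<le>n. if i' = i then c i * (\<Prod>j\<in>{..n} - {i}. cnj (w i) - cnj (w j)) else 0)"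
    proof (rule sum.cong[OF refl])
      fix i' assume "i' \<in> {..n}"
      show "c i' * (\<Prod>j\<in>{..n} - {i'}. cnj (w i) - cnj (w j))
          = (if i' = i then c i * (\<Prod>j\<in>{..n} - {i}. cnj (w i) - cnj (w j)) else 0)"
        using i(1) by (cases "i' = i") auto
    qed
    also have "\<dots> = c i * (\<Prod>j\<in>{..n} - {i}. cnj (w i) - cnj (w j))" using i(1) by simp
    finally have "c i * (\<Prod>j\<in>{..n} - {i}. cnj (w i) - cnj (w j)) = 0" by simp
    moreover have "(\<Prod>j\<in>{..n} - {i}. cnj (w i) - cnj (w j)) \<noteq> 0"
    proof -
      have "cnj (w i) - cnj (w j) \<noteq> 0" if "j \<in> {..n} - {i}" for j
        using that by (simp add: w_def complex_eq_iff)
      then show ?thesis by (subst prod_zero_iff) auto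
    qed
    ultimately show False using i(2) by simp
  qed
  moreover have "ispoly f"
    unfolding f_def by (intro ispoly_sum ispoly_mult_poly ispoly_const)
  moreover have "poly p z *\<^sub>C F z k = f z" if z: "Im z > 0" for z
  proof -
    define Q where "Q = (\<Prod>j\<le>n. z - cnj (w j))"
    have Qi: "Q * (c i / (z - cnj (w i))) = c i * (\<Prod>j\<in>{..n} - {i}. z - cnj (w j))" if "i \<le> n" for i
      unfolding Q_def using that prod.remove[of "{..n}" i "\<lambda>j. z - cnj (w j)"] cnj_diff_ne[OF z w[of i]]
      by simp
    have "0 = Q *\<^sub>C (\<Sum>i\<le>n. (c i / (z - cnj (w i))) *\<^sub>C (F z k - G (w i) k))" using lin[OF z] by simp
    also have "\<dots> = (\<Sum>i\<le>n. (c i * (\<Prod>j\<in>{..n} - {i}. z - cnj (w j))) *\<^sub>C (F z k - G (w i) k))"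
      unfolding scaleC_sum_right scaleC_scaleC by (rule sum.cong) (use Qi in auto)
    also have "\<dots> = poly p z *\<^sub>C F z k - f z"
      by (simp add: p_def f_def poly_sum pw scaleC_diff_right sum_subtractf scaleC_sum_left)
    finally show ?thesis by simp
  qed
  ultimately show "\<exists>p f. p \<noteq> 0 \<and> ispoly f \<and> (\<forall>z. Im z > 0 \<longrightarrow> poly p z *\<^sub>C F z k = f z)" by blast
qed

end

section \<open>A basis of the multiplicity space from a rational representation\<close>

lemma is_adjoint_add: "is_adjoint A A' \<Longrightarrow> is_adjoint B B' \<Longrightarrow> is_adjoint (A + B) (A' + B')"
  by (simp add: is_adjoint_def blinfun.add_left cinner_add_left cinner_add_right)

lemma is_adjoint_scaleC: "is_adjoint A A' \<Longrightarrow> is_adjoint (c *\<^sub>C A) (cnj c *\<^sub>C A')"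
  by (simp add: is_adjoint_def scaleC_blinfun.rep_eq cinner_scaleC_left cinner_scaleC_right)

lemma is_adjoint_sum:
  "(\<And>i. i \<in> I \<Longrightarrow> is_adjoint (A i) (A' i)) \<Longrightarrow> is_adjoint (\<Sum>i\<in>I. A i) (\<Sum>i\<in>I. A' i)"
proof (induction I rule: infinite_finite_induct)
  case (insert i I)
  then have "is_adjoint (A i + (\<Sum>i\<in>I. A i)) (A' i + (\<Sum>i\<in>I. A' i))"
    by (intro is_adjoint_add) auto
  then show ?case using insert.hyps by simp
qed (simp_all add: is_adjoint_def blinfun.zero_left)

lemma hardy_ext_cong: "(\<And>z. Im z > 0 \<Longrightarrow> f z = g z) \<Longrightarrow> hardy_ext f u \<longleftrightarrow> hardy_ext g u"
  by (auto simp: hardy_ext_def)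

lemma independent_family:
  fixes y :: "'i \<Rightarrow> 'a::complex_normed_vector"
  assumes I: "finite I"
    and ind: "\<And>a i. (\<Sum>i\<in>I. a i *\<^sub>C y i) = 0 \<Longrightarrow> i \<in> I \<Longrightarrow> a i = 0"
  shows "inj_on y I" "complex_vector.independent (y ` I)"
proof -
  show inj: "inj_on y I"
  proof (rule inj_onI, rule ccontr)
    fix i j assume ij: "i \<in> I" "j \<in> I" "y i = y j" "i \<noteq> j"
    let ?a = "\<lambda>k. (if k = i then 1 else 0) - (if k = j then 1 else (0::complex))"
    have "(\<Sum>k\<in>I. ?a k *\<^sub>C y k) = (\<Sum>k\<in>I. if k = i then y k else 0) - (\<Sum>k\<in>I. if k = j then y k else 0)"
      unfolding sum_subtractf[symmetric] by (rule sum.cong) (auto simp: scaleC_minus_left)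
    also have "\<dots> = 0" using I ij by simp
    finally have "?a i = 0" by (rule ind) (rule ij(1))
    then show False using ij(4) by simp
  qed
  show "complex_vector.independent (y ` I)"
  proof
    assume "complex_vector.dependent (y ` I)"
    then obtain u v where u: "v \<in> y ` I" "u v \<noteq> 0" "(\<Sum>v\<in>y ` I. u v *\<^sub>C v) = 0"
      using complex_vector.dependent_finite[of "y ` I"] I by auto
    have "(\<Sum>i\<in>I. u (y i) *\<^sub>C y i) = 0" using u(3) by (simp add: sum.reindex[OF inj])
    then have "u (y i) = 0" if "i \<in> I" for i using that by (rule ind)
    then show False using u by auto
  qed
qed

lemma sum_lessThan_Suc_split: "(\<Sum>j<Suc m. f j) = f 0 + (\<Sum>j=1..m. f j :: 'a::comm_monoid_add)"
  unfolding sum.lessThan_Suc_shift by (simp add: sum.atLeast1_atMost_eq)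

context pick_multiplicity
begin

text \<open>Reduces identities in \<open>M\<close> to pointwise identities between Cauchy
  integrals.\<close>

lemma M_eqI:
  assumes "u \<in> M" "v \<in> M" "hardy_ext f u" "hardy_ext f v"
  shows "u = v"
proof -
  have "u - v = 0"
  proof (rule H2_ext_zero)
    show "u - v \<in> H2"
      using assms M_subset_H2 by (intro complex_vector.subspace_diff[OF subspace_H2]) auto
    show "hardy_ext (\<lambda>z. f z - f z) (u - v)" by (rule hardy_ext_diff[OF assms(3,4)])
  qed simp
  then show ?thesis by simp
qed

lemma resolv_sum:
  assumes "Im z > 0"
  shows "resolv (F z) (\<Sum>i\<in>I. v i) = (\<Sum>i\<in>I. resolv (F z) (v i))"
  using F_dissipative[OF assms]
  by (induction I rule: infinite_finite_induct) (simp_all add: resolv_add[OF fd] resolv_eq_0_iff[OF fd])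

text \<open>The quotient of \<open>F z - G w\<close> by \<open>z - cnj w\<close> is a sum of
  \<open>p j (cnj w)\<close> times \<open>p j z\<close> times \<open>R j\<close>. So the kernels are
  combinations of elements \<open>V j k\<close> with Cauchy integral
  \<open>J z (p j z R j k)\<close>. Conversely, each \<open>V j k\<close> is a combination of
  finitely many kernels and hence lies in \<open>M\<close>. Letting \<open>R j k\<close> run through
  bases of the ranges gives a basis of \<open>M\<close>.\<close>

lemma rational_basis:
  assumes rep: "rational_representation F C D m l A"
  shows "\<exists>Z::'k set. finite Z \<and> complex_vector.independent Z \<and> complex_vector.span Z = UNIV \<and>
    card Z = op_rank D + (\<Sum>j=1..m. op_rank (A j))"
proof -
  \<comment> \<open>Index 0 stands for the linear term, with constant function \<open>p 0\<close>,
    and the indices from 1 to \<open>m\<close> for the poles, so one sum covers both.\<close>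
  define R where "R j = (if j = 0 then D else A j)" for j
  define p where "p j z = (if j = 0 then 1 else 1 / (complex_of_real (l j) - z))" for j z
  have posR: "positive_op (R j)" if "j < Suc m" for j
    using rep that by (auto simp: R_def rational_representation_def)
  then have clR: "complex_linear (R j)" if "j < Suc m" for j
    using that by (simp add: positive_op_def)
  have adjR: "is_adjoint (R j) (R j)" if "j < Suc m" for j
    using positive_selfadjoint[OF clR[OF that]] posR[OF that]
    by (auto simp: positive_op_def selfadjoint_op_def complex_is_Real_iff)
  have adjC: "is_adjoint C C" and inj: "inj_on l {1..m}"
    and Feq: "\<And>z. Im z > 0 \<Longrightarrow> F z = C + z *\<^sub>C D + (\<Sum>j=1..m. (1 / (of_real (l j) - z)) *\<^sub>C A j)"
    using rep by (auto simp: rational_representation_def selfadjoint_op_def)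
  have pole_ne: "of_real (l j) - z \<noteq> 0" if "Im z \<noteq> 0" for j z
    using that by (auto simp: complex_eq_iff)
  have Geq: "G w = C + cnj w *\<^sub>C D + (\<Sum>j=1..m. (1 / (of_real (l j) - cnj w)) *\<^sub>C A j)" if w: "Im w > 0" for w
  proof (rule cadjoint_eqI)
    have "is_adjoint (C + w *\<^sub>C D + (\<Sum>j=1..m. (1 / (of_real (l j) - w)) *\<^sub>C A j))
        (C + cnj w *\<^sub>C D + (\<Sum>j=1..m. cnj (1 / (of_real (l j) - w)) *\<^sub>C A j))"
    proof (intro is_adjoint_add is_adjoint_scaleC is_adjoint_sum adjC)
      show "is_adjoint D D" using adjR[of 0] by (simp add: R_def)
      show "is_adjoint (A j) (A j)" if "j \<in> {1..m}" for j using adjR[of j] that by (simp add: R_def)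
    qed
    then show "is_adjoint (F w) (C + cnj w *\<^sub>C D + (\<Sum>j=1..m. (1 / (of_real (l j) - cnj w)) *\<^sub>C A j))"
      unfolding Feq[OF w] by simp
  qed
  \<comment> \<open>\<open>C\<close> cancels because it is self-adjoint, and each pole contributes
    the difference of two reciprocals.\<close>
  have diff: "F z k - G w k = (z - cnj w) *\<^sub>C (\<Sum>j<Suc m. p j (cnj w) *\<^sub>C (p j z *\<^sub>C R j k))"
    if z: "Im z > 0" and w: "Im w > 0" for z w k
  proof -
    have "F z k - G w k = (z - cnj w) *\<^sub>C D k
        + (\<Sum>j=1..m. (1 / (of_real (l j) - z) - 1 / (of_real (l j) - cnj w)) *\<^sub>C A j k)"
      unfolding Feq[OF z] Geq[OF w]
      by (simp add: blinfun.add_left blinfun.sum_left scaleC_blinfun.rep_eq scaleC_diff_left sum_subtractf)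
    also have "(\<Sum>j=1..m. (1 / (of_real (l j) - z) - 1 / (of_real (l j) - cnj w)) *\<^sub>C A j k)
        = (\<Sum>j=1..m. (z - cnj w) *\<^sub>C (p j (cnj w) *\<^sub>C (p j z *\<^sub>C R j k)))"
    proof (rule sum.cong[OF refl])
      fix j assume j: "j \<in> {1..m}"
      have "1 / (of_real (l j) - z) - 1 / (of_real (l j) - cnj w)
          = (z - cnj w) * (1 / (of_real (l j) - cnj w) * (1 / (of_real (l j) - z)))"
        using pole_ne[of z j] pole_ne[of "cnj w" j] z w by (simp add: field_simps)
      then show "(1 / (of_real (l j) - z) - 1 / (of_real (l j) - cnj w)) *\<^sub>C A j k
          = (z - cnj w) *\<^sub>C (p j (cnj w) *\<^sub>C (p j z *\<^sub>C R j k))"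
        using j by (simp add: p_def R_def scaleC_scaleC mult.assoc)
    qed
    finally show ?thesis
      unfolding sum_lessThan_Suc_split scaleC_add_right scaleC_sum_right
      by (simp add: p_def R_def)
  qed
  define e where "e j b z = resolv (F z) (p j z *\<^sub>C b)" for j b z
  have e_sum: "e j (\<Sum>b\<in>T. t b *\<^sub>C b) z = (\<Sum>b\<in>T. t b *\<^sub>C e j b z)" if z: "Im z > 0" for j T t z
  proof -
    have "p j z *\<^sub>C (\<Sum>b\<in>T. t b *\<^sub>C b) = (\<Sum>b\<in>T. t b *\<^sub>C (p j z *\<^sub>C b))"
      by (simp add: scaleC_sum_right scaleC_scaleC mult.commute)
    then show ?thesis
      by (simp add: e_def resolv_sum[OF z] resolv_scaleC[OF fd F_dissipative[OF z]])
  qed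
  have kap_e: "hardy_ext (\<lambda>z. \<Sum>j<Suc m. p j (cnj w) *\<^sub>C e j (R j k) z) (kap w k)" if w: "Im w > 0" for w k
  proof -
    obtain f where f: "hardy_ext f (kap w k)"
      "\<And>z. Im z > 0 \<Longrightarrow> f z = (1 / (z - cnj w)) *\<^sub>C resolv (F z) (F z k - G w k)"
      using kap_ext[OF w, where k = k] by blast
    have "f z = (\<Sum>j<Suc m. p j (cnj w) *\<^sub>C e j (R j k) z)" if z: "Im z > 0" for z
    proof -
      note sc = resolv_scaleC[OF fd F_dissipative[OF z]]
      have "f z = resolv (F z) (\<Sum>j<Suc m. p j (cnj w) *\<^sub>C (p j z *\<^sub>C R j k))"
        unfolding f(2)[OF z] diff[OF z w] sc using cnj_diff_ne[OF z w] by (simp add: scaleC_scaleC)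
      then show ?thesis unfolding resolv_sum[OF z] sc e_def .
    qed
    from iffD1[OF hardy_ext_cong[OF this] f(1)] show ?thesis .
  qed
  \<comment> \<open>Conjugation moves the argument \<open>cnj w\<close> back to the upper
    half-plane, where \<open>poles_independent\<close> applies.\<close>
  have indep: "\<forall>j<Suc m. a j = 0" if a: "\<And>w. w \<in> upper_half_plane \<Longrightarrow> (\<Sum>j<Suc m. a j * p j (cnj w)) = 0" for a
  proof -
    have "cnj (a j) = 0" if "j \<le> m" for j
    proof (rule poles_independent[OF inj _ that, of "\<lambda>j. cnj (a j)"])
      fix z :: complex assume "Im z > 0"
      then have "cnj (\<Sum>j<Suc m. a j * p j (cnj z)) = 0" using a[of z] by simp
      then have "cnj (a 0) * cnj (p 0 (cnj z)) + (\<Sum>j=1..m. cnj (a j) * cnj (p j (cnj z))) = 0"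
        unfolding sum_lessThan_Suc_split by simp
      then show "cnj (a 0) + (\<Sum>j=1..m. (1 / (of_real (l j) - z)) *\<^sub>C cnj (a j)) = 0"
        by (simp add: p_def scaleC_complex_def)
    qed
    then show ?thesis by (simp add: less_Suc_eq_le)
  qed
  \<comment> \<open>Points and weights that extract the coefficient of a single function
    \<open>p j (cnj w)\<close> from a kernel.\<close>
  obtain S c where S: "finite S" "S \<subseteq> upper_half_plane"
    and c: "\<forall>j<Suc m. \<forall>i<Suc m. (\<Sum>w\<in>S. c j w * p i (cnj w)) = (if i = j then 1 else 0)"
    using dual_functionals[where X = upper_half_plane and m = "Suc m" and g = "\<lambda>j w. p j (cnj w)", OF indep]
    by blast
  have wS: "Im w > 0" if "w \<in> S" for w using S(2) that by auto
  define V where "V j k = (\<Sum>w\<in>S. c j w *\<^sub>C kap w k)" for j k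
  have VM: "V j k \<in> M" for j k
    unfolding V_def
    by (intro complex_vector.subspace_sum[OF subspace_M] complex_vector.subspace_scale[OF subspace_M] kap_in_M wS)
  have V_e: "hardy_ext (e j (R j k)) (V j k)" if j: "j < Suc m" for j k
  proof -
    have "hardy_ext (\<lambda>z. \<Sum>w\<in>S. c j w *\<^sub>C (\<Sum>i<Suc m. p i (cnj w) *\<^sub>C e i (R i k) z)) (V j k)"
      unfolding V_def by (intro hardy_ext_sum hardy_ext_scaleC kap_e wS)
    moreover have "(\<Sum>w\<in>S. c j w *\<^sub>C (\<Sum>i<Suc m. p i (cnj w) *\<^sub>C e i (R i k) z)) = e j (R j k) z" for z
    proof -
      have "(\<Sum>w\<in>S. c j w *\<^sub>C (\<Sum>i<Suc m. p i (cnj w) *\<^sub>C e i (R i k) z))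
          = (\<Sum>i<Suc m. (\<Sum>w\<in>S. c j w * p i (cnj w)) *\<^sub>C e i (R i k) z)"
        unfolding scaleC_sum_right scaleC_sum_left scaleC_scaleC by (rule sum.swap)
      also have "\<dots> = (\<Sum>i<Suc m. if i = j then e i (R i k) z else 0)"
        by (rule sum.cong) (use c j in auto)
      also have "\<dots> = e j (R j k) z" using j by (simp add: sum.delta' del: sum.lessThan_Suc)
      finally show ?thesis .
    qed
    ultimately show ?thesis by (simp only:)
  qed
  obtain E :: "'h set" where E: "finite E" "orthonormal E" "complex_vector.span E = UNIV"
    by (rule finite_dimensional_orthonormal[OF fd], rule that)
  have "\<exists>Bs. finite Bs \<and> Bs \<subseteq> range (R j) \<and> complex_vector.independent Bs \<and>
      range (R j) \<subseteq> complex_vector.span Bs \<and> card Bs = op_rank (R j)" for j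
  proof -
    obtain Bs where Bs: "Bs \<subseteq> range (R j)" "complex_vector.independent Bs"
      "range (R j) \<subseteq> complex_vector.span Bs" "card Bs = complex_vector.dim (range (R j))"
      by (rule complex_vector.basis_exists[of "range (blinfun_apply (R j))"])
    then have "finite Bs" using complex_vector.independent_span_bound[OF E(1) Bs(2)] E(3) by simp
    with Bs show ?thesis by (auto simp: op_rank_def)
  qed
  then obtain Bs where Bs: "\<And>j. finite (Bs j)" "\<And>j. Bs j \<subseteq> range (R j)" "\<And>j. complex_vector.independent (Bs j)"
    "\<And>j. range (R j) \<subseteq> complex_vector.span (Bs j)" "\<And>j. card (Bs j) = op_rank (R j)" by metis
  \<comment> \<open>\<open>V\<close> is indexed by arguments of \<open>R j\<close>, the basis by
    values. By \<open>V_e\<close> the Cauchy integral depends on the value only, so any preimage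
    serves.\<close>
  define pre where "pre j b = (SOME k. R j k = b)" for j b
  have pre: "R j (pre j b) = b" if b: "b \<in> Bs j" for j b
    unfolding pre_def by (rule someI_ex) (use Bs(2) b in blast)
  define I where "I = Sigma {..<Suc m} Bs"
  have finI: "finite I" using Bs(1) by (simp add: I_def)
  define y where "y i = V (fst i) (pre (fst i) (snd i))" for i
  have yM: "y i \<in> M" for i unfolding y_def by (rule VM)
  have y_e: "hardy_ext (e j b) (y (j, b))" if "j < Suc m" "b \<in> Bs j" for j b
    using V_e[OF that(1), of "pre j b"] pre[OF that(2)] by (simp add: y_def)
  have y_ind: "a i = 0" if a: "(\<Sum>i\<in>I. a i *\<^sub>C y i) = 0" and i: "i \<in> I" for a i
  proof -
    define d where "d j = (\<Sum>b\<in>Bs j. a (j, b) *\<^sub>C b)" for j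
    have sumI: "(\<Sum>i\<in>I. q (fst i) (snd i)) = (\<Sum>j<Suc m. \<Sum>b\<in>Bs j. q j b)" for q :: "nat \<Rightarrow> 'h \<Rightarrow> 'b::comm_monoid_add"
      unfolding I_def by (subst sum.Sigma) (auto simp: Bs(1) case_prod_beta')
    have ext: "hardy_ext (\<lambda>z. \<Sum>i\<in>I. a i *\<^sub>C e (fst i) (snd i) z) 0"
      unfolding a[symmetric]
    proof (intro hardy_ext_sum hardy_ext_scaleC)
      fix i assume "i \<in> I"
      then show "hardy_ext (e (fst i) (snd i)) (y i)"
        using y_e[of "fst i" "snd i"] by (auto simp: I_def)
    qed
    \<comment> \<open>The resolvent at \<open>z\<close> is injective, so the relation reduces to one
      between simple poles with coefficients \<open>d j\<close>.\<close>
    have zero: "d 0 + (\<Sum>j=1..m. (1 / (of_real (l j) - z)) *\<^sub>C d j) = 0" if z: "Im z > 0" for z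
    proof -
      note rz = resolv_sum[OF z] and sc = resolv_scaleC[OF fd F_dissipative[OF z]]
      have "hardy_ext (\<lambda>_. 0) (0 :: 'h L2)" by (simp add: hardy_ext_def)
      from hardy_ext_unique[OF ext this z]
      have "0 = (\<Sum>i\<in>I. a (fst i, snd i) *\<^sub>C e (fst i) (snd i) z)" by simp
      also have "\<dots> = (\<Sum>j<Suc m. \<Sum>b\<in>Bs j. a (j, b) *\<^sub>C e j b z)"
        by (rule sumI[of "\<lambda>j b. a (j, b) *\<^sub>C e j b z"])
      also have "\<dots> = (\<Sum>j<Suc m. e j (d j) z)"
        unfolding d_def e_sum[OF z] ..
      also have "\<dots> = resolv (F z) (\<Sum>j<Suc m. p j z *\<^sub>C d j)"
        unfolding e_def rz ..
      finally have "(\<Sum>j<Suc m. p j z *\<^sub>C d j) = 0"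
        using resolv_eq_0_iff[OF fd F_dissipative[OF z]] by simp
      then show ?thesis unfolding sum_lessThan_Suc_split by (simp add: p_def)
    qed
    obtain j b where jb: "i = (j, b)" "j < Suc m" "b \<in> Bs j" using i by (auto simp: I_def)
    have "d j = 0" by (rule poles_independent[OF inj zero]) (use jb(2) in simp_all)
    show ?thesis
    proof (rule ccontr)
      assume "a i \<noteq> 0"
      then have "(\<exists>b\<in>Bs j. a (j, b) \<noteq> 0) \<and> (\<Sum>b\<in>Bs j. a (j, b) *\<^sub>C b) = 0"
        using jb \<open>d j = 0\<close> unfolding d_def by auto
      then have "complex_vector.dependent (Bs j)"
        unfolding complex_vector.dependent_finite[OF Bs(1)[of j]]
        by (rule exI[of _ "\<lambda>b. a (j, b)"])
      then show False using Bs(3) by simp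
    qed
  qed
  have V_span: "V j k \<in> complex_vector.span (y ` I)" if j: "j < Suc m" for j k
  proof -
    have "R j k \<in> complex_vector.span (Bs j)" using Bs(4) by blast
    then obtain t where t: "R j k = (\<Sum>b\<in>Bs j. t b *\<^sub>C b)"
      using complex_vector.span_finite[OF Bs(1)] by auto
    have "V j k = (\<Sum>b\<in>Bs j. t b *\<^sub>C y (j, b))"
    proof (rule M_eqI[OF VM _ V_e[OF j]])
      show "(\<Sum>b\<in>Bs j. t b *\<^sub>C y (j, b)) \<in> M"
        by (intro complex_vector.subspace_sum[OF subspace_M] complex_vector.subspace_scale[OF subspace_M] yM)
      have "hardy_ext (\<lambda>z. \<Sum>b\<in>Bs j. t b *\<^sub>C e j b z) (\<Sum>b\<in>Bs j. t b *\<^sub>C y (j, b))"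
        by (intro hardy_ext_sum hardy_ext_scaleC y_e j)
      then show "hardy_ext (e j (R j k)) (\<Sum>b\<in>Bs j. t b *\<^sub>C y (j, b))"
        unfolding t by (subst hardy_ext_cong[OF e_sum])
    qed
    also have "\<dots> \<in> complex_vector.span (y ` I)"
      by (intro complex_vector.span_sum complex_vector.span_scale complex_vector.span_base)
        (use j in \<open>auto simp: I_def\<close>)
    finally show ?thesis .
  qed
  have kap_span: "kap w k \<in> complex_vector.span (y ` I)" if w: "Im w > 0" for w k
  proof -
    have "kap w k = (\<Sum>j<Suc m. p j (cnj w) *\<^sub>C V j k)"
    proof (rule M_eqI[OF kap_in_M[OF w] _ kap_e[OF w]])
      show "(\<Sum>j<Suc m. p j (cnj w) *\<^sub>C V j k) \<in> M"
        by (intro complex_vector.subspace_sum[OF subspace_M] complex_vector.subspace_scale[OF subspace_M] VM)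
      show "hardy_ext (\<lambda>z. \<Sum>j<Suc m. p j (cnj w) *\<^sub>C e j (R j k) z) (\<Sum>j<Suc m. p j (cnj w) *\<^sub>C V j k)"
        by (intro hardy_ext_sum hardy_ext_scaleC V_e) simp
    qed
    also have "\<dots> \<in> complex_vector.span (y ` I)"
      by (intro complex_vector.span_sum complex_vector.span_scale V_span) simp
    finally show ?thesis .
  qed
  \<comment> \<open>The remainder after projection onto the finite-dimensional span stays in
    \<open>M\<close> and is orthogonal to every kernel, so \<open>kap_total\<close> annihilates
    it.\<close>
  have span_M: "u \<in> complex_vector.span (y ` I)" if u: "u \<in> M" for u
  proof -
    obtain B' where B': "finite B'" "orthonormal B'" "complex_vector.span B' = complex_vector.span (y ` I)"
      using gram_schmidt[of "y ` I"] finI by blast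
    have "complex_vector.span (y ` I) \<subseteq> M"
      by (rule complex_vector.span_minimal[OF _ subspace_M]) (use yM in auto)
    then have pM: "proj_on B' u \<in> M" using proj_on_in_span[of B' u] B'(3) by blast
    have "u - proj_on B' u = 0"
    proof (rule kap_total)
      show "u - proj_on B' u \<in> M" by (rule complex_vector.subspace_diff[OF subspace_M u pM])
      fix w k assume "Im w > 0"
      then show "cinner (kap w k) (u - proj_on B' u) = 0"
        using kap_span[of w k] B'(3) by (intro cinner_proj_on_diff[OF B'(2,1)]) simp
    qed
    then have "u = proj_on B' u" by simp
    then show ?thesis using proj_on_in_span[of B' u] B'(3) by simp
  qed
  \<comment> \<open>The basis of \<open>M\<close> is now carried back to the multiplicity space
    along \<open>\<Phi>\<close>.\<close>
  have "\<exists>k. y i = \<Phi> k" for i using yM[of i] unfolding range_Phi[symmetric] by blast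
  then obtain yk where yk: "\<And>i. y i = \<Phi> (yk i)" by metis
  have Phi0: "\<Phi> 0 = 0" using Phi_scaleC[of 0 0] by simp
  have yk_ind: "a i = 0" if a: "(\<Sum>i\<in>I. a i *\<^sub>C yk i) = 0" and i: "i \<in> I" for a i
  proof (rule y_ind[OF _ i])
    have "(\<Sum>i\<in>I. a i *\<^sub>C y i) = \<Phi> (\<Sum>i\<in>I. a i *\<^sub>C yk i)" by (simp only: yk Phi_sum)
    then show "(\<Sum>i\<in>I. a i *\<^sub>C y i) = 0" by (simp only: a Phi0)
  qed
  have fam: "inj_on yk I" "complex_vector.independent (yk ` I)"
    by (rule independent_family[OF finI], erule (1) yk_ind)+
  have "k \<in> complex_vector.span (yk ` I)" for k
  proof -
    have "\<Phi> k \<in> complex_vector.span (y ` I)" using span_M range_Phi by blast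
    also have "\<dots> \<subseteq> \<Phi> ` complex_vector.span (yk ` I)"
    proof (rule complex_vector.span_minimal)
      show "y ` I \<subseteq> \<Phi> ` complex_vector.span (yk ` I)"
        using yk complex_vector.span_base[of _ "yk ` I"] by auto
      show "complex_vector.subspace (\<Phi> ` complex_vector.span (yk ` I))"
        unfolding complex_vector.subspace_def
      proof (safe)
        show "0 \<in> \<Phi> ` complex_vector.span (yk ` I)"
          using Phi0[symmetric] complex_vector.span_zero[of "yk ` I"] by (rule image_eqI)
        fix k l assume kl: "k \<in> complex_vector.span (yk ` I)" "l \<in> complex_vector.span (yk ` I)"
        show "\<Phi> k + \<Phi> l \<in> \<Phi> ` complex_vector.span (yk ` I)"
          unfolding Phi_add[symmetric] by (rule imageI[OF complex_vector.span_add[OF kl]])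
      next
        fix c k assume k: "k \<in> complex_vector.span (yk ` I)"
        show "c *\<^sub>C \<Phi> k \<in> \<Phi> ` complex_vector.span (yk ` I)"
          unfolding Phi_scaleC[symmetric] by (rule imageI[OF complex_vector.span_scale[OF k]])
      qed
    qed
    finally obtain k' where k': "\<Phi> k = \<Phi> k'" "k' \<in> complex_vector.span (yk ` I)" by blast
    have "\<Phi> (k + (- 1) *\<^sub>C k') = 0" by (simp only: Phi_add Phi_scaleC k') (simp add: scaleC_minus_left)
    from Phi_eq_0[OF this] have "k = k'" by (simp add: scaleC_minus_left)
    then show ?thesis using k'(2) by simp
  qed
  then have span: "complex_vector.span (yk ` I) = UNIV" by blast
  have "card (yk ` I) = card I" by (rule card_image[OF fam(1)])
  also have "\<dots> = (\<Sum>j<Suc m. card (Bs j))"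
    unfolding I_def by (rule card_SigmaI) (auto simp: Bs(1))
  also have "\<dots> = op_rank D + (\<Sum>j=1..m. op_rank (A j))"
    unfolding sum_lessThan_Suc_split Bs(5) by (simp add: R_def)
  finally show ?thesis using fam(2) span finI by (intro exI[of _ "yk ` I"]) simp
qed

end

section \<open>Dimension and degree\<close>

theorem theorem3p42:
  fixes F :: "complex \<Rightarrow> 'h::separable_complex_hilbert \<Rightarrow>\<^sub>L 'h"
  assumes "finite_dimensional TYPE('h)"
    and "F \<in> pick_R"
    and "pick_regular F"
    and "multiplicity_space TYPE('k::separable_complex_hilbert) (H2 :: 'h L2 set) (pick_group F)"
  shows "hilbert_dim TYPE('k) = pick_degree F \<and>
    (F \<in> Rat \<longrightarrow> isomorphic_ell2 TYPE('k) {..<the_enat (pick_degree F)}) \<and>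
    (F \<notin> Rat \<longrightarrow> isomorphic_ell2 TYPE('k) UNIV)"
proof -
  obtain \<psi> :: "'h L2 \<Rightarrow> 'k L2" where \<psi>: "unitary \<psi>" "\<psi> ` H2 = H2"
    "\<And>t u. \<psi> (pick_group F t u) = shift_group t (\<psi> u)"
    using assms(4) unfolding multiplicity_space_def by blast
  interpret pick_multiplicity F \<psi>
  proof
    show "complex_vector.subspace (H2 :: 'h L2 set)"
      using assms(3) by (simp add: pick_regular_def ropg_def)
  qed (use assms \<psi> in simp_all)
  show ?thesis
  proof (cases "F \<in> Rat")
    case True
    \<comment> \<open>Stated for every number \<open>d\<close> that some representation yields. It
      gives the dimension and, because the dimension is unique, also shows that all representations
      yield the same number, so the description in \<open>pick_degree\<close> is proper.\<close>
    have dim: "hilbert_dim TYPE('k) = enat d \<and> isomorphic_ell2 TYPE('k) {..<d}"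
      if "\<exists>C D m l A. rational_representation F C D m l A \<and> d = op_rank D + (\<Sum>j=1..m. op_rank (A j))" for d
    proof -
      from that obtain Z :: "'k set" where Z: "finite Z" "complex_vector.independent Z"
        "complex_vector.span Z = UNIV" "card Z = d"
        using rational_basis by blast
      show ?thesis using hilbert_dim_finite[OF Z(1-3)] Z(4) by simp
    qed
    define deg where "deg = (THE d. \<exists>C D m l A. rational_representation F C D m l A \<and>
      d = op_rank D + (\<Sum>j=1..m. op_rank (A j)))"
    have "\<exists>C D m l A. rational_representation F C D m l A \<and>
      deg = op_rank D + (\<Sum>j=1..m. op_rank (A j))"
      unfolding deg_def
    proof (rule theI')
      show "\<exists>!d. \<exists>C D m l A. rational_representation F C D m l A \<and>
        d = op_rank D + (\<Sum>j=1..m. op_rank (A j))"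
      proof (rule ex_ex1I)
        show "\<exists>d C D m l A. rational_representation F C D m l A \<and>
          d = op_rank D + (\<Sum>j=1..m. op_rank (A j))"
          using True unfolding Rat_def by blast
      next
        fix d d'
        assume "\<exists>C D m l A. rational_representation F C D m l A \<and> d = op_rank D + (\<Sum>j=1..m. op_rank (A j))"
          "\<exists>C D m l A. rational_representation F C D m l A \<and> d' = op_rank D + (\<Sum>j=1..m. op_rank (A j))"
        from dim[OF this(1)] dim[OF this(2)] show "d = d'" by simp
      qed
    qed
    from dim[OF this] True show ?thesis by (simp add: pick_degree_def deg_def)
  next
    case False
    then have "\<not> finite_dimensional TYPE('k)" using Rat_if_finite_dimensional by blast
    from hilbert_dim_infinite[OF this] False show ?thesis by (simp add: pick_degree_def)
  qed
qed

end
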